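(* Let $n\ge 2$, let $M=\mathbb{B}^n$ be the Poincaré ball, and endow its tangent bundle $TM$ with the Riemannian metric obtained by pulling back the Bergman metric of the Lie ball $\mathcal{B}^n$ by the diffeomorphism $\theta=T^{-1}\circ S: TM\to\mathcal{B}^n$ defined in the context. This metric has the following properties: (i) every vector line (one-dimensional linear subspace of a tangent space $T_pM$, $p\in M$, viewed as a curve in $TM$) is a geodesic of $TM$; (ii) for every $p\in M$, the tangent space $T_pM$ is a totally geodesic submanifold of $TM$; (iii) for every geodesic $\ell$ of $M$, the tangent space $T\ell\subset TM$ to $\ell$ (the set of vectors tangent to $\ell$ at points of $\ell$) is a hyperbolic disk, i.e. with the induced metric it is isometric to the open unit disk of $\mathbb{C}$ with the metric $\frac{|d\zeta|^2}{(1-|\zeta|^2)^2}$.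
   Context: $\mathbb{B}^n$ is the open unit ball of $\mathbb{R}^n$ with the hyperbolic metric $\frac{ds^2}{(1-\|x\|^2)^2}$ at $x$, where $ds^2$ is the Euclidean metric. For $z\in\mathbb{C}^n$ put $Q(z)=\sum_{i=1}^n z_i^2$ and $\|z\|^2=\sum_{i=1}^n|z_i|^2$. The Lie ball is $\mathcal{B}^n=\{z\in\mathbb{C}^n:\ \|z\|^2+\sqrt{\|z\|^4-|Q(z)|^2}<1\}$; its Bergman metric is normalized by a positive constant factor so that it induces on $\mathbb{B}^n=\mathcal{B}^n\cap\mathbb{R}^n$ the hyperbolic metric above. $\mathcal{S}(\mathbb{B}^n)$ is the space of oriented $(n-2)$-spheres contained in $\mathbb{B}^n$ (including points, i.e. spheres of radius $0$, without orientation; for $n=2$ an oriented $0$-sphere is an ordered pair of points). The spheres are the same sets in Euclidean and hyperbolic geometry. The map $T:\mathcal{B}^n\to\mathcal{S}(\mathbb{B}^n)$ sends $z=x+iy$ ($x,y\in\mathbb{R}^n$) to the sphere with Euclidean center $x$ and radius $\|y\|$ in the affine hyperplane through $x$ orthogonal to $y$, oriented as follows: for $n\ge3$, a basis $b$ of the tangent space of the sphere at a point $p$ is direct iff $(y,\nu,b)$ is a direct basis of $\mathbb{R}^n$, $\nu$ being the external normal at $p$ to the sphere in that hyperplane; for $n=2$, $T(z)=(z_1+iz_2,\ \overline{z_1}+i\overline{z_2})$ with $\mathbb{R}^2\simeq\mathbb{C}$. It is a bijection. The map $S:T\mathbb{B}^n\to\mathcal{S}(\mathbb{B}^n)$ sends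 a tangent vector $v$ at $x$ to the sphere with hyperbolic center $x$ and hyperbolic radius the hyperbolic length of $v$, contained in the hyperbolic hyperplane through $x$ orthogonal to $v$, oriented by the same rule: for $n\ge3$, $b$ is direct iff $(w,\nu,b)$ is direct, where $w$ is the normal at $p$ to the hyperbolic hyperplane on the same side as $v$ and $\nu$ is the external normal at $p$ to the sphere in the hyperbolic hyperplane; for $n=2$ the first point is the one reached from $x$ in the direction of $v$ rotated by $+\pi/2$. It is a bijection. Thus $\theta(v)=z$ iff $T(z)=S(v)$. *)

theory Defs
  imports "HOL-Analysis.Analysis"
begin

section \<open>Riemannian geometry on open subsets of a Euclidean space\<close>

text \<open>
  All manifolds involved are (submanifolds of) open subsets \<open>U\<close> of Euclidean spaces; a metric on
  \<open>U\<close> is a function \<open>g\<close> with \<open>g x u v\<close> the inner product of \<open>u\<close> and \<open>v\<close> at \<open>x\<close>. Its values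
  outside \<open>U\<close> are irrelevant, since derivatives are only taken at points of the open set \<open>U\<close>.
\<close>

type_synonym 'a metric_field = "'a \<Rightarrow> 'a \<Rightarrow> 'a \<Rightarrow> real"

primrec Ck_on :: "nat \<Rightarrow> 'a::real_normed_vector set \<Rightarrow> ('a \<Rightarrow> 'b::real_normed_vector) \<Rightarrow> bool" where
  "Ck_on 0 U f \<longleftrightarrow> continuous_on U f"
| "Ck_on (Suc k) U f \<longleftrightarrow>
     f differentiable_on U \<and> (\<forall>v. Ck_on k U (\<lambda>x. frechet_derivative f (at x) v))"

definition smooth_on :: "'a::real_normed_vector set \<Rightarrow> ('a \<Rightarrow> 'b::real_normed_vector) \<Rightarrow> bool" where
  "smooth_on U f \<longleftrightarrow> (\<forall>k. Ck_on k U f)"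

definition tangent_space :: "'a::real_normed_vector set \<Rightarrow> 'a \<Rightarrow> 'a set" where
  "tangent_space N q = {w. \<exists>c e. e > 0 \<and> smooth_on {-e<..<e} c \<and> c ` {-e<..<e} \<subseteq> N \<and>
     c (0::real) = q \<and> (c has_vector_derivative w) (at 0)}"

definition embedded_submanifold :: "'a::euclidean_space set \<Rightarrow> bool" where
  "embedded_submanifold N \<longleftrightarrow> (\<exists>L. subspace L \<and> (\<forall>x\<in>N. \<exists>V W \<phi> \<psi>.
     open V \<and> x \<in> V \<and> open W \<and> homeomorphism V W \<phi> \<psi> \<and> smooth_on V \<phi> \<and> smooth_on W \<psi> \<and>
     \<phi> ` (N \<inter> V) = (L::'a set) \<inter> W))"

definition pullback_metric ::
    "('a::real_normed_vector \<Rightarrow> 'b::real_normed_vector) \<Rightarrow> 'b metric_field \<Rightarrow> 'a metric_field" where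
  "pullback_metric f g x u v = g (f x) (frechet_derivative f (at x) u) (frechet_derivative f (at x) v)"

text \<open>
  \<open>christoffel g x u w\<close> is the vector with components
  \<open>\<Gamma>\<^sup>k\<^sub>i\<^sub>j u\<^sup>i w\<^sup>j\<close> of the Levi-Civita connection: \<open>\<nabla>\<^sub>u W = D\<^sub>u W + christoffel g x u W\<close>.
\<close>

definition christoffel :: "'a::real_normed_vector metric_field \<Rightarrow> 'a \<Rightarrow> 'a \<Rightarrow> 'a \<Rightarrow> 'a" where
  "christoffel g x u w = (THE c. \<forall>z. g x c z =
     (frechet_derivative (\<lambda>y. g y w z) (at x) u + frechet_derivative (\<lambda>y. g y u z) (at x) w
       - frechet_derivative (\<lambda>y. g y u w) (at x) z) / 2)"

definition geodesic_on ::
    "'a::real_normed_vector set \<Rightarrow> 'a metric_field \<Rightarrow> real set \<Rightarrow> (real \<Rightarrow> 'a) \<Rightarrow> bool" where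
  "geodesic_on U g I \<gamma> \<longleftrightarrow> open I \<and> is_interval I \<and> \<gamma> ` I \<subseteq> U \<and>
     (\<exists>\<gamma>'. \<forall>t\<in>I. (\<gamma> has_vector_derivative \<gamma>' t) (at t) \<and>
        (\<gamma>' has_vector_derivative - christoffel g (\<gamma> t) (\<gamma>' t) (\<gamma>' t)) (at t))"

text \<open>Complete, non-constant geodesics, regarded as unparametrized curves.\<close>

definition geodesic_line :: "'a::real_normed_vector set \<Rightarrow> 'a metric_field \<Rightarrow> 'a set \<Rightarrow> bool" where
  "geodesic_line U g l \<longleftrightarrow>
     (\<exists>\<gamma>. geodesic_on U g UNIV \<gamma> \<and> \<not> \<gamma> constant_on UNIV \<and> l = range \<gamma>)"

text \<open>
  The definition of Kobayashi and Nomizu: every geodesic of the ambient manifold that starts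
  tangentially to \<open>N\<close> stays in \<open>N\<close> for small values of the parameter.
\<close>

definition totally_geodesic :: "'a::euclidean_space set \<Rightarrow> 'a metric_field \<Rightarrow> 'a set \<Rightarrow> bool" where
  "totally_geodesic U g N \<longleftrightarrow> N \<subseteq> U \<and> embedded_submanifold N \<and>
     (\<forall>I \<gamma> w. geodesic_on U g I \<gamma> \<and> 0 \<in> I \<and> \<gamma> 0 \<in> N \<and>
        (\<gamma> has_vector_derivative w) (at 0) \<and> w \<in> tangent_space N (\<gamma> 0) \<longrightarrow>
        (\<exists>e>0. \<forall>t. \<bar>t\<bar> < e \<longrightarrow> t \<in> I \<and> \<gamma> t \<in> N))"

text \<open>
  \<open>N\<close>, with the metric induced by \<open>g\<close>, is isometric to the open set \<open>D\<close> with the metric \<open>h\<close>.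
  As \<open>h\<close> is positive definite on \<open>D\<close>, the last condition makes \<open>\<phi>\<close> an immersion, hence (being a
  homeomorphism onto \<open>N\<close>) an embedding with image \<open>N\<close> and a diffeomorphism from \<open>D\<close> onto \<open>N\<close>.
\<close>

definition isometric_to_domain ::
    "'a::real_normed_vector metric_field \<Rightarrow> 'a set \<Rightarrow> 'b::real_normed_vector set \<Rightarrow> 'b metric_field \<Rightarrow> bool"
  where
  "isometric_to_domain g N D h \<longleftrightarrow> (\<exists>\<phi> \<psi>. homeomorphism D N \<phi> \<psi> \<and> smooth_on D \<phi> \<and>
     (\<forall>x\<in>D. \<forall>u v. pullback_metric \<phi> g x u v = h x u v))"

definition curve_length :: "'a::real_normed_vector metric_field \<Rightarrow> (real \<Rightarrow> 'a) \<Rightarrow> real" where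
  "curve_length g \<gamma> = integral {0..1} (\<lambda>t. sqrt (g (\<gamma> t)
     (vector_derivative \<gamma> (at t)) (vector_derivative \<gamma> (at t))))"

text \<open>
  The curves are \<open>C\<^sup>1\<close> up to the endpoints. The library's piecewise \<open>C\<^sup>1\<close> paths are unsuitable
  here: their derivative may be unbounded near a break point, so their speed need not be
  integrable, in which case \<open>integral\<close> has the value \<open>0\<close>.
\<close>

definition riem_dist :: "'a::real_normed_vector set \<Rightarrow> 'a metric_field \<Rightarrow> 'a \<Rightarrow> 'a \<Rightarrow> real" where
  "riem_dist U g x y = Inf {curve_length g \<gamma> |\<gamma>.
     \<gamma> C1_differentiable_on {0..1} \<and> \<gamma> ` {0..1} \<subseteq> U \<and> \<gamma> 0 = x \<and> \<gamma> 1 = y}"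

definition riem_exp :: "'a::real_normed_vector set \<Rightarrow> 'a metric_field \<Rightarrow> 'a \<Rightarrow> 'a \<Rightarrow> 'a" where
  "riem_exp U g x v = (THE p. \<exists>I \<gamma>. geodesic_on U g I \<gamma> \<and> {0..1} \<subseteq> I \<and> \<gamma> 0 = x \<and>
     (\<gamma> has_vector_derivative v) (at 0) \<and> \<gamma> 1 = p)"


section \<open>The Poincare ball and the Lie ball\<close>

definition poincare_metric :: "'a::real_inner metric_field" where
  "poincare_metric x u v = (u \<bullet> v) / (1 - (norm x)\<^sup>2)\<^sup>2"

definition lie_Q :: "complex^'n \<Rightarrow> complex" where
  "lie_Q z = (\<Sum>i\<in>UNIV. (z $ i)\<^sup>2)"

definition lie_ball :: "(complex^'n) set" where
  "lie_ball = {z. (norm z)\<^sup>2 + sqrt ((norm z) ^ 4 - (cmod (lie_Q z))\<^sup>2) < 1}"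

definition re_vec :: "complex^'n \<Rightarrow> real^'n" where
  "re_vec z = (\<chi> i. Re (z $ i))"

definition im_vec :: "complex^'n \<Rightarrow> real^'n" where
  "im_vec z = (\<chi> i. Im (z $ i))"

definition of_real_vec :: "real^'n \<Rightarrow> complex^'n" where
  "of_real_vec x = (\<chi> i. complex_of_real (x $ i))"

definition holomorphic_vec_on :: "(complex^'n \<Rightarrow> complex) \<Rightarrow> (complex^'n) set \<Rightarrow> bool" where
  "holomorphic_vec_on f U \<longleftrightarrow>
     (\<forall>z\<in>U. \<exists>f'. (f has_derivative f') (at z) \<and> (\<forall>c v. f' (c *s v) = c * f' v))"

definition bergman_space :: "(complex^'n) set \<Rightarrow> (complex^'n \<Rightarrow> complex) set" where
  "bergman_space U =
     {f. holomorphic_vec_on f U \<and> set_integrable lborel U (\<lambda>z. (cmod (f z))\<^sup>2)}"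

text \<open>
  The reproducing kernel of the Bergman space; the functions \<open>k\<close> are extended by \<open>0\<close> outside \<open>U\<close>
  to make them unique as total functions.
\<close>

definition bergman_kernel :: "(complex^'n) set \<Rightarrow> complex^'n \<Rightarrow> complex^'n \<Rightarrow> complex" where
  "bergman_kernel U z w = (THE k. k \<in> bergman_space U \<and> (\<forall>u. u \<notin> U \<longrightarrow> k u = 0) \<and>
     (\<forall>f\<in>bergman_space U. f w = set_lebesgue_integral lborel U (\<lambda>u. f u * cnj (k u)))) z"

definition wirtinger :: "'n \<Rightarrow> (complex^'n \<Rightarrow> complex) \<Rightarrow> complex^'n \<Rightarrow> complex" where
  "wirtinger i F z = (frechet_derivative F (at z) (axis i 1)
     - \<i> * frechet_derivative F (at z) (axis i \<i>)) / 2"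

definition wirtinger_bar :: "'n \<Rightarrow> (complex^'n \<Rightarrow> complex) \<Rightarrow> complex^'n \<Rightarrow> complex" where
  "wirtinger_bar j F z = (frechet_derivative F (at z) (axis j 1)
     + \<i> * frechet_derivative F (at z) (axis j \<i>)) / 2"

text \<open>
  The Riemannian metric that is the real part of the Hermitian metric with coefficients
  \<open>\<partial>\<^sup>2 log K(z, z) / (\<partial>z\<^sub>i \<partial>cnj z\<^sub>j)\<close>.
\<close>

definition bergman_metric :: "(complex^'n) set \<Rightarrow> (complex^'n) metric_field" where
  "bergman_metric U z u v = Re (\<Sum>i\<in>UNIV. \<Sum>j\<in>UNIV.
     wirtinger i (wirtinger_bar j (\<lambda>\<zeta>. complex_of_real (ln (Re (bergman_kernel U \<zeta> \<zeta>))))) z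
       * (u $ i) * cnj (v $ j))"

definition lie_metric :: "(complex^'n) metric_field" where
  "lie_metric z u v =
     (THE c. c > 0 \<and> (\<forall>x\<in>ball 0 1. \<forall>a b :: real^'n.
        c * bergman_metric lie_ball (of_real_vec x) (of_real_vec a) (of_real_vec b)
          = poincare_metric x a b))
     * bergman_metric lie_ball z u v"


section \<open>Oriented spheres of codimension two\<close>

text \<open>
  The linear order of the index type orders the coordinates and hence orients \<open>\<real>\<^sup>n\<close>:
  \<open>[v\<^sub>1, \<dots>, v\<^sub>n]\<close> is direct if the matrix with rows \<open>v\<^sub>1, \<dots>, v\<^sub>n\<close> has positive determinant.
\<close>

definition direct_basis :: "(real^('n::{finite,linorder})) list \<Rightarrow> bool" where
  "direct_basis vs \<longleftrightarrow>
     length vs = CARD('n) \<and> det (\<chi> i. vs ! card {k. k < i}) > 0"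

definition ordered_basis :: "'a::real_vector set \<Rightarrow> 'a list \<Rightarrow> bool" where
  "ordered_basis V b \<longleftrightarrow> distinct b \<and> set b \<subseteq> V \<and> independent (set b) \<and> V \<subseteq> span (set b)"

text \<open>For \<open>n = 2\<close>, the identification of \<open>\<real>\<^sup>2\<close> with the complex numbers.\<close>

definition complex_of_plane :: "real^('n::{finite,linorder}) \<Rightarrow> complex" where
  "complex_of_plane x = Complex (x $ Min UNIV) (x $ Max UNIV)"

definition plane_of_complex :: "complex \<Rightarrow> real^('n::{finite,linorder})" where
  "plane_of_complex c = (\<chi> i. if i = Min UNIV then Re c else Im c)"

text \<open>
  For \<open>n = 2\<close> an oriented sphere is an ordered pair of points. For \<open>n \<ge> 3\<close> it is a set together
  with the set of all \<open>(p, b)\<close> with \<open>b\<close> a direct basis of the tangent space at the point \<open>p\<close>.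
  For a sphere of radius \<open>0\<close> the latter set is empty, as the tangent space is then trivial while
  direct bases must have length \<open>n - 2\<close>.
\<close>

datatype 'a oriented_sphere =
    Point_Pair 'a 'a
  | Oriented_Sphere "'a set" "('a \<times> 'a list) set"

definition sphere_T ::
    "complex^('n::{finite,linorder}) \<Rightarrow> (real^('n::{finite,linorder})) oriented_sphere"
  where
  "sphere_T z =
    (if CARD('n) = 2 then
       Point_Pair (plane_of_complex (z $ Min UNIV + \<i> * z $ Max UNIV))
                  (plane_of_complex (cnj (z $ Min UNIV) + \<i> * cnj (z $ Max UNIV)))
     else
       (let x = re_vec z; y = im_vec z; A = {p. dist x p = norm y \<and> (p - x) \<bullet> y = 0} in
         Oriented_Sphere A {(p, b). p \<in> A \<and> ordered_basis (tangent_space A p) b \<and>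
           direct_basis (y # ((p - x) /\<^sub>R norm y) # b)}))"

definition hyp_hyperplane :: "real^'n \<Rightarrow> real^'n \<Rightarrow> (real^'n) set" where
  "hyp_hyperplane x v = {riem_exp (ball 0 1) poincare_metric x u |u. poincare_metric x u v = 0}"

definition hyp_sphere :: "real^'n \<Rightarrow> real^'n \<Rightarrow> (real^'n) set" where
  "hyp_sphere x v = {p \<in> hyp_hyperplane x v.
     riem_dist (ball 0 1) poincare_metric x p = sqrt (poincare_metric x v v)}"

text \<open>
  \<open>w\<close> is normal at \<open>p\<close> to the hyperplane and on the same side as \<open>v\<close>: the points \<open>x + sv\<close> and
  \<open>p + sw\<close>, for small \<open>s > 0\<close>, lie in the same component of the complement of the hyperplane.
\<close>

definition hyperplane_normal :: "real^'n \<Rightarrow> real^'n \<Rightarrow> real^'n \<Rightarrow> real^'n \<Rightarrow> bool" where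
  "hyperplane_normal x v p w \<longleftrightarrow> w \<noteq> 0 \<and>
     (\<forall>u\<in>tangent_space (hyp_hyperplane x v) p. poincare_metric p w u = 0) \<and>
     (\<exists>e>0. \<forall>s\<in>{0<..<e}.
        connected_component (ball 0 1 - hyp_hyperplane x v) (x + s *\<^sub>R v) (p + s *\<^sub>R w))"

text \<open>External: moving from \<open>p\<close> in the direction \<open>\<nu>\<close> leaves the ball bounded by the sphere.\<close>

definition external_normal :: "real^'n \<Rightarrow> real^'n \<Rightarrow> real^'n \<Rightarrow> real^'n \<Rightarrow> bool" where
  "external_normal x v p \<nu> \<longleftrightarrow> \<nu> \<noteq> 0 \<and> \<nu> \<in> tangent_space (hyp_hyperplane x v) p \<and>
     (\<forall>u\<in>tangent_space (hyp_sphere x v) p. poincare_metric p \<nu> u = 0) \<and>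
     (\<exists>e>0. \<forall>s\<in>{0<..<e}. p + s *\<^sub>R \<nu> \<in> ball 0 1 \<and>
        riem_dist (ball 0 1) poincare_metric x (p + s *\<^sub>R \<nu>) > sqrt (poincare_metric x v v))"

text \<open>
  The normals are not normalized, as only their directions matter for the orientation. For
  \<open>n = 2\<close>, multiplication by \<open>\<i>\<close> is the rotation by \<open>+\<pi>/2\<close>.
\<close>

definition sphere_S ::
    "(real^('n::{finite,linorder})) \<times> (real^('n::{finite,linorder}))
      \<Rightarrow> (real^('n::{finite,linorder})) oriented_sphere"
  where
  "sphere_S = (\<lambda>(x, v).
     if CARD('n) = 2 then
       (let u = plane_of_complex (\<i> * complex_of_plane v) in
         Point_Pair (riem_exp (ball 0 1) poincare_metric x u)
                    (riem_exp (ball 0 1) poincare_metric x (- u)))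
     else
       Oriented_Sphere (hyp_sphere x v)
         {(p, b). p \<in> hyp_sphere x v \<and> ordered_basis (tangent_space (hyp_sphere x v) p) b \<and>
           (\<exists>w \<nu>. hyperplane_normal x v p w \<and> external_normal x v p \<nu> \<and>
              direct_basis (w # \<nu> # b))})"


section \<open>The metric on the tangent bundle of the Poincare ball\<close>

text \<open>\<open>TB\<^sup>n\<close> is \<open>B\<^sup>n \<times> \<real>\<^sup>n\<close>; the pair \<open>(x, v)\<close> is the tangent vector \<open>v\<close> at \<open>x\<close>.\<close>

definition ball_tangent_bundle :: "((real^'n) \<times> (real^'n)) set" where
  "ball_tangent_bundle = ball 0 1 \<times> UNIV"

definition theta ::
    "(real^('n::{finite,linorder})) \<times> (real^('n::{finite,linorder})) \<Rightarrow> complex^('n::{finite,linorder})" where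
  "theta = inv_into lie_ball sphere_T \<circ> sphere_S"

definition tangent_bundle_metric ::
    "((real^('n::{finite,linorder})) \<times> (real^('n::{finite,linorder}))) metric_field" where
  "tangent_bundle_metric = pullback_metric theta lie_metric"

definition tangent_vectors :: "'a::real_normed_vector set \<Rightarrow> ('a \<times> 'a) set" where
  "tangent_vectors l = {(q, w). q \<in> l \<and> w \<in> tangent_space l q}"

end

theory Submission
  imports Defs "HOL-Complex_Analysis.Cauchy_Integral_Formula"
begin

text \<open>
  The isometries of the ball act on the Lie ball by complexified Moebius transformations, which are
  isometries of the Bergman metric. Write \<open>mob x\<close> for the one moving \<open>x\<close> to \<open>0\<close>. Points of the
  sphere \<open>T z\<close> are the real zeros of \<open>Q (p - z)\<close>, and Moebius maps multiply \<open>Q (z - w)\<close> by nonzero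
  factors; so \<open>T\<close> and \<open>S\<close> are equivariant, and comparing them at the origin gives
  \<open>\<theta> (x, v) = mob (- x) (\<i> y)\<close> with \<open>y\<close> the vector of length \<open>tanh |v|\<^sub>h\<^sub>y\<^sub>p\<close> in the direction of \<open>v\<close>.

  Hence \<open>mob p \<circ> \<theta>\<close> is, for each \<open>p\<close>, an isometry of the tangent bundle onto the Lie ball that
  sends the tangent space at \<open>p\<close> to the purely imaginary vectors. Purely imaginary lines carry
  geodesics, and the purely imaginary vectors are totally geodesic as the fixed points of the isometry
  \<open>z \<mapsto> - cnj z\<close> (used through the uniqueness of geodesics). Finally, \<open>\<theta>\<close> maps the vectors tangent
  to a geodesic through \<open>x\<close> with direction \<open>e\<close> to the image under \<open>mob (- x)\<close> of the disk \<open>\<zeta> e\<close>,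
  \<open>|\<zeta>| < 1\<close>, on which the Bergman metric is the hyperbolic metric.

  The Bergman kernel is found by transitivity: at \<open>0\<close> the constants reproduce by the mean value
  property, and the automorphisms \<open>mob a\<close> and \<open>z \<mapsto> \<i> z\<close> transport this to all points.
\<close>

section \<open>Smooth maps\<close>

text \<open>\<open>theta\<close> is given by choice, as an inverse of \<open>sphere_T\<close>, so a
  formula for it needs injectivity of \<open>sphere_T\<close> and equality of two oriented spheres.
  For \<open>n \<ge> 3\<close> the orientations agree because Moebius maps multiply
  \<open>Q (p - z)\<close> by a nonzero complex factor, which acts on the normal plane of the sphere
  as a rotation and dilation, of positive determinant.

  Conjugate points are treated as independent variables: \<open>hb z w\<close> is a polynomial that
  is real for \<open>w = cnjv z\<close>. Invariance of kernel and metric thereby becomes a matter of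
  polynomial identities, and the Kaehler symmetry makes the Christoffel symbols complex bilinear.

  The base point of a vector is recovered from its image through Klein coordinates. This gives
  transitivity, injectivity of the derivative of \<open>theta\<close>, and the recognition of
  fibres. As \<open>christoffel\<close> is a definite description, the pulled back connection is
  under control only once that derivative is known to be bijective. Smoothness at zero vectors,
  where \<open>norm\<close> and \<open>sgn\<close> fail, comes from entire series in the squared
  length.\<close>

lemma Ck_on_cong:
  assumes "open U" "\<And>x. x \<in> U \<Longrightarrow> f x = g x"
  shows "Ck_on k U f \<longleftrightarrow> Ck_on k U g"
  using assms(2)
proof (induction k arbitrary: f g)
  case 0
  then show ?case by (simp cong: continuous_on_cong)
next
  case (Suc k)
  have d: "(f has_derivative D) (at x) \<longleftrightarrow> (g has_derivative D) (at x)" if "x \<in> U" for x D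
    using assms(1) that Suc.prems has_derivative_transform_within_open[of f D x UNIV U g]
      has_derivative_transform_within_open[of g D x UNIV U f] by auto
  have fd: "frechet_derivative f (at x) = frechet_derivative g (at x)" if "x \<in> U" for x
    by (simp add: frechet_derivative_def d that)
  have "f differentiable_on U \<longleftrightarrow> g differentiable_on U"
    unfolding differentiable_on_eq_differentiable_at[OF assms(1)] differentiable_def
    using d by auto
  moreover have "Ck_on k U (\<lambda>x. frechet_derivative f (at x) v)
      \<longleftrightarrow> Ck_on k U (\<lambda>x. frechet_derivative g (at x) v)" for v
    by (rule Suc.IH) (simp add: fd)
  ultimately show ?case by simp
qed

text \<open>\<open>Ck_on\<close> is phrased with \<open>frechet_derivative\<close>; on an open set
  any explicit derivative can take its place, which is how closed-form derivatives enter.\<close>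

lemma Ck_on_SucI:
  assumes "open U" "\<And>x. x \<in> U \<Longrightarrow> (f has_derivative f' x) (at x)"
    "\<And>v. Ck_on k U (\<lambda>x. f' x v)"
  shows "Ck_on (Suc k) U f"
proof -
  have "frechet_derivative f (at x) = f' x" if "x \<in> U" for x
    using frechet_derivative_at[OF assms(2)[OF that]] by simp
  then have "Ck_on k U (\<lambda>x. frechet_derivative f (at x) v)" for v
    using assms(3)[of v] Ck_on_cong[OF assms(1), of "\<lambda>x. frechet_derivative f (at x) v" "\<lambda>x. f' x v" k] by simp
  moreover have "f differentiable_on U"
    using assms(2) differentiable_at_imp_differentiable_on differentiableI by blast
  ultimately show ?thesis by simp
qed

lemma Ck_on_SucD:
  assumes "open U" "Ck_on (Suc k) U f" "x \<in> U"
  shows "(f has_derivative frechet_derivative f (at x)) (at x)"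
  using assms by (auto simp: differentiable_on_eq_differentiable_at frechet_derivative_works)

lemma Ck_on_mono:
  assumes "Ck_on m U f" "k \<le> m"
  shows "Ck_on k U f"
proof -
  have step: "Ck_on (Suc k) U f \<Longrightarrow> Ck_on k U f" for k and f :: "'a \<Rightarrow> 'b"
  proof (induction k arbitrary: f)
    case 0
    then show ?case by (auto intro: differentiable_imp_continuous_on)
  next
    case (Suc k)
    have "f differentiable_on U" "Ck_on (Suc k) U (\<lambda>x. frechet_derivative f (at x) v)" for v
      using Suc.prems by (simp_all only: Ck_on.simps(2)[of "Suc k"])
    then show ?case using Suc.IH by (metis Ck_on.simps(2))
  qed
  show ?thesis
    using assms by (induction m) (auto simp del: Ck_on.simps simp: le_Suc_eq dest: step)
qed

lemma Ck_on_imp_continuous_on: "Ck_on k U f \<Longrightarrow> continuous_on U f"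
  using Ck_on_mono[of k U f 0] by simp

lemma Ck_on_subset:
  assumes "Ck_on k U f" "V \<subseteq> U"
  shows "Ck_on k V f"
  using assms
  by (induction k arbitrary: f) (auto intro: continuous_on_subset differentiable_on_subset)

lemma Ck_on_const [intro!]: "open U \<Longrightarrow> Ck_on k U (\<lambda>x. c)"
proof (induction k arbitrary: c)
  case (Suc k)
  then show ?case by (intro Ck_on_SucI[where f' = "\<lambda>_ _. 0"]) auto
qed simp

lemma Ck_on_bounded_linear:
  assumes "open U" "bounded_linear L"
  shows "Ck_on k U L"
proof (cases k)
  case 0
  then show ?thesis using assms(2) by (simp add: linear_continuous_on)
next
  case (Suc m)
  show ?thesis
    unfolding Suc
    by (rule Ck_on_SucI[OF assms(1), where f' = "\<lambda>_. L"])
      (auto intro: bounded_linear_imp_has_derivative assms)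
qed

lemma Ck_on_id [intro!]: "open U \<Longrightarrow> Ck_on k U (\<lambda>x. x)"
  by (rule Ck_on_bounded_linear) (auto intro: bounded_linear_ident)

lemma Ck_on_linear_comp:
  assumes "open U" "bounded_linear L" "Ck_on k U f"
  shows "Ck_on k U (\<lambda>x. L (f x))"
  using assms(3)
proof (induction k arbitrary: f)
  case 0
  then show ?case using assms(2) by (auto intro: bounded_linear.continuous_on)
next
  case (Suc k)
  show ?case
    by (rule Ck_on_SucI[OF assms(1), where f' = "\<lambda>x v. L (frechet_derivative f (at x) v)"])
      (use Suc in \<open>auto intro!: bounded_linear.has_derivative[OF assms(2)] Ck_on_SucD[OF assms(1)] simp del: Ck_on.simps\<close>,
       use Suc.prems Suc.IH in auto)
qed

lemma Ck_on_add:
  assumes "open U" "Ck_on k U f" "Ck_on k U g"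
  shows "Ck_on k U (\<lambda>x. f x + g x)"
  using assms(2,3)
proof (induction k arbitrary: f g)
  case 0
  then show ?case by (auto intro: continuous_on_add)
next
  case (Suc k)
  show ?case
  proof (rule Ck_on_SucI[OF assms(1)])
    show "((\<lambda>x. f x + g x) has_derivative (\<lambda>v. frechet_derivative f (at x) v + frechet_derivative g (at x) v)) (at x)"
      if "x \<in> U" for x
      using Suc.prems that by (intro has_derivative_add Ck_on_SucD[OF assms(1)])
    show "Ck_on k U (\<lambda>x. frechet_derivative f (at x) v + frechet_derivative g (at x) v)" for v
      using Suc by simp
  qed
qed

lemma Ck_on_bilinear:
  assumes "open U" "bounded_bilinear B" "Ck_on k U f" "Ck_on k U g"
  shows "Ck_on k U (\<lambda>x. B (f x) (g x))"
  using assms(3,4)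
proof (induction k arbitrary: f g)
  case 0
  then show ?case using assms(2) by (auto intro: bounded_bilinear.continuous_on)
next
  case (Suc k)
  show ?case
  proof (rule Ck_on_SucI[OF assms(1)])
    show "((\<lambda>x. B (f x) (g x)) has_derivative
        (\<lambda>v. B (f x) (frechet_derivative g (at x) v) + B (frechet_derivative f (at x) v) (g x))) (at x)"
      if "x \<in> U" for x
      using Suc.prems that by (intro bounded_bilinear.FDERIV[OF assms(2)] Ck_on_SucD[OF assms(1)])
    have "Ck_on k U f" "Ck_on k U g"
      using Suc.prems Ck_on_mono le_SucI by blast+
    then show "Ck_on k U (\<lambda>x. B (f x) (frechet_derivative g (at x) v) + B (frechet_derivative f (at x) v) (g x))" for v
      using Suc by (intro Ck_on_add assms(1) Suc.IH) auto
  qed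
qed

lemma Ck_on_minus: "open U \<Longrightarrow> Ck_on k U f \<Longrightarrow> Ck_on k U (\<lambda>x. - f x)"
  by (rule Ck_on_linear_comp) (auto intro: bounded_linear_minus bounded_linear_ident)

lemma Ck_on_diff: "open U \<Longrightarrow> Ck_on k U f \<Longrightarrow> Ck_on k U g \<Longrightarrow> Ck_on k U (\<lambda>x. f x - g x)"
  using Ck_on_add[of U k f "\<lambda>x. - g x"] Ck_on_minus[of U k g] by simp

lemma Ck_on_mult:
  fixes f g :: "'a::real_normed_vector \<Rightarrow> 'b::real_normed_algebra"
  shows "open U \<Longrightarrow> Ck_on k U f \<Longrightarrow> Ck_on k U g \<Longrightarrow> Ck_on k U (\<lambda>x. f x * g x)"
  by (rule Ck_on_bilinear[OF _ bounded_bilinear_mult])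

lemma Ck_on_scaleR: "open U \<Longrightarrow> Ck_on k U f \<Longrightarrow> Ck_on k U g \<Longrightarrow> Ck_on k U (\<lambda>x. f x *\<^sub>R g x)"
  by (rule Ck_on_bilinear[OF _ bounded_bilinear_scaleR])

lemma Ck_on_inner: "open U \<Longrightarrow> Ck_on k U f \<Longrightarrow> Ck_on k U g \<Longrightarrow> Ck_on k U (\<lambda>x. f x \<bullet> g x)"
  by (rule Ck_on_bilinear[OF _ bounded_bilinear_inner])

lemma Ck_on_sum:
  assumes "open U" "\<And>i. i \<in> I \<Longrightarrow> Ck_on k U (f i)"
  shows "Ck_on k U (\<lambda>x. \<Sum>i\<in>I. f i x)"
  using assms(2)
proof (induction I rule: infinite_finite_induct)
  case (insert i I)
  then show ?case by (auto intro!: Ck_on_add assms(1))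
qed (auto intro: assms(1))

lemma Ck_on_power:
  fixes f :: "'a::real_normed_vector \<Rightarrow> 'b::real_normed_algebra_1"
  shows "open U \<Longrightarrow> Ck_on k U f \<Longrightarrow> Ck_on k U (\<lambda>x. f x ^ m)"
  by (induction m) (auto intro: Ck_on_mult)

text \<open>\<open>Ck_on\<close> controls derivatives of \<open>g\<close> in fixed directions only,
  while the chain rule takes them in a direction that moves with \<open>x\<close>. Expanding this
  direction in the basis leaves a finite sum of products covered by the induction hypothesis; hence
  the Euclidean middle space.\<close>

lemma Ck_on_compose:
  fixes g :: "'b::euclidean_space \<Rightarrow> 'c::real_normed_vector"
  assumes "open U" "open V" "Ck_on k U f" "Ck_on k V g" "f ` U \<subseteq> V"
  shows "Ck_on k U (\<lambda>x. g (f x))"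
  using assms(3,4)
proof (induction k arbitrary: g)
  case 0
  then show ?case using assms(5) by (auto intro: continuous_on_compose2)
next
  case (Suc k)
  let ?D = "\<lambda>x v. \<Sum>b\<in>Basis. (frechet_derivative f (at x) v \<bullet> b) *\<^sub>R frechet_derivative g (at (f x)) b"
  show ?case
  proof (rule Ck_on_SucI[OF assms(1)])
    show "((\<lambda>x. g (f x)) has_derivative ?D x) (at x)" if "x \<in> U" for x
    proof -
      have dg: "(g has_derivative frechet_derivative g (at (f x))) (at (f x))"
        using Suc.prems assms(5) that by (auto intro: Ck_on_SucD[OF assms(2)] simp del: Ck_on.simps)
      have df: "(f has_derivative frechet_derivative f (at x)) (at x)"
        using Suc.prems that by (auto intro: Ck_on_SucD[OF assms(1)] simp del: Ck_on.simps)
      have eq: "frechet_derivative g (at (f x)) w = (\<Sum>b\<in>Basis. (w \<bullet> b) *\<^sub>R frechet_derivative g (at (f x)) b)" for w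
      proof -
        have lin: "linear (frechet_derivative g (at (f x)))"
          using dg has_derivative_linear by blast
        show ?thesis
          by (subst (1) euclidean_representation[symmetric, of w])
            (simp add: linear_sum[OF lin] linear_cmul[OF lin])
      qed
      show ?thesis
        using has_derivative_compose[OF df dg] by (subst (asm) eq)
    qed
    have "Ck_on k U f" using Suc.prems Ck_on_mono le_SucI by blast
    then show "Ck_on k U (\<lambda>x. ?D x v)" for v
      by (intro Ck_on_sum Ck_on_scaleR Ck_on_inner assms(1) Ck_on_const Suc.IH)
        (use Suc.prems in auto)
  qed
qed

text \<open>The derivative of \<open>inverse\<close> is a polynomial in \<open>inverse\<close>, so
  the induction closes on itself.\<close>

lemma Ck_on_inverse_field: "Ck_on k (- {0::'a}) (inverse :: 'a::real_normed_field \<Rightarrow> 'a)"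
proof (induction k)
  case 0
  show ?case by (auto intro!: continuous_intros)
next
  case (Suc k)
  have o: "open (- {0::'a})" by auto
  show ?case
  proof (rule Ck_on_SucI[OF o])
    show "(inverse has_derivative (\<lambda>v. - (inverse x * v * inverse x))) (at x)" if "x \<in> - {0}" for x :: 'a
      using that by (intro has_derivative_inverse') simp
    show "Ck_on k (- {0}) (\<lambda>x::'a. - (inverse x * v * inverse x))" for v
      by (intro Ck_on_minus Ck_on_mult o Ck_on_const Suc)
  qed
qed

lemma Ck_on_inverse:
  fixes f :: "'a::real_normed_vector \<Rightarrow> 'b::{real_normed_field,euclidean_space}"
  assumes "open U" "Ck_on k U f" "\<And>x. x \<in> U \<Longrightarrow> f x \<noteq> 0"
  shows "Ck_on k U (\<lambda>x. inverse (f x))"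
  by (rule Ck_on_compose[where V = "- {0}"]) (use assms in \<open>auto intro: Ck_on_inverse_field\<close>)

lemma Ck_on_divide:
  fixes f g :: "'a::real_normed_vector \<Rightarrow> 'b::{real_normed_field,euclidean_space}"
  assumes "open U" "Ck_on k U f" "Ck_on k U g" "\<And>x. x \<in> U \<Longrightarrow> g x \<noteq> 0"
  shows "Ck_on k U (\<lambda>x. f x / g x)"
  unfolding divide_inverse by (intro Ck_on_mult Ck_on_inverse assms)

lemma Ck_on_real_SucI:
  assumes "open S" "\<And>x. x \<in> S \<Longrightarrow> (f has_real_derivative f' x) (at x)" "Ck_on k S f'"
  shows "Ck_on (Suc k) S f"
  by (rule Ck_on_SucI[where f' = "\<lambda>x v. f' x * v", OF assms(1)])
    (use assms in \<open>auto simp: has_field_derivative_def intro!: Ck_on_mult\<close>)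

text \<open>Generalizing over the index of the sequence makes the induction on the order of
  differentiability immediate. Trigonometric functions and entire power series are both handled this
  way.\<close>

lemma Ck_on_derivative_seq:
  fixes f :: "nat \<Rightarrow> real \<Rightarrow> real"
  assumes "open S" "\<And>j x. x \<in> S \<Longrightarrow> (f j has_real_derivative f (Suc j) x) (at x)"
  shows "Ck_on k S (f j)"
proof (induction k arbitrary: j)
  case 0
  then show ?case
    using assms by (auto intro!: continuous_at_imp_continuous_on DERIV_isCont)
next
  case (Suc k)
  show ?case by (rule Ck_on_real_SucI[OF assms(1) assms(2) Suc])
qed

lemma Ck_on_ln: "Ck_on k {0<..} (ln :: real \<Rightarrow> real)"
proof (cases k)
  case (Suc m)
  show ?thesis
    unfolding Suc
    by (rule Ck_on_real_SucI[where f' = inverse])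
      (auto intro!: derivative_eq_intros Ck_on_subset[OF Ck_on_inverse_field] simp: divide_inverse)
qed (auto intro!: continuous_intros)

lemma Ck_on_sqrt: "Ck_on k {0<..} sqrt"
proof (induction k)
  case (Suc m)
  show ?case
    by (rule Ck_on_real_SucI[where f' = "\<lambda>x. inverse (sqrt x) / 2"])
      (auto intro!: DERIV_real_sqrt Ck_on_divide Ck_on_inverse Suc)
qed (auto intro!: continuous_intros)

lemma frechet_derivative_apply_cong:
  "open U \<Longrightarrow> x \<in> U \<Longrightarrow> (\<And>y. y \<in> U \<Longrightarrow> f y = g y) \<Longrightarrow> frechet_derivative f (at x) = frechet_derivative g (at x)"
proof -
  assume a: "open U" "x \<in> U" "\<And>y. y \<in> U \<Longrightarrow> f y = g y"
  have "(f has_derivative D) (at x) \<longleftrightarrow> (g has_derivative D) (at x)" for D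
    using a has_derivative_transform_within_open[of f D x UNIV U g]
      has_derivative_transform_within_open[of g D x UNIV U f] by auto
  then show ?thesis by (simp add: frechet_derivative_def)
qed

lemma Ck_on_Pair:
  assumes "open U" "Ck_on k U f" "Ck_on k U g"
  shows "Ck_on k U (\<lambda>x. (f x, g x))"
proof -
  have "Ck_on k U (\<lambda>x. (f x, 0) + (0, g x))"
    by (intro Ck_on_add assms(1) Ck_on_linear_comp[where f=f and L="\<lambda>a. (a, 0)"]
        Ck_on_linear_comp[where f=g and L="\<lambda>a. (0, a)"] assms)
      (auto intro!: bounded_linear_intros)
  then show ?thesis by simp
qed

text \<open>Both orders of differentiation arise as limits of the same second difference quotient,
  by applying the mean value theorem twice.\<close>

lemma second_difference_mvt:
  fixes f :: "'a::real_normed_vector \<Rightarrow> real"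
  assumes "open U" "Ck_on (Suc (Suc 0)) U f" "h > 0"
    and box: "\<And>s t. 0 \<le> s \<Longrightarrow> s \<le> h \<Longrightarrow> 0 \<le> t \<Longrightarrow> t \<le> h \<Longrightarrow> x + s *\<^sub>R u + t *\<^sub>R v \<in> U"
  shows "\<exists>s t. 0 \<le> s \<and> s \<le> h \<and> 0 \<le> t \<and> t \<le> h \<and>
    f (x + h *\<^sub>R u + h *\<^sub>R v) - f (x + h *\<^sub>R u) - f (x + h *\<^sub>R v) + f x
      = h * h * frechet_derivative (\<lambda>y. frechet_derivative f (at y) u) (at (x + s *\<^sub>R u + t *\<^sub>R v)) v"
proof -
  let ?D = "\<lambda>y. frechet_derivative f (at y)"
  let ?E = "\<lambda>y. frechet_derivative (\<lambda>y. ?D y u) (at y)"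
  have df: "(f has_derivative ?D y) (at y)" if "y \<in> U" for y
    using Ck_on_SucD[OF assms(1,2) that] .
  have dD: "((\<lambda>y. ?D y u) has_derivative ?E y) (at y)" if "y \<in> U" for y
    using assms(2) by (intro Ck_on_SucD[OF assms(1) _ that, where k = 0]) (simp del: Ck_on.simps add: Ck_on.simps(2)[of "Suc 0"])
  define \<phi> where "\<phi> s = f (x + s *\<^sub>R u + h *\<^sub>R v) - f (x + s *\<^sub>R u)" for s
  have d1: "((\<lambda>s. f (x + s *\<^sub>R u + t *\<^sub>R v)) has_real_derivative ?D (x + s *\<^sub>R u + t *\<^sub>R v) u) (at s)"
    if "0 \<le> s" "s \<le> h" "0 \<le> t" "t \<le> h" for s t
  proof -
    have lin: "linear (?D (x + s *\<^sub>R u + t *\<^sub>R v))"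
      using df[OF box[OF that]] has_derivative_linear by blast
    have "((\<lambda>s. x + s *\<^sub>R u + t *\<^sub>R v) has_derivative (\<lambda>r. r *\<^sub>R u)) (at s)"
      by (auto intro!: derivative_eq_intros)
    from has_derivative_compose[OF this df[OF box[OF that]]]
    show ?thesis
      by (simp add: has_field_derivative_def linear_cmul[OF lin] mult_commute_abs)
  qed
  have d1': "((\<lambda>s. f (x + s *\<^sub>R u)) has_real_derivative ?D (x + s *\<^sub>R u) u) (at s)"
    if "0 \<le> s" "s \<le> h" for s
    using d1[OF that, of 0] assms(3) by simp
  have "\<exists>s::real. s > 0 \<and> s < h \<and> \<phi> h - \<phi> 0 = (h - 0) * (?D (x + s *\<^sub>R u + h *\<^sub>R v) u - ?D (x + s *\<^sub>R u) u)"
    unfolding \<phi>_def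
    by (rule MVT2) (use assms(3) in \<open>auto intro!: derivative_intros d1 d1'\<close>)
  then obtain s where s: "0 < s" "s < h"
    and \<phi>: "\<phi> h - \<phi> 0 = h * (?D (x + s *\<^sub>R u + h *\<^sub>R v) u - ?D (x + s *\<^sub>R u) u)" by auto
  have d2: "((\<lambda>t. ?D (x + s *\<^sub>R u + t *\<^sub>R v) u) has_real_derivative ?E (x + s *\<^sub>R u + t *\<^sub>R v) v) (at t)"
    if "0 \<le> t" "t \<le> h" for t
  proof -
    have b: "x + s *\<^sub>R u + t *\<^sub>R v \<in> U" using box that s by auto
    have lin: "linear (?E (x + s *\<^sub>R u + t *\<^sub>R v))"
      using dD[OF b] has_derivative_linear by blast
    have "((\<lambda>t. x + s *\<^sub>R u + t *\<^sub>R v) has_derivative (\<lambda>r. r *\<^sub>R v)) (at t)"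
      by (auto intro!: derivative_eq_intros)
    from has_derivative_compose[OF this dD[OF b]]
    show ?thesis
      by (simp add: has_field_derivative_def linear_cmul[OF lin] mult_commute_abs)
  qed
  have "\<exists>t::real. t > 0 \<and> t < h \<and> ?D (x + s *\<^sub>R u + h *\<^sub>R v) u - ?D (x + s *\<^sub>R u + 0 *\<^sub>R v) u
      = (h - 0) * ?E (x + s *\<^sub>R u + t *\<^sub>R v) v"
    by (rule MVT2[where f = "\<lambda>t. ?D (x + s *\<^sub>R u + t *\<^sub>R v) u"]) (use assms(3) d2 in auto)
  then obtain t where "0 < t" "t < h"
    "?D (x + s *\<^sub>R u + h *\<^sub>R v) u - ?D (x + s *\<^sub>R u) u = h * ?E (x + s *\<^sub>R u + t *\<^sub>R v) v" by auto
  with s \<phi> show ?thesis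
    by (intro exI[of _ s] exI[of _ t]) (simp add: \<phi>_def)
qed

lemma second_derivative_symmetric_real:
  fixes f :: "'a::real_normed_vector \<Rightarrow> real"
  assumes "open U" "Ck_on (Suc (Suc 0)) U f" "x \<in> U"
  shows "frechet_derivative (\<lambda>y. frechet_derivative f (at y) u) (at x) v
       = frechet_derivative (\<lambda>y. frechet_derivative f (at y) v) (at x) u"
proof -
  let ?E = "\<lambda>u v y. frechet_derivative (\<lambda>y. frechet_derivative f (at y) u) (at y) v"
  define H where "H h = (f (x + h *\<^sub>R u + h *\<^sub>R v) - f (x + h *\<^sub>R u) - f (x + h *\<^sub>R v) + f x) / (h * h)" for h
  obtain d where d: "d > 0" "ball x d \<subseteq> U" using assms(1,3) openE by blast
  define c where "c = norm u + norm v + 1"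
  have c: "c > 0" by (simp add: c_def add_nonneg_pos)
  have near: "x + s *\<^sub>R u + t *\<^sub>R v \<in> ball x e"
    if "0 \<le> s" "s \<le> h" "0 \<le> t" "t \<le> h" "h * c < e" for s t h e
  proof -
    have "norm (s *\<^sub>R u + t *\<^sub>R v) \<le> s * norm u + t * norm v"
      using norm_triangle_ineq[of "s *\<^sub>R u" "t *\<^sub>R v"] that by simp
    also have "\<dots> \<le> h * norm u + h * norm v"
      using that by (intro add_mono mult_right_mono) auto
    also have "\<dots> \<le> h * c" using that by (simp add: c_def algebra_simps)
    also have "\<dots> < e" by fact
    finally show ?thesis
      using norm_minus_cancel[of "s *\<^sub>R u + t *\<^sub>R v"] by (simp add: dist_norm algebra_simps)
  qed
  have lim: "(H \<longlongrightarrow> ?E a b x) (at_right 0)"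
    if ab: "(a, b) = (u, v) \<or> (a, b) = (v, u)" for a b
  proof (rule tendstoI)
    fix e :: real assume "e > 0"
    have "continuous_on U (?E a b)"
      using assms(2) by (simp add: numeral_eq_Suc)
    then have "isCont (?E a b) x" using assms(1,3) continuous_on_eq_continuous_at by blast
    then obtain r where r: "r > 0" "\<And>y. dist y x < r \<Longrightarrow> dist (?E a b y) (?E a b x) < e"
      using \<open>e > 0\<close> unfolding continuous_at_eps_delta by blast
    have "dist (H h) (?E a b x) < e" if h: "0 < h" "h < min r d / c" for h
    proof -
      have hc: "h * c < min r d" using h c by (simp add: pos_less_divide_eq)
      have sw: "x + s *\<^sub>R a + t *\<^sub>R b \<in> ball x r \<inter> ball x d"
        if "0 \<le> s" "s \<le> h" "0 \<le> t" "t \<le> h" for s t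
        using near[of s h t r] near[of s h t d] near[of t h s r] near[of t h s d] ab that hc
        by (auto simp: add.assoc add.commute[of "_ *\<^sub>R u"])
      have "\<exists>s t. 0 \<le> s \<and> s \<le> h \<and> 0 \<le> t \<and> t \<le> h \<and>
        f (x + h *\<^sub>R a + h *\<^sub>R b) - f (x + h *\<^sub>R a) - f (x + h *\<^sub>R b) + f x
        = h * h * ?E a b (x + s *\<^sub>R a + t *\<^sub>R b)"
        by (rule second_difference_mvt[OF assms(1,2)]) (use h sw d in auto)
      then obtain s t where st: "0 \<le> s" "s \<le> h" "0 \<le> t" "t \<le> h"
        "f (x + h *\<^sub>R a + h *\<^sub>R b) - f (x + h *\<^sub>R a) - f (x + h *\<^sub>R b) + f x
        = h * h * ?E a b (x + s *\<^sub>R a + t *\<^sub>R b)" by blast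
      have "f (x + h *\<^sub>R a + h *\<^sub>R b) - f (x + h *\<^sub>R a) - f (x + h *\<^sub>R b) + f x = h * h * H h"
        using ab h by (auto simp: H_def add.assoc add.commute[of "h *\<^sub>R v"])
      then have "H h = ?E a b (x + s *\<^sub>R a + t *\<^sub>R b)" using st(5) h by simp
      then show ?thesis using r(2)[of "x + s *\<^sub>R a + t *\<^sub>R b"] sw[OF st(1-4)] by (simp add: dist_commute[of _ x])
    qed
    then show "\<forall>\<^sub>F h in at_right 0. dist (H h) (?E a b x) < e"
      unfolding eventually_at_right_field using r(1) d(1) c
      by (intro exI[of _ "min r d / c"]) auto
  qed
  show ?thesis
    by (rule tendsto_unique[OF _ lim[of u v] lim[of v u]]) auto
qed

lemma second_derivative_symmetric:
  fixes f :: "'a::real_normed_vector \<Rightarrow> 'b::euclidean_space"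
  assumes "open U" "Ck_on (Suc (Suc 0)) U f" "x \<in> U"
  shows "frechet_derivative (\<lambda>y. frechet_derivative f (at y) u) (at x) v
       = frechet_derivative (\<lambda>y. frechet_derivative f (at y) v) (at x) u"
proof (rule euclidean_eqI)
  fix b :: 'b
  have bl: "bounded_linear (\<lambda>y. y \<bullet> b)" by (rule bounded_linear_inner_left)
  have 1: "frechet_derivative (\<lambda>y. f y \<bullet> b) (at y) = (\<lambda>v. frechet_derivative f (at y) v \<bullet> b)" if "y \<in> U" for y
    using frechet_derivative_at[OF bounded_linear.has_derivative[OF bl Ck_on_SucD[OF assms(1,2) that]]] by simp
  have C1: "Ck_on (Suc 0) U (\<lambda>y. frechet_derivative f (at y) w)" for w
    using assms(2) by (simp del: Ck_on.simps add: Ck_on.simps(2)[of "Suc 0"])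
  have 2: "frechet_derivative (\<lambda>y. frechet_derivative f (at y) w \<bullet> b) (at x)
      = (\<lambda>v. frechet_derivative (\<lambda>y. frechet_derivative f (at y) w) (at x) v \<bullet> b)" for w
    using frechet_derivative_at[OF bounded_linear.has_derivative[OF bl Ck_on_SucD[OF assms(1) C1 assms(3)]]] by simp
  have 3: "frechet_derivative (\<lambda>y. frechet_derivative (\<lambda>y. f y \<bullet> b) (at y) w) (at x)
     = frechet_derivative (\<lambda>y. frechet_derivative f (at y) w \<bullet> b) (at x)" for w
    by (rule frechet_derivative_apply_cong[OF assms(1,3)]) (simp add: 1)
  have "Ck_on (Suc (Suc 0)) U (\<lambda>y. f y \<bullet> b)"
    by (rule Ck_on_linear_comp[OF assms(1) bl assms(2)])
  from second_derivative_symmetric_real[OF assms(1) this assms(3), of u v]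
  show "frechet_derivative (\<lambda>y. frechet_derivative f (at y) u) (at x) v \<bullet> b
      = frechet_derivative (\<lambda>y. frechet_derivative f (at y) v) (at x) u \<bullet> b"
    by (simp add: 3 2)
qed

section \<open>Levi-Civita connections and geodesics\<close>

text \<open>The Koszul formula for constant vector fields. It is the right-hand side in
  \<open>christoffel\<close> and can be computed before a vector representing it has been
  found.\<close>

definition koszul :: "'a::real_normed_vector metric_field \<Rightarrow> 'a \<Rightarrow> 'a \<Rightarrow> 'a \<Rightarrow> 'a \<Rightarrow> real" where
  "koszul g x u w z = (frechet_derivative (\<lambda>y. g y w z) (at x) u + frechet_derivative (\<lambda>y. g y u z) (at x) w
       - frechet_derivative (\<lambda>y. g y u w) (at x) z) / 2"

lemma christoffel_eqI:
  assumes "\<And>z. linear (\<lambda>c. g x c z)" "\<And>c. (\<And>z. g x c z = 0) \<Longrightarrow> c = 0"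
    "\<And>z. g x c z = koszul g x u w z"
  shows "christoffel g x u w = c"
  unfolding christoffel_def koszul_def[symmetric]
proof (rule the_equality)
  show "\<forall>z. g x c z = koszul g x u w z" using assms(3) by simp
next
  fix d assume d: "\<forall>z. g x d z = koszul g x u w z"
  have "g x (d - c) z = 0" for z
    using d assms(3) linear_diff[OF assms(1)] by simp
  then show "d = c" using assms(2) by force
qed

text \<open>A product rule for a linear map applied to a moving vector, when differentiability of
  \<open>L\<close> is known only at each fixed vector. Expanding the argument in the basis reduces
  it to products with scalars. Metrics on moving vectors and derivatives along curves are both of
  this kind.\<close>

lemma has_derivative_linear_family:
  fixes L :: "'a::real_normed_vector \<Rightarrow> 'b::euclidean_space \<Rightarrow> 'c::real_normed_vector"
  assumes "open V" "x \<in> V" "\<And>y. y \<in> V \<Longrightarrow> linear (L y)"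
    "\<And>a. (\<lambda>y. L y a) differentiable (at x)" "(A has_derivative A') (at x)"
  shows "((\<lambda>y. L y (A y)) has_derivative
    (\<lambda>h. frechet_derivative (\<lambda>y. L y (A x)) (at x) h + L x (A' h))) (at x)"
proof -
  let ?D = "\<lambda>a. frechet_derivative (\<lambda>y. L y a) (at x)"
  have D: "((\<lambda>y. L y a) has_derivative ?D a) (at x)" for a
    using assms(4) frechet_derivative_works by blast
  have rep: "L y a = (\<Sum>b\<in>Basis. (a \<bullet> b) *\<^sub>R L y b)" if "y \<in> V" for y a
    by (subst (1) euclidean_representation[symmetric, of a])
      (simp add: linear_sum[OF assms(3)[OF that]] linear_cmul[OF assms(3)[OF that]])
  have repD: "?D a h = (\<Sum>b\<in>Basis. (a \<bullet> b) *\<^sub>R ?D b h)" for a h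
  proof -
    have "((\<lambda>y. \<Sum>b\<in>Basis. (a \<bullet> b) *\<^sub>R L y b) has_derivative (\<lambda>h. \<Sum>b\<in>Basis. (a \<bullet> b) *\<^sub>R ?D b h)) (at x)"
      by (auto intro!: derivative_eq_intros D)
    then have "((\<lambda>y. L y a) has_derivative (\<lambda>h. \<Sum>b\<in>Basis. (a \<bullet> b) *\<^sub>R ?D b h)) (at x)"
      by (rule has_derivative_transform_within_open[OF _ assms(1,2)]) (simp add: rep)
    from has_derivative_unique[OF D this] show ?thesis by metis
  qed
  have "((\<lambda>y. \<Sum>b\<in>Basis. (A y \<bullet> b) *\<^sub>R L y b) has_derivative
      (\<lambda>h. \<Sum>b\<in>Basis. (A x \<bullet> b) *\<^sub>R ?D b h + (A' h \<bullet> b) *\<^sub>R L x b)) (at x)"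
    by (auto intro!: derivative_eq_intros D assms(5))
  then have "((\<lambda>y. \<Sum>b\<in>Basis. (A y \<bullet> b) *\<^sub>R L y b) has_derivative
      (\<lambda>h. ?D (A x) h + L x (A' h))) (at x)"
    by (simp add: sum.distrib repD[of "A x"] rep[OF assms(2), of "A' _"])
  then show ?thesis
    by (rule has_derivative_transform_within_open[OF _ assms(1,2)]) (simp add: rep)
qed

lemma has_derivative_metric_along:
  fixes g :: "'b::euclidean_space metric_field"
  assumes V: "open V" "\<And>y. y \<in> V \<Longrightarrow> bilinear (g y)"
    "\<And>y a b. y \<in> V \<Longrightarrow> (\<lambda>y. g y a b) differentiable (at y)"
    and F: "open U" "x \<in> U" "F ` U \<subseteq> V" "\<And>y. y \<in> U \<Longrightarrow> (F has_derivative F' y) (at y)"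
    and A: "(A has_derivative A') (at x)" and B: "(B has_derivative B') (at x)"
  shows "((\<lambda>y. g (F y) (A y) (B y)) has_derivative
    (\<lambda>h. frechet_derivative (\<lambda>y. g y (A x) (B x)) (at (F x)) (F' x h)
        + g (F x) (A' h) (B x) + g (F x) (A x) (B' h))) (at x)"
proof -
  have Fx: "F x \<in> V" using F by auto
  have lin1: "linear (\<lambda>a. g y a b)" if "y \<in> V" for y b using V(2)[OF that] by (simp add: bilinear_def)
  have lin2: "linear (\<lambda>b. g y a b)" if "y \<in> V" for y a using V(2)[OF that] by (simp add: bilinear_def)
  have d0: "((\<lambda>y. g (F y) a b) has_derivative (\<lambda>h. frechet_derivative (\<lambda>y. g y a b) (at (F x)) (F' x h))) (at x)" for a b
    using has_derivative_compose[OF F(4)[OF F(2)]] V(3)[OF Fx] frechet_derivative_works by blast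
  have d1: "((\<lambda>y. g (F y) a (B y)) has_derivative
      (\<lambda>h. frechet_derivative (\<lambda>y. g (F y) a (B x)) (at x) h + g (F x) a (B' h))) (at x)" for a
    by (rule has_derivative_linear_family[OF F(1,2) _ _ B])
      (use F(2,3) d0 differentiableI in \<open>blast intro: lin2\<close>)+
  have e0: "frechet_derivative (\<lambda>y. g (F y) a b) (at x) h = frechet_derivative (\<lambda>y. g y a b) (at (F x)) (F' x h)" for a b h
    using frechet_derivative_at[OF d0] by metis
  have e1: "frechet_derivative (\<lambda>y. g (F y) a (B y)) (at x) h
      = frechet_derivative (\<lambda>y. g y a (B x)) (at (F x)) (F' x h) + g (F x) a (B' h)" for a h
    using frechet_derivative_at[OF d1, symmetric] by (simp add: e0)
  have "((\<lambda>y. g (F y) (A y) (B y)) has_derivative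
      (\<lambda>h. frechet_derivative (\<lambda>y. g (F y) (A x) (B y)) (at x) h + g (F x) (A' h) (B x))) (at x)"
    by (rule has_derivative_linear_family[OF F(1,2) _ _ A])
      (use F(2,3) d1 differentiableI in \<open>blast intro: lin1\<close>)+
  then show ?thesis by (simp add: e1 algebra_simps)
qed

section \<open>Transformation of the connection under a map\<close>

abbreviation deriv2 :: "('a::real_normed_vector \<Rightarrow> 'b::real_normed_vector) \<Rightarrow> 'a \<Rightarrow> 'a \<Rightarrow> 'a \<Rightarrow> 'b" where
  "deriv2 F x u v \<equiv> frechet_derivative (\<lambda>y. frechet_derivative F (at y) u) (at x) v"

locale pullback_setting =
  fixes U :: "'a::euclidean_space set" and V :: "'b::euclidean_space set"
    and F :: "'a \<Rightarrow> 'b" and g :: "'b metric_field"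
  assumes U: "open U" and V: "open V" and F2: "Ck_on (Suc (Suc 0)) U F" and FV: "F ` U \<subseteq> V"
    and bil: "\<And>y. y \<in> V \<Longrightarrow> bilinear (g y)" and sym: "\<And>y a b. y \<in> V \<Longrightarrow> g y a b = g y b a"
    and dif: "\<And>y a b. y \<in> V \<Longrightarrow> (\<lambda>y. g y a b) differentiable (at y)"
begin

abbreviation "F' x \<equiv> frechet_derivative F (at x)"

lemma F_has_derivative: "x \<in> U \<Longrightarrow> (F has_derivative F' x) (at x)"
  using Ck_on_SucD[OF U F2] .

lemma F'_has_derivative: "x \<in> U \<Longrightarrow> ((\<lambda>y. F' y u) has_derivative deriv2 F x u) (at x)"
  using F2 by (intro Ck_on_SucD[OF U, where k = 0]) (simp del: Ck_on.simps add: Ck_on.simps(2)[of "Suc 0"])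

text \<open>Each derivative of the pulled back metric yields one derivative of \<open>g\<close> and
  two second derivatives of \<open>F\<close>. Of the six second-derivative terms, symmetry of
  \<open>deriv2\<close> and of \<open>g\<close> cancels four and merges the other two.\<close>

lemma koszul_pullback:
  assumes x: "x \<in> U"
  shows "koszul (pullback_metric F g) x u w z
    = koszul g (F x) (F' x u) (F' x w) (F' x z) + g (F x) (deriv2 F x u w) (F' x z)"
proof -
  have d: "frechet_derivative (\<lambda>y. g (F y) (F' y a) (F' y b)) (at x) h =
     frechet_derivative (\<lambda>y. g y (F' x a) (F' x b)) (at (F x)) (F' x h)
     + g (F x) (deriv2 F x a h) (F' x b) + g (F x) (F' x a) (deriv2 F x b h)" for a b h
    using frechet_derivative_at[OF has_derivative_metric_along[OF V bil dif U x FV F_has_derivative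
          F'_has_derivative[OF x] F'_has_derivative[OF x], of a b], symmetric] by simp
  have s: "deriv2 F x a b = deriv2 F x b a" for a b
    by (rule second_derivative_symmetric[OF U F2 x])
  have gs: "g (F x) a b = g (F x) b a" for a b using sym FV x by auto
  show ?thesis
    unfolding koszul_def pullback_metric_def d
    using s[of w u] s[of z u] s[of z w]
      gs[of "deriv2 F x u z" "F' x w"] gs[of "deriv2 F x w z" "F' x u"]
    by (simp add: field_simps) 
qed

text \<open>The transformation law of the Christoffel symbols. \<open>\<Gamma>\<close> is given
  through the Koszul formula alone, so a closed expression can be inserted without identifying it as
  \<open>christoffel g\<close>. Bijectivity of the derivative supplies the vector and its
  uniqueness.\<close>

lemma christoffel_pullback:
  assumes x: "x \<in> U" and nd: "\<And>c. (\<And>z. g (F x) c z = 0) \<Longrightarrow> c = 0" and bij: "bij (F' x)"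
    and \<Gamma>: "\<And>u w z. g (F x) (\<Gamma> u w) z = koszul g (F x) u w z"
  shows "F' x (christoffel (pullback_metric F g) x u w) = \<Gamma> (F' x u) (F' x w) + deriv2 F x u w"
proof -
  have lin: "linear (F' x)" using F_has_derivative[OF x] has_derivative_linear by blast
  have linc: "linear (\<lambda>c. g (F x) c z)" for z using bil FV x by (auto simp: bilinear_def)
  obtain c where c: "F' x c = \<Gamma> (F' x u) (F' x w) + deriv2 F x u w"
    using bij by (metis bij_pointE)
  have "christoffel (pullback_metric F g) x u w = c"
  proof (rule christoffel_eqI)
    show "linear (\<lambda>c. pullback_metric F g x c z)" for z
      unfolding pullback_metric_def using linear_compose[OF lin linc] by (simp add: o_def)
    show "c = 0" if "\<And>z. pullback_metric F g x c z = 0" for c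
    proof -
      have "g (F x) (F' x c) z = 0" for z
        using that[of "inv (F' x) z"] bij by (simp add: pullback_metric_def bij_is_surj surj_f_inv_f)
      then have "F' x c = 0" by (rule nd)
      then show ?thesis using bij lin by (metis bij_is_inj injD linear_0)
    qed
    show "pullback_metric F g x c z = koszul (pullback_metric F g) x u w z" for z
      by (simp add: koszul_pullback[OF x] pullback_metric_def c linear_add[OF linc] \<Gamma>)
  qed
  then show ?thesis using c by simp
qed

text \<open>Velocity and acceleration of the image curve. Combined with
  \<open>christoffel_pullback\<close>, the second derivatives of \<open>F\<close> drop out, and
  geodesics of the pulled back metric map to solutions of the geodesic equation for
  \<open>\<Gamma>\<close>.\<close>

lemma curve_derivatives:
  assumes "\<gamma> t \<in> U" "open I" "t \<in> I" "\<And>s. s \<in> I \<Longrightarrow> (\<gamma> has_vector_derivative \<gamma>' s) (at s)"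
    "(\<gamma>' has_vector_derivative a) (at t)"
  shows "((\<lambda>s. F (\<gamma> s)) has_vector_derivative F' (\<gamma> t) (\<gamma>' t)) (at t)"
    "((\<lambda>s. F' (\<gamma> s) (\<gamma>' s)) has_vector_derivative deriv2 F (\<gamma> t) (\<gamma>' t) (\<gamma>' t) + F' (\<gamma> t) a) (at t)"
proof -
  have lin: "linear (F' x)" if "x \<in> U" for x using F_has_derivative[OF that] has_derivative_linear by blast
  have lin2: "linear (deriv2 F x v)" if "x \<in> U" for x v using F'_has_derivative[OF that] has_derivative_linear by blast
  have dg: "(\<gamma> has_derivative (\<lambda>r. r *\<^sub>R \<gamma>' t)) (at t)"
    using assms by (simp add: has_vector_derivative_def)
  show "((\<lambda>s. F (\<gamma> s)) has_vector_derivative F' (\<gamma> t) (\<gamma>' t)) (at t)"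
    using has_derivative_compose[OF dg F_has_derivative[OF assms(1)]]
    by (simp add: has_vector_derivative_def linear_cmul[OF lin[OF assms(1)]])
  have cont: "continuous (at t) \<gamma>" using dg has_derivative_continuous by blast
  obtain W where W: "open W" "t \<in> W" "\<And>s. s \<in> W \<Longrightarrow> \<gamma> s \<in> U"
    using continuous_at_open[THEN iffD1, OF cont, rule_format, of U] U assms(1) by auto
  have e: "((\<lambda>s. F' (\<gamma> s) v) has_derivative (\<lambda>r. deriv2 F (\<gamma> t) v (r *\<^sub>R \<gamma>' t))) (at t)" for v
    using has_derivative_compose[OF dg F'_has_derivative[OF assms(1)]] .
  have "((\<lambda>s. F' (\<gamma> s) (\<gamma>' s)) has_derivative
     (\<lambda>r. frechet_derivative (\<lambda>s. F' (\<gamma> s) (\<gamma>' t)) (at t) r + F' (\<gamma> t) (r *\<^sub>R a))) (at t)"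
    by (rule has_derivative_linear_family[OF W(1,2)])
      (use e W(3) lin assms(5) in \<open>auto intro: differentiableI simp: has_vector_derivative_def\<close>)
  then show "((\<lambda>s. F' (\<gamma> s) (\<gamma>' s)) has_vector_derivative deriv2 F (\<gamma> t) (\<gamma>' t) (\<gamma>' t) + F' (\<gamma> t) a) (at t)"
    using frechet_derivative_at[OF e, symmetric]
    by (simp add: has_vector_derivative_def linear_cmul[OF lin[OF assms(1)]] linear_cmul[OF lin2[OF assms(1)]]
        scaleR_add_right)
qed

end

section \<open>Uniqueness of solutions of ordinary differential equations\<close>

text \<open>A Gronwall argument: the weight \<open>exp (- 2 * L * t)\<close> compensates the growth
  that the Lipschitz bound allows to the squared distance, so the weighted distance cannot rise from
  its initial value 0.\<close>

lemma ode_unique_forward: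
  fixes X Y :: "real \<Rightarrow> 'a::real_inner"
  assumes "\<And>t. t \<in> {a..b} \<Longrightarrow> (X has_vector_derivative G (X t)) (at t)"
    "\<And>t. t \<in> {a..b} \<Longrightarrow> (Y has_vector_derivative G (Y t)) (at t)"
    "\<And>t. t \<in> {a..b} \<Longrightarrow> norm (G (X t) - G (Y t)) \<le> L * norm (X t - Y t)"
    "X a = Y a" "a \<le> b"
  shows "X b = Y b"
proof -
  define \<phi> where "\<phi> t = ((X t - Y t) \<bullet> (X t - Y t)) * exp (- 2 * L * t)" for t
  have "\<phi> b \<le> \<phi> a"
  proof (rule DERIV_nonpos_imp_nonincreasing[OF assms(5)])
    fix t assume t: "a \<le> t" "t \<le> b"
    let ?Z = "X t - Y t" let ?W = "G (X t) - G (Y t)"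
    have dZ: "((\<lambda>t. X t - Y t) has_derivative (\<lambda>h. h *\<^sub>R ?W)) (at t)"
      using assms(1,2)[of t] t by (auto simp: has_vector_derivative_def scaleR_diff_right intro!: derivative_eq_intros)
    have "((\<lambda>t. (X t - Y t) \<bullet> (X t - Y t)) has_derivative (\<lambda>h. ?Z \<bullet> (h *\<^sub>R ?W) + (h *\<^sub>R ?W) \<bullet> ?Z)) (at t)"
      by (rule has_derivative_inner[OF dZ dZ])
    then have "((\<lambda>t. (X t - Y t) \<bullet> (X t - Y t)) has_real_derivative 2 * (?Z \<bullet> ?W)) (at t)"
      unfolding has_field_derivative_def
      by (rule has_derivative_eq_rhs) (auto simp: inner_commute[of ?W])
    then have "(\<phi> has_real_derivative 2 * (?Z \<bullet> ?W) * exp (- 2 * L * t)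
        + (?Z \<bullet> ?Z) * (exp (- 2 * L * t) * (- 2 * L))) (at t)"
      unfolding \<phi>_def by (auto intro!: derivative_eq_intros)
    moreover have "?Z \<bullet> ?W \<le> L * (?Z \<bullet> ?Z)"
    proof -
      have "?Z \<bullet> ?W \<le> norm ?Z * norm ?W" by (rule norm_cauchy_schwarz)
      also have "\<dots> \<le> norm ?Z * (L * norm ?Z)"
        using assms(3)[of t] t by (intro mult_left_mono) auto
      finally show ?thesis by (simp add: power2_norm_eq_inner[symmetric] power2_eq_square algebra_simps)
    qed
    then have "(2 * (?Z \<bullet> ?W) - 2 * L * (?Z \<bullet> ?Z)) * exp (- 2 * L * t) \<le> 0"
      by (intro mult_nonpos_nonneg) auto
    ultimately show "\<exists>y. (\<phi> has_real_derivative y) (at t) \<and> y \<le> 0"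
      by (intro exI conjI) (auto simp: algebra_simps)
  qed
  then have "((X b - Y b) \<bullet> (X b - Y b)) * exp (- 2 * L * b) \<le> 0"
    using assms(4) by (simp add: \<phi>_def)
  then have "(X b - Y b) \<bullet> (X b - Y b) \<le> 0"
    by (simp add: mult_le_0_iff)
  then show ?thesis by (metis eq_iff_diff_eq_0 inner_ge_zero inner_eq_zero_iff order_antisym)
qed

definition loc_lipschitz_at :: "'a::metric_space \<Rightarrow> ('a \<Rightarrow> 'b::real_normed_vector) \<Rightarrow> bool" where
  "loc_lipschitz_at p f \<longleftrightarrow> (\<exists>r>0. \<exists>L. \<forall>y\<in>ball p r. \<forall>z\<in>ball p r. norm (f y - f z) \<le> L * dist y z)"

lemma isCont_imp_tendsto_nhds: "isCont f p \<Longrightarrow> (f \<longlongrightarrow> f p) (nhds p)"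
  by (simp add: isCont_def tendsto_at_iff_tendsto_nhds)

text \<open>Continuous partial derivatives are bounded near \<open>p\<close>; summing the bounds
  over the basis bounds the operator norm on a ball, where the mean value inequality
  applies.\<close>

lemma Ck_on_imp_loc_lipschitz:
  fixes f :: "'a::euclidean_space \<Rightarrow> 'b::real_normed_vector"
  assumes "open U" "Ck_on (Suc 0) U f" "p \<in> U"
  shows "loc_lipschitz_at p f"
proof -
  let ?D = "\<lambda>y. frechet_derivative f (at y)"
  have cont: "continuous_on U (\<lambda>y. ?D y b)" for b using assms(2) by simp
  have ev: "\<forall>\<^sub>F y in nhds p. norm (?D y b) < norm (?D p b) + 1" for b
  proof -
    have "isCont (\<lambda>y. ?D y b) p"
      using cont[of b] assms(3) by (simp add: continuous_on_eq_continuous_at[OF assms(1)])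
    from isCont_imp_tendsto_nhds[OF continuous_norm[OF this]] have "((\<lambda>y. norm (?D y b)) \<longlongrightarrow> norm (?D p b)) (nhds p)" .
    then show ?thesis by (rule order_tendstoD) simp
  qed
  have "\<forall>\<^sub>F y in nhds p. y \<in> U \<and> (\<forall>b\<in>Basis. norm (?D y b) < norm (?D p b) + 1)"
    using ev eventually_nhds_in_open[OF assms(1,3)] by (auto intro!: eventually_conj eventually_ball_finite)
  then obtain r where r: "r > 0" "\<And>y. y \<in> ball p r \<Longrightarrow> y \<in> U \<and> (\<forall>b\<in>Basis. norm (?D y b) < norm (?D p b) + 1)"
    unfolding eventually_nhds_metric by (metis dist_commute mem_ball)
  define L where "L = (\<Sum>b\<in>(Basis::'a set). norm (?D p b) + 1)"
  have "norm (f y - f z) \<le> L * norm (y - z)" if "y \<in> ball p r" "z \<in> ball p r" for y z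
  proof (rule differentiable_bound[of "ball p r" f ?D L y z])
    show "(f has_derivative ?D x) (at x within ball p r)" if "x \<in> ball p r" for x
      using Ck_on_SucD[OF assms(1,2)] r(2)[OF that] has_derivative_at_withinI by blast
    show "onorm (?D x) \<le> L" if "x \<in> ball p r" for x
    proof (rule onorm_le)
      fix v
      have lin: "linear (?D x)"
        using Ck_on_SucD[OF assms(1,2)] r(2)[OF that] has_derivative_linear by blast
      have "?D x v = (\<Sum>b\<in>Basis. (v \<bullet> b) *\<^sub>R ?D x b)"
        by (subst (1) euclidean_representation[symmetric, of v])
          (simp add: linear_sum[OF lin] linear_cmul[OF lin])
      also have "norm \<dots> \<le> (\<Sum>b\<in>Basis. norm v * (norm (?D p b) + 1))"
      proof (rule sum_norm_le)
        fix b :: 'a assume b: "b \<in> Basis"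
        show "norm ((v \<bullet> b) *\<^sub>R ?D x b) \<le> norm v * (norm (?D p b) + 1)"
          unfolding norm_scaleR
          by (rule mult_mono) (use b r(2)[OF that] Basis_le_norm in \<open>auto intro: less_imp_le\<close>)
      qed
      finally show "norm (?D x v) \<le> L * norm v" by (simp add: L_def sum_distrib_left mult.commute)
    qed
  qed (use that in auto)
  then show ?thesis using r(1) unfolding loc_lipschitz_at_def dist_norm by blast
qed

lemma ode_unique_local:
  fixes X Y :: "real \<Rightarrow> 'a::real_inner"
  assumes I: "open I" "t0 \<in> I"
    and X: "\<And>t. t \<in> I \<Longrightarrow> (X has_vector_derivative G (X t)) (at t)"
    and Y: "\<And>t. t \<in> I \<Longrightarrow> (Y has_vector_derivative G (Y t)) (at t)"
    and "X t0 = Y t0" and lip: "loc_lipschitz_at (X t0) G"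
  shows "\<exists>e>0. \<forall>t. \<bar>t - t0\<bar> < e \<longrightarrow> t \<in> I \<and> X t = Y t"
proof -
  obtain r L where r: "r > 0" "\<And>y z. y \<in> ball (X t0) r \<Longrightarrow> z \<in> ball (X t0) r \<Longrightarrow> norm (G y - G z) \<le> L * norm (y - z)"
    using lip unfolding loc_lipschitz_at_def dist_norm by blast
  have "isCont X t0" "isCont Y t0" using X Y I has_vector_derivative_continuous by blast+
  then have "\<forall>\<^sub>F t in nhds t0. X t \<in> ball (X t0) r" "\<forall>\<^sub>F t in nhds t0. Y t \<in> ball (X t0) r"
    using r(1) assms(5) topological_tendstoD[OF isCont_imp_tendsto_nhds, of t0 _ "ball (X t0) r"]
    by (simp_all del: mem_ball add: centre_in_ball)
  then have "\<forall>\<^sub>F t in nhds t0. t \<in> I \<and> X t \<in> ball (X t0) r \<and> Y t \<in> ball (X t0) r"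
    using eventually_nhds_in_open[OF I] by (auto intro: eventually_conj)
  then obtain e where e: "e > 0" "\<And>t. \<bar>t - t0\<bar> < e \<Longrightarrow> t \<in> I \<and> X t \<in> ball (X t0) r \<and> Y t \<in> ball (X t0) r"
    unfolding eventually_nhds_metric dist_real_def by auto
  have "X t = Y t" if t: "\<bar>t - t0\<bar> < e" for t
  proof (cases "t0 \<le> t")
    case True
    show ?thesis
      by (rule ode_unique_forward[of t0 t X G Y L]) (use X Y e r(2) t True assms(5) in auto)
  next
    case False
    \<comment> \<open>Backward times: reversing time turns both curves into solutions for
      \<open>- G\<close>, to which the forward case applies.\<close>
    have u: "(uminus has_vector_derivative - 1) (at s)" for s :: real
      by (auto simp: has_vector_derivative_def intro!: derivative_eq_intros)
    have "((\<lambda>s. X (- s)) has_vector_derivative - G (X (- s))) (at s)" if "s \<in> {- t0.. - t}" for s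
      using vector_diff_chain_at[OF u[of s], where g = X and g' = "G (X (- s))"] X[of "- s"] e(2)[of "- s"] that t False
      by (auto simp: o_def)
    moreover have "((\<lambda>s. Y (- s)) has_vector_derivative - G (Y (- s))) (at s)" if "s \<in> {- t0.. - t}" for s
      using vector_diff_chain_at[OF u[of s], where g = Y and g' = "G (Y (- s))"] Y[of "- s"] e(2)[of "- s"] that t False
      by (auto simp: o_def)
    moreover have "norm (- G (X (- s)) - - G (Y (- s))) \<le> L * norm (X (- s) - Y (- s))" if "s \<in> {- t0.. - t}" for s
      using r(2)[of "X (- s)" "Y (- s)"] e(2)[of "- s"] that t False
      by (auto simp: norm_minus_commute)
    ultimately show ?thesis
      using ode_unique_forward[of "- t0" "- t" "\<lambda>s. X (- s)" "\<lambda>x. - G x" "\<lambda>s. Y (- s)" L] assms(5) False by auto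
  qed
  then show ?thesis using e by blast
qed

text \<open>The set where the solutions agree is closed by continuity and open by local uniqueness,
  and the interval is connected.\<close>

lemma ode_unique:
  fixes X Y :: "real \<Rightarrow> 'a::real_inner"
  assumes I: "open I" "connected I" "t0 \<in> I"
    and X: "\<And>t. t \<in> I \<Longrightarrow> (X has_vector_derivative G (X t)) (at t)"
    and Y: "\<And>t. t \<in> I \<Longrightarrow> (Y has_vector_derivative G (Y t)) (at t)"
    and "X t0 = Y t0" and lip: "\<And>t. t \<in> I \<Longrightarrow> loc_lipschitz_at (X t) G"
    and "t \<in> I"
  shows "X t = Y t"
proof -
  let ?E = "{t \<in> I. X t = Y t}"
  have cont: "continuous_on I X" "continuous_on I Y"
    using X Y has_vector_derivative_continuous by (blast intro: continuous_at_imp_continuous_on)+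
  have "openin (top_of_set I) ?E"
  proof -
    have "\<exists>e>0. ball t e \<subseteq> ?E" if "t \<in> ?E" for t
    proof -
      have "\<exists>e>0. \<forall>s. \<bar>s - t\<bar> < e \<longrightarrow> s \<in> I \<and> X s = Y s"
        by (rule ode_unique_local[OF I(1) _ X Y _ lip]) (use that in auto)
      then show ?thesis by (simp add: ball_def dist_real_def abs_minus_commute subset_eq)
    qed
    then have "open ?E" by (simp add: open_contains_ball)
    then show ?thesis using I(1) by (auto simp: openin_open_eq)
  qed
  moreover have "closedin (top_of_set I) ?E"
    using continuous_closedin_preimage_constant[of I "\<lambda>t. X t - Y t" 0] cont by (auto intro: continuous_on_diff)
  ultimately have "?E = {} \<or> ?E = I" using I(2) by (auto simp: connected_clopen)
  then show ?thesis using assms(3,6,8) by auto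
qed

section \<open>The complex bilinear form and complexified Moebius maps\<close>

text \<open>Bilinear, not Hermitian; the Hermitian product is \<open>cdot z (cnjv w)\<close>. Being
  holomorphic in both arguments, this is the form that complexified Moebius maps respect.\<close>

definition cdot :: "complex^'n \<Rightarrow> complex^'n \<Rightarrow> complex" where
  "cdot z w = (\<Sum>i\<in>UNIV. z $ i * w $ i)"

definition cnjv :: "complex^'n \<Rightarrow> complex^'n" where
  "cnjv z = (\<chi> i. cnj (z $ i))"

abbreviation ofr :: "real^'n \<Rightarrow> complex^'n" where "ofr \<equiv> of_real_vec"

lemma lie_Q_eq: "lie_Q z = cdot z z"
  by (simp add: lie_Q_def cdot_def power2_eq_square)

lemma cdot_commute: "cdot z w = cdot w z"
  by (simp add: cdot_def mult.commute)

lemma cdot_add_left: "cdot (z + z') w = cdot z w + cdot z' w"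
  by (simp add: cdot_def algebra_simps sum.distrib)

lemma cdot_smult_left: "cdot (c *s z) w = c * cdot z w"
  by (simp add: cdot_def algebra_simps sum_distrib_left)

lemma cdot_scaleR_left: "cdot (r *\<^sub>R z) w = of_real r * cdot z w"
  by (simp add: cdot_def sum_distrib_left scaleR_conv_of_real[where 'a=complex] mult.assoc)

lemma cdot_add_right: "cdot w (z + z') = cdot w z + cdot w z'"
  by (simp add: cdot_commute[of w] cdot_add_left)

lemma cdot_smult_right: "cdot w (c *s z) = c * cdot w z"
  by (simp add: cdot_commute[of w] cdot_smult_left)

lemma cdot_scaleR_right: "cdot w (r *\<^sub>R z) = of_real r * cdot w z"
  by (simp add: cdot_commute[of w] cdot_scaleR_left)

lemma cdot_minus_left: "cdot (- z) w = - cdot z w"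
  by (simp add: cdot_def sum_negf)

lemma cdot_minus_right: "cdot w (- z) = - cdot w z"
  by (simp add: cdot_commute[of w] cdot_minus_left)

lemma cdot_diff_left: "cdot (z - z') w = cdot z w - cdot z' w"
  by (simp add: cdot_def algebra_simps sum_subtractf)

lemma cdot_diff_right: "cdot w (z - z') = cdot w z - cdot w z'"
  by (simp add: cdot_commute[of w] cdot_diff_left)

lemma cdot_zero [simp]: "cdot 0 w = 0" "cdot w 0 = 0"
  by (simp_all add: cdot_def)

lemmas cdot_simps = cdot_add_left cdot_add_right cdot_smult_left cdot_smult_right
  cdot_scaleR_left cdot_scaleR_right cdot_minus_left cdot_minus_right cdot_diff_left cdot_diff_right

lemma cdot_cnjv: "cdot (cnjv z) (cnjv w) = cnj (cdot z w)"
  by (simp add: cdot_def cnjv_def)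

lemma cnjv_simps [simp]: "cnjv (cnjv z) = z" "cnjv (z + w) = cnjv z + cnjv w" "cnjv (z - w) = cnjv z - cnjv w"
  "cnjv (- z) = - cnjv z" "cnjv (c *s z) = cnj c *s cnjv z" "cnjv (r *\<^sub>R z) = r *\<^sub>R cnjv z" "cnjv 0 = 0"
  "cnjv (ofr x) = ofr x"
  by (simp_all add: cnjv_def vec_eq_iff of_real_vec_def)

lemma inner_cdot: "z \<bullet> w = Re (cdot z (cnjv w))"
  by (simp add: inner_vec_def inner_complex_def cdot_def cnjv_def)

lemma cdot_cnjv_self: "cdot z (cnjv z) = of_real ((norm z)\<^sup>2)"
proof -
  have "cdot z (cnjv z) = (\<Sum>i\<in>UNIV. of_real ((cmod (z $ i))\<^sup>2))"
    by (simp only: cdot_def cnjv_def vec_lambda_beta complex_norm_square)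
  then show ?thesis by (simp add: norm_vec_def L2_set_def sum_nonneg)
qed

lemma cdot_ofr: "cdot (ofr x) (ofr y) = of_real (x \<bullet> y)"
  by (simp add: cdot_def of_real_vec_def inner_vec_def)

lemma ofr_simps: "ofr (x + y) = ofr x + ofr y" "ofr (x - y) = ofr x - ofr y" "ofr (- x) = - ofr x"
  "ofr (r *\<^sub>R x) = complex_of_real r *s ofr x" "ofr 0 = 0"
  by (simp_all add: of_real_vec_def vec_eq_iff)

lemma ofr_eq_iff [simp]: "ofr x = ofr y \<longleftrightarrow> x = y"
  by (simp add: of_real_vec_def vec_eq_iff)

lemma norm_ofr [simp]: "norm (ofr x) = norm x"
proof -
  have "of_real ((norm (ofr x))\<^sup>2) = (of_real ((norm x)\<^sup>2) :: complex)"
    using cdot_cnjv_self[of "ofr x"] by (simp add: cdot_ofr power2_norm_eq_inner)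
  then have "(norm (ofr x))\<^sup>2 = (norm x)\<^sup>2" by (simp only: of_real_eq_iff)
  then show ?thesis by simp
qed

lemma scaleR_smult: "r *\<^sub>R (z::complex^'n) = complex_of_real r *s z"
  by (simp add: vec_eq_iff scaleR_conv_of_real[where 'a=complex])

lemma smult_scaleR_left: "(r *\<^sub>R c) *s (z::complex^'n) = r *\<^sub>R (c *s z)"
  by (simp add: vec_eq_iff)

lemma smult_scaleR_right: "c *s (r *\<^sub>R (z::complex^'n)) = r *\<^sub>R (c *s z)"
  by (simp add: vec_eq_iff)

lemma bounded_bilinear_cdot: "bounded_bilinear cdot"
  unfolding bilinear_conv_bounded_bilinear[symmetric] bilinear_def
  by (auto intro!: linearI simp: cdot_simps scaleR_conv_of_real[where 'a=complex])

lemma bounded_bilinear_smult: "bounded_bilinear (\<lambda>(c::complex) (z::complex^'n). c *s z)"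
  unfolding bilinear_conv_bounded_bilinear[symmetric] bilinear_def
  by (auto intro!: linearI simp: smult_scaleR_left smult_scaleR_right vector_sadd_rdistrib vector_add_ldistrib)

lemma bounded_linear_cnjv: "bounded_linear cnjv"
  unfolding linear_conv_bounded_linear[symmetric] by (auto intro!: linearI)

lemma bounded_linear_ofr: "bounded_linear ofr"
  unfolding linear_conv_bounded_linear[symmetric] by (auto intro!: linearI simp: ofr_simps scaleR_smult)

lemma norm_cnjv [simp]: "norm (cnjv z) = norm z"
  by (simp add: cnjv_def norm_vec_def)

lemmas has_derivative_cdot [derivative_intros] = bounded_bilinear.FDERIV[OF bounded_bilinear_cdot]
lemmas has_derivative_smult [derivative_intros] = bounded_bilinear.FDERIV[OF bounded_bilinear_smult]
lemmas has_derivative_cnjv [derivative_intros] = bounded_linear.has_derivative[OF bounded_linear_cnjv]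
lemmas has_derivative_ofr [derivative_intros] = bounded_linear.has_derivative[OF bounded_linear_ofr]
lemmas continuous_on_cdot [continuous_intros] = bounded_bilinear.continuous_on[OF bounded_bilinear_cdot]
lemmas continuous_on_smult [continuous_intros] = bounded_bilinear.continuous_on[OF bounded_bilinear_smult]
lemmas continuous_on_cnjv [continuous_intros] = bounded_linear.continuous_on[OF bounded_linear_cnjv]
lemmas continuous_on_ofr [continuous_intros] = bounded_linear.continuous_on[OF bounded_linear_ofr]
lemmas Ck_on_cdot = Ck_on_bilinear[OF _ bounded_bilinear_cdot]
lemmas Ck_on_smult = Ck_on_bilinear[OF _ bounded_bilinear_smult]
lemmas Ck_on_cnjv = Ck_on_linear_comp[OF _ bounded_linear_cnjv]
lemmas Ck_on_ofr = Ck_on_linear_comp[OF _ bounded_linear_ofr]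

text \<open>
  \<open>mob a\<close> is the complexification of the Moebius transformation of the ball that maps \<open>a\<close> to \<open>0\<close>.
  In the null lift \<open>z \<mapsto> (1, z, cdot z z)\<close> it is linear: the lift of \<open>z\<close> is mapped to
  \<open>(mob_den a z, mob_num a z, mob_last a z)\<close>.
\<close>

definition mob_den :: "real^'n \<Rightarrow> complex^'n \<Rightarrow> complex" where
  "mob_den a z = 1 - 2 * cdot z (ofr a) + cdot z z * of_real (a \<bullet> a)"

definition mob_num :: "real^'n \<Rightarrow> complex^'n \<Rightarrow> complex^'n" where
  "mob_num a z = complex_of_real (1 - a \<bullet> a) *s z + (2 * cdot z (ofr a) - 1 - cdot z z) *s ofr a"

definition mob_last :: "real^'n \<Rightarrow> complex^'n \<Rightarrow> complex" where
  "mob_last a z = cdot z z - 2 * cdot z (ofr a) + of_real (a \<bullet> a)"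

definition mob :: "real^'n \<Rightarrow> complex^'n \<Rightarrow> complex^'n" where
  "mob a z = inverse (mob_den a z) *s mob_num a z"

definition mob_den' :: "real^'n \<Rightarrow> complex^'n \<Rightarrow> complex^'n \<Rightarrow> complex" where
  "mob_den' a z u = - 2 * cdot u (ofr a) + 2 * cdot z u * of_real (a \<bullet> a)"

definition mob_num' :: "real^'n \<Rightarrow> complex^'n \<Rightarrow> complex^'n \<Rightarrow> complex^'n" where
  "mob_num' a z u = complex_of_real (1 - a \<bullet> a) *s u + (2 * cdot u (ofr a) - 2 * cdot z u) *s ofr a"

definition mob_last' :: "real^'n \<Rightarrow> complex^'n \<Rightarrow> complex^'n \<Rightarrow> complex" where
  "mob_last' a z u = 2 * cdot z u - 2 * cdot u (ofr a)"

definition mob' :: "real^'n \<Rightarrow> complex^'n \<Rightarrow> complex^'n \<Rightarrow> complex^'n" where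
  "mob' a z u = inverse (mob_den a z) *s (mob_num' a z u - mob_den' a z u *s mob a z)"

text \<open>The linear action on null lifts multiplies by \<open>(1 - a \<bullet> a)\<^sup>2\<close>
  the form whose value on the lifts of \<open>z\<close> and \<open>w\<close> is
  \<open>cdot (z - w) (z - w)\<close>: the crossed products of the outer components minus twice the
  product of the middle ones. The next two identities are its derivatives in one and in both
  variables.\<close>

lemma mob_num_cdot:
  "2 * cdot (mob_num a z) (mob_num a w) =
    - (of_real (1 - a \<bullet> a))\<^sup>2 * cdot (z - w) (z - w) + mob_last a z * mob_den a w + mob_den a z * mob_last a w"
  unfolding mob_num_def mob_den_def mob_last_def
  by (simp add: cdot_simps cdot_ofr cdot_commute[of "ofr a"] cdot_commute[of w z] of_real_diff)
     (simp add: algebra_simps power2_eq_square)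

lemma mob_num'_cdot_num:
  "2 * cdot (mob_num' a z u) (mob_num a w) =
    - (of_real (1 - a \<bullet> a))\<^sup>2 * (2 * cdot (z - w) u) + mob_last' a z u * mob_den a w + mob_den' a z u * mob_last a w"
  unfolding mob_num_def mob_den_def mob_last_def mob_num'_def mob_den'_def mob_last'_def
  by (simp add: cdot_simps cdot_ofr cdot_commute[of "ofr a"] cdot_commute[of w u] of_real_diff)
     (simp add: algebra_simps power2_eq_square)

lemma mob_num'_cdot_num':
  "2 * cdot (mob_num' a z u) (mob_num' a w v) =
    (of_real (1 - a \<bullet> a))\<^sup>2 * (2 * cdot u v) + mob_last' a z u * mob_den' a w v + mob_den' a z u * mob_last' a w v"
  unfolding mob_num'_def mob_den'_def mob_last'_def
  by (simp add: cdot_simps cdot_ofr cdot_commute[of "ofr a"] of_real_diff)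
     (simp add: algebra_simps power2_eq_square)

lemma mob_num_cdot_self: "cdot (mob_num a z) (mob_num a z) = mob_last a z * mob_den a z"
  using mob_num_cdot[of a z z] by simp

lemma cdot_mob_self: "mob_den a z \<noteq> 0 \<Longrightarrow> cdot (mob a z) (mob a z) = mob_last a z / mob_den a z"
  unfolding mob_def by (simp add: cdot_simps mob_num_cdot_self divide_inverse)

lemma cdot_mob:
  "mob_den a z \<noteq> 0 \<Longrightarrow> mob_den a w \<noteq> 0 \<Longrightarrow>
   2 * cdot (mob a z) (mob a w) = (- (of_real (1 - a \<bullet> a))\<^sup>2 * cdot (z - w) (z - w)
     + mob_last a z * mob_den a w + mob_den a z * mob_last a w) / (mob_den a z * mob_den a w)"
  using mob_num_cdot[of a z w] unfolding mob_def by (simp add: cdot_simps field_simps)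

lemma cdot_mob_diff:
  assumes "mob_den a z \<noteq> 0" "mob_den a w \<noteq> 0"
  shows "cdot (mob a z - mob a w) (mob a z - mob a w)
    = (of_real (1 - a \<bullet> a))\<^sup>2 * cdot (z - w) (z - w) / (mob_den a z * mob_den a w)"
proof -
  have "cdot (mob a z - mob a w) (mob a z - mob a w)
    = cdot (mob a z) (mob a z) + cdot (mob a w) (mob a w) - 2 * cdot (mob a z) (mob a w)"
    by (simp add: cdot_simps cdot_commute[of "mob a w" "mob a z"])
  also have "\<dots> = (of_real (1 - a \<bullet> a))\<^sup>2 * cdot (z - w) (z - w) / (mob_den a z * mob_den a w)"
    unfolding cdot_mob[OF assms] cdot_mob_self[OF assms(1)] cdot_mob_self[OF assms(2)]
    using assms by (simp add: field_simps)
  finally show ?thesis .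
qed

text \<open>The polarized Bergman kernel function is a power of \<open>hb z (cnjv w)\<close>.\<close>

definition hb :: "complex^'n \<Rightarrow> complex^'n \<Rightarrow> complex" where
  "hb z w = 1 - 2 * cdot z w + cdot z z * cdot w w"

definition hb1 :: "complex^'n \<Rightarrow> complex^'n \<Rightarrow> complex^'n \<Rightarrow> complex" where
  "hb1 z w u = - 2 * cdot u w + 2 * cdot z u * cdot w w"

definition hb12 :: "complex^'n \<Rightarrow> complex^'n \<Rightarrow> complex^'n \<Rightarrow> complex^'n \<Rightarrow> complex" where
  "hb12 z w u v = - 2 * cdot u v + 4 * cdot z u * cdot w v"

lemma mob_den_last: "mob_den a z - mob_last a z = of_real (1 - a \<bullet> a) * (1 - cdot z z)"
  by (simp add: mob_den_def mob_last_def algebra_simps)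

text \<open>\<open>hb z w\<close> is the sum of \<open>(1 - cdot z z) * (1 - cdot w w)\<close> and
  \<open>cdot (z - w) (z - w)\<close>. The first summand is governed by \<open>mob_den_last\<close>,
  the second by the action on lifts, and both acquire the same factor.\<close>

lemma hb_mob:
  assumes "mob_den a z \<noteq> 0" "mob_den a w \<noteq> 0"
  shows "hb (mob a z) (mob a w) = (of_real (1 - a \<bullet> a))\<^sup>2 * hb z w / (mob_den a z * mob_den a w)"
proof -
  let ?c = "complex_of_real (1 - a \<bullet> a)"
  have "hb (mob a z) (mob a w) * (mob_den a z * mob_den a w)
    = (mob_den a z - mob_last a z) * (mob_den a w - mob_last a w) + ?c\<^sup>2 * cdot (z - w) (z - w)"
    unfolding hb_def cdot_mob[OF assms] cdot_mob_self[OF assms(1)] cdot_mob_self[OF assms(2)]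
    using assms by (simp add: field_simps)
  also have "\<dots> = ?c\<^sup>2 * hb z w"
    unfolding mob_den_last by (simp add: hb_def cdot_simps cdot_commute[of w z] algebra_simps power2_eq_square)
  finally show ?thesis using assms by (simp add: field_simps)
qed

text \<open>The derivative is a complex similarity. The contributions of the differentiated
  denominator cancel because the lift is null (\<open>mob_num_cdot_self\<close>) and its derivative
  is tangent to the null cone.\<close>

lemma cdot_mob':
  assumes "mob_den a z \<noteq> 0"
  shows "cdot (mob' a z u) (mob' a z v) = (of_real (1 - a \<bullet> a) / mob_den a z)\<^sup>2 * cdot u v"
proof -
  let ?h = "mob_den a z" and ?k = "mob_last a z" and ?m = "mob_num a z"
  let ?c = "complex_of_real (1 - a \<bullet> a)"
  note A = mob_num'_cdot_num[of a z u z] mob_num'_cdot_num[of a z v z]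
  have "cdot (mob' a z u) (mob' a z v) * ?h ^ 4 * 2
    = ?h\<^sup>2 * (2 * cdot (mob_num' a z u) (mob_num' a z v))
     - ?h * mob_den' a z v * (2 * cdot (mob_num' a z u) ?m)
     - ?h * mob_den' a z u * (2 * cdot (mob_num' a z v) ?m)
     + 2 * mob_den' a z u * mob_den' a z v * cdot ?m ?m"
    unfolding mob'_def mob_def using assms
    by (simp add: cdot_simps cdot_commute[of "mob_num a z" "mob_num' a z v"] field_simps power4_eq_xxxx power2_eq_square)
  also have "\<dots> = ?h\<^sup>2 * (?c\<^sup>2 * (2 * cdot u v))"
    unfolding A mob_num'_cdot_num' mob_num_cdot_self by (simp add: algebra_simps power2_eq_square)
  finally have "cdot (mob' a z u) (mob' a z v) = ?h\<^sup>2 * (?c\<^sup>2 * (2 * cdot u v)) / (?h ^ 4 * 2)"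
    using assms by (simp only: eq_divide_eq) simp
  also have "\<dots> = (?c / ?h)\<^sup>2 * cdot u v"
    using assms by (simp add: power4_eq_xxxx power2_eq_square del: of_real_diff)
  finally show ?thesis .
qed

text \<open>The derivative of \<open>hb_mob\<close> in \<open>z\<close> with denominators cleared;
  \<open>hb12_mob\<close> is the mixed derivative. Both become polynomial identities once
  \<open>mob_last\<close> and its derivative are eliminated in favour of
  \<open>mob_den\<close>.\<close>

lemma hb1_mob:
  assumes "mob_den a z \<noteq> 0" "mob_den a w \<noteq> 0"
  shows "hb1 (mob a z) (mob a w) (mob' a z u) * (mob_den a z)\<^sup>2 * mob_den a w
    = (of_real (1 - a \<bullet> a))\<^sup>2 * (hb1 z w u * mob_den a z - hb z w * mob_den' a z u)"
proof -
  let ?h = "mob_den a z" and ?k = "mob_last a z" and ?g = "mob_den a w" and ?l = "mob_last a w"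
  let ?c = "complex_of_real (1 - a \<bullet> a)"
  note A = mob_num'_cdot_num[of a z u w] mob_num'_cdot_num[of a z u z] mob_num_cdot[of a z w]
  have "hb1 (mob a z) (mob a w) (mob' a z u) * ?h\<^sup>2 * ?g
    = - ?h * (2 * cdot (mob_num' a z u) (mob_num a w)) + mob_den' a z u * (2 * cdot (mob_num a z) (mob_num a w))
      + (2 * cdot (mob_num' a z u) (mob_num a z) - 2 * mob_den' a z u * ?k) * ?l"
    unfolding hb1_def cdot_mob_self[OF assms(2)] mob'_def
    unfolding cdot_simps cdot_mob_self[OF assms(1)]
    unfolding mob_def using assms
    by (simp add: cdot_simps cdot_commute[of "mob_num a z" "mob_num' a z u"] field_simps power2_eq_square)
  also have "\<dots> = ?c\<^sup>2 * (hb1 z w u * ?h - hb z w * mob_den' a z u)"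
  proof -
    have 1: "mob_last a z = ?h - ?c * (1 - cdot z z)" "mob_last a w = ?g - ?c * (1 - cdot w w)"
      "mob_last' a z u = mob_den' a z u + ?c * (2 * cdot z u)"
      using mob_den_last[of a z] mob_den_last[of a w]
      by (auto simp: mob_last'_def mob_den'_def algebra_simps)
    show ?thesis
      unfolding A 1 hb_def hb1_def
      by (simp add: cdot_simps cdot_commute[of w z] cdot_commute[of w u] algebra_simps power2_eq_square)
  qed
  finally show ?thesis .
qed

lemma hb12_mob:
  assumes "mob_den a z \<noteq> 0" "mob_den a w \<noteq> 0"
  shows "hb12 (mob a z) (mob a w) (mob' a z u) (mob' a w v) * (mob_den a z)\<^sup>2 * (mob_den a w)\<^sup>2
    = (of_real (1 - a \<bullet> a))\<^sup>2 * (hb12 z w u v * mob_den a z * mob_den a w - hb1 z w u * mob_den a z * mob_den' a w v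
      - hb1 w z v * mob_den' a z u * mob_den a w + hb z w * mob_den' a z u * mob_den' a w v)"
proof -
  let ?h = "mob_den a z" and ?k = "mob_last a z" and ?g = "mob_den a w" and ?l = "mob_last a w"
  let ?c = "complex_of_real (1 - a \<bullet> a)"
  note A = mob_num'_cdot_num[of a z u w] mob_num'_cdot_num[of a z u z] mob_num_cdot[of a z w]
    mob_num'_cdot_num[of a w v z] mob_num'_cdot_num[of a w v w] mob_num'_cdot_num'[of a z u w v]
  have "hb12 (mob a z) (mob a w) (mob' a z u) (mob' a w v) * ?h\<^sup>2 * ?g\<^sup>2
    = - ?h * ?g * (2 * cdot (mob_num' a z u) (mob_num' a w v))
      + ?h * mob_den' a w v * (2 * cdot (mob_num' a z u) (mob_num a w))
      + ?g * mob_den' a z u * (2 * cdot (mob_num' a w v) (mob_num a z))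
      - mob_den' a z u * mob_den' a w v * (2 * cdot (mob_num a z) (mob_num a w))
      + (2 * cdot (mob_num' a z u) (mob_num a z) - 2 * mob_den' a z u * ?k)
        * (2 * cdot (mob_num' a w v) (mob_num a w) - 2 * mob_den' a w v * ?l)"
    unfolding hb12_def mob'_def
    unfolding cdot_simps cdot_mob_self[OF assms(1)] cdot_mob_self[OF assms(2)]
    unfolding mob_def using assms
    by (simp add: cdot_simps cdot_commute[of "mob_num a z" "mob_num' a z u"] cdot_commute[of "mob_num a w" "mob_num' a w v"]
        cdot_commute[of "mob_num a z" "mob_num' a w v"] field_simps power2_eq_square)
  also have "\<dots> = ?c\<^sup>2 * (hb12 z w u v * ?h * ?g - hb1 z w u * ?h * mob_den' a w v
      - hb1 w z v * mob_den' a z u * ?g + hb z w * mob_den' a z u * mob_den' a w v)"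
  proof -
    have 1: "mob_last a z = ?h - ?c * (1 - cdot z z)" "mob_last a w = ?g - ?c * (1 - cdot w w)"
      "mob_last' a z u = mob_den' a z u + ?c * (2 * cdot z u)" "mob_last' a w v = mob_den' a w v + ?c * (2 * cdot w v)"
      using mob_den_last[of a z] mob_den_last[of a w]
      by (auto simp: mob_last'_def mob_den'_def algebra_simps)
    show ?thesis
      unfolding A 1 hb_def hb1_def hb12_def
      by (simp add: cdot_simps cdot_commute[of w z] cdot_commute[of w u] cdot_commute[of v z] algebra_simps power2_eq_square)
  qed
  finally show ?thesis .
qed

text \<open>Minus one half of the polarized mixed second derivative of \<open>log hb\<close>. The numerator is a Gram
  determinant, hence insensitive to rescaling the null lifts.\<close>

definition hbg :: "complex^'n \<Rightarrow> complex^'n \<Rightarrow> complex^'n \<Rightarrow> complex^'n \<Rightarrow> complex" where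
  "hbg z w u v = (hb1 z w u * hb1 w z v - hb z w * hb12 z w u v) / (2 * (hb z w)\<^sup>2)"

lemma hb_commute: "hb z w = hb w z"
  by (simp add: hb_def cdot_commute[of w z] algebra_simps)

lemma hbg_mob:
  assumes "mob_den a z \<noteq> 0" "mob_den a w \<noteq> 0" "a \<bullet> a \<noteq> 1"
  shows "hbg (mob a z) (mob a w) (mob' a z u) (mob' a w v) = hbg z w u v"
proof -
  let ?h = "mob_den a z" and ?g = "mob_den a w"
  let ?c = "(complex_of_real (1 - a \<bullet> a))\<^sup>2"
  have c: "?c \<noteq> 0" using assms(3) by (simp flip: of_real_diff)
  have e1: "hb1 (mob a z) (mob a w) (mob' a z u) = ?c * (hb1 z w u * ?h - hb z w * mob_den' a z u) / (?h\<^sup>2 * ?g)"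
    using hb1_mob[OF assms(1,2), of u] assms by (simp add: eq_divide_eq mult.assoc)
  have e2: "hb1 (mob a w) (mob a z) (mob' a w v) = ?c * (hb1 w z v * ?g - hb z w * mob_den' a w v) / (?g\<^sup>2 * ?h)"
    using hb1_mob[OF assms(2,1), of v] assms by (simp add: eq_divide_eq mult.assoc hb_commute[of w z])
  have e3: "hb12 (mob a z) (mob a w) (mob' a z u) (mob' a w v) = ?c * (hb12 z w u v * ?h * ?g
      - hb1 z w u * ?h * mob_den' a w v - hb1 w z v * mob_den' a z u * ?g
      + hb z w * mob_den' a z u * mob_den' a w v) / (?h\<^sup>2 * ?g\<^sup>2)"
    using hb12_mob[OF assms(1,2), of u v] assms by (simp add: eq_divide_eq mult.assoc)
  define C where "C = ?c"
  define h where "h = ?h" define g where "g = ?g"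
  have nz: "h \<noteq> 0" "g \<noteq> 0" "C \<noteq> 0" using assms c by (auto simp: h_def g_def C_def)
  show ?thesis
    unfolding hbg_def e1 e2 e3 hb_mob[OF assms(1,2)]
    unfolding C_def[symmetric] h_def[symmetric] g_def[symmetric]
    by (cases "hb z w = 0") (use nz in \<open>simp_all add: field_simps power2_eq_square\<close>)
qed

text \<open>Evaluates a Moebius map on an arbitrary null lift \<open>(A, m, B)\<close>. After one
  map the first component of the lift is no longer 1, so composing two maps calls for this
  form.\<close>

lemma mob_lift:
  assumes "A \<noteq> 0" "cdot m m = A * B"
  shows "mob a (inverse A *s m) = inverse (A - 2 * cdot m (ofr a) + B * of_real (a \<bullet> a)) *s
    (complex_of_real (1 - a \<bullet> a) *s m + (2 * cdot m (ofr a) - A - B) *s ofr a)"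
proof -
  let ?d = "A - 2 * cdot m (ofr a) + B * of_real (a \<bullet> a)"
  have d: "mob_den a (inverse A *s m) = inverse A * ?d"
    unfolding mob_den_def using assms by (simp add: cdot_simps field_simps)
  have n: "mob_num a (inverse A *s m) = inverse A *s
    (complex_of_real (1 - a \<bullet> a) *s m + (2 * cdot m (ofr a) - A - B) *s ofr a)"
    unfolding mob_num_def using assms by (simp add: cdot_simps vec_eq_iff field_simps)
  have "inverse (inverse A * ?d) * inverse A = inverse ?d" using assms(1) by simp
  then show ?thesis unfolding mob_def d n vector_smult_assoc by (rule arg_cong)
qed

lemma mob_eq_lift: "mob a z = inverse (mob_den a z) *s mob_num a z"
  by (rule mob_def)

lemma mob_den_lift:
  assumes "mob_den a z \<noteq> 0"
  shows "mob_den (- a) (mob a z) = (of_real (1 - a \<bullet> a))\<^sup>2 / mob_den a z"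
proof -
  have "mob_den a z * mob_den (- a) (mob a z) = mob_den a z + 2 * cdot (mob_num a z) (ofr a) + mob_last a z * of_real (a \<bullet> a)"
    unfolding mob_den_def[of "- a"] cdot_mob_self[OF assms] unfolding mob_def
    using assms by (simp add: cdot_simps ofr_simps field_simps)
  also have "\<dots> = (of_real (1 - a \<bullet> a))\<^sup>2"
    by (simp add: mob_den_def mob_num_def mob_last_def cdot_simps cdot_ofr algebra_simps power2_eq_square)
  finally show ?thesis using assms by (simp add: field_simps)
qed

text \<open>On lifts the two linear maps compose to multiplication by
  \<open>(1 - a \<bullet> a)\<^sup>2\<close>.\<close>

lemma mob_inverse:
  assumes "mob_den a z \<noteq> 0" "a \<bullet> a \<noteq> 1"
  shows "mob (- a) (mob a z) = z"
proof -
  let ?c = "complex_of_real (1 - a \<bullet> a)"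
  have c: "?c \<noteq> 0" using assms(2) by (simp flip: of_real_diff)
  have d: "mob_den a z - 2 * cdot (mob_num a z) (ofr (- a)) + mob_last a z * of_real (- a \<bullet> - a) = ?c\<^sup>2"
    by (simp add: mob_den_def mob_num_def mob_last_def cdot_simps cdot_ofr ofr_simps algebra_simps power2_eq_square)
  have "mob (- a) (mob a z) = inverse (?c\<^sup>2) *s
    (?c *s mob_num a z + (2 * cdot (mob_num a z) (ofr (- a)) - mob_den a z - mob_last a z) *s ofr (- a))"
    unfolding mob_eq_lift[of a z]
    by (subst mob_lift[OF assms(1), where B = "mob_last a z"]) (unfold d, simp_all add: mob_num_cdot_self mult.commute)
  also have "?c *s mob_num a z + (2 * cdot (mob_num a z) (ofr (- a)) - mob_den a z - mob_last a z) *s ofr (- a) = ?c\<^sup>2 *s z"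
    by (simp add: vec_eq_iff mob_den_def mob_num_def mob_last_def cdot_simps cdot_ofr ofr_simps algebra_simps power2_eq_square)
  finally show ?thesis using c by (simp add: vector_smult_assoc del: of_real_diff)
qed

lemma mob_cnjv: "mob a (cnjv z) = cnjv (mob a z)" "mob_den a (cnjv z) = cnj (mob_den a z)"
  "mob' a (cnjv z) (cnjv u) = cnjv (mob' a z u)"
proof -
  have 1: "cdot (cnjv w) (ofr a) = cnj (cdot w (ofr a))" for w
    using cdot_cnjv[of w "ofr a"] by simp
  show d: "mob_den a (cnjv z) = cnj (mob_den a z)"
    by (simp add: mob_den_def 1 cdot_cnjv)
  show m: "mob a (cnjv z) = cnjv (mob a z)"
    unfolding mob_def d by (simp add: mob_num_def 1 cdot_cnjv)
  show "mob' a (cnjv z) (cnjv u) = cnjv (mob' a z u)"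
    unfolding mob'_def d m by (simp add: mob_num'_def mob_den'_def 1 cdot_cnjv)
qed

lemma mob_self [simp]: "mob a (ofr a) = 0"
  by (simp add: mob_def mob_num_def cdot_ofr vec_eq_iff algebra_simps)

lemma mob_zero [simp]: "mob a 0 = - ofr a"
  by (simp add: mob_def mob_num_def mob_den_def vec_eq_iff)

lemma has_derivative_mob:
  assumes "mob_den a z \<noteq> 0"
  shows "(mob a has_derivative mob' a z) (at z)"
proof -
  have 1: "(mob_den a has_derivative mob_den' a z) (at z)"
    unfolding mob_den_def[abs_def] mob_den'_def[abs_def]
    by (auto intro!: derivative_eq_intros simp: cdot_commute[of _ z])
  have eq: "(\<lambda>u. inverse (mob_den a z) *s mob_num' a z u + (- (inverse (mob_den a z) * mob_den' a z u * inverse (mob_den a z))) *s mob_num a z)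
      = mob' a z"
    by (auto simp: mob'_def mob_def vec_eq_iff algebra_simps)
  have k: "((\<lambda>z. 2 * cdot z (ofr a) - 1 - cdot z z) has_derivative (\<lambda>u. 2 * cdot u (ofr a) - 2 * cdot z u)) (at z)"
    by (auto intro!: derivative_eq_intros simp: cdot_commute[of _ z])
  have 2: "(mob_num a has_derivative mob_num' a z) (at z)"
    unfolding mob_num_def[abs_def] mob_num'_def[abs_def]
    by (rule has_derivative_eq_rhs[OF has_derivative_add[OF has_derivative_smult[OF has_derivative_const has_derivative_ident]
            has_derivative_smult[OF k has_derivative_const]]]) simp
  have "((\<lambda>z. inverse (mob_den a z) *s mob_num a z) has_derivative
     (\<lambda>u. inverse (mob_den a z) *s mob_num' a z u + (- (inverse (mob_den a z) * mob_den' a z u * inverse (mob_den a z))) *s mob_num a z)) (at z)"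
    by (rule has_derivative_smult[OF Deriv.has_derivative_inverse[OF assms 1] 2])
  moreover have "mob a = (\<lambda>z. inverse (mob_den a z) *s mob_num a z)" by (simp add: fun_eq_iff mob_def)
  ultimately show ?thesis
    by (simp only: eq)
qed

lemma mob'_smult: "mob' a z (c *s u) = c *s mob' a z u"
  by (simp add: mob'_def mob_num'_def mob_den'_def cdot_simps vec_eq_iff algebra_simps)

lemma Ck_on_mob:
  assumes "open U" "Ck_on k U f" "\<And>x. x \<in> U \<Longrightarrow> mob_den a (f x) \<noteq> 0"
  shows "Ck_on k U (\<lambda>x. mob a (f x))"
proof -
  have "Ck_on k U (\<lambda>x. mob_den a (f x))"
    unfolding mob_den_def by (intro Ck_on_add Ck_on_diff Ck_on_mult Ck_on_cdot Ck_on_const assms)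
  moreover have "Ck_on k U (\<lambda>x. mob_num a (f x))"
    unfolding mob_num_def by (intro Ck_on_add Ck_on_diff Ck_on_mult Ck_on_cdot Ck_on_const Ck_on_smult assms)
  ultimately show ?thesis
    unfolding mob_def by (intro Ck_on_smult Ck_on_inverse assms)
qed

section \<open>The Lie ball\<close>

lemma re_im_decomp: "z = ofr (re_vec z) + \<i> *s ofr (im_vec z)"
  by (simp add: vec_eq_iff of_real_vec_def re_vec_def im_vec_def complex_eq_iff)

lemma re_vec_simps: "re_vec (z + w) = re_vec z + re_vec w" "re_vec (z - w) = re_vec z - re_vec w"
  "re_vec (c *s ofr x) = Re c *\<^sub>R x" "re_vec (complex_of_real r *s z) = r *\<^sub>R re_vec z" "re_vec (ofr x) = x"
  "re_vec (\<i> *s z) = - im_vec z"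
  by (simp_all add: re_vec_def of_real_vec_def vec_eq_iff im_vec_def)

lemma bounded_linear_re_vec: "bounded_linear re_vec"
  unfolding linear_conv_bounded_linear[symmetric]
  by (auto intro!: linearI simp: re_vec_simps scaleR_smult)

lemma Re_cdot_ofr: "Re (cdot z (ofr x)) = re_vec z \<bullet> x"
  by (simp add: cdot_def of_real_vec_def re_vec_def inner_vec_def)

lemma cmod_square: "(complex_of_real (cmod z))\<^sup>2 = z * cnj z"
  by (metis complex_norm_square of_real_power)

lemma norm_re_vec: "(norm (re_vec z))\<^sup>2 = ((norm z)\<^sup>2 + Re (cdot z z)) / 2"
proof -
  have "2 * (re_vec z \<bullet> re_vec z) = z \<bullet> z + Re (cdot z z)"
    by (simp add: inner_vec_def re_vec_def cdot_def inner_complex_def sum.distrib[symmetric] sum_distrib_left)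
  then show ?thesis by (simp add: power2_norm_eq_inner)
qed

lemma cmod_cdot_le: "cmod (cdot z w) \<le> norm z * norm w"
proof -
  have "cmod (cdot z w) \<le> (\<Sum>i\<in>UNIV. \<bar>norm (z $ i)\<bar> * \<bar>norm (w $ i)\<bar>)"
    unfolding cdot_def by (rule sum_norm_le) (simp add: norm_mult)
  also have "\<dots> \<le> norm z * norm w" unfolding norm_vec_def by (rule L2_set_mult_ineq)
  finally show ?thesis .
qed

lemma cmod_cdot_self_le: "cmod (cdot z z) \<le> (norm z)\<^sup>2"
  using cmod_cdot_le[of z z] by (simp add: power2_eq_square)

text \<open>The generic norm of the domain, that is, \<open>hb\<close> on the conjugate diagonal.
  The Bergman kernel turns out to be a constant times a negative power of it.\<close>

definition rho :: "complex^'n \<Rightarrow> real" where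
  "rho z = 1 - 2 * (norm z)\<^sup>2 + (cmod (cdot z z))\<^sup>2"

lemma hb_rho: "hb z (cnjv z) = of_real (rho z)"
  by (simp add: hb_def rho_def cdot_cnjv_self cdot_cnjv complex_norm_square[symmetric])

text \<open>Squaring \<open>sqrt (N\<^sup>2 - q\<^sup>2) < 1 - N\<close>, with \<open>N\<close> the
  squared norm and \<open>q = cmod (cdot z z)\<close>, gives positivity of \<open>rho\<close> but
  loses the sign of \<open>1 - N\<close>. The condition \<open>q < 1\<close> restores it.\<close>

lemma lie_ball_iff: "z \<in> lie_ball \<longleftrightarrow> cmod (cdot z z) < 1 \<and> rho z > 0"
proof -
  define N where "N = (norm z)\<^sup>2"
  define q where "q = cmod (cdot z z)"
  have qN: "0 \<le> q" "q \<le> N" by (auto simp: q_def N_def cmod_cdot_self_le)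
  have N4: "norm z ^ 4 = N\<^sup>2" by (simp add: N_def)
  have "q\<^sup>2 \<le> N\<^sup>2" using qN by (intro power_mono) auto
  have "N + sqrt (N\<^sup>2 - q\<^sup>2) < 1 \<longleftrightarrow> q < 1 \<and> 1 - 2 * N + q\<^sup>2 > 0"
  proof
    assume a: "N + sqrt (N\<^sup>2 - q\<^sup>2) < 1"
    have s0: "sqrt (N\<^sup>2 - q\<^sup>2) \<ge> 0" using \<open>q\<^sup>2 \<le> N\<^sup>2\<close> by simp
    have "(sqrt (N\<^sup>2 - q\<^sup>2))\<^sup>2 < (1 - N)\<^sup>2" using a s0 by (intro power_strict_mono) auto
    then have "N\<^sup>2 - q\<^sup>2 < (1 - N)\<^sup>2" using \<open>q\<^sup>2 \<le> N\<^sup>2\<close> by simp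
    moreover have "q < 1" using a s0 qN by linarith
    ultimately show "q < 1 \<and> 1 - 2 * N + q\<^sup>2 > 0" by (simp add: power2_eq_square algebra_simps)
  next
    assume a: "q < 1 \<and> 1 - 2 * N + q\<^sup>2 > 0"
    have "q\<^sup>2 < 1" using a qN by (simp add: power2_eq_square) (metis mult_strict_mono' mult_1)
    then have N1: "N < 1" using a by auto
    have "N\<^sup>2 - q\<^sup>2 < (1 - N)\<^sup>2" using a by (simp add: power2_eq_square algebra_simps)
    then have "sqrt (N\<^sup>2 - q\<^sup>2) < sqrt ((1 - N)\<^sup>2)" by (rule real_sqrt_less_mono)
    then show "N + sqrt (N\<^sup>2 - q\<^sup>2) < 1" using N1 by simp
  qed
  then show ?thesis
    unfolding lie_ball_def lie_Q_eq rho_def mem_Collect_eq N4 N_def[symmetric] q_def[symmetric] .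
qed

lemma norm_lie_ball: "z \<in> lie_ball \<Longrightarrow> norm z < 1"
proof -
  assume "z \<in> lie_ball"
  moreover have "(cmod (cdot z z))\<^sup>2 \<le> (norm z) ^ 4"
    using power_mono[OF cmod_cdot_self_le[of z], of 2] by simp
  ultimately have "(norm z)\<^sup>2 < 1" unfolding lie_ball_def lie_Q_eq
    by simp (smt (verit) real_sqrt_ge_zero)
  then show ?thesis by (simp add: power2_less_1_iff abs_square_less_1)
qed

lemma open_lie_ball: "open lie_ball"
proof -
  have eq: "lie_ball = {z. cmod (cdot z z) < 1} \<inter> {z. 0 < 1 - 2 * (norm z)\<^sup>2 + (cmod (cdot z z))\<^sup>2}"
    by (auto simp: lie_ball_iff rho_def)
  show ?thesis
    unfolding eq by (intro open_Int open_Collect_less continuous_intros)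
qed

lemma norm_smult: "norm (c *s (z::complex^'n)) = cmod c * norm z"
proof -
  have "complex_of_real ((norm (c *s z))\<^sup>2) = of_real ((cmod c * norm z)\<^sup>2)"
    unfolding cdot_cnjv_self[symmetric]
    by (simp add: cdot_simps cdot_cnjv_self power_mult_distrib cmod_square)
  then have "(norm (c *s z))\<^sup>2 = (cmod c * norm z)\<^sup>2" by (simp only: of_real_eq_iff)
  then show ?thesis by simp
qed

text \<open>The defining function is homogeneous of degree two, so the domain is circled and
  star-shaped about 0. Rotations enter the mean value property, radial contractions the continuity
  argument for \<open>mob_den\<close>.\<close>

lemma smult_lie_ball:
  assumes "z \<in> lie_ball" "cmod c \<le> 1"
  shows "c *s z \<in> lie_ball"
proof -
  let ?v = "(norm z)\<^sup>2 + sqrt ((norm z) ^ 4 - (cmod (cdot z z))\<^sup>2)"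
  have "sqrt ((norm (c *s z)) ^ 4 - (cmod (cdot (c *s z) (c *s z)))\<^sup>2)
     = sqrt (((cmod c)\<^sup>2)\<^sup>2 * ((norm z) ^ 4 - (cmod (cdot z z))\<^sup>2))"
    by (simp add: norm_smult cdot_simps norm_mult power_mult_distrib algebra_simps power2_eq_square power4_eq_xxxx)
  also have "\<dots> = (cmod c)\<^sup>2 * sqrt ((norm z) ^ 4 - (cmod (cdot z z))\<^sup>2)"
    unfolding real_sqrt_mult by (subst real_sqrt_unique[of "(cmod c)\<^sup>2"]) auto
  finally have e: "(norm (c *s z))\<^sup>2 + sqrt ((norm (c *s z)) ^ 4 - (cmod (cdot (c *s z) (c *s z)))\<^sup>2) = (cmod c)\<^sup>2 * ?v"
    by (simp add: norm_smult power_mult_distrib distrib_left)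
  have "(cmod (cdot z z))\<^sup>2 \<le> (norm z) ^ 4"
    using power_mono[OF cmod_cdot_self_le[of z], of 2] by simp
  then have "0 \<le> ?v" by simp
  moreover have "(cmod c)\<^sup>2 \<le> 1" using assms(2) by (simp add: power_le_one)
  ultimately have "(cmod c)\<^sup>2 * ?v \<le> ?v" by (intro mult_left_le_one_le) auto
  then show ?thesis using assms(1) e unfolding lie_ball_def lie_Q_eq by simp
qed

lemma zero_in_lie_ball [simp]: "0 \<in> lie_ball"
  by (simp add: lie_ball_iff rho_def)

lemma ofr_lie_ball: "norm x < 1 \<Longrightarrow> ofr x \<in> lie_ball"
proof -
  assume "norm x < 1"
  then have "(norm x)\<^sup>2 < 1" by (simp add: abs_square_less_1)
  moreover have "norm x ^ 4 = (cmod (lie_Q (ofr x)))\<^sup>2"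
    by (simp add: lie_Q_eq cdot_ofr power2_norm_eq_inner[symmetric] power_mult[symmetric] norm_power)
  ultimately show ?thesis by (simp add: lie_ball_def)
qed

lemma ball_inner: "x \<in> ball 0 1 \<Longrightarrow> x \<bullet> x < 1" "norm x < 1 \<Longrightarrow> x \<bullet> x < 1" for x :: "'a::real_inner"
  by (simp_all add: power2_norm_eq_inner[symmetric] abs_square_less_1)

text \<open>The form of \<open>hb_mob\<close> with denominators cleared. It makes no assumption on
  \<open>mob_den\<close>, and so can serve to show that \<open>mob_den\<close> has no zero in the
  Lie ball.\<close>

lemma mob_gram:
  "mob_den a z * mob_den a w - 2 * cdot (mob_num a z) (mob_num a w) + mob_last a z * mob_last a w
    = (of_real (1 - a \<bullet> a))\<^sup>2 * hb z w"
proof -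
  have "mob_den a z * mob_den a w - 2 * cdot (mob_num a z) (mob_num a w) + mob_last a z * mob_last a w
    = (mob_den a z - mob_last a z) * (mob_den a w - mob_last a w) + (of_real (1 - a \<bullet> a))\<^sup>2 * cdot (z - w) (z - w)"
    unfolding mob_num_cdot by (simp add: algebra_simps)
  also have "\<dots> = (of_real (1 - a \<bullet> a))\<^sup>2 * hb z w"
    unfolding mob_den_last by (simp add: hb_def cdot_simps cdot_commute[of w z] algebra_simps power2_eq_square)
  finally show ?thesis .
qed

lemma mob_num_cnjv: "mob_num a (cnjv z) = cnjv (mob_num a z)" "mob_last a (cnjv z) = cnj (mob_last a z)"
  using cdot_cnjv[of z "ofr a"] by (simp_all add: mob_num_def mob_last_def cdot_cnjv)

text \<open>If both moduli agreed at \<open>w\<close>, \<open>mob_gram\<close> on the conjugate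
  diagonal would give \<open>(norm (mob_num a w))\<^sup>2 < (cmod (mob_den a w))\<^sup>2\<close>,
  whereas nullity of the lift gives the opposite inequality. So the difference of the moduli keeps,
  along the segment from 0, the sign it has at 0, where it equals
  \<open>1 - a \<bullet> a\<close>.\<close>

lemma mob_den_gt_last:
  assumes a: "norm a < 1" and z: "z \<in> lie_ball"
  shows "cmod (mob_last a z) < cmod (mob_den a z)"
proof (rule ccontr)
  assume n: "\<not> ?thesis"
  have ne: "cmod (mob_den a w) \<noteq> cmod (mob_last a w)" if w: "w \<in> lie_ball" for w
  proof
    assume eq: "cmod (mob_den a w) = cmod (mob_last a w)"
    have "complex_of_real ((cmod (mob_den a w))\<^sup>2 - 2 * (norm (mob_num a w))\<^sup>2 + (cmod (mob_last a w))\<^sup>2)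
      = of_real ((1 - a \<bullet> a)\<^sup>2 * rho w)"
      using mob_gram[of a w "cnjv w"]
      by (simp add: mob_cnjv mob_num_cnjv hb_rho cdot_cnjv_self cmod_square)
    then have "(cmod (mob_den a w))\<^sup>2 - 2 * (norm (mob_num a w))\<^sup>2 + (cmod (mob_last a w))\<^sup>2 = (1 - a \<bullet> a)\<^sup>2 * rho w"
      by (simp only: of_real_eq_iff)
    moreover have "(1 - a \<bullet> a)\<^sup>2 * rho w > 0"
      using ball_inner(2)[OF a] w by (intro mult_pos_pos) (auto simp: lie_ball_iff)
    moreover have "cmod (mob_last a w) * cmod (mob_den a w) \<le> (norm (mob_num a w))\<^sup>2"
      using cmod_cdot_self_le[of "mob_num a w"] by (simp add: mob_num_cdot_self norm_mult)
    ultimately show False unfolding eq by (simp add: power2_eq_square)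
  qed
  define f where "f t = cmod (mob_den a (of_real t *s z)) - cmod (mob_last a (of_real t *s z))" for t
  have "continuous_on {0..1} f"
    unfolding f_def mob_den_def mob_last_def by (intro continuous_intros)
  moreover have "f 1 \<le> 0" using n by (simp add: f_def)
  moreover have "f 0 \<ge> 0"
    using ball_inner(2)[OF a] by (simp add: f_def mob_den_def mob_last_def)
  ultimately obtain t where t: "0 \<le> t" "t \<le> 1" "f t = 0"
    using IVT2'[of f 1 0 0] by auto
  then show False using ne[OF smult_lie_ball[OF z, of "of_real t"]] by (simp add: f_def)
qed

lemma mob_den_nz: "norm a < 1 \<Longrightarrow> z \<in> lie_ball \<Longrightarrow> mob_den a z \<noteq> 0"
  using mob_den_gt_last[of a z] by auto

lemma rho_mob:
  assumes "mob_den a z \<noteq> 0"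
  shows "rho (mob a z) = (1 - a \<bullet> a)\<^sup>2 * rho z / (cmod (mob_den a z))\<^sup>2"
proof -
  have "complex_of_real (rho (mob a z)) = of_real ((1 - a \<bullet> a)\<^sup>2 * rho z / (cmod (mob_den a z))\<^sup>2)"
    using hb_mob[OF assms, of "cnjv z"] assms
    by (simp add: mob_cnjv hb_rho complex_norm_square[symmetric])
  then show ?thesis by (simp only: of_real_eq_iff)
qed

lemma mob_lie_ball:
  assumes "norm a < 1" "z \<in> lie_ball"
  shows "mob a z \<in> lie_ball"
  unfolding lie_ball_iff
proof
  note h = mob_den_nz[OF assms]
  show "cmod (cdot (mob a z) (mob a z)) < 1"
    using mob_den_gt_last[OF assms] h by (simp add: cdot_mob_self norm_divide)
  show "0 < rho (mob a z)"
    unfolding rho_mob[OF h] using assms ball_inner(2)[OF assms(1)] h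
    by (intro divide_pos_pos mult_pos_pos) (auto simp: lie_ball_iff)
qed

lemma mob_inverse_lie_ball:
  assumes "norm a < 1" "z \<in> lie_ball"
  shows "mob (- a) (mob a z) = z" "mob a (mob (- a) z) = z"
  using mob_inverse[OF mob_den_nz[OF assms]] mob_inverse[of "- a" z] mob_den_nz[of "- a" z] assms ball_inner(2)[OF assms(1)]
  by auto

text \<open>The projection of the Lie ball to the ball that corresponds to the bundle projection
  of the tangent bundle, in the Klein model: \<open>kleinV z / klein0 z = 2x / (1 + |x|\<^sup>2)\<close> if \<open>mob x z\<close> is
  purely imaginary.\<close>

definition kleinV :: "complex^'n \<Rightarrow> real^'n" where
  "kleinV z = re_vec ((2 * (1 - cnj (cdot z z))) *s z)"

definition klein0 :: "complex^'n \<Rightarrow> real" where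
  "klein0 z = 1 - (cmod (cdot z z))\<^sup>2"

lemma klein0_pos: "z \<in> lie_ball \<Longrightarrow> klein0 z > 0"
  by (simp add: klein0_def lie_ball_iff abs_square_less_1)

text \<open>The difference of squares factors: \<open>(klein0 z)\<^sup>2 - (norm (kleinV z))\<^sup>2
  = (cmod (1 - cdot z z))\<^sup>2 * rho z\<close>.\<close>

lemma norm_kleinV:
  assumes z: "z \<in> lie_ball"
  shows "norm (kleinV z) < klein0 z"
proof -
  define p where "p = Re (cdot z z)"
  define q where "q = Im (cdot z z)"
  have Q: "cdot z z = Complex p q" by (simp add: p_def q_def)
  define N where "N = (norm z)\<^sup>2"
  define s where "s = p\<^sup>2 + q\<^sup>2"
  have s: "(cmod (cdot z z))\<^sup>2 = s" by (simp add: Q s_def cmod_power2)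
  have s1: "s < 1" using klein0_pos[OF z] by (simp add: klein0_def s)
  have N: "2 * N < 1 + s" using z by (simp add: lie_ball_iff rho_def s N_def)
  have d: "(cmod (1 - cnj (cdot z z)))\<^sup>2 = 1 - 2 * p + s"
    unfolding Q cmod_power2 by (simp add: s_def power2_eq_square algebra_simps)
  have "p \<noteq> 1 \<or> q \<noteq> 0" using s1 by (auto simp: s_def)
  then have "0 < (1 - p)\<^sup>2 + q\<^sup>2" by (auto intro: add_pos_nonneg add_nonneg_pos)
  then have dpos: "1 - 2 * p + s > 0" by (simp add: s_def power2_eq_square algebra_simps)
  have "2 * (1 - cnj (cdot z z)) * (2 * (1 - cnj (cdot z z)) * cdot z z) = 4 * ((1 - cnj (cdot z z))\<^sup>2 * cdot z z)"
    by (simp add: power2_eq_square algebra_simps)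
  moreover have "Re (4 * X) = 4 * Re X" for X by simp
  ultimately have e: "Re (2 * (1 - cnj (cdot z z)) * (2 * (1 - cnj (cdot z z)) * cdot z z))
      = 4 * Re ((1 - cnj (cdot z z))\<^sup>2 * cdot z z)" by (simp only:)
  have "(norm (kleinV z))\<^sup>2 = 2 * (1 - 2 * p + s) * N + 2 * Re ((1 - cnj (cdot z z))\<^sup>2 * cdot z z)"
    unfolding kleinV_def norm_re_vec norm_smult norm_mult power_mult_distrib cdot_smult_left cdot_smult_right
      N_def[symmetric] d e by simp
  also have "Re ((1 - cnj (cdot z z))\<^sup>2 * cdot z z) = p - 2 * s + p * s"
    by (simp add: Q power2_eq_square s_def algebra_simps)
  also have "2 * (1 - 2 * p + s) * N + 2 * (p - 2 * s + p * s) < (1 - 2 * p + s) * (1 + s) + 2 * (p - 2 * s + p * s)"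
    using mult_strict_left_mono[OF N dpos] by (simp add: algebra_simps)
  also have "\<dots> = (klein0 z)\<^sup>2"
    unfolding klein0_def s by (simp add: power2_eq_square algebra_simps)
  finally show ?thesis using klein0_pos[OF z] by (simp add: power2_less_imp_less)
qed

text \<open>Up to a positive factor, \<open>kleinV (mob x z)\<close> is a linear expression in
  \<open>klein0 z\<close> and \<open>kleinV z\<close>, and the asserted equation says that it
  vanishes. That \<open>kleinV w = 0\<close> only for imaginary \<open>w\<close> is seen by pairing
  it with the imaginary part of \<open>w\<close>, which forces real and imaginary parts to be
  orthogonal.\<close>

lemma re_vec_mob_eq_0_iff:
  assumes x: "norm x < 1" and z: "z \<in> lie_ball"
  shows "re_vec (mob x z) = 0 \<longleftrightarrow> (1 - x \<bullet> x) *\<^sub>R kleinV z = (2 * (klein0 z - kleinV z \<bullet> x)) *\<^sub>R x"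
proof -
  let ?w = "mob x z" and ?Q = "cdot z z"
  note h = mob_den_nz[OF x z]
  have w: "?w \<in> lie_ball" using mob_lie_ball[OF x z] .
  have 1: "re_vec w = 0 \<longleftrightarrow> kleinV w = 0" if w: "w \<in> lie_ball" for w
  proof
    assume "re_vec w = 0"
    then have "w = \<i> *s ofr (im_vec w)" using re_im_decomp[of w] by (simp add: ofr_simps)
    then obtain y where y: "w = \<i> *s ofr y" by blast
    show "kleinV w = 0"
      unfolding kleinV_def y by (simp add: cdot_simps cdot_ofr re_vec_simps vector_smult_assoc)
  next
    assume k: "kleinV w = 0"
    define p where "p = re_vec w" define q where "q = im_vec w"
    have w': "w = ofr p + \<i> *s ofr q" unfolding p_def q_def by (rule re_im_decomp)
    have Q: "cdot w w = Complex (p \<bullet> p - q \<bullet> q) (2 * (p \<bullet> q))"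
      unfolding w' by (simp add: cdot_simps cdot_ofr inner_commute[of q p] complex_eq_iff)
    have N: "(norm w)\<^sup>2 = p \<bullet> p + q \<bullet> q"
    proof -
      have "complex_of_real ((norm w)\<^sup>2) = of_real (p \<bullet> p + q \<bullet> q)"
        unfolding cdot_cnjv_self[symmetric] unfolding w'
        by (simp add: cdot_simps cdot_ofr inner_commute[of q p] distrib_left)
      then show ?thesis by (simp only: of_real_eq_iff)
    qed
    have lt: "p \<bullet> p + q \<bullet> q < 1" using norm_lie_ball[OF w] N abs_square_less_1[of "norm w"] by simp
    have "kleinV w = (2 * (1 - (p \<bullet> p - q \<bullet> q))) *\<^sub>R p - (4 * (p \<bullet> q)) *\<^sub>R q"
      unfolding kleinV_def Q by (subst w') (simp add: vector_add_ldistrib vector_smult_assoc re_vec_simps scaleR_diff_left)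
    also have "\<dots> = 2 *\<^sub>R ((1 - (p \<bullet> p - q \<bullet> q)) *\<^sub>R p - (2 * (p \<bullet> q)) *\<^sub>R q)"
      by (simp add: scaleR_diff_right)
    finally have e: "(1 - (p \<bullet> p - q \<bullet> q)) *\<^sub>R p = (2 * (p \<bullet> q)) *\<^sub>R q"
      unfolding k by simp
    from arg_cong[OF e, of "\<lambda>v. v \<bullet> q"] have "(p \<bullet> q) * (1 - (p \<bullet> p + q \<bullet> q)) = 0"
      by (simp add: algebra_simps)
    then have "p \<bullet> q = 0" using lt by simp
    with e have "(1 - (p \<bullet> p - q \<bullet> q)) *\<^sub>R p = 0" by simp
    moreover have "1 - (p \<bullet> p - q \<bullet> q) > 0" using lt inner_ge_zero[of q] by linarith
    ultimately show "re_vec w = 0" by (simp add: p_def)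
  qed
  let ?c = "1 - x \<bullet> x"
  have c: "?c > 0" using ball_inner(2)[OF x] by simp
  have n: "mob_num x z = complex_of_real ?c *s z + (2 * cdot z (ofr x) - 1 - ?Q) *s ofr x" by (rule mob_num_def)
  have "kleinV ?w = re_vec ((2 * (1 - cnj (mob_last x z / mob_den x z)) / mob_den x z) *s mob_num x z)"
    unfolding kleinV_def cdot_mob_self[OF h] unfolding mob_def by (simp add: vector_smult_assoc divide_inverse)
  also have "2 * (1 - cnj (mob_last x z / mob_den x z)) / mob_den x z
    = of_real (?c / (cmod (mob_den x z))\<^sup>2) * (2 * (1 - cnj ?Q))"
  proof -
    have "1 - cnj (mob_last x z / mob_den x z) = cnj (mob_den x z - mob_last x z) / cnj (mob_den x z)"
      using h by (simp add: field_simps)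
    also have "\<dots> = of_real ?c * (1 - cnj ?Q) / cnj (mob_den x z)" unfolding mob_den_last by simp
    finally have "1 - cnj (mob_last x z / mob_den x z) = of_real ?c * (1 - cnj ?Q) / cnj (mob_den x z)" .
    then show ?thesis
      by (simp only: of_real_divide of_real_power of_real_mult of_real_inverse cmod_square divide_inverse inverse_mult_distrib mult_ac)
  qed
  also have "re_vec ((of_real (?c / (cmod (mob_den x z))\<^sup>2) * (2 * (1 - cnj ?Q))) *s mob_num x z)
    = (?c / (cmod (mob_den x z))\<^sup>2) *\<^sub>R re_vec ((2 * (1 - cnj ?Q)) *s mob_num x z)"
    unfolding vector_smult_assoc[symmetric] by (simp only: re_vec_simps)
  also have "re_vec ((2 * (1 - cnj ?Q)) *s mob_num x z) = ?c *\<^sub>R kleinV z - (2 * (klein0 z - kleinV z \<bullet> x)) *\<^sub>R x"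
  proof -
    have "(2 * (1 - cnj ?Q)) *s mob_num x z = complex_of_real ?c *s ((2 * (1 - cnj ?Q)) *s z)
      + (2 * cdot ((2 * (1 - cnj ?Q)) *s z) (ofr x) - 2 * ((1 + ?Q) * (1 - cnj ?Q))) *s ofr x"
      unfolding n by (simp add: cdot_simps vec_eq_iff algebra_simps)
    moreover have "Re ((1 + ?Q) * (1 - cnj ?Q)) = klein0 z"
      unfolding klein0_def cmod_power2 by (simp add: algebra_simps power2_eq_square)
    ultimately have "re_vec ((2 * (1 - cnj ?Q)) *s mob_num x z)
      = ?c *\<^sub>R kleinV z + (2 * (kleinV z \<bullet> x) - 2 * klein0 z) *\<^sub>R x"
      by (simp only: re_vec_simps(1,3,4) minus_complex.simps kleinV_def[symmetric] Re_cdot_ofr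
          complex_Re_numeral Re_complex_of_real mult_2[symmetric]) (simp add: Re_cdot_ofr kleinV_def)
    then show ?thesis by (simp add: algebra_simps)
  qed
  finally have "kleinV ?w = 0 \<longleftrightarrow> ?c *\<^sub>R kleinV z - (2 * (klein0 z - kleinV z \<bullet> x)) *\<^sub>R x = 0"
    using h c by simp
  then show ?thesis using 1[OF w] by simp
qed

lemma re_vec_mob_eq_0_iff_klein:
  assumes x: "norm x < 1" and z: "z \<in> lie_ball"
  shows "re_vec (mob x z) = 0 \<longleftrightarrow> kleinV z /\<^sub>R klein0 z = (2 / (1 + x \<bullet> x)) *\<^sub>R x"
proof -
  have x1: "x \<bullet> x < 1" "x \<bullet> x \<ge> 0" using ball_inner(2)[OF x] by auto
  have k0: "klein0 z > 0" using klein0_pos[OF z] .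
  have nz: "1 + x \<bullet> x \<noteq> 0" using x1 by linarith
  show ?thesis unfolding re_vec_mob_eq_0_iff[OF assms]
  proof
    assume e: "(1 - x \<bullet> x) *\<^sub>R kleinV z = (2 * (klein0 z - kleinV z \<bullet> x)) *\<^sub>R x"
    \<comment> \<open>Pairing with \<open>x\<close> determines \<open>kleinV z \<bullet> x\<close>,
      and with it the coefficient on the right.\<close>
    from arg_cong[OF e, of "\<lambda>v. v \<bullet> x"]
    have "(1 - x \<bullet> x) * (kleinV z \<bullet> x) = 2 * (klein0 z - kleinV z \<bullet> x) * (x \<bullet> x)"
      by (simp only: inner_scaleR_left)
    then have "kleinV z \<bullet> x = 2 * klein0 z * (x \<bullet> x) / (1 + x \<bullet> x)"
      using x1 nz by (simp add: field_simps)
    then have k: "klein0 z - kleinV z \<bullet> x = klein0 z * (1 - x \<bullet> x) / (1 + x \<bullet> x)"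
      using x1 nz by (simp add: field_simps)
    have "(1 - x \<bullet> x) *\<^sub>R kleinV z = (1 - x \<bullet> x) *\<^sub>R ((2 * klein0 z / (1 + x \<bullet> x)) *\<^sub>R x)"
      unfolding e k by simp
    then have "kleinV z = (2 * klein0 z / (1 + x \<bullet> x)) *\<^sub>R x \<or> 1 - x \<bullet> x = 0" by (simp only: scaleR_cancel_left)
    then have "kleinV z = (2 * klein0 z / (1 + x \<bullet> x)) *\<^sub>R x" using x1 by auto
    then show "kleinV z /\<^sub>R klein0 z = (2 / (1 + x \<bullet> x)) *\<^sub>R x" using k0 by simp
  next
    assume "kleinV z /\<^sub>R klein0 z = (2 / (1 + x \<bullet> x)) *\<^sub>R x"
    then have "klein0 z *\<^sub>R (kleinV z /\<^sub>R klein0 z) = klein0 z *\<^sub>R ((2 / (1 + x \<bullet> x)) *\<^sub>R x)" by simp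
    then have v: "kleinV z = (2 * klein0 z / (1 + x \<bullet> x)) *\<^sub>R x" using k0 by simp
    have "(1 - x \<bullet> x) * (2 * klein0 z / (1 + x \<bullet> x)) = 2 * (klein0 z - 2 * klein0 z / (1 + x \<bullet> x) * (x \<bullet> x))"
      using x1 nz by (simp add: field_simps)
    then show "(1 - x \<bullet> x) *\<^sub>R kleinV z = (2 * (klein0 z - kleinV z \<bullet> x)) *\<^sub>R x"
      unfolding v by simp
  qed
qed

lemma klein_inj:
  fixes x y :: "'a::real_inner"
  assumes "norm x < 1" "norm y < 1" "(2 / (1 + x \<bullet> x)) *\<^sub>R x = (2 / (1 + y \<bullet> y)) *\<^sub>R y"
  shows "x = y"
proof -
  have n: "2 / (1 + x \<bullet> x) * norm x = 2 / (1 + y \<bullet> y) * norm y"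
    using arg_cong[OF assms(3), of norm] by (simp add: add_nonneg_nonneg)
  have pos: "1 + x \<bullet> x > 0" "1 + y \<bullet> y > 0" using inner_ge_zero[of x] inner_ge_zero[of y] by linarith+
  have "norm x * (1 + (norm y)\<^sup>2) = norm y * (1 + (norm x)\<^sup>2)"
    using n pos by (simp add: field_simps power2_norm_eq_inner)
  then have "(norm x - norm y) * (1 - norm x * norm y) = 0"
    by (simp add: algebra_simps power2_eq_square)
  moreover have "norm x * norm y < 1" using assms(1,2)
    by (metis mult_strict_mono' mult_1 norm_ge_zero)
  ultimately have "norm x = norm y" by simp
  then have "x \<bullet> x = y \<bullet> y" by (simp add: power2_norm_eq_inner[symmetric])
  then show ?thesis using assms(3) pos by simp
qed

lemma klein_surj:
  fixes b :: "'a::real_inner"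
  assumes "norm b < 1"
  shows "\<exists>x. norm x < 1 \<and> b = (2 / (1 + x \<bullet> x)) *\<^sub>R x"
proof -
  \<comment> \<open>The preimage of \<open>b\<close> under the Klein map is
    \<open>b / (1 + s)\<close>, from the smaller root of the quadratic equation for its
    length.\<close>
  define s where "s = sqrt (1 - b \<bullet> b)"
  have b1: "b \<bullet> b < 1" using ball_inner(2)[OF assms] .
  have s: "s > 0" "s\<^sup>2 = 1 - b \<bullet> b" using b1 by (auto simp: s_def)
  define x where "x = b /\<^sub>R (1 + s)"
  have "x \<bullet> x = (b \<bullet> b) / (1 + s)\<^sup>2" by (simp add: x_def power2_eq_square divide_inverse)
  also have "b \<bullet> b = (1 - s) * (1 + s)" using s(2) by (simp add: algebra_simps power2_eq_square)
  finally have xx: "x \<bullet> x = (1 - s) / (1 + s)" using s(1) by (simp add: power2_eq_square)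
  have "1 + x \<bullet> x = 2 / (1 + s)" using s(1) xx by (simp add: field_simps)
  then have "2 / (1 + x \<bullet> x) = 1 + s" by simp
  then have "b = (2 / (1 + x \<bullet> x)) *\<^sub>R x" using s(1) by (simp add: x_def)
  moreover have "x \<bullet> x < 1" using s(1) xx by simp
  then have "norm x < 1" by (simp add: power2_norm_eq_inner[symmetric] abs_square_less_1)
  ultimately show ?thesis by blast
qed

lemma imag_lie_ball: "norm y < 1 \<Longrightarrow> \<i> *s ofr y \<in> lie_ball"
  using smult_lie_ball[OF ofr_lie_ball, of y "\<i>"] by simp

lemma imag_lie_ballD: "\<i> *s ofr y \<in> lie_ball \<Longrightarrow> norm y < 1"
  using norm_lie_ball[of "\<i> *s ofr y"] by (simp add: norm_smult)

text \<open>\<open>x\<close> is the point of the ball with Klein coordinate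
  \<open>kleinV z / klein0 z\<close>. Facts about arbitrary points are reduced to imaginary ones
  through this.\<close>

lemma lie_ball_mob_imag:
  assumes z: "z \<in> lie_ball"
  obtains x y where "norm x < 1" "norm y < 1" "z = mob (- x) (\<i> *s ofr y)"
proof -
  have "norm (kleinV z /\<^sub>R klein0 z) < 1"
    using norm_kleinV[OF z] klein0_pos[OF z] by (simp add: divide_inverse_commute[symmetric])
  then obtain x where x: "norm x < 1" "kleinV z /\<^sub>R klein0 z = (2 / (1 + x \<bullet> x)) *\<^sub>R x"
    using klein_surj by blast
  then have "re_vec (mob x z) = 0" using re_vec_mob_eq_0_iff_klein[OF x(1) z] by simp
  then have m: "mob x z = \<i> *s ofr (im_vec (mob x z))" using re_im_decomp[of "mob x z"] by (simp add: ofr_simps)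
  moreover have "norm (im_vec (mob x z)) < 1"
    using imag_lie_ballD[of "im_vec (mob x z)"] m mob_lie_ball[OF x(1) z] by simp
  ultimately show ?thesis using that[OF x(1)] mob_inverse_lie_ball(1)[OF x(1) z] by metis
qed

section \<open>Change of variables for complex conformal maps\<close>

text \<open>Matches orthonormal bases of two spaces of equal dimension. Change of variables and
  determinants live on \<open>real^'m\<close>, so both the domain \<open>complex^'n\<close> and the
  complex values of functions are carried to such spaces.\<close>

lemma linear_isometry_lborel:
  assumes "DIM('a::euclidean_space) = DIM('b::euclidean_space)"
  obtains T :: "'a::euclidean_space \<Rightarrow> 'b::euclidean_space" and S :: "'b \<Rightarrow> 'a" where "linear T" "linear S" "\<And>x. S (T x) = x" "\<And>y. T (S y) = y"
    "\<And>x y. T x \<bullet> T y = x \<bullet> y" "distr lborel borel T = lborel"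
proof -
  obtain f :: "'a \<Rightarrow> 'b" where f: "bij_betw f Basis Basis"
    using assms finite_same_card_bij[of "Basis::'a set" "Basis::'b set"] by auto
  define T :: "'a \<Rightarrow> 'b" where "T x = (\<Sum>b\<in>Basis. (x \<bullet> b) *\<^sub>R f b)" for x
  define S :: "'b \<Rightarrow> 'a" where "S y = (\<Sum>b\<in>Basis. (y \<bullet> f b) *\<^sub>R b)" for y
  have fB: "f b \<in> Basis" if "b \<in> Basis" for b using f that by (auto simp: bij_betw_def)
  have ff: "f b \<bullet> f b' = (if b = b' then 1 else 0)" if "b \<in> Basis" "b' \<in> Basis" for b b'
    using fB[OF that(1)] fB[OF that(2)] f that by (auto simp: inner_Basis bij_betw_def inj_on_def)
  have linT: "linear T" unfolding T_def
    by (auto intro!: linearI simp: inner_add_left scaleR_add_left sum.distrib scaleR_sum_right)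
  have linS: "linear S" unfolding S_def
    by (auto intro!: linearI simp: inner_add_left scaleR_add_left sum.distrib scaleR_sum_right)
  have Tb: "T x \<bullet> f b = x \<bullet> b" if "b \<in> Basis" for x b
  proof -
    have "T x \<bullet> f b = (\<Sum>b'\<in>Basis. if b' = b then x \<bullet> b' else 0)"
      unfolding T_def inner_sum_left using ff that by (intro sum.cong) auto
    then show ?thesis using that by simp
  qed
  have ST: "S (T x) = x" for x
  proof -
    have "S (T x) = (\<Sum>b\<in>Basis. (x \<bullet> b) *\<^sub>R b)" unfolding S_def using Tb by (intro sum.cong) auto
    then show ?thesis by (simp add: euclidean_representation)
  qed
  have TS: "T (S y) = y" for y
  proof -
    have "S y \<bullet> b = y \<bullet> f b" if "b \<in> Basis" for b unfolding S_def using that by simp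
    then have "T (S y) = (\<Sum>b\<in>Basis. (y \<bullet> f b) *\<^sub>R f b)" unfolding T_def by (intro sum.cong) auto
    also have "\<dots> = (\<Sum>c\<in>Basis. (y \<bullet> c) *\<^sub>R c)" by (rule sum.reindex_bij_betw[OF f])
    finally show ?thesis by (simp add: euclidean_representation)
  qed
  have inn: "T x \<bullet> T y = x \<bullet> y" for x y
  proof -
    have "T x \<bullet> T y = (\<Sum>b\<in>Basis. (y \<bullet> b) * (x \<bullet> b))" unfolding T_def[of y] inner_sum_right using Tb by simp
    then show ?thesis by (simp add: euclidean_inner[of x y] mult.commute)
  qed
  have meas: "T \<in> borel_measurable borel"
    using linT by (intro borel_measurable_continuous_onI linear_continuous_on linear_conv_bounded_linear[THEN iffD1])
  have "lborel = distr lborel borel T"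
  proof (rule lborel_eqI)
    fix l u :: 'b assume lu: "\<And>b. b \<in> Basis \<Longrightarrow> l \<bullet> b \<le> u \<bullet> b"
    have Sb: "S y \<bullet> b = y \<bullet> f b" if "b \<in> Basis" for b y unfolding S_def using that by simp
    have Bf: "(Basis :: 'b set) = f ` Basis" using f by (simp add: bij_betw_def)
    have vim: "T -` box l u = box (S l) (S u)"
    proof -
      have "T x \<in> box l u \<longleftrightarrow> x \<in> box (S l) (S u)" for x
        unfolding mem_box Bf by (simp add: Tb Sb)
      then show ?thesis by auto
    qed
    have "emeasure (distr lborel borel T) (box l u) = emeasure lborel (box (S l) (S u))"
      using meas by (subst emeasure_distr) (auto simp: vim)
    also have "\<dots> = (\<Prod>b\<in>Basis. (S u - S l) \<bullet> b)"
      using lu fB by (intro emeasure_lborel_box) (auto simp: Sb)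
    also have "\<dots> = (\<Prod>b\<in>Basis. (u - l) \<bullet> f b)"
      by (simp add: inner_diff_left Sb)
    also have "\<dots> = (\<Prod>b\<in>Basis. (u - l) \<bullet> b)"
      by (simp add: prod.reindex_bij_betw[OF f, of "\<lambda>b. (u - l) \<bullet> b"])
    finally show "emeasure (distr lborel borel T) (box l u) = (\<Prod>b\<in>Basis. (u - l) \<bullet> b)" .
  qed simp
  then show ?thesis using that[OF linT linS ST TS inn] by simp
qed

lemma change_of_variables_complex_valued:
  fixes f :: "real^'m::{finite,wellorder} \<Rightarrow> complex" and g :: "real^'m::_ \<Rightarrow> real^'m::_"
  assumes "S \<in> sets lebesgue"
    and "\<And>x. x \<in> S \<Longrightarrow> (g has_derivative g' x) (at x within S)"
    and "inj_on g S"
  shows "(\<lambda>x. \<bar>det (matrix (g' x))\<bar> *\<^sub>R f (g x)) absolutely_integrable_on S \<and>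
           integral S (\<lambda>x. \<bar>det (matrix (g' x))\<bar> *\<^sub>R f (g x)) = b
     \<longleftrightarrow> f absolutely_integrable_on (g ` S) \<and> integral (g ` S) f = b"
proof -
  obtain T :: "complex \<Rightarrow> real^2" and U where TU: "linear T" "linear U" "\<And>x. U (T x) = x" "\<And>y. T (U y) = y"
    by (rule linear_isometry_lborel[where 'a = complex and 'b = "real^2"]) auto
  have bl: "bounded_linear T" "bounded_linear U" using TU linear_conv_bounded_linear by blast+
  have iff: "(\<lambda>x. T (h x)) absolutely_integrable_on A \<longleftrightarrow> h absolutely_integrable_on A"
    for h :: "real^'m::_ \<Rightarrow> complex" and A
  proof
    assume "(\<lambda>x. T (h x)) absolutely_integrable_on A"
    from absolutely_integrable_linear[OF this bl(2)] show "h absolutely_integrable_on A" by (simp add: o_def TU)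
  next
    assume "h absolutely_integrable_on A"
    from absolutely_integrable_linear[OF this bl(1)] show "(\<lambda>x. T (h x)) absolutely_integrable_on A" by (simp add: o_def)
  qed
  have int: "integral A (\<lambda>x. T (h x)) = T (integral A h)" if "h absolutely_integrable_on A"
    for h :: "real^'m::_ \<Rightarrow> complex" and A
  proof -
    have "h integrable_on A" using that by (simp add: absolutely_integrable_on_def)
    from integral_linear[OF this bl(1)] show ?thesis by (simp add: o_def)
  qed
  have inj: "T x = T y \<longleftrightarrow> x = y" for x y using TU(3) by metis
  have sc: "r *\<^sub>R T x = T (r *\<^sub>R x)" for r x using TU(1) by (simp add: linear_cmul)
  have "(\<lambda>x. \<bar>det (matrix (g' x))\<bar> *\<^sub>R f (g x)) absolutely_integrable_on S \<and>
           integral S (\<lambda>x. T (\<bar>det (matrix (g' x))\<bar> *\<^sub>R f (g x))) = T b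
     \<longleftrightarrow> f absolutely_integrable_on (g ` S) \<and> integral (g ` S) (\<lambda>x. T (f x)) = T b"
    using has_absolute_integral_change_of_variables[OF assms, of "\<lambda>x. T (f x)" "T b"]
    unfolding sc iff by simp
  then show ?thesis by (simp add: int inj cong: conj_cong)
qed

lemma absolutely_integrable_iff_lborel:
  fixes h :: "'a::euclidean_space \<Rightarrow> 'b::euclidean_space"
  assumes "open A" "continuous_on A h"
  shows "h absolutely_integrable_on A \<longleftrightarrow> set_integrable lborel A h"
    "set_lebesgue_integral lebesgue A h = set_lebesgue_integral lborel A h"
proof -
  have "(\<lambda>x. indicator A x *\<^sub>R h x) \<in> borel_measurable borel"
    using assms by (intro borel_measurable_continuous_on_indicator) auto
  then have m: "(\<lambda>x. indicator A x *\<^sub>R h x) \<in> borel_measurable lborel" by simp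
  show "h absolutely_integrable_on A \<longleftrightarrow> set_integrable lborel A h"
    unfolding set_integrable_def by (rule integrable_completion[OF m])
  show "set_lebesgue_integral lebesgue A h = set_lebesgue_integral lborel A h"
    unfolding set_lebesgue_integral_def by (rule integral_completion[OF m])
qed

lemma set_integral_image_isometry:
  fixes T :: "'a::euclidean_space \<Rightarrow> 'b::euclidean_space" and h :: "'b \<Rightarrow> 'c::euclidean_space"
  assumes T: "linear T" "distr lborel borel T = lborel" "\<And>x. S (T x) = x" "\<And>y. T (S y) = y"
    and "open (T ` A)" "continuous_on (T ` A) h"
  shows "set_integrable lborel (T ` A) h \<longleftrightarrow> set_integrable lborel A (\<lambda>x. h (T x))"
    "set_lebesgue_integral lborel (T ` A) h = set_lebesgue_integral lborel A (\<lambda>x. h (T x))"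
proof -
  have mT: "T \<in> borel_measurable lborel"
    using T(1) by (simp, intro borel_measurable_continuous_onI linear_continuous_on linear_conv_bounded_linear[THEN iffD1])
  have m: "(\<lambda>x. indicator (T ` A) x *\<^sub>R h x) \<in> borel_measurable borel"
    using assms(5,6) by (intro borel_measurable_continuous_on_indicator) auto
  have ind: "indicator (T ` A) (T x) = (indicator A x :: real)" for x
    using T(3) by (auto simp: indicator_def image_iff) metis
  show "set_integrable lborel (T ` A) h \<longleftrightarrow> set_integrable lborel A (\<lambda>x. h (T x))"
    unfolding set_integrable_def using integrable_distr_eq[OF mT m] by (simp add: T(2) ind)
  show "set_lebesgue_integral lborel (T ` A) h = set_lebesgue_integral lborel A (\<lambda>x. h (T x))"
    unfolding set_lebesgue_integral_def using integral_distr[OF mT m] by (simp add: T(2) ind)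
qed

lemma matrix_eqI_inner:
  fixes A B :: "real^'n^'n"
  assumes "\<And>u v. u \<bullet> (A *v v) = u \<bullet> (B *v v)"
  shows "A = B"
  unfolding matrix_eq using assms vector_eq_ldot by blast

lemma inner_transpose: "u \<bullet> (transpose A *v w) = (A *v u) \<bullet> w" for A :: "real^'n^'m"
  by (metis dot_lmul_matrix inner_commute transpose_matrix_vector)

text \<open>A complex linear map that multiplies the complex bilinear form by \<open>\<mu>\<^sup>2\<close> has real determinant
  of modulus \<open>|\<mu>|\<^bsup>2n\<^esup>\<close>, as it multiplies the real symmetric form \<open>Re (cdot u v)\<close>
  by the real linear map \<open>\<mu>\<^sup>2\<close>.\<close>

lemma det_complex_conformal:
  fixes T :: "complex^'n \<Rightarrow> real^'m" and L :: "complex^'n \<Rightarrow> complex^'n"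
  assumes T: "linear T" "linear S" "\<And>x. S (T x) = x" "\<And>y. T (S y) = y" "\<And>x y. T x \<bullet> T y = x \<bullet> y"
    and L: "linear L" "\<And>u v. cdot (L u) (L v) = \<mu>\<^sup>2 * cdot u v"
  shows "\<bar>det (matrix (\<lambda>y. T (L (S y))))\<bar> = cmod \<mu> ^ CARD('m)"
proof -
  have lin: "linear (\<lambda>y. T (M (S y)))" if "linear M" for M
    using linear_compose[OF linear_compose[OF T(2) that] T(1)] by (simp add: o_def)
  have Tin: "T x \<bullet> y = x \<bullet> S y" for x y using T(5)[of x "S y"] T(4) by simp
  have linC: "linear (cnjv :: complex^'n \<Rightarrow> _)" using bounded_linear_cnjv bounded_linear.linear by blast
  have linM: "linear (\<lambda>v::complex^'n. \<mu>\<^sup>2 *s v)"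
    by (auto intro!: linearI simp: vector_add_ldistrib smult_scaleR_right)
  define A where "A = matrix (\<lambda>y. T (L (S y)))"
  define K where "K = matrix (\<lambda>y. T (cnjv (S y)))"
  define \<Lambda> where "\<Lambda> = matrix (\<lambda>y. T (\<mu>\<^sup>2 *s S y))"
  have A: "A *v y = T (L (S y))" for y using fun_cong[OF matrix_vector_mul(2)[OF lin[OF L(1)]]] by (simp add: A_def)
  have K: "K *v y = T (cnjv (S y))" for y using fun_cong[OF matrix_vector_mul(2)[OF lin[OF linC]]] by (simp add: K_def)
  have \<Lambda>: "\<Lambda> *v y = T (\<mu>\<^sup>2 *s S y)" for y using fun_cong[OF matrix_vector_mul(2)[OF lin[OF linM]]] by (simp add: \<Lambda>_def)
  have "K ** K = mat 1"
    by (rule matrix_eqI_inner) (simp add: matrix_vector_mul_assoc[symmetric] K T)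
  then have "det K * det K = 1" by (metis det_I det_mul)
  then have dK: "det K \<noteq> 0" by auto
  \<comment> \<open>\<open>K\<close> is the matrix of conjugation, so
    \<open>u \<bullet> (K *v v)\<close> is the form \<open>Re (cdot u v)\<close> in real
    coordinates. Taking determinants yields the square of \<open>det A\<close>.\<close>
  have "transpose A ** (K ** A) = K ** \<Lambda>"
  proof (rule matrix_eqI_inner)
    fix u v
    have "u \<bullet> ((transpose A ** (K ** A)) *v v) = (A *v u) \<bullet> (K *v (A *v v))"
      by (simp only: matrix_vector_mul_assoc[symmetric] inner_transpose)
    also have "\<dots> = L (S u) \<bullet> cnjv (L (S v))" by (simp add: A K T)
    also have "\<dots> = Re (cdot (L (S u)) (L (S v)))" by (simp add: inner_cdot)
    also have "\<dots> = Re (cdot (S u) (\<mu>\<^sup>2 *s S v))" by (simp add: L(2) cdot_simps)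
    also have "\<dots> = S u \<bullet> cnjv (\<mu>\<^sup>2 *s S v)" by (simp add: inner_cdot)
    also have "\<dots> = u \<bullet> (K *v (\<Lambda> *v v))"
      using Tin[of "cnjv (\<mu>\<^sup>2 *s S v)" u] by (simp add: K \<Lambda> T inner_commute)
    finally show "u \<bullet> ((transpose A ** (K ** A)) *v v) = u \<bullet> ((K ** \<Lambda>) *v v)"
      by (simp add: matrix_vector_mul_assoc[symmetric])
  qed
  then have "det A * (det K * det A) = det K * det \<Lambda>"
    by (metis det_mul det_transpose)
  then have dA: "(det A)\<^sup>2 = det \<Lambda>" using dK by (simp add: power2_eq_square)
  \<comment> \<open>\<open>\<Lambda>\<close> is multiplication by \<open>\<mu>\<^sup>2\<close>, a
    Euclidean similarity of ratio \<open>cmod (\<mu>\<^sup>2)\<close>; this determines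
    \<open>det \<Lambda>\<close> up to sign.\<close>
  have "transpose \<Lambda> ** \<Lambda> = matrix ((*\<^sub>R) ((cmod (\<mu>\<^sup>2))\<^sup>2))"
  proof (rule matrix_eqI_inner)
    fix u v
    have "u \<bullet> ((transpose \<Lambda> ** \<Lambda>) *v v) = (\<Lambda> *v u) \<bullet> (\<Lambda> *v v)"
      by (simp only: matrix_vector_mul_assoc[symmetric] inner_transpose)
    also have "\<dots> = Re (cdot (\<mu>\<^sup>2 *s S u) (cnjv (\<mu>\<^sup>2 *s S v)))" by (simp add: \<Lambda> T inner_cdot)
    also have "\<dots> = Re ((\<mu>\<^sup>2 * cnj (\<mu>\<^sup>2)) * cdot (S u) (cnjv (S v)))"
      by (simp only: cnjv_simps cdot_smult_left cdot_smult_right mult_ac)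
    also have "\<dots> = (cmod (\<mu>\<^sup>2))\<^sup>2 * Re (cdot (S u) (cnjv (S v)))"
      unfolding cmod_square[symmetric] of_real_power[symmetric] by simp
    also have "Re (cdot (S u) (cnjv (S v))) = u \<bullet> v"
      using T(5)[of "S u" "S v"] by (simp add: inner_cdot[symmetric] T)
    finally show "u \<bullet> ((transpose \<Lambda> ** \<Lambda>) *v v) = u \<bullet> (matrix ((*\<^sub>R) ((cmod (\<mu>\<^sup>2))\<^sup>2)) *v v)"
      using fun_cong[OF matrix_vector_mul(2)[of "(*\<^sub>R) ((cmod (\<mu>\<^sup>2))\<^sup>2)"], of v] by simp
  qed
  then have "det \<Lambda> * det \<Lambda> = ((cmod (\<mu>\<^sup>2))\<^sup>2) ^ CARD('m)"
    by (metis det_mul det_transpose det_matrix_scaleR)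
  then have "(det A)\<^sup>2 * (det A)\<^sup>2 = (cmod \<mu> ^ CARD('m)) ^ 4"
    unfolding dA by (simp add: norm_power power_mult[symmetric] mult.commute)
  then have "\<bar>det A\<bar> ^ 4 = (cmod \<mu> ^ CARD('m)) ^ 4"
    by (simp add: power2_eq_square power4_eq_xxxx abs_mult[symmetric] mult.assoc)
  then show ?thesis unfolding A_def by (rule power_eq_imp_eq_base) auto
qed

lemma change_of_variables_conformal:
  fixes \<phi> :: "complex^'n \<Rightarrow> complex^'n" and F :: "complex^'n \<Rightarrow> complex"
  assumes U: "open U" "inj_on \<phi> U" "\<phi> ` U = U"
    and d: "\<And>z. z \<in> U \<Longrightarrow> (\<phi> has_derivative \<phi>' z) (at z)"
    and c: "\<And>z u v. z \<in> U \<Longrightarrow> cdot (\<phi>' z u) (\<phi>' z v) = (\<mu> z)\<^sup>2 * cdot u v"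
    and cont: "continuous_on U \<mu>" "continuous_on U F"
  shows "set_integrable lborel U (\<lambda>z. (cmod (\<mu> z) ^ (2 * CARD('n))) *\<^sub>R F (\<phi> z)) \<longleftrightarrow> set_integrable lborel U F"
    "set_lebesgue_integral lborel U (\<lambda>z. (cmod (\<mu> z) ^ (2 * CARD('n))) *\<^sub>R F (\<phi> z)) = set_lebesgue_integral lborel U F"
proof -
  \<comment> \<open>\<open>'n bit0\<close> has twice as many elements as \<open>'n\<close>, matching
    the real dimension of \<open>complex^'n\<close>.\<close>
  obtain T :: "complex^'n \<Rightarrow> real^('n bit0)" and S where
    T: "linear T" "linear S" "\<And>x. S (T x) = x" "\<And>y. T (S y) = y" "\<And>x y. T x \<bullet> T y = x \<bullet> y"
      "distr lborel borel T = lborel"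
    by (rule linear_isometry_lborel[where 'a = "complex^'n" and 'b = "real^('n bit0)"]) auto
  have bT: "bounded_linear T" "bounded_linear S" using T(1,2) linear_conv_bounded_linear by blast+
  have contT: "continuous_on A T" "continuous_on B S" for A B
    using bT linear_continuous_on by blast+
  have TU: "T ` U = S -` U" using T(3,4) by (auto simp: image_iff) metis
  have oTU: "open (T ` U)" unfolding TU using U(1) contT(2)[of UNIV] by (simp add: open_vimage)
  define g where "g = (\<lambda>y. T (\<phi> (S y)))"
  define g' where "g' = (\<lambda>y v. T (\<phi>' (S y) (S v)))"
  have gU: "g ` (T ` U) = T ` U" using U(3) by (simp add: g_def image_image T) (metis image_image)
  have dg: "(g has_derivative g' y) (at y within T ` U)" if "y \<in> T ` U" for y
  proof -
    have "S y \<in> U" using that TU by auto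
    have "((\<lambda>y. \<phi> (S y)) has_derivative (\<lambda>v. \<phi>' (S y) (S v))) (at y)"
      using has_derivative_compose[OF bounded_linear_imp_has_derivative[OF bT(2)] d[OF \<open>S y \<in> U\<close>]] .
    from bounded_linear.has_derivative[OF bT(1) this] show ?thesis
      unfolding g_def g'_def by (rule has_derivative_at_withinI)
  qed
  have injg: "inj_on g (T ` U)"
    using U(2) T(3) by (auto simp: inj_on_def g_def) metis
  have det: "\<bar>det (matrix (g' y))\<bar> = cmod (\<mu> (S y)) ^ (2 * CARD('n))" if "y \<in> T ` U" for y
  proof -
    have "S y \<in> U" using that TU by auto
    have lin: "linear (\<phi>' (S y))" using d[OF \<open>S y \<in> U\<close>] has_derivative_linear by blast
    show ?thesis
      unfolding g'_def
      using det_complex_conformal[OF T(1-5) lin c[OF \<open>S y \<in> U\<close>]] by simp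
  qed
  let ?h = "\<lambda>y. \<bar>det (matrix (g' y))\<bar> *\<^sub>R F (S (g y))"
  let ?k = "\<lambda>y. (cmod (\<mu> (S y)) ^ (2 * CARD('n))) *\<^sub>R F (\<phi> (S y))"
  have hk: "?h y = ?k y" if "y \<in> T ` U" for y using det[OF that] by (simp add: g_def T)
  have cov: "?h absolutely_integrable_on T ` U \<and> integral (T ` U) ?h = b
      \<longleftrightarrow> (\<lambda>y. F (S y)) absolutely_integrable_on T ` U \<and> integral (T ` U) (\<lambda>y. F (S y)) = b" for b
    using change_of_variables_complex_valued[of "T ` U" g g' "\<lambda>y. F (S y)" b] dg injg oTU
    unfolding gU by simp
  have hk1: "?h absolutely_integrable_on T ` U \<longleftrightarrow> ?k absolutely_integrable_on T ` U"
    "integral (T ` U) ?h = integral (T ` U) ?k"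
    by (rule set_integrable_cong, simp_all only: hk) (rule integral_cong, simp only: hk)
  have SU: "S ` (T ` U) = U" using T(3) by (simp add: image_image)
  have c\<phi>: "continuous_on U \<phi>" using d has_derivative_continuous continuous_at_imp_continuous_on by blast
  have cF: "continuous_on (T ` U) (\<lambda>y. F (S y))"
    by (rule continuous_on_compose2[OF cont(2) contT(2)]) (simp add: SU)
  have cF\<phi>: "continuous_on U (\<lambda>z. F (\<phi> z))"
    by (rule continuous_on_compose2[OF cont(2) c\<phi>]) (simp add: U(3))
  have ckU: "continuous_on U (\<lambda>z. (cmod (\<mu> z) ^ (2 * CARD('n))) *\<^sub>R F (\<phi> z))"
    by (intro continuous_intros cont cF\<phi>)
  have ck: "continuous_on (T ` U) ?k"
    by (rule continuous_on_compose2[OF ckU contT(2)]) (simp add: SU)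
  have i1: "?k absolutely_integrable_on T ` U \<longleftrightarrow> set_integrable lborel U (\<lambda>z. (cmod (\<mu> z) ^ (2 * CARD('n))) *\<^sub>R F (\<phi> z))"
    using absolutely_integrable_iff_lborel(1)[OF oTU ck] set_integral_image_isometry(1)[OF T(1,6,3,4) oTU ck]
    by (simp add: T)
  have i2: "(\<lambda>y. F (S y)) absolutely_integrable_on T ` U \<longleftrightarrow> set_integrable lborel U F"
    using absolutely_integrable_iff_lborel(1)[OF oTU cF] set_integral_image_isometry(1)[OF T(1,6,3,4) oTU cF]
    by (simp add: T)
  show iff: "set_integrable lborel U (\<lambda>z. (cmod (\<mu> z) ^ (2 * CARD('n))) *\<^sub>R F (\<phi> z)) \<longleftrightarrow> set_integrable lborel U F"
    using cov[of "integral (T ` U) ?h"] cov[of "integral (T ` U) (\<lambda>y. F (S y))"] hk1(1) i1 i2 by blast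
  show "set_lebesgue_integral lborel U (\<lambda>z. (cmod (\<mu> z) ^ (2 * CARD('n))) *\<^sub>R F (\<phi> z)) = set_lebesgue_integral lborel U F"
  proof (cases "set_integrable lborel U F")
    case True
    have e1: "set_lebesgue_integral lborel U (\<lambda>z. (cmod (\<mu> z) ^ (2 * CARD('n))) *\<^sub>R F (\<phi> z)) = integral (T ` U) ?k"
      using set_lebesgue_integral_eq_integral(2)[of "T ` U" ?k] absolutely_integrable_iff_lborel(2)[OF oTU ck]
        set_integral_image_isometry(2)[OF T(1,6,3,4) oTU ck] i1 iff True by (simp add: T)
    have e2: "set_lebesgue_integral lborel U F = integral (T ` U) (\<lambda>y. F (S y))"
      using set_lebesgue_integral_eq_integral(2)[of "T ` U" "\<lambda>y. F (S y)"] absolutely_integrable_iff_lborel(2)[OF oTU cF]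
        set_integral_image_isometry(2)[OF T(1,6,3,4) oTU cF] i2 True by (simp add: T)
    have "?h absolutely_integrable_on T ` U" using hk1(1) i1 iff True by blast
    then show ?thesis using cov[of "integral (T ` U) ?h"] hk1(2) e1 e2 by metis
  next
    \<comment> \<open>Neither side is integrable, and both integrals have the default value
      0.\<close>
    case False
    then show ?thesis using iff unfolding set_lebesgue_integral_def set_integrable_def
      by (simp add: not_integrable_integral_eq)
  qed
qed

section \<open>The Bergman kernel of the Lie ball\<close>

abbreviation LB :: "(complex^'n) set" where "LB \<equiv> lie_ball"
abbreviation A2 :: "(complex^'n \<Rightarrow> complex) set" where "A2 \<equiv> bergman_space lie_ball"
abbreviation lint :: "(complex^'n \<Rightarrow> complex) \<Rightarrow> complex" where
  "lint f \<equiv> set_lebesgue_integral lborel lie_ball f"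

lemma holomorphic_vec_on_cont: "holomorphic_vec_on f U \<Longrightarrow> continuous_on U f"
  unfolding holomorphic_vec_on_def
  by (auto intro!: continuous_at_imp_continuous_on dest!: bspec has_derivative_continuous)

lemma A2_cont: "f \<in> A2 \<Longrightarrow> continuous_on LB f"
  by (simp add: bergman_space_def holomorphic_vec_on_cont)

lemma holomorphic_vec_on_cong:
  assumes "open U" "\<And>z. z \<in> U \<Longrightarrow> f z = g z" "holomorphic_vec_on f U"
  shows "holomorphic_vec_on g U"
  using assms unfolding holomorphic_vec_on_def
  by (metis has_derivative_transform_within_open)

lemma holomorphic_vec_on_mult:
  assumes "holomorphic_vec_on f U" "holomorphic_vec_on g U"
  shows "holomorphic_vec_on (\<lambda>z. f z * g z) U"
  unfolding holomorphic_vec_on_def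
proof
  fix z assume "z \<in> U"
  then obtain f' g' where f': "(f has_derivative f') (at z)" "\<And>c v. f' (c *s v) = c * f' v"
    and g': "(g has_derivative g') (at z)" "\<And>c v. g' (c *s v) = c * g' v"
    using assms unfolding holomorphic_vec_on_def by metis
  have "((\<lambda>z. f z * g z) has_derivative (\<lambda>v. f z * g' v + f' v * g z)) (at z)"
    by (rule has_derivative_mult[OF f'(1) g'(1)])
  then show "\<exists>d. ((\<lambda>z. f z * g z) has_derivative d) (at z) \<and> (\<forall>c v. d (c *s v) = c * d v)"
    by (intro exI conjI) (auto simp: f'(2) g'(2) algebra_simps)
qed

lemma holomorphic_vec_on_const: "holomorphic_vec_on (\<lambda>z. c) U"
  unfolding holomorphic_vec_on_def by (auto intro!: exI[of _ "\<lambda>_. 0"])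

lemma holomorphic_vec_on_power: "holomorphic_vec_on f U \<Longrightarrow> holomorphic_vec_on (\<lambda>z. f z ^ m) U"
  by (induction m) (auto intro: holomorphic_vec_on_mult holomorphic_vec_on_const)

lemma holomorphic_vec_on_diff:
  assumes "holomorphic_vec_on f U" "holomorphic_vec_on g U"
  shows "holomorphic_vec_on (\<lambda>z. f z - g z) U"
  unfolding holomorphic_vec_on_def
proof
  fix z assume "z \<in> U"
  then obtain f' g' where f': "(f has_derivative f') (at z)" "\<And>c v. f' (c *s v) = c * f' v"
    and g': "(g has_derivative g') (at z)" "\<And>c v. g' (c *s v) = c * g' v"
    using assms unfolding holomorphic_vec_on_def by metis
  have "((\<lambda>z. f z - g z) has_derivative (\<lambda>v. f' v - g' v)) (at z)"
    by (rule has_derivative_diff[OF f'(1) g'(1)])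
  then show "\<exists>d. ((\<lambda>z. f z - g z) has_derivative d) (at z) \<and> (\<forall>c v. d (c *s v) = c * d v)"
    by (intro exI conjI) (auto simp: f'(2) g'(2) algebra_simps)
qed

lemma emeasure_lie_ball_finite: "emeasure lborel (LB :: (complex^'n) set) < \<infinity>"
proof -
  have "(LB :: (complex^'n) set) \<subseteq> ball 0 1" using norm_lie_ball by auto
  then have "emeasure lborel (LB :: (complex^'n) set) \<le> emeasure lborel (ball (0 :: complex^'n) 1)"
    by (rule emeasure_mono) simp
  also have "\<dots> < \<infinity>" by (rule emeasure_bounded_finite) simp
  finally show ?thesis .
qed

lemma lie_ball_sets [measurable]: "lie_ball \<in> sets borel"
  using open_lie_ball by (rule borel_open)

lemma set_measurable_cont:
  fixes f :: "complex^'n \<Rightarrow> 'b::euclidean_space"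
  shows "continuous_on LB f \<Longrightarrow> set_borel_measurable lborel LB f"
  unfolding set_borel_measurable_def using borel_measurable_continuous_on_indicator[OF lie_ball_sets] by simp

lemma set_integrable_const_lie_ball: "set_integrable lborel LB (\<lambda>_. c :: 'b::euclidean_space)"
  unfolding set_integrable_def using emeasure_lie_ball_finite by (intro integrable_scaleR_left integrable_real_indicator) simp_all

lemma A2_mult_integrable:
  assumes "f \<in> A2" "g \<in> A2"
  shows "set_integrable lborel LB (\<lambda>u. f u * cnj (g u))"
proof (rule set_integrable_bound)
  show "set_integrable lborel LB (\<lambda>u. (cmod (f u))\<^sup>2 + (cmod (g u))\<^sup>2)"
    using assms by (auto simp: bergman_space_def)
  show "set_borel_measurable lborel LB (\<lambda>u. f u * cnj (g u))"
    by (intro set_measurable_cont continuous_intros A2_cont assms)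
  show "AE u in lborel. u \<in> LB \<longrightarrow> norm (f u * cnj (g u)) \<le> norm ((cmod (f u))\<^sup>2 + (cmod (g u))\<^sup>2)"
  proof (intro AE_I2 impI)
    fix u
    have "2 * (cmod (f u) * cmod (g u)) \<le> (cmod (f u))\<^sup>2 + (cmod (g u))\<^sup>2"
      using sum_squares_bound[of "cmod (f u)" "cmod (g u)"] by simp
    moreover have "0 \<le> cmod (f u) * cmod (g u)" by (intro mult_nonneg_nonneg norm_ge_zero)
    ultimately have "cmod (f u) * cmod (g u) \<le> (cmod (f u))\<^sup>2 + (cmod (g u))\<^sup>2" by linarith
    then show "norm (f u * cnj (g u)) \<le> norm ((cmod (f u))\<^sup>2 + (cmod (g u))\<^sup>2)"
      by (simp add: norm_mult)
  qed
qed

lemma A2_const: "(\<lambda>_. c) \<in> A2"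
  unfolding bergman_space_def by (auto intro: holomorphic_vec_on_const set_integrable_const_lie_ball)

lemma A2_integrable: "f \<in> A2 \<Longrightarrow> set_integrable lborel LB f"
  using A2_mult_integrable[OF _ A2_const, of f 1] by simp

lemma A2_iff:
  "f \<in> A2 \<longleftrightarrow> holomorphic_vec_on f LB \<and> set_integrable lborel LB (\<lambda>u. complex_of_real ((cmod (f u))\<^sup>2))"
  unfolding bergman_space_def set_integrable_def
  using complex_of_real_integrable_eq[of lborel "\<lambda>x. indicator LB x *\<^sub>R (cmod (f x))\<^sup>2"]
  by (simp add: scaleR_conv_of_real)

lemma A2_diff:
  assumes "f \<in> A2" "g \<in> A2"
  shows "(\<lambda>u. f u - g u) \<in> A2"
proof -
  have h: "holomorphic_vec_on (\<lambda>u. f u - g u) LB"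
    using assms by (auto simp: bergman_space_def intro: holomorphic_vec_on_diff)
  have "set_integrable lborel LB (\<lambda>u. (cmod (f u - g u))\<^sup>2)"
  proof (rule set_integrable_bound)
    show "set_integrable lborel LB (\<lambda>u. 2 * ((cmod (f u))\<^sup>2 + (cmod (g u))\<^sup>2))"
      using assms by (auto simp: bergman_space_def)
    show "set_borel_measurable lborel LB (\<lambda>u. (cmod (f u - g u))\<^sup>2)"
      by (intro set_measurable_cont continuous_intros A2_cont assms)
    show "AE u in lborel. u \<in> LB \<longrightarrow> norm ((cmod (f u - g u))\<^sup>2) \<le> norm (2 * ((cmod (f u))\<^sup>2 + (cmod (g u))\<^sup>2))"
    proof (intro AE_I2 impI)
      fix u
      have "(cmod (f u - g u))\<^sup>2 \<le> (cmod (f u) + cmod (g u))\<^sup>2"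
        by (intro power_mono norm_triangle_ineq4) simp
      also have "\<dots> \<le> 2 * ((cmod (f u))\<^sup>2 + (cmod (g u))\<^sup>2)"
        using sum_squares_bound[of "cmod (f u)" "cmod (g u)"] by (simp add: power2_sum)
      finally show "norm ((cmod (f u - g u))\<^sup>2) \<le> norm (2 * ((cmod (f u))\<^sup>2 + (cmod (g u))\<^sup>2))" by simp
    qed
  qed
  with h show ?thesis by (simp add: bergman_space_def)
qed

text \<open>The set where \<open>f\<close> does not vanish is open and null, hence empty.\<close>

lemma A2_zero:
  assumes f: "f \<in> A2" and z: "lint (\<lambda>u. f u * cnj (f u)) = 0" and u: "u \<in> LB"
  shows "f u = 0"
proof (rule ccontr)
  assume nz: "f u \<noteq> 0"
  have cont: "continuous_on LB f" using A2_cont[OF f] .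
  have int: "integrable lborel (\<lambda>u. indicator LB u *\<^sub>R (cmod (f u))\<^sup>2)"
    using f by (simp add: bergman_space_def set_integrable_def)
  have "complex_of_real (LINT u|lborel. indicator LB u *\<^sub>R (cmod (f u))\<^sup>2) = lint (\<lambda>u. f u * cnj (f u))"
    unfolding set_lebesgue_integral_def integral_complex_of_real[symmetric]
    by (simp add: cmod_square scaleR_conv_of_real)
  then have "(LINT u|lborel. indicator LB u *\<^sub>R (cmod (f u))\<^sup>2) = 0" using z by (metis of_real_eq_0_iff)
  then have "AE u in lborel. indicator LB u *\<^sub>R (cmod (f u))\<^sup>2 = 0"
    using integral_nonneg_eq_0_iff_AE[OF int] by auto
  then have ae: "AE u in lborel. u \<notin> {u \<in> LB. f u \<noteq> 0}" by (auto elim!: eventually_mono)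
  have "open (LB \<inter> f -` (- {0}))"
    using continuous_open_preimage[OF cont open_lie_ball] by auto
  then have op: "open {u \<in> LB. f u \<noteq> 0}" by (simp add: Int_def vimage_def)
  then have "{u \<in> LB. f u \<noteq> 0} \<in> null_sets lborel"
    using ae AE_iff_null_sets[of "{u \<in> LB. f u \<noteq> 0}" lborel] by simp
  then have "{u \<in> LB. f u \<noteq> 0} \<in> null_sets lebesgue" by (rule null_sets_completionI)
  then have "negligible {u \<in> LB. f u \<noteq> 0}" by (simp add: negligible_iff_null_sets)
  then show False using open_not_negligible[OF op] u nz by auto
qed

lemma measure_lie_ball_pos: "measure lborel (LB :: (complex^'n) set) > 0"
proof -
  have "LB \<notin> null_sets (lborel :: (complex^'n) measure)"
    using open_not_negligible[OF open_lie_ball] zero_in_lie_ball null_sets_completionI[of LB lborel]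
      negligible_iff_null_sets by blast
  then have "emeasure lborel (LB :: (complex^'n) set) \<noteq> 0" by (auto simp: null_sets_def)
  then show ?thesis using emeasure_lie_ball_finite
    by (simp add: measure_def enn2real_positive_iff less_top zero_less_iff_neq_zero)
qed

text \<open>A holomorphic automorphism of the Lie ball with its \<open>n\<close>-th root of the Jacobian.\<close>

definition conf_auto :: "(complex^'n \<Rightarrow> complex^'n) \<Rightarrow> (complex^'n \<Rightarrow> complex) \<Rightarrow> bool" where
  "conf_auto \<phi> \<mu> \<longleftrightarrow> inj_on \<phi> LB \<and> \<phi> ` LB = LB \<and> holomorphic_vec_on \<mu> LB \<and>
     (\<forall>z\<in>LB. \<exists>\<phi>'. (\<phi> has_derivative \<phi>') (at z) \<and> (\<forall>c v. \<phi>' (c *s v) = c *s \<phi>' v)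
        \<and> (\<forall>u v. cdot (\<phi>' u) (\<phi>' v) = (\<mu> z)\<^sup>2 * cdot u v))"

text \<open>The unitary operator on the Bergman space induced by an automorphism; the power restores
  the Jacobian from its root \<open>\<mu>\<close>.\<close>

abbreviation transport :: "(complex^'n \<Rightarrow> complex^'n) \<Rightarrow> (complex^'n \<Rightarrow> complex) \<Rightarrow> (complex^'n \<Rightarrow> complex)
    \<Rightarrow> complex^'n \<Rightarrow> complex" where
  "transport \<phi> \<mu> f \<equiv> \<lambda>u. f (\<phi> u) * \<mu> u ^ CARD('n)"

lemma conf_auto_cov:
  fixes \<phi> :: "complex^'n \<Rightarrow> complex^'n"
  assumes a: "conf_auto \<phi> \<mu>" and "continuous_on LB F"
  shows "set_integrable lborel LB (\<lambda>z. (cmod (\<mu> z) ^ (2 * CARD('n))) *\<^sub>R F (\<phi> z)) \<longleftrightarrow> set_integrable lborel LB F"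
    "lint (\<lambda>z. (cmod (\<mu> z) ^ (2 * CARD('n))) *\<^sub>R F (\<phi> z)) = lint F"
proof -
  from a obtain \<phi>' where d: "\<And>z. z \<in> LB \<Longrightarrow> (\<phi> has_derivative \<phi>' z) (at z)"
    "\<And>z u v. z \<in> LB \<Longrightarrow> cdot (\<phi>' z u) (\<phi>' z v) = (\<mu> z)\<^sup>2 * cdot u v"
    unfolding conf_auto_def by metis
  have p: "inj_on \<phi> LB" "\<phi> ` LB = LB" "continuous_on LB \<mu>"
    using a by (auto simp: conf_auto_def intro: holomorphic_vec_on_cont)
  show "set_integrable lborel LB (\<lambda>z. (cmod (\<mu> z) ^ (2 * CARD('n))) *\<^sub>R F (\<phi> z)) \<longleftrightarrow> set_integrable lborel LB F"
    "lint (\<lambda>z. (cmod (\<mu> z) ^ (2 * CARD('n))) *\<^sub>R F (\<phi> z)) = lint F"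
    using change_of_variables_conformal[OF open_lie_ball p(1,2) d p(3) assms(2)] by blast+
qed

lemma A2_transport:
  fixes \<phi> :: "complex^'n \<Rightarrow> complex^'n"
  assumes a: "conf_auto \<phi> \<mu>" and f: "f \<in> A2"
  shows "transport \<phi> \<mu> f \<in> A2"
  unfolding A2_iff
proof
  have "holomorphic_vec_on (\<lambda>u. f (\<phi> u)) LB"
    unfolding holomorphic_vec_on_def
  proof
    fix z :: "complex^'n" assume z: "z \<in> LB"
    obtain \<phi>' where p: "(\<phi> has_derivative \<phi>') (at z)" "\<And>c v. \<phi>' (c *s v) = c *s \<phi>' v"
      using a z unfolding conf_auto_def by metis
    have "\<phi> z \<in> LB" using a z by (auto simp: conf_auto_def)
    then obtain f' where f': "(f has_derivative f') (at (\<phi> z))" "\<And>c v. f' (c *s v) = c * f' v"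
      using f unfolding bergman_space_def holomorphic_vec_on_def by blast
    show "\<exists>d. ((\<lambda>u. f (\<phi> u)) has_derivative d) (at z) \<and> (\<forall>c v. d (c *s v) = c * d v)"
      using has_derivative_compose[OF p(1) f'(1)] p(2) f'(2) by (intro exI conjI) auto
  qed
  then show "holomorphic_vec_on (transport \<phi> \<mu> f) LB"
    using a by (auto simp: conf_auto_def intro!: holomorphic_vec_on_mult holomorphic_vec_on_power)
  have c: "continuous_on LB (\<lambda>u. complex_of_real ((cmod (f u))\<^sup>2))"
    by (intro continuous_intros A2_cont f)
  have "complex_of_real ((cmod (f (\<phi> u) * \<mu> u ^ CARD('n)))\<^sup>2)
     = (cmod (\<mu> u) ^ (2 * CARD('n))) *\<^sub>R complex_of_real ((cmod (f (\<phi> u)))\<^sup>2)" for u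
    by (simp add: norm_mult norm_power power_mult_distrib power_mult[symmetric] mult.commute scaleR_conv_of_real)
  then show "set_integrable lborel LB (\<lambda>u. complex_of_real ((cmod (f (\<phi> u) * \<mu> u ^ CARD('n)))\<^sup>2))"
    using conf_auto_cov(1)[OF a c] f by (simp add: A2_iff)
qed

lemma lint_transport:
  fixes \<phi> :: "complex^'n \<Rightarrow> complex^'n"
  assumes a: "conf_auto \<phi> \<mu>" and f: "f \<in> A2" "g \<in> A2"
  shows "lint (\<lambda>u. transport \<phi> \<mu> f u * cnj (transport \<phi> \<mu> g u)) = lint (\<lambda>u. f u * cnj (g u))"
proof -
  have c: "continuous_on LB (\<lambda>u. f u * cnj (g u))" by (intro continuous_intros A2_cont f)
  have "transport \<phi> \<mu> f u * cnj (transport \<phi> \<mu> g u)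
      = (cmod (\<mu> u) ^ (2 * CARD('n))) *\<^sub>R (f (\<phi> u) * cnj (g (\<phi> u)))" for u
  proof -
    have "complex_of_real (cmod (\<mu> u) ^ (2 * CARD('n))) = (\<mu> u * cnj (\<mu> u)) ^ CARD('n)"
      unfolding cmod_square[symmetric] by (simp add: power_mult)
    then show ?thesis by (simp add: scaleR_conv_of_real power_mult_distrib)
  qed
  then show ?thesis using conf_auto_cov(2)[OF a c] by simp
qed

section \<open>The mean value property at the origin\<close>

lemma circle_mean:
  assumes f: "holomorphic_vec_on f LB" and u: "u \<in> LB"
  shows "((\<lambda>t. f (exp (2 * of_real pi * \<i> * of_real t) *s u)) has_integral f 0) {0..1}"
proof -
  define g where "g \<zeta> = f (\<zeta> *s u)" for \<zeta>
  have "g field_differentiable at \<zeta>" if "\<zeta> \<in> cball 0 1" for \<zeta>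
  proof -
    have "\<zeta> *s u \<in> LB" using smult_lie_ball[OF u] that by simp
    then obtain f' where f': "(f has_derivative f') (at (\<zeta> *s u))" "\<And>c v. f' (c *s v) = c * f' v"
      using f unfolding holomorphic_vec_on_def by blast
    have "((\<lambda>\<zeta>. \<zeta> *s u) has_derivative (\<lambda>c. c *s u)) (at \<zeta>)"
      by (rule has_derivative_eq_rhs[OF has_derivative_smult[OF has_derivative_ident has_derivative_const]]) simp
    from has_derivative_compose[OF this f'(1)] have "(g has_field_derivative f' u) (at \<zeta>)"
      unfolding g_def has_field_derivative_def f'(2) by (simp add: mult.commute[of _ "f' u"])
    then show ?thesis using field_differentiable_def by blast
  qed
  then have "g holomorphic_on cball 0 1"
    by (simp add: holomorphic_on_def field_differentiable_at_within)
  then have "((\<lambda>w. g w / (w - 0)) has_contour_integral (2 * of_real pi * \<i> * g 0)) (circlepath 0 1)"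
    by (intro Cauchy_integral_circlepath_simple) auto
  then have "((\<lambda>t. g (circlepath 0 1 t) / circlepath 0 1 t * vector_derivative (circlepath 0 1) (at t within {0..1}))
      has_integral (2 * of_real pi * \<i> * g 0)) {0..1}"
    by (simp add: has_contour_integral_def)
  then have "((\<lambda>t. (2 * of_real pi * \<i>) * g (exp (2 * of_real pi * \<i> * of_real t)))
      has_integral (2 * of_real pi * \<i> * g 0)) {0..1}"
  proof (rule has_integral_eq[rotated])
    fix t :: real assume "t \<in> {0..1}"
    then have vd: "vector_derivative (circlepath 0 1) (at t within {0..1}) = 2 * of_real pi * \<i> * exp (2 * of_real pi * \<i> * of_real t)"
      using vector_derivative_circlepath01[of t 0 1] by simp
    show "g (circlepath 0 1 t) / circlepath 0 1 t * vector_derivative (circlepath 0 1) (at t within {0..1})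
        = (2 * of_real pi * \<i>) * g (exp (2 * of_real pi * \<i> * of_real t))"
      unfolding vd by (simp add: circlepath)
  qed
  then have "((\<lambda>t. inverse (2 * of_real pi * \<i>) * ((2 * of_real pi * \<i>) * g (exp (2 * of_real pi * \<i> * of_real t))))
      has_integral (inverse (2 * of_real pi * \<i>) * (2 * of_real pi * \<i> * g 0))) {0..1}"
    by (rule has_integral_mult_right)
  moreover have L: "K \<noteq> 0 \<Longrightarrow> inverse K * (K * X) = X" for K X :: complex by simp
  have "2 * of_real pi * \<i> \<noteq> 0" by simp
  note L[OF this]
  ultimately show ?thesis by (simp only: g_def vector_smult_lzero)
qed

lemma conf_auto_rotation:
  assumes "cmod c = 1"
  shows "conf_auto (\<lambda>z. c *s z) (\<lambda>_. c)"
  unfolding conf_auto_def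
proof (intro conjI ballI)
  have c: "c \<noteq> 0" using assms by auto
  show "inj_on ((*s) c) LB" using c by (auto simp: inj_on_def vec_eq_iff)
  have "z \<in> (*s) c ` LB" if "z \<in> LB" for z
  proof
    show "z = c *s (inverse c *s z)" using c by (simp add: vector_smult_assoc)
    show "inverse c *s z \<in> LB" using assms by (intro smult_lie_ball that) (simp add: norm_inverse)
  qed
  moreover have "c *s z \<in> LB" if "z \<in> LB" for z using assms by (intro smult_lie_ball that) simp
  ultimately show "(*s) c ` LB = LB" by auto
  show "holomorphic_vec_on (\<lambda>_. c) LB" by (rule holomorphic_vec_on_const)
  fix z
  have d: "((*s) c has_derivative (*s) c) (at z)"
    by (rule has_derivative_eq_rhs[OF has_derivative_smult[OF has_derivative_const has_derivative_ident]]) simp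
  show "\<exists>\<phi>'. ((*s) c has_derivative \<phi>') (at z) \<and> (\<forall>d v. \<phi>' (d *s v) = d *s \<phi>' v) \<and>
      (\<forall>u v. cdot (\<phi>' u) (\<phi>' v) = c\<^sup>2 * cdot u v)"
    using d
    by (intro exI[of _ "(*s) c"]) (auto simp: cdot_simps power2_eq_square vector_smult_assoc mult.commute)
qed

text \<open>Rotating \<open>f\<close> does not change its integral, and the average of
  \<open>f\<close> over each circle about 0 is \<open>f 0\<close> by Cauchy's formula. Fubini
  exchanges the two integrations.\<close>

lemma lint_mean:
  fixes f :: "complex^'n \<Rightarrow> complex"
  assumes f: "f \<in> A2"
  shows "lint f = measure lborel (LB :: (complex^'n) set) * f 0"
proof -
  let ?e = "\<lambda>t::real. exp (2 * of_real pi * \<i> * of_real t)"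
  have e1: "cmod (?e t) = 1" for t by simp
  have hol: "holomorphic_vec_on f LB" using f by (simp add: bergman_space_def)
  have cf: "continuous_on LB f" using A2_cont[OF f] .
  define h where "h = (\<lambda>(t::real, u). indicator ({0..1} \<times> LB) (t, u) *\<^sub>R f (?e t *s u))"
  have eLB: "?e t *s u \<in> LB" if "u \<in> LB" for t and u :: "complex^'n"
    using smult_lie_ball[OF that, of "?e t"] by simp
  have "continuous_on ({0..1} \<times> LB) (\<lambda>p. f (?e (fst p) *s snd p))"
    by (rule continuous_on_compose2[OF cf]) (auto intro!: continuous_intros eLB)
  then have "(\<lambda>p. indicator ({0..1} \<times> LB) p *\<^sub>R f (?e (fst p) *s snd p)) \<in> borel_measurable borel"
    by (intro borel_measurable_continuous_on_indicator borel_Times) auto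
  then have mh: "h \<in> borel_measurable (lborel \<Otimes>\<^sub>M lborel)"
    by (simp add: h_def split_def lborel_prod)
  have inner1: "integrable lborel (\<lambda>u. h (t, u))" "(\<integral>u. h (t, u) \<partial>lborel) = indicator {0..1} t *\<^sub>R lint f"
    "(\<integral>u. norm (h (t, u)) \<partial>lborel) = indicator {0..1} t *\<^sub>R (\<integral>u. indicator LB u *\<^sub>R norm (f u) \<partial>lborel)" for t
  proof -
    have eq: "h (t, u) = indicator {0..1} t *\<^sub>R (indicator LB u *\<^sub>R f (?e t *s u))" for u
      by (auto simp: h_def indicator_def)
    have s: "set_integrable lborel LB (\<lambda>u. f (?e t *s u))" "lint (\<lambda>u. f (?e t *s u)) = lint f"
      using conf_auto_cov[OF conf_auto_rotation[OF e1] cf, of t] A2_integrable[OF f] by simp_all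
    then show "integrable lborel (\<lambda>u. h (t, u))"
      unfolding eq set_integrable_def by (intro integrable_scaleR_right)
    show "(\<integral>u. h (t, u) \<partial>lborel) = indicator {0..1} t *\<^sub>R lint f"
      unfolding eq integral_scaleR_right using s(2) by (simp only: set_lebesgue_integral_def)
    have cn: "continuous_on LB (\<lambda>u. complex_of_real (norm (f u)))" by (intro continuous_intros cf)
    have "lint (\<lambda>u. complex_of_real (norm (f (?e t *s u)))) = lint (\<lambda>u. complex_of_real (norm (f u)))"
      using conf_auto_cov(2)[OF conf_auto_rotation[OF e1] cn, of t] by simp
    then have "(\<integral>u. indicator LB u *\<^sub>R norm (f (?e t *s u)) \<partial>lborel) = (\<integral>u. indicator LB u *\<^sub>R norm (f u) \<partial>lborel)"
      unfolding set_integral_complex_of_real of_real_eq_iff set_lebesgue_integral_def .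
    then show "(\<integral>u. norm (h (t, u)) \<partial>lborel) = indicator {0..1} t *\<^sub>R (\<integral>u. indicator LB u *\<^sub>R norm (f u) \<partial>lborel)"
      unfolding eq by (cases "t \<in> {0..1}") (auto simp: indicator_def)
  qed
  have int: "integrable (lborel \<Otimes>\<^sub>M lborel) h"
  proof (rule lborel_pair.Fubini_integrable[OF mh])
    show "integrable lborel (\<lambda>t. \<integral>u. norm (h (t, u)) \<partial>lborel)"
      unfolding inner1 by (intro integrable_scaleR_left) simp
    show "AE t in lborel. integrable lborel (\<lambda>u. h (t, u))" using inner1(1) by simp
  qed
  have "(\<integral>u. (\<integral>t. h (t, u) \<partial>lborel) \<partial>lborel) = (\<integral>t. (\<integral>u. h (t, u) \<partial>lborel) \<partial>lborel)"
    using lborel_pair.Fubini_integral[of "\<lambda>t u. h (t, u)"] int by simp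
  also have "\<dots> = lint f" unfolding inner1 by simp
  also have "(\<integral>u. (\<integral>t. h (t, u) \<partial>lborel) \<partial>lborel) = (\<integral>u. indicator LB (u :: complex^'n) *\<^sub>R f 0 \<partial>lborel)"
  proof (rule Bochner_Integration.integral_cong[OF refl])
    fix u :: "complex^'n"
    show "(\<integral>t. h (t, u) \<partial>lborel) = indicator LB u *\<^sub>R f 0"
    proof (cases "u \<in> LB")
      case True
      have "continuous_on {0..1} (\<lambda>t. f (?e t *s u))"
        by (rule continuous_on_compose2[OF cf]) (auto intro!: continuous_intros eLB True)
      then have "set_integrable lborel {0..1} (\<lambda>t. f (?e t *s u))" by (rule borel_integrable_atLeastAtMost')
      then have "set_lebesgue_integral lborel {0..1} (\<lambda>t. f (?e t *s u)) = integral {0..1} (\<lambda>t. f (?e t *s u))"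
        by (rule set_borel_integral_eq_integral(2))
      also have "\<dots> = f 0" using circle_mean[OF hol True] by (rule integral_unique)
      finally show ?thesis using True
        by (simp add: h_def set_lebesgue_integral_def indicator_times)
    next
      case False
      then show ?thesis by (simp add: h_def indicator_times)
    qed
  qed
  also have "\<dots> = measure lborel (LB :: (complex^'n) set) * f 0"
    using emeasure_lie_ball_finite by (simp add: scaleR_conv_of_real)
  finally show ?thesis by simp
qed

section \<open>Transport of the reproducing kernel\<close>

lemma conf_auto_mob:
  fixes a :: "real^'n"
  assumes a: "norm a < 1"
  shows "conf_auto (mob a) (\<lambda>z. of_real (1 - a \<bullet> a) / mob_den a z)"
  unfolding conf_auto_def
proof (intro conjI ballI)
  show "inj_on (mob a) LB"
    by (rule inj_on_inverseI[where g = "mob (- a)"]) (rule mob_inverse_lie_ball(1)[OF a])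
  have "z \<in> mob a ` LB" if "z \<in> LB" for z
    using mob_inverse_lie_ball(2)[OF a that] mob_lie_ball[of "- a" z] a that
    by (metis imageI norm_minus_cancel)
  then show "mob a ` LB = LB" using mob_lie_ball[OF a] by auto
  show "holomorphic_vec_on (\<lambda>z. of_real (1 - a \<bullet> a) / mob_den a z) LB"
    unfolding holomorphic_vec_on_def
  proof
    fix z :: "complex^'n" assume z: "z \<in> LB"
    note h = mob_den_nz[OF a z]
    have 1: "(mob_den a has_derivative mob_den' a z) (at z)"
      unfolding mob_den_def[abs_def] mob_den'_def[abs_def]
      by (auto intro!: derivative_eq_intros simp: cdot_commute[of _ z])
    have "((\<lambda>z. of_real (1 - a \<bullet> a) * inverse (mob_den a z)) has_derivative
        (\<lambda>v. of_real (1 - a \<bullet> a) * - (inverse (mob_den a z) * mob_den' a z v * inverse (mob_den a z)))) (at z)"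
      by (intro has_derivative_mult_right Deriv.has_derivative_inverse[OF h 1])
    then show "\<exists>d. ((\<lambda>z. of_real (1 - a \<bullet> a) / mob_den a z) has_derivative d) (at z) \<and> (\<forall>c v. d (c *s v) = c * d v)"
      unfolding divide_inverse by (intro exI conjI) (auto simp: mob_den'_def cdot_simps algebra_simps)
  qed
  fix z :: "complex^'n" assume z: "z \<in> LB"
  note h = mob_den_nz[OF a z]
  show "\<exists>\<phi>'. (mob a has_derivative \<phi>') (at z) \<and> (\<forall>c v. \<phi>' (c *s v) = c *s \<phi>' v) \<and>
      (\<forall>u v. cdot (\<phi>' u) (\<phi>' v) = (of_real (1 - a \<bullet> a) / mob_den a z)\<^sup>2 * cdot u v)"
    using has_derivative_mob[OF h] mob'_smult cdot_mob'[OF h] by blast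
qed

text \<open>\<open>w\<close> is the point of evaluation and \<open>u\<close> the holomorphic
  variable, so \<open>bergman_kernel\<close> takes these two in the opposite order. The constant is
  forced by the case \<open>w = 0\<close>, where \<open>hb\<close> is 1.\<close>

definition lie_kernel :: "complex^'n \<Rightarrow> complex^'n \<Rightarrow> complex" where
  "lie_kernel w u = (if u \<in> LB then inverse (of_real (measure lborel (LB :: (complex^'n) set)))
      / hb u (cnjv w) ^ CARD('n) else 0)"

definition reproducing :: "complex^'n \<Rightarrow> (complex^'n \<Rightarrow> complex) \<Rightarrow> bool" where
  "reproducing w k \<longleftrightarrow> k \<in> A2 \<and> (\<forall>f\<in>A2. f w = lint (\<lambda>u. f u * cnj (k u)))"

lemma A2_cong: "(\<And>u. u \<in> LB \<Longrightarrow> f u = g u) \<Longrightarrow> f \<in> A2 \<Longrightarrow> g \<in> A2"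
  unfolding A2_iff using holomorphic_vec_on_cong[OF open_lie_ball, of f g]
  by (auto cong: set_integrable_cong)

lemma lint_cong: "(\<And>u. u \<in> LB \<Longrightarrow> f u = g u) \<Longrightarrow> lint f = lint g"
  by (rule set_lebesgue_integral_cong) auto

text \<open>\<open>f\<close> is moved by the inverse automorphism, evaluated at
  \<open>\<phi> w\<close> through \<open>k\<close>, and moved back; unitarity keeps the inner
  product. The factor in \<open>k'\<close> is the transformation rule of Bergman kernels,
  holomorphic in \<open>u\<close> and conjugated in \<open>w\<close>.\<close>

lemma reproducing_transport:
  fixes \<phi> :: "complex^'n \<Rightarrow> complex^'n"
  assumes a: "conf_auto \<phi> \<mu>" and b: "conf_auto \<psi> \<nu>"
    and inv: "\<And>u. u \<in> LB \<Longrightarrow> \<psi> (\<phi> u) = u" "\<And>u. u \<in> LB \<Longrightarrow> \<nu> (\<phi> u) * \<mu> u = 1"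
    and r: "reproducing (\<phi> w) k" and w: "w \<in> LB"
    and k': "\<And>u. u \<in> LB \<Longrightarrow> k' u = k (\<phi> u) * (\<mu> u * cnj (\<mu> w)) ^ CARD('n)"
  shows "reproducing w k'"
  unfolding reproducing_def
proof (intro conjI ballI)
  have k: "k \<in> A2" using r by (simp add: reproducing_def)
  let ?C = "cnj (\<mu> w) ^ CARD('n)"
  have k'eq: "k' u = transport \<phi> \<mu> k u * ?C" if "u \<in> LB" for u
    using k'[OF that] by (simp add: power_mult_distrib)
  have t: "transport \<phi> \<mu> k \<in> A2" by (rule A2_transport[OF a k])
  have "(\<lambda>u. transport \<phi> \<mu> k u * ?C) \<in> A2"
    unfolding A2_iff
  proof
    show "holomorphic_vec_on (\<lambda>u. transport \<phi> \<mu> k u * ?C) LB"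
      using t by (intro holomorphic_vec_on_mult[OF _ holomorphic_vec_on_const]) (simp add: A2_iff)
    have "set_integrable lborel LB (\<lambda>u. complex_of_real ((cmod (transport \<phi> \<mu> k u))\<^sup>2) * of_real ((cmod ?C)\<^sup>2))"
      using t by (intro set_integrable_mult_left) (simp add: A2_iff)
    then show "set_integrable lborel LB (\<lambda>u. complex_of_real ((cmod (transport \<phi> \<mu> k u * ?C))\<^sup>2))"
      by (simp add: norm_mult power_mult_distrib)
  qed
  then show "k' \<in> A2" by (rule A2_cong[rotated]) (simp add: k'eq)
  fix f :: "complex^'n \<Rightarrow> complex" assume f: "f \<in> A2"
  let ?g = "transport \<psi> \<nu> f"
  have g: "?g \<in> A2" by (rule A2_transport[OF b f])
  have fg: "transport \<phi> \<mu> ?g u = f u" if "u \<in> LB" for u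
    using inv(1)[OF that] inv(2)[OF that] by (simp add: mult.assoc power_mult_distrib[symmetric])
  have "f w = ?g (\<phi> w) * \<mu> w ^ CARD('n)" using fg[OF w] by simp
  also have "?g (\<phi> w) = lint (\<lambda>u. ?g u * cnj (k u))" using r g by (simp add: reproducing_def)
  also have "\<dots> = lint (\<lambda>u. transport \<phi> \<mu> ?g u * cnj (transport \<phi> \<mu> k u))"
    by (rule lint_transport[OF a g k, symmetric])
  also have "\<dots> = lint (\<lambda>u. f u * cnj (transport \<phi> \<mu> k u))"
    by (rule lint_cong) (simp only: fg)
  also have "\<dots> * \<mu> w ^ CARD('n) = lint (\<lambda>u. f u * cnj (transport \<phi> \<mu> k u) * \<mu> w ^ CARD('n))"
    by (rule set_integral_mult_left[symmetric])
  also have "\<dots> = lint (\<lambda>u. f u * cnj (k' u))"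
    by (rule lint_cong) (simp add: k'eq)
  finally show "f w = lint (\<lambda>u. f u * cnj (k' u))" .
qed

lemma reproducing_zero: "reproducing 0 (lie_kernel 0)"
  unfolding reproducing_def
proof (intro conjI ballI)
  let ?m = "measure lborel (LB :: (complex^'a) set)"
  have k: "lie_kernel 0 u = inverse (of_real ?m)" if "u \<in> LB" for u :: "complex^'a"
    using that by (simp add: lie_kernel_def hb_def)
  show "lie_kernel 0 \<in> (A2 :: (complex^'a \<Rightarrow> complex) set)"
    by (rule A2_cong[OF _ A2_const[of "inverse (of_real ?m)"]]) (simp add: k)
  fix f :: "complex^'a \<Rightarrow> complex" assume f: "f \<in> A2"
  have "lint (\<lambda>u. f u * cnj (lie_kernel 0 u)) = lint (\<lambda>u. f u * inverse (of_real ?m))"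
    by (rule lint_cong) (simp add: k)
  also have "\<dots> = lint f * inverse (of_real ?m)" by (rule set_integral_mult_left)
  also have "\<dots> = f 0" using lint_mean[OF f] measure_lie_ball_pos[where 'n = 'a] by simp
  finally show "f 0 = lint (\<lambda>u. f u * cnj (lie_kernel 0 u))" by simp
qed

lemma reproducing_mob:
  fixes a :: "real^'n"
  assumes a: "norm a < 1" and w: "w \<in> LB" and r: "reproducing (mob a w) (lie_kernel (mob a w))"
  shows "reproducing w (lie_kernel w)"
proof (rule reproducing_transport[OF conf_auto_mob[OF a] conf_auto_mob[of "- a"] _ _ r w])
  have c: "a \<bullet> a \<noteq> 1" using ball_inner(2)[OF a] by auto
  then have c': "1 - complex_of_real (a \<bullet> a) \<noteq> 0" by (metis eq_iff_diff_eq_0 of_real_eq_1_iff)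
  show "norm (- a) < 1" using a by simp
  fix u :: "complex^'n" assume u: "u \<in> LB"
  note h = mob_den_nz[OF a u] mob_den_nz[OF a w]
  show "mob (- a) (mob a u) = u" using mob_inverse_lie_ball(1)[OF a u] .
  show "of_real (1 - - a \<bullet> - a) / mob_den (- a) (mob a u) * (of_real (1 - a \<bullet> a) / mob_den a u) = 1"
    unfolding mob_den_lift[OF h(1)] using h c' by (simp add: power2_eq_square)
  define J where "J = of_real (1 - a \<bullet> a) / mob_den a u * cnj (of_real (1 - a \<bullet> a) / mob_den a w)"
  have "hb (mob a u) (cnjv (mob a w)) = hb u (cnjv w) * ((of_real (1 - a \<bullet> a) / mob_den a u) * cnj (of_real (1 - a \<bullet> a) / mob_den a w))"
    using hb_mob[OF h(1), of "cnjv w"] h by (simp add: mob_cnjv power2_eq_square)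
  then have hbJ: "hb (mob a u) (cnjv (mob a w)) = hb u (cnjv w) * J" by (simp only: J_def)
  have "J \<noteq> 0" using h c' by (simp add: J_def)
  then show "lie_kernel w u = lie_kernel (mob a w) (mob a u) *
      (of_real (1 - a \<bullet> a) / mob_den a u * cnj (of_real (1 - a \<bullet> a) / mob_den a w)) ^ CARD('n)"
    unfolding lie_kernel_def hbJ J_def[symmetric] using u mob_lie_ball[OF a u] by (simp add: power_mult_distrib)
qed

lemma reproducing_i:
  fixes w :: "complex^'n"
  assumes w: "w \<in> LB" and r: "reproducing (\<i> *s w) (lie_kernel (\<i> *s w))"
  shows "reproducing w (lie_kernel w)"
proof (rule reproducing_transport[OF conf_auto_rotation[of \<i>] conf_auto_rotation[of "- \<i>"] _ _ r w])
  fix u :: "complex^'n" assume u: "u \<in> LB"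
  show "(- \<i>) *s (\<i> *s u) = u" by (simp add: vector_smult_assoc)
  have "\<i> *s u \<in> LB" using smult_lie_ball[OF u, of \<i>] by simp
  then show "lie_kernel w u = lie_kernel (\<i> *s w) (\<i> *s u) * (\<i> * cnj \<i>) ^ CARD('n)"
    using u by (simp add: lie_kernel_def hb_def cdot_simps)
qed auto

text \<open>The orbit of 0 under the maps \<open>mob a\<close> is the real ball only. Multiplication
  by \<open>\<i>\<close> carries it to the imaginary vectors, and from there the Moebius maps reach
  every point.\<close>

lemma reproducing_lie_kernel:
  assumes w: "w \<in> LB"
  shows "reproducing w (lie_kernel w)"
proof -
  obtain x y where xy: "norm x < 1" "norm y < 1" "w = mob (- x) (\<i> *s ofr y)"
    using lie_ball_mob_imag[OF w] .
  have y: "norm (- y) < 1" using xy by simp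
  have "reproducing (mob (- y) (ofr (- y))) (lie_kernel (mob (- y) (ofr (- y))))"
    unfolding mob_self by (rule reproducing_zero)
  then have "reproducing (ofr (- y)) (lie_kernel (ofr (- y)))"
    by (rule reproducing_mob[OF y ofr_lie_ball[OF y]])
  moreover have "ofr (- y) = \<i> *s (\<i> *s ofr y)" by (simp add: vector_smult_assoc ofr_simps)
  ultimately have "reproducing (\<i> *s ofr y) (lie_kernel (\<i> *s ofr y))"
    using reproducing_i[OF imag_lie_ball[OF xy(2)]] by simp
  moreover have "mob x w = \<i> *s ofr y"
    unfolding xy(3) by (rule mob_inverse_lie_ball(2)[OF xy(1) imag_lie_ball[OF xy(2)]])
  ultimately show ?thesis
    using reproducing_mob[OF xy(1) w] by simp
qed

text \<open>The difference of two reproducing functions is orthogonal to itself, as pairing it with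
  either one gives its value at \<open>w\<close>. The value 0 outside the domain makes them equal as
  total functions.\<close>

lemma bergman_kernel_lie_ball:
  assumes w: "w \<in> LB"
  shows "bergman_kernel LB z w = lie_kernel w z"
proof -
  note r = reproducing_lie_kernel[OF w]
  have "(THE k. k \<in> A2 \<and> (\<forall>u. u \<notin> LB \<longrightarrow> k u = 0) \<and> (\<forall>f\<in>A2. f w = lint (\<lambda>u. f u * cnj (k u)))) = lie_kernel w"
  proof (rule the_equality)
    show "lie_kernel w \<in> A2 \<and> (\<forall>u. u \<notin> LB \<longrightarrow> lie_kernel w u = 0) \<and>
        (\<forall>f\<in>A2. f w = lint (\<lambda>u. f u * cnj (lie_kernel w u)))"
      using r by (simp add: reproducing_def lie_kernel_def)
  next
    fix k assume k: "k \<in> A2 \<and> (\<forall>u. u \<notin> LB \<longrightarrow> k u = 0) \<and> (\<forall>f\<in>A2. f w = lint (\<lambda>u. f u * cnj (k u)))"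
    let ?d = "\<lambda>u. k u - lie_kernel w u"
    have lk: "lie_kernel w \<in> A2" using r by (simp add: reproducing_def)
    have d: "?d \<in> A2" using k lk by (intro A2_diff) auto
    have "lint (\<lambda>u. ?d u * cnj (?d u)) = lint (\<lambda>u. ?d u * cnj (k u)) - lint (\<lambda>u. ?d u * cnj (lie_kernel w u))"
      using k lk d by (subst set_integral_diff(2)[symmetric]) (auto intro: A2_mult_integrable simp: right_diff_distrib)
    also have "lint (\<lambda>u. ?d u * cnj (k u)) = ?d w" using k d by metis
    also have "lint (\<lambda>u. ?d u * cnj (lie_kernel w u)) = ?d w" using r d unfolding reproducing_def by metis
    finally have "lint (\<lambda>u. ?d u * cnj (?d u)) = 0" by simp
    then have "?d u = 0" if "u \<in> LB" for u using A2_zero[OF d _ that] by simp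
    then show "k = lie_kernel w"
      using k by (auto simp: fun_eq_iff lie_kernel_def)
  qed
  then show ?thesis by (simp add: bergman_kernel_def)
qed

lemma bergman_kernel_diag:
  fixes z :: "complex^'n"
  assumes "z \<in> LB"
  shows "bergman_kernel LB z z = of_real (inverse (measure lborel (LB :: (complex^'n) set)) / rho z ^ CARD('n))"
  using assms by (simp add: bergman_kernel_lie_ball lie_kernel_def hb_rho)

section \<open>The Bergman metric of the Lie ball\<close>

text \<open>Already the normalized metric: the Bergman metric is \<open>2 * CARD('n)\<close> times
  this, and on real vectors it is the Poincare metric.\<close>

definition lieG :: "(complex^'n) metric_field" where
  "lieG z u v = Re (hbg z (cnjv z) u (cnjv v))"

lemma hb1_linear: "hb1 z w (u + u') = hb1 z w u + hb1 z w u'" "hb1 z w (c *s u) = c * hb1 z w u"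
  "hb12 z w (u + u') v = hb12 z w u v + hb12 z w u' v" "hb12 z w (c *s u) v = c * hb12 z w u v"
  "hb12 z w u (v + v') = hb12 z w u v + hb12 z w u v'" "hb12 z w u (c *s v) = c * hb12 z w u v"
  by (simp_all add: hb1_def hb12_def cdot_simps algebra_simps)

lemma hbg_linear: "hbg z w (u + u') v = hbg z w u v + hbg z w u' v" "hbg z w (c *s u) v = c * hbg z w u v"
  "hbg z w u (v + v') = hbg z w u v + hbg z w u v'" "hbg z w u (c *s v) = c * hbg z w u v"
  by (simp_all add: hbg_def hb1_linear add_divide_distrib[symmetric] diff_divide_distrib[symmetric])
    (simp_all add: algebra_simps)

lemma hbg_sum: "hbg z w (\<Sum>i\<in>I. c i *s f i) v = (\<Sum>i\<in>I. c i * hbg z w (f i) v)"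
  "hbg z w v (\<Sum>i\<in>I. c i *s f i) = (\<Sum>i\<in>I. c i * hbg z w v (f i))"
proof -
  have 0: "hbg z w 0 v = 0" "hbg z w v 0 = 0"
    using hbg_linear(2)[of z w 0 0 v] hbg_linear(4)[of z w v 0 0] by simp_all
  show "hbg z w (\<Sum>i\<in>I. c i *s f i) v = (\<Sum>i\<in>I. c i * hbg z w (f i) v)"
    by (induction I rule: infinite_finite_induct) (simp_all add: hbg_linear 0)
  show "hbg z w v (\<Sum>i\<in>I. c i *s f i) = (\<Sum>i\<in>I. c i * hbg z w v (f i))"
    by (induction I rule: infinite_finite_induct) (simp_all add: hbg_linear 0)
qed

lemma hb_cnjv: "hb (cnjv z) (cnjv w) = cnj (hb z w)" "hb1 (cnjv z) (cnjv w) (cnjv u) = cnj (hb1 z w u)"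
  "hb12 (cnjv z) (cnjv w) (cnjv u) (cnjv v) = cnj (hb12 z w u v)"
  by (simp_all add: hb_def hb1_def hb12_def cdot_cnjv)

lemma hbg_cnjv: "hbg (cnjv z) (cnjv w) (cnjv u) (cnjv v) = cnj (hbg z w u v)"
  by (simp add: hbg_def hb_cnjv)

lemma hbg_commute: "hbg z w u v = hbg w z v u"
proof -
  have "hb12 z w u v = hb12 w z v u" by (simp add: hb12_def cdot_commute[of v u])
  then show ?thesis by (simp add: hbg_def hb_commute[of z w])
qed

lemma has_derivative_hb:
  "((\<lambda>z. hb z (cnjv z)) has_derivative (\<lambda>s. hb1 z (cnjv z) s + hb1 (cnjv z) z (cnjv s))) (at z)"
  unfolding hb_def hb1_def
  by (rule has_derivative_eq_rhs, (rule derivative_intros)+)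
    (simp add: fun_eq_iff cdot_commute algebra_simps)

lemma has_derivative_hb1:
  "((\<lambda>z. hb1 z (cnjv z) u) has_derivative (\<lambda>s. 2 * cdot s u * cdot (cnjv z) (cnjv z) + hb12 z (cnjv z) u (cnjv s))) (at z)"
  unfolding hb1_def hb12_def
  by (rule has_derivative_eq_rhs, (rule derivative_intros)+)
    (simp add: fun_eq_iff cdot_commute algebra_simps)

lemma has_derivative_hb1':
  "((\<lambda>z. hb1 (cnjv z) z v) has_derivative (\<lambda>s. hb12 z (cnjv z) s v + 2 * cdot (cnjv s) v * cdot z z)) (at z)"
  unfolding hb1_def hb12_def
  by (rule has_derivative_eq_rhs, (rule derivative_intros)+)
    (simp add: fun_eq_iff cdot_commute algebra_simps)

lemma has_derivative_hb12:
  "((\<lambda>z. hb12 z (cnjv z) u v) has_derivative (\<lambda>s. 4 * cdot s u * cdot (cnjv z) v + 4 * cdot z u * cdot (cnjv s) v)) (at z)"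
  unfolding hb12_def
  by (rule has_derivative_eq_rhs, (rule derivative_intros)+) (simp add: fun_eq_iff cdot_commute algebra_simps)

lemma rho_pos: "z \<in> LB \<Longrightarrow> rho z > 0"
  by (simp add: lie_ball_iff)

lemma hb_nz: "z \<in> LB \<Longrightarrow> hb z (cnjv z) \<noteq> 0"
  by (simp add: hb_rho lie_ball_iff)

lemma has_derivative_rho: "(rho has_derivative (\<lambda>s. 2 * Re (hb1 z (cnjv z) s))) (at z)"
proof -
  have rho: "rho = (\<lambda>z. Re (hb z (cnjv z)))" by (simp add: hb_rho fun_eq_iff)
  have "hb1 (cnjv z) z (cnjv s) = cnj (hb1 z (cnjv z) s)" for s
    using hb_cnjv(2)[of z "cnjv z" s] by simp
  then have "((\<lambda>z. Re (hb z (cnjv z))) has_derivative (\<lambda>s. 2 * Re (hb1 z (cnjv z) s))) (at z)"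
    using has_derivative_Re[OF has_derivative_hb[of z]] by simp
  then show ?thesis unfolding rho .
qed

lemma wirtinger_bar_log_kernel:
  fixes z :: "complex^'n"
  assumes z: "z \<in> LB"
  shows "wirtinger_bar j (\<lambda>\<zeta>. complex_of_real (ln (Re (bergman_kernel LB \<zeta> \<zeta>)))) z
    = - of_nat CARD('n) * hb1 (cnjv z) z (axis j 1) / hb z (cnjv z)"
proof -
  let ?n = "CARD('n)" and ?m = "measure lborel (LB :: (complex^'n) set)"
  let ?F = "\<lambda>\<zeta>::complex^'n. complex_of_real (ln (Re (bergman_kernel LB \<zeta> \<zeta>)))"
  let ?h1 = "hb1 z (cnjv z)"
  have mpos: "?m > 0" by (rule measure_lie_ball_pos)
  have F: "?F \<zeta> = complex_of_real (- ln ?m - ?n * ln (rho \<zeta>))" if "\<zeta> \<in> LB" for \<zeta>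
    using rho_pos[OF that] mpos
    by (simp add: bergman_kernel_diag[OF that] ln_div ln_inverse ln_realpow flip: of_real_inverse of_real_power of_real_divide)
  have "((\<lambda>\<zeta>. complex_of_real (- ln ?m - ?n * ln (rho \<zeta>))) has_derivative
      (\<lambda>s. complex_of_real (- ?n * (2 * Re (?h1 s) / rho z)))) (at z)"
    using rho_pos[OF z] by (auto intro!: derivative_eq_intros has_derivative_rho simp: divide_inverse)
  then have "(?F has_derivative (\<lambda>s. complex_of_real (- ?n * (2 * Re (?h1 s) / rho z)))) (at z)"
    by (rule has_derivative_transform_within_open[OF _ open_lie_ball z]) (simp only: F)
  then have D: "frechet_derivative ?F (at z) = (\<lambda>s. complex_of_real (- ?n * (2 * Re (?h1 s) / rho z)))"
    by (rule frechet_derivative_at[symmetric])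
  have ax: "axis j \<i> = \<i> *s (axis j 1 :: complex^'n)" by (simp add: axis_def vec_eq_iff)
  have e: "hb1 (cnjv z) z (axis j 1) = cnj (?h1 (axis j 1))"
    using hb_cnjv(2)[of z "cnjv z" "axis j 1"] by (simp add: cnjv_def axis_def if_distrib cong: if_cong)
  have "complex_of_real (Re b) + \<i> * of_real (Re (\<i> * b)) = cnj b" for b by (simp add: complex_eq_iff)
  then show ?thesis
    unfolding wirtinger_bar_def D ax hb1_linear e hb_rho
    using rho_pos[OF z] by (simp add: field_simps complex_eq_iff)
qed

text \<open>Up to a constant, the logarithm of the kernel on the diagonal is
  \<open>- CARD('n)\<close> times that of \<open>hb z (cnjv z)\<close>; together with the factor one
  half in \<open>hbg\<close> this accounts for \<open>2 * CARD('n)\<close>.\<close>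

lemma wirtinger_log_kernel:
  fixes z :: "complex^'n"
  assumes z: "z \<in> LB"
  shows "wirtinger i (wirtinger_bar j (\<lambda>\<zeta>. complex_of_real (ln (Re (bergman_kernel LB \<zeta> \<zeta>))))) z
    = 2 * of_nat CARD('n) * hbg z (cnjv z) (axis i 1) (axis j 1)"
proof -
  let ?F = "\<lambda>\<zeta>::complex^'n. complex_of_real (ln (Re (bergman_kernel LB \<zeta> \<zeta>)))"
  let ?e = "axis j 1 :: complex^'n" and ?n = "of_nat CARD('n) :: complex"
  define G where "G = (\<lambda>\<zeta>::complex^'n. - ?n * hb1 (cnjv \<zeta>) \<zeta> ?e * inverse (hb \<zeta> (cnjv \<zeta>)))"
  let ?h = "hb z (cnjv z)"
  have h: "?h \<noteq> 0" using hb_nz[OF z] .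
  have G: "wirtinger_bar j ?F \<zeta> = G \<zeta>" if "\<zeta> \<in> LB" for \<zeta>
    unfolding wirtinger_bar_log_kernel[OF that] G_def by (simp add: divide_inverse)
  let ?D = "\<lambda>s. - ?n * (hb1 (cnjv z) z ?e * - (inverse ?h * (hb1 z (cnjv z) s + hb1 (cnjv z) z (cnjv s)) * inverse ?h)
      + (hb12 z (cnjv z) s ?e + 2 * cdot (cnjv s) ?e * cdot z z) * inverse ?h)"
  have "(G has_derivative ?D) (at z)"
    unfolding G_def mult.assoc[of "- ?n"]
    by (intro has_derivative_mult_right has_derivative_mult[OF has_derivative_hb1' Deriv.has_derivative_inverse[OF h has_derivative_hb]])
  then have D: "frechet_derivative (wirtinger_bar j ?F) (at z) = ?D"
    by (subst frechet_derivative_apply_cong[OF open_lie_ball z, of _ G]) (simp_all only: G frechet_derivative_at[symmetric])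
  have ax: "axis i \<i> = \<i> *s (axis i 1 :: complex^'n)" by (simp add: axis_def vec_eq_iff)
  have cn: "cnjv (axis i 1) = (axis i 1 :: complex^'n)"
    by (simp add: cnjv_def axis_def vec_eq_iff)
  \<comment> \<open>The combination of the directions \<open>axis i 1\<close> and
    \<open>axis i \<i>\<close> removes every term that is conjugate linear in the direction.\<close>
  have "wirtinger i (wirtinger_bar j ?F) z
    = - ?n * (hb1 (cnjv z) z ?e * - (inverse ?h * hb1 z (cnjv z) (axis i 1) * inverse ?h) + hb12 z (cnjv z) (axis i 1) ?e * inverse ?h)"
    unfolding wirtinger_def D ax cnjv_simps cn hb1_linear cdot_simps
    using h by (simp add: field_simps)
  also have "\<dots> = 2 * ?n * hbg z (cnjv z) (axis i 1) ?e"
    using h by (simp add: hbg_def field_simps power2_eq_square)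
  finally show ?thesis .
qed

lemma bergman_metric_lie_ball:
  fixes z :: "complex^'n"
  assumes "z \<in> LB"
  shows "bergman_metric LB z u v = 2 * of_nat CARD('n) * lieG z u v"
proof -
  have u: "u = (\<Sum>i\<in>UNIV. (u $ i) *s axis i 1)" and v: "cnjv v = (\<Sum>j\<in>UNIV. cnj (v $ j) *s axis j 1)"
    using basis_expansion[of u] basis_expansion[of "cnjv v"] by (simp_all add: cnjv_def)
  have "hbg z (cnjv z) u (cnjv v) = (\<Sum>i\<in>UNIV. \<Sum>j\<in>UNIV. hbg z (cnjv z) (axis i 1) (axis j 1) * (u $ i) * cnj (v $ j))"
    by (subst u, subst v) (simp only: hbg_sum(1), simp only: hbg_sum(2) sum_distrib_left, simp only: mult_ac)
  then have "(\<Sum>i\<in>UNIV. \<Sum>j\<in>UNIV. 2 * of_nat CARD('n) * hbg z (cnjv z) (axis i 1) (axis j 1) * (u $ i) * cnj (v $ j))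
    = complex_of_real (2 * CARD('n)) * hbg z (cnjv z) u (cnjv v)"
    by (simp add: sum_distrib_left mult.assoc)
  then show ?thesis
    unfolding bergman_metric_def wirtinger_log_kernel[OF assms] lieG_def by simp
qed

lemma lieG_real:
  assumes "norm x < 1"
  shows "lieG (ofr x) (ofr a) (ofr b) = poincare_metric x a b"
proof -
  define s where "s = 1 - x \<bullet> x"
  have s: "s \<noteq> 0" using ball_inner(2)[OF assms] by (simp add: s_def)
  have xx: "x \<bullet> x = 1 - s" by (simp add: s_def)
  have hb: "hb (ofr x) (ofr x) = of_real (s\<^sup>2)"
    by (simp add: hb_def cdot_ofr xx power2_eq_square algebra_simps)
  have h1: "hb1 (ofr x) (ofr x) (ofr a) = of_real (- 2 * s * (a \<bullet> x))" for a
    by (simp add: hb1_def cdot_ofr xx inner_commute[of x a] algebra_simps)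
  have h12: "hb12 (ofr x) (ofr x) (ofr a) (ofr b) = of_real (- 2 * (a \<bullet> b) + 4 * (a \<bullet> x) * (b \<bullet> x))"
    by (simp add: hb12_def cdot_ofr inner_commute[of x])
  have "hbg (ofr x) (ofr x) (ofr a) (ofr b) = of_real ((a \<bullet> b) / s\<^sup>2)"
    unfolding hbg_def hb h1 h12 using s by (simp add: field_simps power2_eq_square)
  then show ?thesis by (simp add: lieG_def poincare_metric_def s_def power2_norm_eq_inner)
qed

lemma lie_metric_eq:
  fixes z :: "complex^'n"
  assumes z: "z \<in> LB"
  shows "lie_metric z u v = lieG z u v"
proof -
  let ?P = "\<lambda>c. c > 0 \<and> (\<forall>x\<in>ball 0 1. \<forall>a b :: real^'n.
        c * bergman_metric lie_ball (of_real_vec x) (of_real_vec a) (of_real_vec b) = poincare_metric x a b)"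
  have B: "bergman_metric lie_ball (ofr x) (ofr a) (ofr b) = 2 * CARD('n) * poincare_metric x a b"
    if "x \<in> ball 0 1" for x a b :: "real^'n"
    using that by (simp add: bergman_metric_lie_ball[OF ofr_lie_ball] lieG_real)
  have "(THE c. ?P c) = 1 / (2 * CARD('n))"
  proof (rule the_equality)
    show "?P (1 / (2 * CARD('n)))" by (simp add: B)
    fix c assume c: "?P c"
    \<comment> \<open>Any unit vector at the origin tests the constant; the choice of the coordinate
      is immaterial.\<close>
    let ?a = "axis undefined 1 :: real^'n"
    have "c * (2 * CARD('n) * poincare_metric 0 ?a ?a) = poincare_metric 0 ?a ?a"
      using c B[of 0 ?a ?a] by (metis centre_in_ball zero_less_one)
    moreover have "poincare_metric 0 ?a ?a = 1" by (simp add: poincare_metric_def inner_axis_axis)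
    ultimately show "c = 1 / (2 * CARD('n))" by (simp add: field_simps)
  qed
  then show ?thesis unfolding lie_metric_def by (simp add: bergman_metric_lie_ball[OF z])
qed

lemma lieG_mob:
  assumes "norm a < 1" "z \<in> LB"
  shows "lieG (mob a z) (mob' a z u) (mob' a z v) = lieG z u v"
proof -
  note h = mob_den_nz[OF assms]
  have h': "mob_den a (cnjv z) \<noteq> 0" using h by (simp add: mob_cnjv)
  have "a \<bullet> a \<noteq> 1" using ball_inner(2)[OF assms(1)] by simp
  from hbg_mob[OF h h' this, of u "cnjv v"] show ?thesis
    by (simp add: lieG_def mob_cnjv)
qed

lemma lieG_sym: "lieG z u v = lieG z v u"
proof -
  have "hbg z (cnjv z) u (cnjv v) = cnj (hbg z (cnjv z) v (cnjv u))"
    using hbg_cnjv[of z "cnjv z" v "cnjv u"] hbg_commute[of z "cnjv z" u "cnjv v"] by simp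
  then show ?thesis by (simp add: lieG_def)
qed

lemma lieG_bilinear: "bilinear (lieG z)"
proof -
  have "linear (\<lambda>u. lieG z u v)" for v
    unfolding lieG_def by (auto intro!: linearI simp: hbg_linear scaleR_smult)
  moreover have "linear (\<lambda>v. lieG z u v)" for u
    unfolding lieG_def by (auto intro!: linearI simp: hbg_linear scaleR_smult)
  ultimately show ?thesis by (simp add: bilinear_def)
qed

text \<open>All complex directions are covered, so this yields definiteness at imaginary points and,
  by transport, nondegeneracy everywhere.\<close>

lemma lieG_imag:
  assumes "norm y < 1"
  shows "lieG (\<i> *s ofr y) u v = (u \<bullet> v) / (1 - y \<bullet> y)\<^sup>2"
proof -
  define s where "s = complex_of_real (1 - y \<bullet> y)"
  have s: "s \<noteq> 0" using ball_inner(2)[OF assms] by (simp add: s_def del: of_real_diff)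
  have yy: "complex_of_real (y \<bullet> y) = 1 - s" by (simp add: s_def)
  let ?z = "\<i> *s ofr y" and ?w = "(- \<i>) *s ofr y"
  have w: "cnjv ?z = ?w" by simp
  have hb: "hb ?z ?w = s\<^sup>2"
    by (simp add: hb_def cdot_simps cdot_ofr yy power2_eq_square algebra_simps)
  have h1: "hb1 ?z ?w u = 2 * \<i> * cdot u (ofr y) * s" "hb1 ?w ?z u = - 2 * \<i> * cdot u (ofr y) * s" for u
    by (simp_all add: hb1_def cdot_simps cdot_ofr yy cdot_commute[of "ofr y"] algebra_simps)
  have h12: "hb12 ?z ?w u v = - 2 * cdot u v + 4 * cdot u (ofr y) * cdot v (ofr y)" for u v
    by (simp add: hb12_def cdot_simps cdot_commute[of "ofr y"])
  have "hbg ?z ?w u (cnjv v) = (4 * cdot u (ofr y) * cdot (cnjv v) (ofr y) * s\<^sup>2 - s\<^sup>2 * hb12 ?z ?w u (cnjv v)) / (2 * (s\<^sup>2)\<^sup>2)"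
    unfolding hbg_def hb h1 by (simp add: power2_eq_square algebra_simps)
  also have "\<dots> = cdot u (cnjv v) / s\<^sup>2"
    unfolding h12 using s by (simp add: field_simps power2_eq_square)
  finally have e: "hbg ?z ?w u (cnjv v) = cdot u (cnjv v) / s\<^sup>2" .
  have s2: "s\<^sup>2 = of_real ((1 - y \<bullet> y)\<^sup>2)" by (simp add: s_def)
  show ?thesis unfolding lieG_def w inner_cdot e s2 by (rule Re_divide_of_real)
qed

lemma lieG_disk:
  assumes e: "norm e = 1" and z: "cmod z < 1"
  shows "lieG (z *s ofr e) (a *s ofr e) (b *s ofr e) = (a \<bullet> b) / (1 - (cmod z)\<^sup>2)\<^sup>2"
proof -
  have ee: "e \<bullet> e = 1" using e by (simp add: power2_norm_eq_inner[symmetric])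
  define s where "s = 1 - z * cnj z"
  have sr: "s = of_real (1 - (cmod z)\<^sup>2)" by (simp add: s_def cmod_square)
  have "(cmod z)\<^sup>2 < 1" using z by (simp add: abs_square_less_1)
  then have s: "s \<noteq> 0" unfolding sr by (simp del: of_real_diff)
  have zz: "z * cnj z = 1 - s" by (simp add: s_def)
  let ?z = "z *s ofr e" and ?w = "cnj z *s ofr e"
  have "hb ?z ?w = 1 - 2 * (z * cnj z) + (z * cnj z)\<^sup>2"
    by (simp add: hb_def cdot_simps cdot_ofr ee power2_eq_square)
  then have hb: "hb ?z ?w = s\<^sup>2" unfolding zz by (simp add: power2_eq_square algebra_simps)
  have "hb1 ?z ?w (a *s ofr e) = - 2 * a * cnj z * (1 - z * cnj z)" for a
    by (simp add: hb1_def cdot_simps cdot_ofr ee algebra_simps)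
  then have h1: "hb1 ?z ?w (a *s ofr e) = - 2 * a * cnj z * s" for a by (simp only: s_def)
  have "hb1 ?w ?z (a *s ofr e) = - 2 * a * z * (1 - z * cnj z)" for a
    by (simp add: hb1_def cdot_simps cdot_ofr ee algebra_simps)
  then have h2: "hb1 ?w ?z (a *s ofr e) = - 2 * a * z * s" for a by (simp only: s_def)
  have h12: "hb12 ?z ?w (a *s ofr e) (b *s ofr e) = - 2 * a * b + 4 * a * b * (z * cnj z)" for a b
    by (simp add: hb12_def cdot_simps cdot_ofr ee algebra_simps)
  have "hbg ?z ?w (a *s ofr e) (cnj b *s ofr e)
      = (4 * a * cnj b * (z * cnj z) * s\<^sup>2 - s\<^sup>2 * hb12 ?z ?w (a *s ofr e) (cnj b *s ofr e)) / (2 * (s\<^sup>2)\<^sup>2)"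
    unfolding hbg_def hb h1 h2 by (simp add: power2_eq_square algebra_simps)
  also have "\<dots> = a * cnj b / s\<^sup>2"
    unfolding h12 using s by (simp add: field_simps power2_eq_square)
  finally have "hbg ?z ?w (a *s ofr e) (cnj b *s ofr e) = a * cnj b / s\<^sup>2" .
  moreover have "s\<^sup>2 = of_real ((1 - (cmod z)\<^sup>2)\<^sup>2)" by (simp add: sr)
  moreover have "cnjv ?z = ?w" "cnjv (b *s ofr e) = cnj b *s ofr e" by simp_all
  ultimately have "lieG ?z (a *s ofr e) (b *s ofr e) = Re (a * cnj b / of_real ((1 - (cmod z)\<^sup>2)\<^sup>2))"
    unfolding lieG_def by (simp only:)
  also have "\<dots> = Re (a * cnj b) / (1 - (cmod z)\<^sup>2)\<^sup>2" by (rule Re_divide_of_real)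
  finally show ?thesis by (simp add: inner_complex_def)
qed

text \<open>The derivative of \<open>hbg z w u v\<close> with respect to \<open>z\<close> in direction \<open>s\<close>.\<close>

definition hbg_d :: "complex^'n \<Rightarrow> complex^'n \<Rightarrow> complex^'n \<Rightarrow> complex^'n \<Rightarrow> complex^'n \<Rightarrow> complex" where
  "hbg_d z w s u v = (2 * cdot s u * cdot w w * hb1 w z v - 4 * hb z w * cdot s u * cdot w v
      + hb1 z w u * hb12 z w s v + hb1 z w s * hb12 z w u v) / (2 * (hb z w)\<^sup>2)
    - hb1 z w u * hb1 z w s * hb1 w z v / (hb z w) ^ 3"

text \<open>The Kaehler condition. Because of it four of the six terms of the Koszul formula cancel,
  which leaves a single complex expression.\<close>

lemma hbg_d_sym: "hbg_d z w s u v = hbg_d z w u s v"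
  by (simp add: hbg_d_def cdot_commute[of s u] algebra_simps)

lemma hbg_d_cnjv: "hbg_d (cnjv z) (cnjv w) (cnjv s) (cnjv u) (cnjv v) = cnj (hbg_d z w s u v)"
  by (simp add: hbg_d_def hb_cnjv cdot_cnjv)

lemma has_derivative_hbg:
  assumes "hb z (cnjv z) \<noteq> 0"
  shows "((\<lambda>z. hbg z (cnjv z) u v) has_derivative
    (\<lambda>s. hbg_d z (cnjv z) s u v + hbg_d (cnjv z) z (cnjv s) v u)) (at z)"
proof -
  let ?w = "cnjv z" and ?h = "hb z (cnjv z)"
  have n: "((\<lambda>z. hb1 z (cnjv z) u * hb1 (cnjv z) z v - hb z (cnjv z) * hb12 z (cnjv z) u v) has_derivative
    (\<lambda>s. (hb1 z ?w u * (hb12 z ?w s v + 2 * cdot (cnjv s) v * cdot z z)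
        + (2 * cdot s u * cdot ?w ?w + hb12 z ?w u (cnjv s)) * hb1 ?w z v)
      - (?h * (4 * cdot s u * cdot ?w v + 4 * cdot z u * cdot (cnjv s) v)
        + (hb1 z ?w s + hb1 ?w z (cnjv s)) * hb12 z ?w u v))) (at z)"
    by (intro has_derivative_diff has_derivative_mult has_derivative_hb has_derivative_hb1 has_derivative_hb1' has_derivative_hb12)
  have d: "((\<lambda>z. 2 * (hb z (cnjv z))\<^sup>2) has_derivative (\<lambda>s. 4 * ?h * (hb1 z ?w s + hb1 ?w z (cnjv s)))) (at z)"
    by (rule has_derivative_eq_rhs[OF has_derivative_mult_right[OF has_derivative_power[OF has_derivative_hb]]])
      (simp add: fun_eq_iff algebra_simps)
  have "2 * ?h\<^sup>2 \<noteq> 0" using assms by simp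
  note q = has_derivative_divide'[OF n d this]
  have c: "hb12 ?w z v s = hb12 z ?w s v" "hb ?w z = ?h" for s v
    by (simp_all add: hb12_def cdot_commute[of v] hb_commute[of ?w])
  have "(hb1 z ?w u * (hb12 z ?w s v + 2 * cdot (cnjv s) v * cdot z z)
        + (2 * cdot s u * cdot ?w ?w + hb12 z ?w u (cnjv s)) * hb1 ?w z v
      - (?h * (4 * cdot s u * cdot ?w v + 4 * cdot z u * cdot (cnjv s) v)
        + (hb1 z ?w s + hb1 ?w z (cnjv s)) * hb12 z ?w u v)) * (2 * ?h\<^sup>2)
      - (hb1 z ?w u * hb1 ?w z v - ?h * hb12 z ?w u v) * (4 * ?h * (hb1 z ?w s + hb1 ?w z (cnjv s)))
    = (hbg_d z ?w s u v + hbg_d ?w z (cnjv s) v u) * (2 * ?h\<^sup>2 * (2 * ?h\<^sup>2))" for s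
    using assms unfolding hbg_d_def c
    by (simp add: field_simps power2_eq_square power3_eq_cube)
  then have e: "((hb1 z ?w u * (hb12 z ?w s v + 2 * cdot (cnjv s) v * cdot z z)
        + (2 * cdot s u * cdot ?w ?w + hb12 z ?w u (cnjv s)) * hb1 ?w z v
      - (?h * (4 * cdot s u * cdot ?w v + 4 * cdot z u * cdot (cnjv s) v)
        + (hb1 z ?w s + hb1 ?w z (cnjv s)) * hb12 z ?w u v)) * (2 * ?h\<^sup>2)
      - (hb1 z ?w u * hb1 ?w z v - ?h * hb12 z ?w u v) * (4 * ?h * (hb1 z ?w s + hb1 ?w z (cnjv s)))) / (2 * ?h\<^sup>2 * (2 * ?h\<^sup>2))
    = hbg_d z ?w s u v + hbg_d ?w z (cnjv s) v u" for s
    using assms by simp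
  show ?thesis
    unfolding hbg_def by (rule has_derivative_eq_rhs[OF q]) (simp only: e)
qed

lemma has_derivative_lieG:
  assumes "z \<in> LB"
  shows "((\<lambda>z. lieG z u v) has_derivative
    (\<lambda>s. Re (hbg_d z (cnjv z) s u (cnjv v)) + Re (hbg_d z (cnjv z) s v (cnjv u)))) (at z)"
proof -
  have "hbg_d (cnjv z) z (cnjv s) (cnjv v) u = cnj (hbg_d z (cnjv z) s v (cnjv u))" for s
    using hbg_d_cnjv[of z "cnjv z" s v "cnjv u"] by simp
  then show ?thesis
    unfolding lieG_def using has_derivative_Re[OF has_derivative_hbg[OF hb_nz[OF assms], of u "cnjv v"]] by simp
qed

lemma lieG_differentiable: "z \<in> LB \<Longrightarrow> (\<lambda>z. lieG z u v) differentiable (at z)"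
  using has_derivative_lieG differentiableI by blast

lemma koszul_lieG:
  assumes "z \<in> LB"
  shows "koszul lieG z u w v = Re (hbg_d z (cnjv z) u w (cnjv v))"
proof -
  have d: "frechet_derivative (\<lambda>z. lieG z u v) (at z) s
    = Re (hbg_d z (cnjv z) s u (cnjv v)) + Re (hbg_d z (cnjv z) s v (cnjv u))" for u v s
    using fun_cong[OF frechet_derivative_at[OF has_derivative_lieG[OF assms, of u v]], of s] by simp
  show ?thesis unfolding koszul_def d
    using hbg_d_sym[of z "cnjv z" u w "cnjv v"] hbg_d_sym[of z "cnjv z" u v "cnjv w"] hbg_d_sym[of z "cnjv z" w v "cnjv u"]
    by simp
qed

text \<open>The Christoffel symbols of a Kaehler metric, complex bilinear in \<open>u\<close> and
  \<open>w\<close>. They solve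
  \<open>hbg z (cnjv z) (lieGamma z u w) v = hbg_d z (cnjv z) u w v\<close>: the first two terms
  account for the summands with \<open>hb1\<close> in the direction \<open>u\<close> or
  \<open>w\<close>, and the vector in the last term is the one that \<open>hbg\<close> pairs to the
  coefficient of \<open>cdot u w\<close>.\<close>

definition lieGamma :: "complex^'n \<Rightarrow> complex^'n \<Rightarrow> complex^'n \<Rightarrow> complex^'n" where
  "lieGamma z u w = (- (hb1 z (cnjv z) u / hb z (cnjv z))) *s w + (- (hb1 z (cnjv z) w / hb z (cnjv z))) *s u
    + (- (2 * cdot u w / hb z (cnjv z))) *s (cnjv z + (- cdot (cnjv z) (cnjv z)) *s z)"

lemma lieG_lieGamma:
  assumes z: "z \<in> LB"
  shows "lieG z (lieGamma z u w) v = koszul lieG z u w v"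
proof -
  let ?w = "cnjv z" and ?h = "hb z (cnjv z)" and ?v = "cnjv v"
  have h: "?h \<noteq> 0" using hb_nz[OF z] .
  have A: "hb1 z ?w (?w + (- cdot ?w ?w) *s z) = - 2 * cdot ?w ?w * ?h"
    by (simp add: hb1_def hb_def cdot_simps cdot_commute[of ?w z] algebra_simps)
  have B: "- 2 * cdot ?w ?w * ?h * hb1 ?w z ?v - ?h * hb12 z ?w (?w + (- cdot ?w ?w) *s z) ?v
    = ?h * (- cdot ?w ?w * hb1 ?w z ?v + 2 * ?h * cdot ?w ?v)"
    by (simp add: hb1_def hb12_def hb_def cdot_simps cdot_commute[of ?w z] cdot_commute[of ?v z] algebra_simps)
  have C: "hbg z ?w (?w + (- cdot ?w ?w) *s z) ?v = (- cdot ?w ?w * hb1 ?w z ?v + 2 * ?h * cdot ?w ?v) / (2 * ?h)"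
    unfolding hbg_def A B using h by (simp add: power2_eq_square)
  define M where "M = ?w + (- cdot ?w ?w) *s z"
  have L: "lieGamma z u w = (- (hb1 z ?w u / ?h)) *s w + (- (hb1 z ?w w / ?h)) *s u + (- (2 * cdot u w / ?h)) *s M"
    by (simp only: lieGamma_def M_def)
  have "hbg z ?w (lieGamma z u w) ?v = hbg_d z ?w u w ?v"
    unfolding L hbg_linear C[folded M_def] unfolding hbg_def hbg_d_def
    using h by (simp add: field_simps power2_eq_square power3_eq_cube)
  then show ?thesis by (simp add: koszul_lieG[OF z] lieG_def)
qed

text \<open>The isometry \<open>z \<mapsto> - cnj z\<close> enters only in this form: it maps
  solutions of the geodesic equation to solutions.\<close>

lemma lieGamma_reflect: "lieGamma (- cnjv z) (- cnjv u) (- cnjv w) = - cnjv (lieGamma z u w)"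
proof -
  have 1: "hb (- cnjv z) (- z) = cnj (hb z (cnjv z))"
    using hb_cnjv(1)[of z "cnjv z"] by (simp add: hb_def cdot_simps)
  have 2: "hb1 (- cnjv z) (- z) (- cnjv u) = cnj (hb1 z (cnjv z) u)" for u
    using hb_cnjv(2)[of z "cnjv z" u] by (simp add: hb1_def cdot_simps)
  have 3: "cdot z z = cnj (cdot (cnjv z) (cnjv z))" by (simp add: cdot_cnjv)
  show ?thesis
    unfolding lieGamma_def cnjv_simps 1 2 cdot_simps
    by (simp add: cdot_cnjv vec_eq_iff algebra_simps)
qed

lemma loc_lipschitz_lieGamma:
  fixes p :: "(complex^'n) \<times> (complex^'n)"
  assumes "fst p \<in> LB"
  shows "loc_lipschitz_at p (\<lambda>(z, u). (u, - lieGamma z u u))"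
proof (rule Ck_on_imp_loc_lipschitz[where U = "LB \<times> UNIV"])
  let ?U = "LB \<times> UNIV :: ((complex^'n) \<times> (complex^'n)) set"
  show U: "open ?U" by (intro open_Times open_lie_ball open_UNIV)
  show "p \<in> ?U" using assms by (cases p) auto
  have f: "Ck_on (Suc 0) ?U fst" "Ck_on (Suc 0) ?U snd"
    by (intro Ck_on_bounded_linear U bounded_linear_fst bounded_linear_snd)+
  note I = Ck_on_add Ck_on_minus Ck_on_mult Ck_on_cdot Ck_on_cnjv Ck_on_smult Ck_on_const Ck_on_diff Ck_on_divide U f
  have nz: "hb (fst x) (cnjv (fst x)) \<noteq> 0" if "x \<in> ?U" for x
    using that by (auto intro!: hb_nz)
  have hb: "Ck_on (Suc 0) ?U (\<lambda>x. hb (fst x) (cnjv (fst x)))" unfolding hb_def by (intro I)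
  have hb1: "Ck_on (Suc 0) ?U (\<lambda>x. hb1 (fst x) (cnjv (fst x)) (snd x))" unfolding hb1_def by (intro I)
  have "Ck_on (Suc 0) ?U (\<lambda>x. lieGamma (fst x) (snd x) (snd x))"
    unfolding lieGamma_def by (intro I hb hb1; erule nz)
  then show "Ck_on (Suc 0) ?U (\<lambda>(z, u). (u, - lieGamma z u u))"
    unfolding split_def by (intro Ck_on_Pair Ck_on_minus U f)
qed

section \<open>The Poincare ball\<close>

abbreviation B1 :: "'a::real_normed_vector set" where "B1 \<equiv> ball 0 1"
abbreviation pmet :: "(real^'n) metric_field" where "pmet \<equiv> poincare_metric"

section \<open>Moebius maps on the real ball\<close>

definition pden :: "real^'n \<Rightarrow> real^'n \<Rightarrow> real" where
  "pden a x = 1 - 2 * (x \<bullet> a) + (x \<bullet> x) * (a \<bullet> a)"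

definition pmob :: "real^'n \<Rightarrow> real^'n \<Rightarrow> real^'n" where
  "pmob a x = re_vec (mob a (ofr x))"

definition pmob' :: "real^'n \<Rightarrow> real^'n \<Rightarrow> real^'n \<Rightarrow> real^'n" where
  "pmob' a x v = re_vec (mob' a (ofr x) (ofr v))"

lemma cnjv_fixed_imp_real: "cnjv z = z \<Longrightarrow> ofr (re_vec z) = z"
  by (auto simp: vec_eq_iff cnjv_def of_real_vec_def re_vec_def complex_eq_iff)

lemma ofr_pmob: "ofr (pmob a x) = mob a (ofr x)"
  unfolding pmob_def by (rule cnjv_fixed_imp_real) (simp flip: mob_cnjv)

lemma ofr_pmob': "ofr (pmob' a x v) = mob' a (ofr x) (ofr v)"
  unfolding pmob'_def by (rule cnjv_fixed_imp_real) (simp flip: mob_cnjv)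

lemma mob_den_ofr: "mob_den a (ofr x) = of_real (pden a x)"
  by (simp add: mob_den_def pden_def cdot_ofr)

lemma pden_pos: "norm a < 1 \<Longrightarrow> norm x < 1 \<Longrightarrow> pden a x > 0"
proof -
  assume a: "norm a < 1" "norm x < 1"
  have "norm x * norm a < 1" using a by (metis mult_strict_mono' mult_1 norm_ge_zero)
  then have "0 < (1 - norm x * norm a)\<^sup>2" by simp
  also have "\<dots> \<le> pden a x"
    using norm_cauchy_schwarz[of x a]
    by (simp add: pden_def power2_eq_square algebra_simps power2_norm_eq_inner[symmetric])
  finally show ?thesis .
qed

lemma norm_pmob: "norm a < 1 \<Longrightarrow> norm x < 1 \<Longrightarrow> norm (pmob a x) < 1"
  using norm_lie_ball[OF mob_lie_ball[OF _ ofr_lie_ball]] by (metis norm_ofr ofr_pmob)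

lemma pmob_inverse:
  assumes "norm a < 1" "norm x < 1"
  shows "pmob (- a) (pmob a x) = x" "pmob a (pmob (- a) x) = x"
  using mob_inverse_lie_ball[OF assms(1) ofr_lie_ball[OF assms(2)]]
  by (simp_all only: ofr_pmob[symmetric] ofr_eq_iff)

lemma pmob_self [simp]: "pmob a a = 0"
  using ofr_pmob[of a a] by (simp add: ofr_simps(5)[symmetric] del: ofr_simps(5))

lemma pmob_zero [simp]: "pmob a 0 = - a"
proof -
  have "ofr (pmob a 0) = ofr (- a)" by (simp only: ofr_pmob ofr_simps mob_zero)
  then show ?thesis by simp
qed

lemma pmob_inner_self:
  assumes "norm a < 1" "norm x < 1"
  shows "1 - pmob a x \<bullet> pmob a x = (1 - a \<bullet> a) * (1 - x \<bullet> x) / pden a x"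
proof -
  have d: "pden a x \<noteq> 0" using pden_pos[OF assms] by simp
  then have d': "mob_den a (ofr x) \<noteq> 0" by (simp add: mob_den_ofr)
  have "complex_of_real (1 - pmob a x \<bullet> pmob a x) = 1 - cdot (mob a (ofr x)) (mob a (ofr x))"
    by (simp add: ofr_pmob[symmetric] cdot_ofr)
  also have "\<dots> = (mob_den a (ofr x) - mob_last a (ofr x)) / mob_den a (ofr x)"
    unfolding cdot_mob_self[OF d'] using d' by (simp add: field_simps)
  also have "\<dots> = of_real ((1 - a \<bullet> a) * (1 - x \<bullet> x) / pden a x)"
    unfolding mob_den_last by (simp add: mob_den_ofr cdot_ofr)
  finally show ?thesis by (simp only: of_real_eq_iff)
qed

lemma pmob'_inner:
  assumes "norm a < 1" "norm x < 1"
  shows "pmob' a x u \<bullet> pmob' a x v = ((1 - a \<bullet> a) / pden a x)\<^sup>2 * (u \<bullet> v)"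
proof -
  have "mob_den a (ofr x) \<noteq> 0" using pden_pos[OF assms] by (simp add: mob_den_ofr)
  from cdot_mob'[OF this, of "ofr u" "ofr v"]
  have "complex_of_real (pmob' a x u \<bullet> pmob' a x v) = of_real (((1 - a \<bullet> a) / pden a x)\<^sup>2 * (u \<bullet> v))"
    by (simp add: ofr_pmob'[symmetric] cdot_ofr mob_den_ofr)
  then show ?thesis by (simp only: of_real_eq_iff)
qed

lemma has_derivative_pmob:
  assumes "norm a < 1" "norm x < 1"
  shows "(pmob a has_derivative pmob' a x) (at x)"
proof -
  have d: "mob_den a (ofr x) \<noteq> 0" using pden_pos[OF assms] by (simp add: mob_den_ofr)
  have "((\<lambda>x. mob a (ofr x)) has_derivative (\<lambda>v. mob' a (ofr x) (ofr v))) (at x)"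
    using has_derivative_compose[OF bounded_linear_imp_has_derivative[OF bounded_linear_ofr] has_derivative_mob[OF d]] .
  from bounded_linear.has_derivative[OF bounded_linear_re_vec this] show ?thesis
    by (simp add: pmob_def[abs_def] pmob'_def[abs_def])
qed

lemma pmet_pmob:
  assumes "norm a < 1" "norm x < 1"
  shows "pmet (pmob a x) (pmob' a x u) (pmob' a x v) = pmet x u v"
proof -
  have 1: "1 - a \<bullet> a \<noteq> 0" "1 - x \<bullet> x \<noteq> 0" using ball_inner(2) assms by (auto dest: ball_inner(2))
  have 2: "pden a x \<noteq> 0" using pden_pos[OF assms] by simp
  have "(b / d)\<^sup>2 * k / (b * c / d)\<^sup>2 = k / c\<^sup>2" if "b \<noteq> 0" "c \<noteq> 0" "d \<noteq> 0" for b c d k :: real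
    using that by (simp add: field_simps power2_eq_square)
  from this[OF 1 2] show ?thesis
    unfolding poincare_metric_def power2_norm_eq_inner pmob_inner_self[OF assms] pmob'_inner[OF assms] .
qed

lemma pmob_eq:
  "pmob a x = (1 / pden a x) *\<^sub>R ((1 - a \<bullet> a) *\<^sub>R x + (2 * (x \<bullet> a) - 1 - x \<bullet> x) *\<^sub>R a)"
proof -
  have "mob a (ofr x) = ofr ((1 / pden a x) *\<^sub>R ((1 - a \<bullet> a) *\<^sub>R x + (2 * (x \<bullet> a) - 1 - x \<bullet> x) *\<^sub>R a))"
    by (simp add: mob_def mob_num_def mob_den_ofr ofr_simps cdot_ofr divide_inverse)
  then show ?thesis by (simp only: ofr_pmob[symmetric] ofr_eq_iff)
qed

lemma pmob'_smult: "pmob' a x (r *\<^sub>R v) = r *\<^sub>R pmob' a x v"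
proof -
  have "ofr (pmob' a x (r *\<^sub>R v)) = ofr (r *\<^sub>R pmob' a x v)"
    by (simp only: ofr_pmob' ofr_simps mob'_smult)
  then show ?thesis by simp
qed

subsection \<open>Christoffel symbols and geodesics\<close>

definition pGamma :: "'a::real_inner \<Rightarrow> 'a \<Rightarrow> 'a \<Rightarrow> 'a" where
  "pGamma x u w = (2 / (1 - x \<bullet> x)) *\<^sub>R ((x \<bullet> u) *\<^sub>R w + (x \<bullet> w) *\<^sub>R u - (u \<bullet> w) *\<^sub>R x)"

lemma christoffel_poincare:
  fixes x :: "'a::real_inner"
  assumes "norm x < 1"
  shows "christoffel poincare_metric x u w = pGamma x u w"
proof -
  define s where "s = 1 - x \<bullet> x"
  have s: "s > 0" using ball_inner(2)[OF assms] by (simp add: s_def)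
  have d: "frechet_derivative (\<lambda>y. poincare_metric y u w) (at x) v = (u \<bullet> w) * (4 * (x \<bullet> v)) / s ^ 3" for u w v
  proof -
    have dq: "((\<lambda>y. 1 - y \<bullet> y) has_derivative (\<lambda>v. - 2 * (x \<bullet> v))) (at x)"
      by (rule has_derivative_eq_rhs[OF has_derivative_diff[OF has_derivative_const
              has_derivative_inner[OF has_derivative_ident has_derivative_ident]]])
        (simp add: fun_eq_iff inner_commute)
    have "((\<lambda>q. (u \<bullet> w) * inverse (q\<^sup>2)) has_real_derivative (u \<bullet> w) * (- 2 / s ^ 3)) (at s)"
      using s by (auto intro!: derivative_eq_intros simp: field_simps power2_eq_square power3_eq_cube)
    from has_derivative_compose[OF dq this[unfolded has_field_derivative_def s_def]]
    have "((\<lambda>y. (u \<bullet> w) * inverse ((1 - y \<bullet> y)\<^sup>2)) has_derivative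
      (\<lambda>v. (u \<bullet> w) * (4 * (x \<bullet> v)) / s ^ 3)) (at x)"
      by (rule has_derivative_eq_rhs) (simp add: s_def fun_eq_iff)
    then have "((\<lambda>y. poincare_metric y u w) has_derivative (\<lambda>v. (u \<bullet> w) * (4 * (x \<bullet> v)) / s ^ 3)) (at x)"
      by (simp add: poincare_metric_def[abs_def] power2_norm_eq_inner divide_inverse)
    from fun_cong[OF frechet_derivative_at[OF this], of v] show ?thesis by simp
  qed
  have K: "koszul poincare_metric x u w z = ((w \<bullet> z) * (4 * (x \<bullet> u)) / s ^ 3 + (u \<bullet> z) * (4 * (x \<bullet> w)) / s ^ 3
      - (u \<bullet> w) * (4 * (x \<bullet> z)) / s ^ 3) / 2" for z
    by (simp only: koszul_def d)
  show ?thesis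
  proof (rule christoffel_eqI)
    show "linear (\<lambda>c. poincare_metric x c z)" for z
      by (auto intro!: linearI simp: poincare_metric_def inner_add_left add_divide_distrib)
    show "c = 0" if "\<And>z. poincare_metric x c z = 0" for c
      using that[of c] s by (simp add: poincare_metric_def power2_norm_eq_inner s_def)
    show "poincare_metric x (pGamma x u w) z = koszul poincare_metric x u w z" for z
      unfolding K poincare_metric_def pGamma_def power2_norm_eq_inner s_def[symmetric]
      using s by (simp add: inner_add_left inner_diff_left field_simps power2_eq_square power3_eq_cube)
  qed
qed

lemma loc_lipschitz_pGamma:
  fixes p :: "'a::euclidean_space \<times> 'a"
  assumes "norm (fst p) < 1"
  shows "loc_lipschitz_at p (\<lambda>(x, u). (u, - pGamma x u u))"
proof (rule Ck_on_imp_loc_lipschitz[where U = "B1 \<times> UNIV"])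
  let ?U = "B1 \<times> UNIV :: ('a \<times> 'a) set"
  show U: "open ?U" by (intro open_Times) auto
  show "p \<in> ?U" using assms by (cases p) auto
  have f: "Ck_on (Suc 0) ?U fst" "Ck_on (Suc 0) ?U snd"
    by (intro Ck_on_bounded_linear U bounded_linear_fst bounded_linear_snd)+
  have nz: "1 - fst x \<bullet> fst x \<noteq> 0" if "x \<in> ?U" for x
    using that ball_inner(1)[of "fst x"] by auto
  have "Ck_on (Suc 0) ?U (\<lambda>x. pGamma (fst x) (snd x) (snd x))"
    unfolding pGamma_def
    by (intro Ck_on_add Ck_on_minus Ck_on_mult Ck_on_const Ck_on_diff Ck_on_divide Ck_on_inner Ck_on_scaleR U f; erule nz)
  then show "Ck_on (Suc 0) ?U (\<lambda>(x, u). (u, - pGamma x u u))"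
    unfolding split_def by (intro Ck_on_Pair Ck_on_minus U f)
qed

text \<open>For \<open>norm e = 1\<close> this has unit speed: along a diameter the metric is
  \<open>dr / (1 - r\<^sup>2)\<close>, with arc length \<open>artanh r\<close>. The value
  \<open>e = 0\<close> gives the constant curves.\<close>

definition pgeo :: "real^'n \<Rightarrow> real^'n \<Rightarrow> real \<Rightarrow> real^'n" where
  "pgeo x e t = pmob (- x) (tanh t *\<^sub>R e)"

lemma norm_tanh_lt: "norm e \<le> 1 \<Longrightarrow> norm (tanh t *\<^sub>R e) < 1" for e :: "'a::real_normed_vector"
proof -
  assume "norm e \<le> 1"
  then have "\<bar>tanh t\<bar> * norm e \<le> \<bar>tanh t\<bar>" by (intro mult_left_le) auto
  also have "\<dots> < 1" using tanh_real_bounds[of t] by (simp add: abs_less_iff minus_less_iff)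
  finally show ?thesis by simp
qed

lemma norm_pgeo: "norm x < 1 \<Longrightarrow> norm e \<le> 1 \<Longrightarrow> norm (pgeo x e t) < 1"
  unfolding pgeo_def by (intro norm_pmob norm_tanh_lt) simp_all

lemma pgeo_0 [simp]: "pgeo x e 0 = x"
  by (simp add: pgeo_def)

definition pgeo' :: "real^'n \<Rightarrow> real^'n \<Rightarrow> real \<Rightarrow> real^'n" where
  "pgeo' x e t = pmob' (- x) (tanh t *\<^sub>R e) ((1 - (tanh t)\<^sup>2) *\<^sub>R e)"

lemma pgeo_has_derivative:
  assumes "norm x < 1" "norm e \<le> 1"
  shows "(pgeo x e has_vector_derivative pgeo' x e t) (at t)"
proof -
  have ht: "(tanh has_real_derivative (1 - (tanh t)\<^sup>2)) (at t)"
    using cosh_real_pos[of t] by (auto intro!: derivative_eq_intros)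
  have 1: "((\<lambda>t. tanh t *\<^sub>R e) has_derivative (\<lambda>r. r *\<^sub>R ((1 - (tanh t)\<^sup>2) *\<^sub>R e))) (at t)"
    using has_vector_derivative_scaleR[OF ht has_vector_derivative_const[of e]] by (simp add: has_vector_derivative_def)
  show ?thesis
    unfolding pgeo_def[abs_def] pgeo'_def has_vector_derivative_def
    using has_derivative_compose[OF 1 has_derivative_pmob[OF _ norm_tanh_lt[OF assms(2)], of "- x" t]] assms(1)
    by (simp add: pmob'_smult)
qed

lemma sech2: "1 - (tanh t)\<^sup>2 = 1 / (cosh t)\<^sup>2" for t :: real
proof -
  have "cosh t > 0" by (rule cosh_real_pos)
  then have "1 - (tanh t)\<^sup>2 = ((cosh t)\<^sup>2 - (sinh t)\<^sup>2) / (cosh t)\<^sup>2"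
    by (simp add: tanh_def power_divide diff_divide_distrib)
  then show ?thesis by (simp add: hyperbolic_pythagoras)
qed

text \<open>Multiplied by \<open>cosh\<^sup>2\<close>, numerator and denominator of \<open>pgeo x e\<close> become combinations of
  \<open>1\<close>, \<open>cosh (2 t)\<close> and \<open>sinh (2 t)\<close>; so the geodesic equation reduces to \<open>A'' = 4 A\<close>
  and \<open>B'' = 4 (B - b)\<close>.\<close>

lemma pgeo_geodesic:
  assumes x: "norm x < 1" and e: "norm e = 1"
  shows "(pgeo' x e has_vector_derivative - pGamma (pgeo x e t) (pgeo' x e t) (pgeo' x e t)) (at t)"
    "pgeo' x e 0 = (1 - x \<bullet> x) *\<^sub>R e" "pmet (pgeo x e t) (pgeo' x e t) (pgeo' x e t) = 1"
proof -
  have ee: "e \<bullet> e = 1" using e by (simp add: power2_norm_eq_inner[symmetric])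
  define k where "k = e \<bullet> x"
  define b where "b = (1 - x \<bullet> x) / 2"
  have b: "b > 0" using ball_inner(2)[OF x] by (simp add: b_def)
  define A where "A = (\<lambda>t. (sinh (2 * t) * b) *\<^sub>R e + (cosh (2 * t) + sinh (2 * t) * k) *\<^sub>R x)"
  define B where "B = (\<lambda>t. (1 + cosh (2 * t)) / 2 + sinh (2 * t) * k + (cosh (2 * t) - 1) / 2 * (x \<bullet> x))"
  define A' where "A' = (\<lambda>t. (2 * cosh (2 * t) * b) *\<^sub>R e + (2 * sinh (2 * t) + 2 * cosh (2 * t) * k) *\<^sub>R x)"
  define B' where "B' = (\<lambda>t. sinh (2 * t) + 2 * cosh (2 * t) * k + sinh (2 * t) * (x \<bullet> x))"
  let ?g = "pgeo x e" and ?v = "pgeo' x e"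
  have c2: "cosh (2 * t) = (cosh t)\<^sup>2 + (sinh t)\<^sup>2" "sinh (2 * t) = 2 * sinh t * cosh t"
    "(1 + cosh (2 * t)) / 2 = (cosh t)\<^sup>2" "(cosh (2 * t) - 1) / 2 = (sinh t)\<^sup>2" for t :: real
    using cosh_double[of t] sinh_double[of t] cosh_square_eq[of t] by auto
  have cp: "cosh t > 0" for t :: real by (rule cosh_real_pos)
  have th: "tanh t = sinh t / cosh t" for t :: real by (simp add: tanh_def)
  have den: "pden (- x) (tanh t *\<^sub>R e) = B t / (cosh t)\<^sup>2" for t
    unfolding pden_def B_def c2(2-4) th using cp[of t]
    by (simp add: ee k_def field_simps power2_eq_square)
  have Bpos: "B t > 0" for t
    using pden_pos[of "- x" "tanh t *\<^sub>R e"] x norm_tanh_lt[of e t] e den[of t] cp[of t]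
    by (simp add: zero_less_divide_iff)
  have num: "(1 - x \<bullet> x) *\<^sub>R (tanh t *\<^sub>R e) + (2 * ((tanh t *\<^sub>R e) \<bullet> - x) - 1 - (tanh t *\<^sub>R e) \<bullet> (tanh t *\<^sub>R e)) *\<^sub>R (- x)
      = (1 / (cosh t)\<^sup>2) *\<^sub>R A t" for t
  proof -
    have 1: "(1 - x \<bullet> x) * tanh t = 1 / (cosh t)\<^sup>2 * (sinh (2 * t) * b)"
      unfolding c2(2) th b_def using cp[of t] by (simp add: field_simps power2_eq_square)
    have 2: "1 + 2 * (tanh t * k) + tanh t * tanh t = 1 / (cosh t)\<^sup>2 * (cosh (2 * t) + sinh (2 * t) * k)"
      unfolding c2(1,2) th using cp[of t] by (simp add: field_simps power2_eq_square)
    have "(1 - x \<bullet> x) *\<^sub>R (tanh t *\<^sub>R e) + (2 * ((tanh t *\<^sub>R e) \<bullet> - x) - 1 - (tanh t *\<^sub>R e) \<bullet> (tanh t *\<^sub>R e)) *\<^sub>R (- x)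
      = ((1 - x \<bullet> x) * tanh t) *\<^sub>R e + (1 + 2 * (tanh t * k) + tanh t * tanh t) *\<^sub>R x"
      by (simp add: ee k_def algebra_simps)
    then show ?thesis unfolding 1 2 A_def by (simp add: scaleR_add_right)
  qed
  have g: "?g t = (1 / B t) *\<^sub>R A t" for t
    unfolding pgeo_def pmob_eq den using num[of t] cp[of t] by simp
  have gA: "A t = B t *\<^sub>R ?g t" for t using g[of t] Bpos[of t] by simp
  have dA: "(A has_vector_derivative A' t) (at t)" for t
    unfolding A_def A'_def has_vector_derivative_def
    by (auto intro!: derivative_eq_intros simp: fun_eq_iff algebra_simps)
  have dA': "(A' has_vector_derivative 4 *\<^sub>R A t) (at t)" for t
    unfolding A_def A'_def has_vector_derivative_def
    by (auto intro!: derivative_eq_intros simp: fun_eq_iff algebra_simps)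
  have dB: "(B has_real_derivative B' t) (at t)" for t
    unfolding B_def B'_def by (auto intro!: derivative_eq_intros simp: field_simps)
  have dB': "(B' has_real_derivative 4 * (B t - b)) (at t)" for t
    unfolding B_def B'_def b_def by (auto intro!: derivative_eq_intros simp: field_simps)
  have dg: "(?g has_vector_derivative ?v t) (at t)" for t
    using pgeo_has_derivative[OF x] e by simp
  \<comment> \<open>Differentiating the product \<open>B t *\<^sub>R ?g t = A t\<close> gives the
    velocity in terms of \<open>A'\<close>, \<open>B'\<close> and the curve itself.\<close>
  have v: "?v t = (1 / B t) *\<^sub>R (A' t - B' t *\<^sub>R ?g t)" for t
  proof -
    have "((\<lambda>t. B t *\<^sub>R ?g t) has_vector_derivative (B t *\<^sub>R ?v t + B' t *\<^sub>R ?g t)) (at t)"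
      by (rule has_vector_derivative_scaleR[OF dB dg])
    moreover have "(\<lambda>t. B t *\<^sub>R ?g t) = A" using gA by (simp add: fun_eq_iff)
    ultimately have "B t *\<^sub>R ?v t + B' t *\<^sub>R ?g t = A' t"
      using dA[of t] vector_derivative_at by metis
    then have "A' t - B' t *\<^sub>R ?g t = B t *\<^sub>R ?v t" by (simp add: algebra_simps)
    then show ?thesis using Bpos[of t] by simp
  qed
  show "?v 0 = (1 - x \<bullet> x) *\<^sub>R e"
    unfolding v by (simp add: A'_def B'_def B_def b_def)
  have n1: "1 - ?g t \<bullet> ?g t = 2 * b / B t" for t
  proof -
    have "1 - ?g t \<bullet> ?g t = (1 - x \<bullet> x) * (1 - (tanh t)\<^sup>2) / (B t / (cosh t)\<^sup>2)"
      unfolding pgeo_def using pmob_inner_self[of "- x" "tanh t *\<^sub>R e"] x norm_tanh_lt[of e t] e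
      by (simp add: den ee power2_eq_square)
    moreover have b2: "2 * b = 1 - x \<bullet> x" by (simp add: b_def)
    ultimately show ?thesis unfolding sech2 b2 using cp[of t] by simp
  qed
  have iso: "pmet (?g t) (?v t) (?v t) = 1" for t
  proof -
    have "pmet (?g t) (?v t) (?v t) = pmet (tanh t *\<^sub>R e) ((1 - (tanh t)\<^sup>2) *\<^sub>R e) ((1 - (tanh t)\<^sup>2) *\<^sub>R e)"
      unfolding pgeo_def pgeo'_def by (rule pmet_pmob) (use x e norm_tanh_lt[of e t] in auto)
    also have "\<dots> = 1"
    proof -
      have "1 - (tanh t)\<^sup>2 \<noteq> 0" unfolding sech2 using cp[of t] by simp
      then show ?thesis by (simp add: poincare_metric_def e ee power2_eq_square)
    qed
    finally show ?thesis .
  qed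
  then show "pmet (?g t) (?v t) (?v t) = 1" .
  have vv: "?v t \<bullet> ?v t = (2 * b / B t)\<^sup>2" for t
    using iso[of t] n1[of t] b Bpos[of t] by (simp add: poincare_metric_def power2_norm_eq_inner field_simps)
  \<comment> \<open>Comes from differentiating \<open>1 - ?g t \<bullet> ?g t = 2 * b / B t\<close>,
    without any computation with vectors.\<close>
  have gv: "?g t \<bullet> ?v t = b * B' t / (B t)\<^sup>2" for t
  proof -
    have "((\<lambda>t. 1 - ?g t \<bullet> ?g t) has_derivative (\<lambda>h. - (?g t \<bullet> (h *\<^sub>R ?v t) + (h *\<^sub>R ?v t) \<bullet> ?g t))) (at t)"
      using dg[of t] by (auto intro!: derivative_eq_intros simp: has_vector_derivative_def)
    then have "((\<lambda>t. 1 - ?g t \<bullet> ?g t) has_real_derivative - (2 * (?g t \<bullet> ?v t))) (at t)"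
      unfolding has_field_derivative_def
      by (rule has_derivative_eq_rhs) (auto simp: fun_eq_iff inner_commute[of "?v t"])
    moreover have "((\<lambda>t. 2 * b / B t) has_real_derivative - (2 * b * B' t / (B t)\<^sup>2)) (at t)"
      using dB[of t] Bpos[of t] by (auto intro!: derivative_eq_intros simp: power2_eq_square)
    ultimately have "- (2 * (?g t \<bullet> ?v t)) = - (2 * b * B' t / (B t)\<^sup>2)"
      unfolding n1 by (rule DERIV_unique)
    then show ?thesis by simp
  qed
  have Bnz: "B t \<noteq> 0" using Bpos[of t] by simp
  have dI: "((\<lambda>t. 1 / B t) has_real_derivative - (B' t / (B t)\<^sup>2)) (at t)"
    using dB[of t] Bnz by (auto intro!: derivative_eq_intros simp: power2_eq_square)
  have dN: "((\<lambda>t. A' t - B' t *\<^sub>R ?g t) has_vector_derivative 4 *\<^sub>R A t - (B' t *\<^sub>R ?v t + (4 * (B t - b)) *\<^sub>R ?g t)) (at t)"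
    by (intro has_vector_derivative_diff dA' has_vector_derivative_scaleR dB' dg)
  have "((\<lambda>t. (1 / B t) *\<^sub>R (A' t - B' t *\<^sub>R ?g t)) has_vector_derivative
     ((1 / B t) *\<^sub>R (4 *\<^sub>R A t - (B' t *\<^sub>R ?v t + (4 * (B t - b)) *\<^sub>R ?g t)) + (- (B' t / (B t)\<^sup>2)) *\<^sub>R (A' t - B' t *\<^sub>R ?g t))) (at t)"
    by (rule has_vector_derivative_scaleR[OF dI dN])
  moreover have "(\<lambda>t. (1 / B t) *\<^sub>R (A' t - B' t *\<^sub>R ?g t)) = ?v" using v by (simp add: fun_eq_iff)
  moreover have "(1 / B t) *\<^sub>R (4 *\<^sub>R A t - (B' t *\<^sub>R ?v t + (4 * (B t - b)) *\<^sub>R ?g t)) + (- (B' t / (B t)\<^sup>2)) *\<^sub>R (A' t - B' t *\<^sub>R ?g t)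
      = - pGamma (?g t) (?v t) (?v t)"
  proof -
    have N: "A' t - B' t *\<^sub>R ?g t = B t *\<^sub>R ?v t" using v[of t] Bnz by simp
    have "- pGamma (?g t) (?v t) (?v t) = (4 * b / B t) *\<^sub>R ?g t - (2 * B' t / B t) *\<^sub>R ?v t"
    proof -
      have "pGamma (?g t) (?v t) (?v t) = (B t / b) *\<^sub>R ((2 * (b * B' t / (B t)\<^sup>2)) *\<^sub>R ?v t - ((2 * b / B t)\<^sup>2) *\<^sub>R ?g t)"
        unfolding pGamma_def n1 gv vv by (simp add: scaleR_add_left[symmetric])
      then show ?thesis
        using Bnz b by (simp add: scaleR_diff_right power2_eq_square)
    qed
    moreover have "(1 / B t) *\<^sub>R (4 *\<^sub>R A t - (B' t *\<^sub>R ?v t + (4 * (B t - b)) *\<^sub>R ?g t)) + (- (B' t / (B t)\<^sup>2)) *\<^sub>R (B t *\<^sub>R ?v t)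
      = (4 * b / B t) *\<^sub>R ?g t - (2 * B' t / B t) *\<^sub>R ?v t"
    proof -
      have e1: "4 *\<^sub>R A t - (B' t *\<^sub>R ?v t + (4 * (B t - b)) *\<^sub>R ?g t) = (4 * b) *\<^sub>R ?g t - B' t *\<^sub>R ?v t"
        unfolding gA by (simp add: algebra_simps)
      have e2: "(- (B' t / (B t)\<^sup>2)) *\<^sub>R (B t *\<^sub>R ?v t) = - ((B' t / B t) *\<^sub>R ?v t)"
        using Bnz by (simp add: power2_eq_square)
      have e3: "2 * B' t / B t = B' t / B t + B' t / B t" by simp
      show ?thesis unfolding e1 e2 e3 scaleR_add_left scaleR_diff_right by simp
    qed
    ultimately show ?thesis unfolding N by simp
  qed
  ultimately show "(?v has_vector_derivative - pGamma (?g t) (?v t) (?v t)) (at t)" by simp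
qed

text \<open>The geodesic with initial point \<open>x\<close> and initial velocity \<open>u\<close>.\<close>

definition pcurve :: "real^'n \<Rightarrow> real^'n \<Rightarrow> real \<Rightarrow> real^'n" where
  "pcurve x u t = pgeo x (sgn u) (t * (norm u / (1 - x \<bullet> x)))"

definition pcurve' :: "real^'n \<Rightarrow> real^'n \<Rightarrow> real \<Rightarrow> real^'n" where
  "pcurve' x u t = (norm u / (1 - x \<bullet> x)) *\<^sub>R pgeo' x (sgn u) (t * (norm u / (1 - x \<bullet> x)))"

lemma pGamma_scaleR: "pGamma x (r *\<^sub>R u) (r *\<^sub>R u) = (r * r) *\<^sub>R pGamma x u u"
  by (simp add: pGamma_def scaleR_add_right scaleR_diff_right mult_ac)

lemma pcurve_props:
  assumes x: "norm x < 1"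
  shows "(pcurve x u has_vector_derivative pcurve' x u t) (at t)"
    "(pcurve' x u has_vector_derivative - pGamma (pcurve x u t) (pcurve' x u t) (pcurve' x u t)) (at t)"
    "pcurve x u 0 = x" "pcurve' x u 0 = u" "norm (pcurve x u t) < 1"
    "pmet (pcurve x u t) (pcurve' x u t) (pcurve' x u t) = pmet x u u"
proof -
  let ?r = "norm u / (1 - x \<bullet> x)"
  have s: "1 - x \<bullet> x > 0" using ball_inner(2)[OF x] by simp
  have e: "norm (sgn u) \<le> 1" by (simp add: norm_sgn)
  show "pcurve x u 0 = x" by (simp add: pcurve_def)
  show "norm (pcurve x u t) < 1" unfolding pcurve_def by (rule norm_pgeo[OF x e])
  have "((\<lambda>t. t * c) has_vector_derivative c) (at t)" for t c :: real
    by (auto simp: has_vector_derivative_def intro!: derivative_eq_intros)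
  then have dr: "((\<lambda>t. t * ?r) has_vector_derivative ?r) (at t)" for t :: real .
  show "(pcurve x u has_vector_derivative pcurve' x u t) (at t)"
    using vector_diff_chain_at[OF dr pgeo_has_derivative[OF x e]]
    by (simp add: pcurve_def[abs_def] pcurve'_def o_def)
  \<comment> \<open>\<open>sgn 0 = 0\<close> is not a unit vector, so the constant curve is treated
    apart.\<close>
  consider "u = 0" | "u \<noteq> 0" by blast
  then have "(pcurve' x u has_vector_derivative - pGamma (pcurve x u t) (pcurve' x u t) (pcurve' x u t)) (at t)
    \<and> pcurve' x u 0 = u \<and> pmet (pcurve x u t) (pcurve' x u t) (pcurve' x u t) = pmet x u u"
  proof cases
    case 1
    then show ?thesis
      by (simp add: pcurve'_def[abs_def] pGamma_def poincare_metric_def)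
  next
    case 2
    then have e1: "norm (sgn u) = 1" by (simp add: norm_sgn)
    have "((\<lambda>t. ?r *\<^sub>R pgeo' x (sgn u) (t * ?r)) has_vector_derivative
      ?r *\<^sub>R (?r *\<^sub>R - pGamma (pgeo x (sgn u) (t * ?r)) (pgeo' x (sgn u) (t * ?r)) (pgeo' x (sgn u) (t * ?r)))) (at t)"
      using bounded_linear.has_vector_derivative[OF bounded_linear_scaleR_right
          vector_diff_chain_at[OF dr pgeo_geodesic(1)[OF x e1]], of ?r]
      by (simp add: o_def)
    then have "(pcurve' x u has_vector_derivative - pGamma (pcurve x u t) (pcurve' x u t) (pcurve' x u t)) (at t)"
      unfolding pcurve_def pcurve'_def pGamma_scaleR by simp
    moreover have "pcurve' x u 0 = u"
      using s 2 pgeo_geodesic(2)[OF x e1] by (simp add: pcurve'_def sgn_div_norm)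
    moreover have "pmet (pcurve x u t) (pcurve' x u t) (pcurve' x u t) = ?r\<^sup>2 * pmet (pgeo x (sgn u) (t * ?r)) (pgeo' x (sgn u) (t * ?r)) (pgeo' x (sgn u) (t * ?r))"
      by (simp add: pcurve_def pcurve'_def poincare_metric_def power2_eq_square)
    ultimately show ?thesis
      unfolding pgeo_geodesic(3)[OF x e1]
      by (simp add: poincare_metric_def power2_norm_eq_inner[symmetric] power_divide)
  qed
  then show "(pcurve' x u has_vector_derivative - pGamma (pcurve x u t) (pcurve' x u t) (pcurve' x u t)) (at t)"
    "pcurve' x u 0 = u" "pmet (pcurve x u t) (pcurve' x u t) (pcurve' x u t) = pmet x u u" by blast+
qed

lemma pcurve_geodesic: "norm x < 1 \<Longrightarrow> geodesic_on B1 pmet UNIV (pcurve x u)"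
  unfolding geodesic_on_def
  using pcurve_props(1,2,5)[of x u] by (auto intro!: exI[of _ "pcurve' x u"] simp: christoffel_poincare)

lemma poincare_geodesic_unique:
  fixes \<gamma> :: "real \<Rightarrow> real^'n"
  assumes "geodesic_on B1 pmet I \<gamma>" "0 \<in> I" "(\<gamma> has_vector_derivative u) (at 0)" "t \<in> I"
  shows "\<gamma> t = pcurve (\<gamma> 0) u t"
proof -
  obtain \<gamma>' where I: "open I" "is_interval I" "\<gamma> ` I \<subseteq> B1"
    and d: "\<And>t. t \<in> I \<Longrightarrow> (\<gamma> has_vector_derivative \<gamma>' t) (at t)"
      "\<And>t. t \<in> I \<Longrightarrow> (\<gamma>' has_vector_derivative - christoffel pmet (\<gamma> t) (\<gamma>' t) (\<gamma>' t)) (at t)"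
    using assms(1) unfolding geodesic_on_def by blast
  have n: "norm (\<gamma> t) < 1" if "t \<in> I" for t using I(3) that by auto
  note x = n[OF assms(2)]
  have "(\<lambda>t. (\<gamma> t, \<gamma>' t)) t = (\<lambda>t. (pcurve (\<gamma> 0) u t, pcurve' (\<gamma> 0) u t)) t"
  proof (rule ode_unique[OF I(1) is_interval_connected[OF I(2)] assms(2), where G = "\<lambda>(x, u). (u, - pGamma x u u)"])
    show "((\<lambda>t. (\<gamma> t, \<gamma>' t)) has_vector_derivative (case (\<gamma> t, \<gamma>' t) of (x, u) \<Rightarrow> (u, - pGamma x u u))) (at t)" if "t \<in> I" for t
      using has_vector_derivative_Pair[OF d(1)[OF that] d(2)[OF that]] by (simp add: christoffel_poincare n that)
    show "((\<lambda>t. (pcurve (\<gamma> 0) u t, pcurve' (\<gamma> 0) u t)) has_vector_derivative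
        (case (pcurve (\<gamma> 0) u t, pcurve' (\<gamma> 0) u t) of (x, u) \<Rightarrow> (u, - pGamma x u u))) (at t)" for t
      using has_vector_derivative_Pair[OF pcurve_props(1,2)[OF x]] by simp
    show "(\<gamma> 0, \<gamma>' 0) = (pcurve (\<gamma> 0) u 0, pcurve' (\<gamma> 0) u 0)"
      using vector_derivative_unique_at[OF d(1)[OF assms(2)] assms(3)] by (simp add: pcurve_props(3,4)[OF x])
    show "loc_lipschitz_at (\<gamma> t, \<gamma>' t) (\<lambda>(x, u). (u, - pGamma x u u))" if "t \<in> I" for t
      by (rule loc_lipschitz_pGamma) (simp add: n that)
  qed (use assms(4) in auto)
  then show ?thesis by simp
qed

lemma riem_exp_poincare:
  assumes x: "norm x < 1"
  shows "riem_exp B1 pmet x u = pcurve x u 1"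
  unfolding riem_exp_def
proof (rule the_equality)
  show "\<exists>I \<gamma>. geodesic_on B1 pmet I \<gamma> \<and> {0..1} \<subseteq> I \<and> \<gamma> 0 = x \<and> (\<gamma> has_vector_derivative u) (at 0) \<and> \<gamma> 1 = pcurve x u 1"
    using pcurve_geodesic[OF x, of u] pcurve_props(1)[OF x, of u 0] pcurve_props(3,4)[OF x]
    by (intro exI[of _ UNIV] exI[of _ "pcurve x u"]) auto
  fix p assume "\<exists>I \<gamma>. geodesic_on B1 pmet I \<gamma> \<and> {0..1} \<subseteq> I \<and> \<gamma> 0 = x \<and> (\<gamma> has_vector_derivative u) (at 0) \<and> \<gamma> 1 = p"
  then obtain I \<gamma> where g: "geodesic_on B1 pmet I \<gamma>" "{0..1} \<subseteq> I" "\<gamma> 0 = x" "(\<gamma> has_vector_derivative u) (at 0)" "\<gamma> 1 = p"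
    by blast
  have "(0::real) \<in> {0..1}" "(1::real) \<in> {0..1}" by auto
  then have "0 \<in> I" "1 \<in> I" using g(2) by blast+
  then show "p = pcurve x u 1" using poincare_geodesic_unique[OF g(1) _ g(4)] g(3,5) by metis
qed

subsection \<open>Hyperbolic distance\<close>

lemma tanh_artanh_real:
  fixes x :: real
  assumes "\<bar>x\<bar> < 1"
  shows "tanh (artanh x) = x"
proof -
  have p: "(1 + x) / (1 - x) > 0" using assms by (auto simp: abs_less_iff)
  have "exp (- 2 * artanh x) = inverse ((1 + x) / (1 - x))"
    using p by (simp add: artanh_def exp_minus)
  then have "tanh (artanh x) = (1 - (1 - x) / (1 + x)) / (1 + (1 - x) / (1 + x))"
    unfolding tanh_real_altdef by simp
  moreover have nz: "1 + x \<noteq> 0" using assms by auto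
  then have "1 - (1 - x) / (1 + x) = 2 * x / (1 + x)" "1 + (1 - x) / (1 + x) = 2 / (1 + x)"
    by (simp_all add: field_simps)
  ultimately show ?thesis using nz by simp
qed

text \<open>A calibration argument. After \<open>x\<close> is moved to 0, the curve is projected to
  the direction \<open>e\<close> of its end point; \<open>artanh (\<delta> t \<bullet> e)\<close>
  grows no faster than arc length, and runs from 0 to the claimed distance.\<close>

lemma curve_length_ge:
  fixes \<gamma> :: "real \<Rightarrow> real^'n"
  assumes c1: "\<gamma> C1_differentiable_on {0..1}" and B: "\<gamma> ` {0..1} \<subseteq> B1" and x: "norm x < 1" "\<gamma> 0 = x"
  shows "artanh (norm (pmob x (\<gamma> 1))) \<le> curve_length pmet \<gamma>"
proof -
  obtain D where D: "\<And>t. t \<in> {0..1} \<Longrightarrow> (\<gamma> has_vector_derivative D t) (at t)" and contD: "continuous_on {0..1} D"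
    using c1 unfolding C1_differentiable_on_def by blast
  have n: "norm (\<gamma> t) < 1" if "t \<in> {0..1}" for t using B that by (simp add: image_subset_iff)
  define \<delta> where "\<delta> t = pmob x (\<gamma> t)" for t
  define e where "e = sgn (\<delta> 1)"
  have e: "norm e \<le> 1" by (simp add: e_def norm_sgn)
  have nd: "norm (\<delta> t) < 1" if "t \<in> {0..1}" for t unfolding \<delta>_def by (rule norm_pmob[OF x(1) n[OF that]])
  have d: "(\<delta> has_vector_derivative pmob' x (\<gamma> t) (D t)) (at t)" if "t \<in> {0..1}" for t
    unfolding \<delta>_def using has_derivative_compose[OF D[OF that, unfolded has_vector_derivative_def] has_derivative_pmob[OF x(1) n[OF that]]]
    by (simp add: has_vector_derivative_def pmob'_smult)
  have de: "\<bar>\<delta> t \<bullet> e\<bar> \<le> norm (\<delta> t)" for t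
    using Cauchy_Schwarz_ineq2[of "\<delta> t" e] e by (meson mult_left_le norm_ge_zero order_trans)
  let ?f = "\<lambda>t. sqrt (pmet (\<gamma> t) (vector_derivative \<gamma> (at t)) (vector_derivative \<gamma> (at t)))"
  have f: "?f t = sqrt (pmet (\<delta> t) (pmob' x (\<gamma> t) (D t)) (pmob' x (\<gamma> t) (D t)))" if "t \<in> {0..1}" for t
    unfolding \<delta>_def pmet_pmob[OF x(1) n[OF that]] using vector_derivative_at[OF D[OF that]] by simp
  have cont\<gamma>: "continuous_on {0..1} \<gamma>"
    using D by (meson continuous_at_imp_continuous_on has_vector_derivative_continuous)
  have "continuous_on {0..1} (\<lambda>t. sqrt (pmet (\<gamma> t) (D t) (D t)))"
    unfolding poincare_metric_def power2_norm_eq_inner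
    by (intro continuous_intros cont\<gamma> contD) (use ball_inner(2)[OF n] in \<open>force\<close>)
  then have "continuous_on {0..1} ?f"
    by (rule continuous_on_eq) (simp add: vector_derivative_at[OF D])
  then have int: "?f integrable_on {0..1}" by (rule integrable_continuous_real)
  have ft: "((\<lambda>t. (pmob' x (\<gamma> t) (D t) \<bullet> e) / (1 - (\<delta> t \<bullet> e)\<^sup>2)) has_integral
      (artanh (\<delta> 1 \<bullet> e) - artanh (\<delta> 0 \<bullet> e))) {0..1}"
  proof (rule fundamental_theorem_of_calculus)
    fix t :: real assume t: "t \<in> {0..1}"
    have lt: "\<bar>\<delta> t \<bullet> e\<bar> < 1" using de[of t] nd[OF t] by simp
    have "((\<lambda>t. \<delta> t \<bullet> e) has_real_derivative pmob' x (\<gamma> t) (D t) \<bullet> e) (at t)"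
      using bounded_linear.has_vector_derivative[OF bounded_linear_inner_left d[OF t], of e]
      by (simp add: has_real_derivative_iff_has_vector_derivative)
    then have "((\<lambda>t. artanh (\<delta> t \<bullet> e)) has_real_derivative (1 / (1 - (\<delta> t \<bullet> e)\<^sup>2)) * (pmob' x (\<gamma> t) (D t) \<bullet> e)) (at t)"
      by (rule DERIV_chain2[where f = artanh and g = "\<lambda>t. \<delta> t \<bullet> e", OF artanh_real_has_field_derivative[OF lt]])
    then have "((\<lambda>t. artanh (\<delta> t \<bullet> e)) has_vector_derivative (pmob' x (\<gamma> t) (D t) \<bullet> e) / (1 - (\<delta> t \<bullet> e)\<^sup>2)) (at t)"
      by (simp add: has_real_derivative_iff_has_vector_derivative)
    then show "((\<lambda>t. artanh (\<delta> t \<bullet> e)) has_vector_derivative (pmob' x (\<gamma> t) (D t) \<bullet> e) / (1 - (\<delta> t \<bullet> e)\<^sup>2)) (at t within {0..1})"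
      by (rule has_vector_derivative_at_within)
  qed simp
  have "artanh (\<delta> 1 \<bullet> e) - artanh (\<delta> 0 \<bullet> e) \<le> integral {0..1} ?f"
  proof (rule has_integral_le[OF ft integrable_integral[OF int]])
    fix t :: real assume t: "t \<in> {0..1}"
    let ?w = "pmob' x (\<gamma> t) (D t)"
    have s: "1 - \<delta> t \<bullet> \<delta> t > 0" using ball_inner(2)[OF nd[OF t]] by simp
    have "(\<delta> t \<bullet> e)\<^sup>2 \<le> \<delta> t \<bullet> \<delta> t"
      using power_mono[OF de[of t], of 2] by (simp add: power2_norm_eq_inner)
    moreover have "?w \<bullet> e \<le> norm ?w"
      using Cauchy_Schwarz_ineq2[of ?w e] e by (meson abs_le_D1 mult_left_le norm_ge_zero order_trans)
    ultimately have "(?w \<bullet> e) / (1 - (\<delta> t \<bullet> e)\<^sup>2) \<le> norm ?w / (1 - \<delta> t \<bullet> \<delta> t)"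
      using s by (intro frac_le) auto
    also have "\<dots> = sqrt (pmet (\<delta> t) ?w ?w)"
      unfolding poincare_metric_def power2_norm_eq_inner
      using s by (simp add: real_sqrt_divide norm_eq_sqrt_inner)
    also have "\<dots> = ?f t" by (rule f[OF t, symmetric])
    finally show "(?w \<bullet> e) / (1 - (\<delta> t \<bullet> e)\<^sup>2) \<le> ?f t" .
  qed
  moreover have "\<delta> 0 \<bullet> e = 0" using x(2) by (simp add: \<delta>_def)
  moreover have "\<delta> 1 \<bullet> e = norm (\<delta> 1)"
    by (cases "\<delta> 1 = 0") (simp_all add: e_def sgn_div_norm dot_square_norm power2_eq_square)
  ultimately show ?thesis by (simp add: curve_length_def \<delta>_def)
qed

lemma artanh_nonneg: "0 \<le> a \<Longrightarrow> a < 1 \<Longrightarrow> artanh a \<ge> (0::real)"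
  by (simp add: artanh_def ln_ge_zero)

text \<open>The vector is the logarithm of \<open>p\<close> at \<open>x\<close>:
  \<open>artanh\<close> gives its hyperbolic length, and the factor \<open>1 - x \<bullet> x\<close>
  converts this to Euclidean length at \<open>x\<close>.\<close>

lemma pcurve_log:
  assumes x: "norm x < 1" and p: "norm p < 1"
  shows "pcurve x ((artanh (norm (pmob x p)) * (1 - x \<bullet> x)) *\<^sub>R sgn (pmob x p)) 1 = p"
proof -
  let ?w = "pmob x p"
  define r where "r = artanh (norm ?w)"
  define u where "u = (r * (1 - x \<bullet> x)) *\<^sub>R sgn ?w"
  have w: "norm ?w < 1" by (rule norm_pmob[OF x p])
  have r0: "r \<ge> 0" unfolding r_def using w by (intro artanh_nonneg) auto
  have s: "1 - x \<bullet> x > 0" using ball_inner(2)[OF x] by simp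
  have tr: "tanh r = norm ?w" unfolding r_def using w by (intro tanh_artanh_real) auto
  have "tanh (norm u / (1 - x \<bullet> x)) *\<^sub>R sgn u = ?w"
  proof (cases "?w = 0 \<or> r = 0")
    case True
    then have "?w = 0" using tr by auto
    then show ?thesis by (simp add: u_def)
  next
    case False
    then have "norm u / (1 - x \<bullet> x) = r" "sgn u = sgn ?w"
      using r0 s by (simp_all add: u_def norm_sgn sgn_scaleR sgn_div_norm[of "sgn ?w"])
    moreover have "?w \<noteq> 0" using False by blast
    ultimately show ?thesis by (simp add: tr sgn_div_norm[of ?w])
  qed
  then show ?thesis
    using pmob_inverse(1)[OF x p] by (simp add: pcurve_def pgeo_def u_def[symmetric] r_def[symmetric])
qed

lemma riem_dist_poincare:
  assumes x: "norm x < 1" and p: "norm p < 1"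
  shows "riem_dist B1 pmet x p = artanh (norm (pmob x p))"
proof -
  let ?w = "pmob x p"
  define r where "r = artanh (norm ?w)"
  define u where "u = (r * (1 - x \<bullet> x)) *\<^sub>R sgn ?w"
  have w: "norm ?w < 1" by (rule norm_pmob[OF x p])
  have r0: "r \<ge> 0" unfolding r_def using w by (intro artanh_nonneg) auto
  have s: "1 - x \<bullet> x > 0" using ball_inner(2)[OF x] by simp
  have end1: "pcurve x u 1 = p" using pcurve_log[OF x p] by (simp add: u_def r_def)
  have "pmet x u u = (norm u / (1 - x \<bullet> x))\<^sup>2"
    by (simp add: poincare_metric_def power2_norm_eq_inner power_divide)
  moreover have "norm u / (1 - x \<bullet> x) = r"
  proof (cases "?w = 0")
    case True
    then have "r = 0" by (simp add: r_def)
    then show ?thesis by (simp add: u_def)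
  qed (use r0 s in \<open>simp add: u_def norm_sgn\<close>)
  ultimately have pu: "sqrt (pmet x u u) = r" using r0 by simp
  have c1: "pcurve x u C1_differentiable_on {0..1}"
    unfolding C1_differentiable_on_def
    by (intro exI[of _ "pcurve' x u"] conjI ballI pcurve_props(1)[OF x] continuous_at_imp_continuous_on)
      (use pcurve_props(2)[OF x] has_vector_derivative_continuous in blast)
  have len: "curve_length pmet (pcurve x u) = r"
    unfolding curve_length_def vector_derivative_at[OF pcurve_props(1)[OF x]] pcurve_props(6)[OF x] pu by simp
  show ?thesis
    unfolding riem_dist_def
  proof (rule cInf_eq_minimum)
    show "artanh (norm ?w) \<in> {curve_length pmet \<gamma> |\<gamma>. \<gamma> C1_differentiable_on {0..1} \<and> \<gamma> ` {0..1} \<subseteq> B1 \<and> \<gamma> 0 = x \<and> \<gamma> 1 = p}"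
      using c1 len end1 pcurve_props(3,5)[OF x, of u] by (auto simp: r_def intro!: exI[of _ "pcurve x u"])
    fix l assume "l \<in> {curve_length pmet \<gamma> |\<gamma>. \<gamma> C1_differentiable_on {0..1} \<and> \<gamma> ` {0..1} \<subseteq> B1 \<and> \<gamma> 0 = x \<and> \<gamma> 1 = p}"
    then show "artanh (norm ?w) \<le> l" using curve_length_ge[OF _ _ x] by auto
  qed
qed

section \<open>Tangent spaces and orientations\<close>

text \<open>Bounds tangent spaces of level sets from above; bounds from below are obtained by
  exhibiting curves.\<close>

lemma tangent_space_const:
  fixes f :: "'a::real_normed_vector \<Rightarrow> real"
  assumes "w \<in> tangent_space N q" "\<And>p. p \<in> N \<Longrightarrow> f p = k" "(f has_derivative f') (at q)"
  shows "f' w = 0"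
proof -
  obtain c e where c: "e > 0" "c ` {-e<..<e} \<subseteq> N" "c (0::real) = q" "(c has_vector_derivative w) (at 0)"
    using assms(1) unfolding tangent_space_def by blast
  have f': "(f has_derivative f') (at (c 0))" using assms(3) c(3) by simp
  have lin: "linear f'" using assms(3) has_derivative_linear by blast
  have "((\<lambda>t. f (c t)) has_derivative (\<lambda>r. f' (r *\<^sub>R w))) (at 0)"
    using has_derivative_compose[OF c(4)[unfolded has_vector_derivative_def] f'] .
  moreover have "((\<lambda>t. f (c t)) has_derivative (\<lambda>r. 0)) (at 0)"
  proof (rule has_derivative_transform_within_open[of "\<lambda>_. k" _ _ _ "{-e<..<e}"])
    show "k = f (c t)" if "t \<in> {-e<..<e}" for t using assms(2)[of "c t"] c(2) that by force
  qed (use c(1) in auto)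
  ultimately have "(\<lambda>r. f' (r *\<^sub>R w)) = (\<lambda>r. 0)" by (rule has_derivative_unique)
  from fun_cong[OF this, of 1] show ?thesis by simp
qed

text \<open>Each differentiation shifts the phase by \<open>pi / 2\<close>, which gives a sequence
  closed under differentiation; the third shift of \<open>cos\<close> is \<open>sin\<close>.\<close>

lemma Ck_on_cos: "Ck_on k UNIV (cos :: real \<Rightarrow> real)" and Ck_on_sin: "Ck_on k UNIV (sin :: real \<Rightarrow> real)"
proof -
  have c: "Ck_on k UNIV (\<lambda>t. cos (t + j * (pi / 2)))" for j :: nat
  proof (rule Ck_on_derivative_seq[where f = "\<lambda>j t. cos (t + real j * (pi / 2))"])
    fix j :: nat and t :: real
    have "t + real (Suc j) * (pi / 2) = (t + real j * (pi / 2)) + pi / 2" by (simp add: distrib_right)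
    then have "cos (t + real (Suc j) * (pi / 2)) = - sin (t + real j * (pi / 2))" by (simp only: cos_add) simp
    then show "((\<lambda>t. cos (t + real j * (pi / 2))) has_real_derivative cos (t + real (Suc j) * (pi / 2))) (at t)"
      by (auto intro!: derivative_eq_intros simp del: of_nat_Suc)
  qed simp
  show "Ck_on k UNIV (cos :: real \<Rightarrow> real)" using c[of 0] by simp
  have "(\<lambda>t::real. cos (t + real 3 * (pi / 2))) = sin"
  proof
    fix t :: real
    have "t + real 3 * (pi / 2) = (t - pi / 2) + 2 * pi" by simp
    then show "cos (t + real 3 * (pi / 2)) = sin t" by (simp only: cos_periodic) (simp add: cos_diff)
  qed
  then show "Ck_on k UNIV (sin :: real \<Rightarrow> real)" using c[of 3] by simp
qed

lemma Ck_on_re_vec: "open U \<Longrightarrow> Ck_on k U f \<Longrightarrow> Ck_on k U (\<lambda>x. re_vec (f x))"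
  by (rule Ck_on_linear_comp[OF _ bounded_linear_re_vec])

lemma Ck_on_pmob:
  assumes "open U" "Ck_on k U f" "norm a < 1" "\<And>x. x \<in> U \<Longrightarrow> norm (f x) < 1"
  shows "Ck_on k U (\<lambda>x. pmob a (f x))"
  unfolding pmob_def
proof (intro Ck_on_re_vec Ck_on_mob Ck_on_ofr assms(1,2))
  show "mob_den a (ofr (f x)) \<noteq> 0" if "x \<in> U" for x
    using pden_pos[OF assms(3) assms(4)[OF that]] by (simp add: mob_den_ofr)
qed

lemma pmob'_inverse:
  assumes a: "norm a < 1" and x: "norm x < 1"
  shows "pmob' (- a) (pmob a x) (pmob' a x v) = v" "pmob' a x (pmob' (- a) (pmob a x) v) = v"
proof -
  have 1: "pmob' (- a) (pmob a x) (pmob' a x v) = v" if a: "norm a < 1" and x: "norm x < 1" for a x v :: "real^'a"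
  proof -
    have "((\<lambda>x. pmob (- a) (pmob a x)) has_derivative (\<lambda>v. pmob' (- a) (pmob a x) (pmob' a x v))) (at x)"
      using has_derivative_compose[OF has_derivative_pmob[OF a x] has_derivative_pmob[OF _ norm_pmob[OF a x]]] a by simp
    moreover have "((\<lambda>x. pmob (- a) (pmob a x)) has_derivative (\<lambda>v. v)) (at x)"
      by (rule has_derivative_transform_within_open[OF has_derivative_ident open_ball[of 0 1]])
        (use x pmob_inverse(1)[OF a] in auto)
    ultimately show ?thesis using has_derivative_unique by metis
  qed
  show "pmob' (- a) (pmob a x) (pmob' a x v) = v" by (rule 1[OF a x])
  show "pmob' a x (pmob' (- a) (pmob a x) v) = v"
    using 1[of "- a" "pmob a x" v] a norm_pmob[OF a x] by (simp add: pmob_inverse(1)[OF a x])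
qed

lemma pmob'_self:
  assumes "norm a < 1"
  shows "pmob' a a v = (1 / (1 - a \<bullet> a)) *\<^sub>R v"
proof -
  have s: "1 - a \<bullet> a \<noteq> 0" using ball_inner(2)[OF assms] by simp
  have p: "pden a a = (1 - a \<bullet> a) * (1 - a \<bullet> a)" by (simp add: pden_def algebra_simps)
  have r: "inverse (r * r) * r = 1 / r" if "r \<noteq> 0" for r :: real using that by (simp add: field_simps)
  have "mob' a (ofr a) (ofr v) = inverse (complex_of_real ((1 - a \<bullet> a) * (1 - a \<bullet> a))) *s (complex_of_real (1 - a \<bullet> a) *s ofr v)"
    unfolding mob'_def mob_den_ofr p by (simp add: mob_num'_def cdot_ofr inner_commute[of v a])
  also have "\<dots> = complex_of_real (1 / (1 - a \<bullet> a)) *s ofr v"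
    unfolding vector_smult_assoc by (simp only: of_real_inverse[symmetric] of_real_mult[symmetric] r[OF s])
  finally have "mob' a (ofr a) (ofr v) = ofr ((1 / (1 - a \<bullet> a)) *\<^sub>R v)" by (simp only: ofr_simps)
  then show ?thesis by (simp only: ofr_pmob'[symmetric] ofr_eq_iff)
qed

lemma bij_betw_card_less: "bij_betw (\<lambda>i::'n::{finite,linorder}. card {k. k < i}) UNIV {..<CARD('n)}"
proof -
  have mono: "card {k. k < i} < card {k. k < j}" if "i < j" for i j :: 'n
    using that by (intro psubset_card_mono) auto
  then have inj: "inj (\<lambda>i::'n. card {k. k < i})"
    by (metis (mono_tags, lifting) injI less_irrefl linorder_neqE)
  have "card {k. k < i} < CARD('n)" for i :: 'n
    by (rule psubset_card_mono) auto
  then have "(\<lambda>i::'n. card {k. k < i}) ` UNIV \<subseteq> {..<CARD('n)}" by auto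
  moreover have "card ((\<lambda>i::'n. card {k. k < i}) ` UNIV) = card {..<CARD('n)}"
    using inj by (simp add: card_image)
  ultimately have "(\<lambda>i::'n. card {k. k < i}) ` UNIV = {..<CARD('n)}" by (intro card_subset_eq) auto
  then show ?thesis using inj by (simp add: bij_betw_def)
qed

text \<open>With the tail \<open>b\<close> fixed, the determinant is an alternating bilinear form in
  the first two vectors, so changing these within their span multiplies it by a 2 by 2 determinant.
  Orientations are compared through this with \<open>b\<close> kept in place. The explicit form of
  \<open>D\<close> serves to show that it is nonzero.\<close>

lemma direct_basis_first_two:
  fixes b :: "(real^('n::{finite,linorder})) list"
  assumes len: "length b + 2 = CARD('n)"
  shows "\<exists>D. (\<forall>u w. direct_basis (u # w # b) \<longleftrightarrow> D u w > 0) \<and>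
    (\<forall>a c a' c' u w. D (a *\<^sub>R u + c *\<^sub>R w) (a' *\<^sub>R u + c' *\<^sub>R w) = (a * c' - c * a') * (D u w :: real)) \<and>
    (\<forall>u w. D u w = det (\<chi> i. (u # w # b) ! card {k. k < i}))"
proof -
  let ?ix = "\<lambda>i::'n. card {k. k < i}"
  have r: "?ix ` UNIV = {..<CARD('n)}" using bij_betw_card_less[where 'n = 'n] by (simp add: bij_betw_def)
  have "0 \<in> ?ix ` UNIV" unfolding r using len by simp
  then obtain i0 where i0': "0 = ?ix i0" by (rule imageE)
  have "1 \<in> ?ix ` UNIV" unfolding r using len by simp
  then obtain i1 where i1': "1 = ?ix i1" by (rule imageE)
  note i0 = i0'[symmetric] and i1 = i1'[symmetric]
  have ne: "i0 \<noteq> i1" using i0 i1 by auto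
  have eq0: "i = i0" if "?ix i = 0" for i
    using bij_betw_card_less[where 'n = 'n] that i0 by (auto simp: bij_betw_def inj_def)
  have eq1: "i = i1" if "?ix i = 1" for i
    using bij_betw_card_less[where 'n = 'n] that i1 by (auto simp: bij_betw_def inj_def)
  define R where "R = (\<lambda>i. b ! (?ix i - 2))"
  define D where "D u w = det (\<chi> i. (u # w # b) ! ?ix i)" for u w
  have row: "(u # w # b) ! ?ix i = (if i = i0 then u else if i = i1 then w else R i)" for u w i
  proof (cases "?ix i = 0 \<or> ?ix i = 1")
    case True
    then show ?thesis using eq0 eq1 i0 i1 ne by (metis nth_Cons_0 nth_Cons_Suc One_nat_def)
  next
    case False
    then obtain m where m: "?ix i = Suc (Suc m)" by (metis One_nat_def not0_implies_Suc)
    have "i \<noteq> i0" "i \<noteq> i1" using False i0 i1 by auto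
    then show ?thesis by (simp add: R_def m)
  qed
  have D: "D u w = det (\<chi> i. if i = i0 then u else if i = i1 then w else R i)" for u w
    unfolding D_def row ..
  have D': "D u w = det (\<chi> i. if i = i1 then w else if i = i0 then u else R i)" for u w
    unfolding D by (rule arg_cong[where f = det]) (use ne in \<open>auto simp: vec_eq_iff\<close>)
  have add1: "D (u + u') w = D u w + D u' w" for u u' w
    unfolding D using det_row_add[of i0 "\<lambda>_. u" "\<lambda>_. u'" "\<lambda>i. if i = i1 then w else R i"] by simp
  have mul1: "D (c *\<^sub>R u) w = c * D u w" for c u w
    unfolding D using det_row_mul[of i0 c "\<lambda>_. u" "\<lambda>i. if i = i1 then w else R i"] by (simp only: scalar_mult_eq_scaleR)
  have add2: "D u (w + w') = D u w + D u w'" for u w w'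
    unfolding D' using det_row_add[of i1 "\<lambda>_. w" "\<lambda>_. w'" "\<lambda>i. if i = i0 then u else R i"] by simp
  have mul2: "D u (c *\<^sub>R w) = c * D u w" for c u w
    unfolding D' using det_row_mul[of i1 c "\<lambda>_. w" "\<lambda>i. if i = i0 then u else R i"] by (simp only: scalar_mult_eq_scaleR)
  have alt: "D u u = 0" for u
    unfolding D by (rule det_identical_rows[of i0 i1]) (use ne in \<open>auto simp: row_def\<close>)
  have "D (u + w) (u + w) = D u w + D w u" for u w
    unfolding add1 add2 using alt by simp
  then have anti: "D w u = - D u w" for u w using alt by (metis add.inverse_unique)
  show ?thesis
  proof (intro exI[of _ D] conjI allI)
    show "direct_basis (u # w # b) \<longleftrightarrow> D u w > 0" for u w
      using len by (simp add: direct_basis_def D_def)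
    show "D (a *\<^sub>R u + c *\<^sub>R w) (a' *\<^sub>R u + c' *\<^sub>R w) = (a * c' - c * a') * D u w" for a c a' c' u w
      by (simp add: add1 add2 mul1 mul2 alt anti[of w u] algebra_simps)
  qed (simp add: D_def)
qed

section \<open>Spheres in the two models\<close>

definition ty :: "real^'n \<Rightarrow> real^'n \<Rightarrow> real^'n" where
  "ty x v = tanh (norm v / (1 - x \<bullet> x)) *\<^sub>R sgn v"

definition Th :: "real^'n \<Rightarrow> real^'n \<Rightarrow> complex^'n" where
  "Th x v = mob (- x) (\<i> *s ofr (ty x v))"

lemma norm_ty: "norm (ty x v) < 1"
  unfolding ty_def by (rule norm_tanh_lt) (simp add: norm_sgn)

lemma norm_ty_eq: "norm x < 1 \<Longrightarrow> norm (ty x v) = tanh (norm v / (1 - x \<bullet> x))"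
  using ball_inner(2)[of x] by (cases "v = 0") (simp_all add: ty_def norm_sgn)

lemma Th_lie_ball: "norm x < 1 \<Longrightarrow> Th x v \<in> LB"
  unfolding Th_def by (intro mob_lie_ball imag_lie_ball norm_ty) simp

lemma mob_Th: "norm x < 1 \<Longrightarrow> mob x (Th x v) = \<i> *s ofr (ty x v)"
  unfolding Th_def by (rule mob_inverse_lie_ball(2)[OF _ imag_lie_ball[OF norm_ty]])

lemma riem_exp_pmob: "norm x < 1 \<Longrightarrow> riem_exp B1 pmet x u = pmob (- x) (ty x u)"
  by (simp add: riem_exp_poincare pcurve_def pgeo_def ty_def)

lemma ty_inner_zero: "norm x < 1 \<Longrightarrow> w \<bullet> ty x v = 0 \<longleftrightarrow> w \<bullet> v = 0"
  using ball_inner(2)[of x] by (cases "v = 0") (auto simp: ty_def sgn_div_norm)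

lemma hyp_hyperplane_eq:
  assumes x: "norm x < 1"
  shows "hyp_hyperplane x v = {p. norm p < 1 \<and> pmob x p \<bullet> v = 0}"
proof -
  have s: "1 - x \<bullet> x > 0" using ball_inner(2)[OF x] by simp
  have pz: "pmet x u v = 0 \<longleftrightarrow> u \<bullet> v = 0" for u
    using s by (simp add: poincare_metric_def power2_norm_eq_inner)
  show ?thesis
  proof (intro set_eqI iffI)
    fix p assume "p \<in> hyp_hyperplane x v"
    then obtain u where u: "p = pmob (- x) (ty x u)" "u \<bullet> v = 0"
      unfolding hyp_hyperplane_def pz riem_exp_pmob[OF x] by blast
    have "pmob x p = ty x u" unfolding u(1) by (rule pmob_inverse(2)[OF x norm_ty])
    moreover have "norm p < 1" unfolding u(1) using x norm_ty by (intro norm_pmob) auto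
    ultimately show "p \<in> {p. norm p < 1 \<and> pmob x p \<bullet> v = 0}"
      using u(2) by (simp add: ty_def sgn_div_norm)
  next
    fix p assume p: "p \<in> {p. norm p < 1 \<and> pmob x p \<bullet> v = 0}"
    let ?u = "(artanh (norm (pmob x p)) * (1 - x \<bullet> x)) *\<^sub>R sgn (pmob x p)"
    have "riem_exp B1 pmet x ?u = p" using pcurve_log[OF x] p riem_exp_poincare[OF x] by simp
    moreover have "pmet x ?u v = 0" using p by (simp add: pz sgn_div_norm)
    ultimately show "p \<in> hyp_hyperplane x v"
      unfolding hyp_hyperplane_def by (intro CollectI exI[of _ ?u]) simp
  qed
qed

lemma artanh_eq_iff: "0 \<le> a \<Longrightarrow> a < 1 \<Longrightarrow> artanh a = r \<longleftrightarrow> a = tanh r" for a r :: real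
  using tanh_artanh_real[of a] artanh_tanh_real[of r] by auto

lemma sqrt_pmet: "norm x < 1 \<Longrightarrow> sqrt (pmet x v v) = norm v / (1 - x \<bullet> x)"
  using ball_inner(2)[of x] by (simp add: poincare_metric_def power2_norm_eq_inner real_sqrt_divide norm_eq_sqrt_inner)

lemma hyp_sphere_eq:
  assumes x: "norm x < 1"
  shows "hyp_sphere x v = {p. norm p < 1 \<and> pmob x p \<bullet> v = 0 \<and> norm (pmob x p) = norm (ty x v)}"
  unfolding hyp_sphere_def hyp_hyperplane_eq[OF x] sqrt_pmet[OF x] norm_ty_eq[OF x]
  using riem_dist_poincare[OF x] artanh_eq_iff norm_pmob[OF x] by (auto simp: artanh_tanh_real)

section \<open>Spheres as real points of null cones\<close>

definition sphere_pts :: "complex^'n \<Rightarrow> (real^'n) set" where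
  "sphere_pts z = {p. dist (re_vec z) p = norm (im_vec z) \<and> (p - re_vec z) \<bullet> im_vec z = 0}"

lemma cdot_ofr_diff_imag:
  "cdot (ofr q - \<i> *s ofr d) (ofr q - \<i> *s ofr d) = Complex (q \<bullet> q - d \<bullet> d) (- 2 * (q \<bullet> d))"
  by (simp add: cdot_simps cdot_ofr inner_commute[of d q] complex_eq_iff)

lemma ofr_diff_decomp: "ofr p - z = ofr (p - re_vec z) - \<i> *s ofr (im_vec z)"
proof -
  have "ofr p - (ofr (re_vec z) + \<i> *s ofr (im_vec z)) = ofr (p - re_vec z) - \<i> *s ofr (im_vec z)"
    by (simp add: ofr_simps)
  then show ?thesis by (simp only: re_im_decomp[of z, symmetric])
qed

lemma cdot_ofr_diff:
  "cdot (ofr p - z) (ofr p - z) = Complex ((p - re_vec z) \<bullet> (p - re_vec z) - im_vec z \<bullet> im_vec z)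
     (- 2 * ((p - re_vec z) \<bullet> im_vec z))"
  unfolding ofr_diff_decomp[of p z] by (rule cdot_ofr_diff_imag)

lemma dist_eq_norm_iff: "dist a p = norm d \<longleftrightarrow> (p - a) \<bullet> (p - a) = d \<bullet> d"
  for a p :: "'a::real_inner" and d :: "'b::real_inner"
  by (metis dist_commute dist_norm norm_eq_sqrt_inner real_sqrt_eq_iff)

lemma sphere_pts_iff: "p \<in> sphere_pts z \<longleftrightarrow> cdot (ofr p - z) (ofr p - z) = 0"
  unfolding sphere_pts_def cdot_ofr_diff by (simp add: complex_eq_iff dist_eq_norm_iff)

text \<open>With center \<open>c\<close>, normal \<open>d\<close> and \<open>q = p - c\<close>, one
  has \<open>p \<bullet> p = c \<bullet> c + d \<bullet> d + 2 * (c \<bullet> q)\<close>. As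
  \<open>q\<close> and \<open>d\<close> are orthogonal of equal length, Bessel's inequality bounds
  \<open>2 * (c \<bullet> q)\<close> by the square root in the definition of the Lie ball.\<close>

lemma sphere_pts_ball:
  assumes z: "z \<in> LB" and p: "p \<in> sphere_pts z"
  shows "norm p < 1"
proof -
  define c where "c = re_vec z"
  define d where "d = im_vec z"
  define q where "q = p - c"
  have q: "q \<bullet> q = d \<bullet> d" "q \<bullet> d = 0"
    using p by (auto simp: sphere_pts_def q_def c_def d_def dist_eq_norm_iff)
  have zd: "z = ofr c + \<i> *s ofr d" unfolding c_def d_def by (rule re_im_decomp)
  have N: "(norm z)\<^sup>2 = c \<bullet> c + d \<bullet> d"
    using norm_re_vec[of z] unfolding c_def[symmetric]
    by (simp add: zd cdot_simps cdot_ofr power2_norm_eq_inner)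
  have Q: "(cmod (cdot z z))\<^sup>2 = (c \<bullet> c - d \<bullet> d)\<^sup>2 + (2 * (c \<bullet> d))\<^sup>2"
    unfolding cmod_power2 by (simp add: zd cdot_simps cdot_ofr inner_commute[of d c])
  have "norm z ^ 4 = ((norm z)\<^sup>2)\<^sup>2" by simp
  then have e: "norm z ^ 4 - (cmod (cdot z z))\<^sup>2 = 4 * ((c \<bullet> c) * (d \<bullet> d) - (c \<bullet> d)\<^sup>2)"
    unfolding N Q by (simp add: power2_eq_square algebra_simps)
  have "(c \<bullet> q)\<^sup>2 \<le> (c \<bullet> c) * (d \<bullet> d) - (c \<bullet> d)\<^sup>2"
  proof (cases "d = 0")
    case True
    then have "q = 0" using q(1) by simp
    then show ?thesis using True by simp
  next
    case False
    then have dd: "d \<bullet> d > 0" by simp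
    let ?u = "(d \<bullet> d) *\<^sub>R c - (c \<bullet> q) *\<^sub>R q - (c \<bullet> d) *\<^sub>R d"
    have "0 \<le> ?u \<bullet> ?u" by simp
    also have "?u \<bullet> ?u = (d \<bullet> d) * ((d \<bullet> d) * (c \<bullet> c) - (c \<bullet> q)\<^sup>2 - (c \<bullet> d)\<^sup>2)"
      using q by (simp add: inner_diff_left inner_diff_right inner_commute[of q c] inner_commute[of d c] inner_commute[of d q] power2_eq_square algebra_simps)
    finally have "0 \<le> (d \<bullet> d) * (c \<bullet> c) - (c \<bullet> q)\<^sup>2 - (c \<bullet> d)\<^sup>2" using dd by (simp add: zero_le_mult_iff)
    then show ?thesis by (simp add: mult.commute)
  qed
  then have "(2 * (c \<bullet> q))\<^sup>2 \<le> norm z ^ 4 - (cmod (cdot z z))\<^sup>2"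
    unfolding e by (simp add: power_mult_distrib)
  then have "2 * (c \<bullet> q) \<le> sqrt (norm z ^ 4 - (cmod (cdot z z))\<^sup>2)" by (rule real_le_rsqrt)
  moreover have "p \<bullet> p = c \<bullet> c + d \<bullet> d + 2 * (c \<bullet> q)"
  proof -
    have "p = c + q" by (simp add: q_def)
    then show ?thesis using q by (simp add: inner_add_left inner_add_right inner_commute[of q c])
  qed
  ultimately have "p \<bullet> p < 1" using z N unfolding lie_ball_def lie_Q_eq by simp
  then show ?thesis by (simp add: norm_eq_sqrt_inner)
qed

text \<open>The two real equations of the hyperbolic sphere, with \<open>x\<close> moved to 0, are
  packed into one complex number, which is a multiple of the null cone equation for
  \<open>Th x v\<close>. The factor is split into a constant and a part depending on
  \<open>q\<close>, in view of differentiation in \<open>q\<close>.\<close>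

lemma mob_sphere_relation:
  assumes x: "norm x < 1" and q: "norm q < 1"
  shows "Complex (pmob x q \<bullet> pmob x q - ty x v \<bullet> ty x v) (- 2 * (pmob x q \<bullet> ty x v))
    = (of_real (1 - x \<bullet> x))\<^sup>2 / mob_den x (Th x v) * inverse (of_real (pden x q)) * cdot (ofr q - Th x v) (ofr q - Th x v)"
proof -
  have d: "mob_den x (ofr q) \<noteq> 0" using pden_pos[OF x q] by (simp add: mob_den_ofr)
  have d': "mob_den x (Th x v) \<noteq> 0" by (rule mob_den_nz[OF x Th_lie_ball[OF x]])
  have "Complex (pmob x q \<bullet> pmob x q - ty x v \<bullet> ty x v) (- 2 * (pmob x q \<bullet> ty x v))
     = cdot (ofr (pmob x q) - \<i> *s ofr (ty x v)) (ofr (pmob x q) - \<i> *s ofr (ty x v))"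
    by (rule cdot_ofr_diff_imag[symmetric])
  also have "\<dots> = cdot (mob x (ofr q) - mob x (Th x v)) (mob x (ofr q) - mob x (Th x v))"
    by (simp only: ofr_pmob mob_Th[OF x])
  also have "\<dots> = (of_real (1 - x \<bullet> x))\<^sup>2 * cdot (ofr q - Th x v) (ofr q - Th x v) / (mob_den x (ofr q) * mob_den x (Th x v))"
    by (rule cdot_mob_diff[OF d d'])
  finally show ?thesis by (simp only: mob_den_ofr divide_inverse inverse_mult_distrib mult_ac)
qed

lemma sphere_pts_Th:
  assumes x: "norm x < 1"
  shows "sphere_pts (Th x v) = hyp_sphere x v"
proof (intro set_eqI)
  fix p
  have d': "mob_den x (Th x v) \<noteq> 0" by (rule mob_den_nz[OF x Th_lie_ball[OF x]])
  have s: "complex_of_real (1 - x \<bullet> x) \<noteq> 0" using ball_inner(2)[OF x] by (simp del: of_real_diff)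
  have eq: "norm (pmob x p) = norm (ty x v) \<longleftrightarrow> pmob x p \<bullet> pmob x p - ty x v \<bullet> ty x v = 0"
    by (simp add: norm_eq)
  show "p \<in> sphere_pts (Th x v) \<longleftrightarrow> p \<in> hyp_sphere x v"
  proof (cases "norm p < 1")
    case True
    have "p \<in> hyp_sphere x v \<longleftrightarrow> Complex (pmob x p \<bullet> pmob x p - ty x v \<bullet> ty x v) (- 2 * (pmob x p \<bullet> ty x v)) = 0"
      using True eq by (auto simp: hyp_sphere_eq[OF x] complex_eq_iff ty_inner_zero[OF x])
    also have "\<dots> \<longleftrightarrow> p \<in> sphere_pts (Th x v)"
      unfolding mob_sphere_relation[OF x True] sphere_pts_iff
      using d' s pden_pos[OF x True] by (simp del: of_real_diff)
    finally show ?thesis by blast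
  next
    case False
    then show ?thesis using sphere_pts_ball[OF Th_lie_ball[OF x]] by (auto simp: hyp_sphere_eq[OF x])
  qed
qed

lemma independent_complement_two:
  fixes N1 N2 :: "real^'n"
  assumes N: "N1 \<noteq> 0" "N2 \<noteq> 0" "N1 \<bullet> N2 = 0"
    and b: "independent B" "card B + 2 = CARD('n)" "\<And>h. h \<in> B \<Longrightarrow> h \<bullet> N1 = 0 \<and> h \<bullet> N2 = 0"
    and d: "d \<bullet> N1 = 0" "d \<bullet> N2 = 0"
  shows "d \<in> span B"
proof -
  let ?V = "{h \<in> UNIV. \<forall>a\<in>span {N1, N2}. orthogonal a h}"
  have V: "h \<in> ?V \<longleftrightarrow> h \<bullet> N1 = 0 \<and> h \<bullet> N2 = 0" for h
  proof
    assume "h \<in> ?V"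
    then have "orthogonal N1 h" "orthogonal N2 h" by (auto intro: span_base)
    then show "h \<bullet> N1 = 0 \<and> h \<bullet> N2 = 0" by (simp add: orthogonal_def inner_commute)
  next
    assume "h \<bullet> N1 = 0 \<and> h \<bullet> N2 = 0"
    then have "orthogonal h a" if "a \<in> span {N1, N2}" for a
      by (intro orthogonal_to_span[OF that]) (auto simp: orthogonal_def)
    then show "h \<in> ?V" by (simp add: orthogonal_commute)
  qed
  have ind: "independent {N1, N2}"
  proof (rule pairwise_orthogonal_independent)
    show "pairwise orthogonal {N1, N2}" using N(3) by (auto simp: pairwise_def orthogonal_def inner_commute)
  qed (use N in auto)
  have "N1 \<noteq> N2" using N by auto
  then have d2: "dim (span {N1, N2}) = 2" using ind by (simp add: dim_eq_card_independent)
  have "dim ?V + dim (span {N1, N2}) = dim (UNIV :: (real^'n) set)"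
    by (rule dim_subspace_orthogonal_to_vectors) auto
  then have dV: "dim ?V = card B" using b(2) d2 by (simp add: dim_UNIV)
  have "B \<subseteq> ?V" using b(3) V by blast
  then have "?V \<subseteq> span B" using b(1) dV card_ge_dim_independent[of B ?V] by simp
  moreover have "d \<in> ?V" using d V by blast
  ultimately show ?thesis by blast
qed

text \<open>\<open>pmob x\<close> moves the center to 0, where the hyperplane is orthogonal to
  \<open>y\<close> and the sphere has Euclidean radius \<open>norm y\<close>; \<open>W\<close> is
  the image of \<open>p\<close>. \<open>N1\<close> and \<open>N2\<close> are \<open>y\<close> and
  \<open>W\<close> carried back to \<open>p\<close>, normal to the hyperplane and to the sphere
  within it. \<open>l2\<close> is the square of the conformal factor of \<open>pmob x\<close> at
  \<open>p\<close>. As \<open>v \<noteq> 0\<close>, the radius is positive.\<close>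

locale sphere_point =
  fixes x v p :: "real^('n::{finite,linorder})"
  assumes x: "norm x < 1" and v: "v \<noteq> 0" and p: "p \<in> hyp_sphere x v"
begin

definition "W = pmob x p"
definition "y = ty x v"
definition "N1 = pmob' (- x) W y"
definition "N2 = pmob' (- x) W W"
definition "l2 = ((1 - x \<bullet> x) / pden x p)\<^sup>2"
abbreviation "H \<equiv> hyp_hyperplane x v"
abbreviation "A \<equiv> hyp_sphere x v"

lemma pn: "norm p < 1" and Wv: "W \<bullet> v = 0" and Wn: "norm W = norm y" and Wn1: "norm W < 1"
  using p norm_ty[of x v] by (auto simp: hyp_sphere_eq[OF x] W_def y_def)

lemma Wy: "W \<bullet> y = 0" using Wv ty_inner_zero[OF x] by (simp add: y_def)

lemma xx: "x \<bullet> x < 1" using ball_inner(2)[OF x] .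

lemma y_pos: "\<exists>t>0. y = t *\<^sub>R v"
  using xx v by (intro exI[of _ "tanh (norm v / (1 - x \<bullet> x)) / norm v"]) (simp add: y_def ty_def sgn_div_norm divide_inverse)

lemma yy: "y \<bullet> y > 0" and y0: "y \<noteq> 0" using y_pos v by auto

lemma WW: "W \<bullet> W > 0" using Wn y0 by (metis inner_gt_zero_iff norm_eq_zero)

lemma l2: "l2 > 0" using xx pden_pos[OF x pn] by (simp add: l2_def)

lemma pW: "p = pmob (- x) W" unfolding W_def using pmob_inverse(1)[OF x pn] by simp

lemma M_N: "pmob' x p N1 = y" "pmob' x p N2 = W" "pmob' (- x) W (pmob' x p h) = h"
  unfolding N1_def N2_def W_def using pmob'_inverse[OF x pn] by auto

lemma inner_N: "pmob' x p h \<bullet> y = l2 * (h \<bullet> N1)" "pmob' x p h \<bullet> W = l2 * (h \<bullet> N2)"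
  using pmob'_inner[OF x pn, of h N1] pmob'_inner[OF x pn, of h N2] by (simp_all add: M_N l2_def)

lemma NN: "N1 \<bullet> N2 = 0" "N1 \<bullet> N1 > 0" "N2 \<bullet> N2 > 0"
  using inner_N(1)[of N2] inner_N(1)[of N1] inner_N(2)[of N2] l2 yy WW Wy
  by (auto simp: M_N inner_commute zero_less_mult_iff)

lemma N0: "N1 \<noteq> 0" "N2 \<noteq> 0" using NN by auto

lemma d_f: "((\<lambda>q. pmob x q \<bullet> k) has_derivative (\<lambda>h. pmob' x p h \<bullet> k)) (at p)"
  by (rule bounded_linear.has_derivative[OF bounded_linear_inner_left has_derivative_pmob[OF x pn]])

lemma d_G: "((\<lambda>q. pmob x q \<bullet> pmob x q) has_derivative (\<lambda>h. 2 * l2 * (h \<bullet> N2))) (at p)"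
  by (rule has_derivative_eq_rhs[OF has_derivative_inner[OF has_derivative_pmob[OF x pn] has_derivative_pmob[OF x pn]]])
    (simp add: fun_eq_iff W_def[symmetric] inner_N inner_commute[of W])

lemma tangent_H: "u \<in> tangent_space H p \<Longrightarrow> u \<bullet> N1 = 0"
proof -
  assume "u \<in> tangent_space H p"
  from tangent_space_const[OF this _ d_f[of y], of 0]
  have "pmob' x p u \<bullet> y = 0" using ty_inner_zero[OF x] by (auto simp: hyp_hyperplane_eq[OF x] y_def)
  then show ?thesis using l2 by (simp add: inner_N)
qed

lemma tangent_A: "u \<in> tangent_space A p \<Longrightarrow> u \<bullet> N1 = 0 \<and> u \<bullet> N2 = 0"
proof -
  assume u: "u \<in> tangent_space A p"
  from tangent_space_const[OF this _ d_f[of y], of 0]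
  have 1: "pmob' x p u \<bullet> y = 0" using ty_inner_zero[OF x] by (auto simp: hyp_sphere_eq[OF x] y_def)
  from tangent_space_const[OF u _ d_G, of "y \<bullet> y"]
  have "2 * l2 * (u \<bullet> N2) = 0" by (auto simp: hyp_sphere_eq[OF x] y_def norm_eq_sqrt_inner)
  with 1 show ?thesis using l2 by (simp add: inner_N)
qed

lemma tangent_H_converse:
  assumes "h \<bullet> N1 = 0"
  shows "h \<in> tangent_space H p"
proof -
  let ?k = "pmob' x p h"
  have k: "?k \<bullet> v = 0" using inner_N(1)[of h] assms ty_inner_zero[OF x] by (simp add: y_def)
  define e where "e = (1 - norm W) / (norm ?k + 1)"
  have e: "e > 0" using Wn1 by (simp add: e_def add_nonneg_pos)
  have n: "norm (W + t *\<^sub>R ?k) < 1" if "t \<in> {-e<..<e}" for t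
  proof -
    have "norm (W + t *\<^sub>R ?k) \<le> norm W + \<bar>t\<bar> * norm ?k" using norm_triangle_ineq[of W "t *\<^sub>R ?k"] by simp
    moreover have "\<bar>t\<bar> * norm ?k \<le> \<bar>t\<bar> * (norm ?k + 1)" by (intro mult_left_mono) auto
    moreover have "\<bar>t\<bar> * (norm ?k + 1) < e * (norm ?k + 1)"
      using that by (intro mult_strict_right_mono) (auto simp: add_nonneg_pos)
    moreover have "e * (norm ?k + 1) = 1 - norm W" by (simp add: e_def add_nonneg_eq_0_iff)
    ultimately show ?thesis by linarith
  qed
  let ?c = "\<lambda>t. pmob (- x) (W + t *\<^sub>R ?k)"
  have "smooth_on {-e<..<e} ?c"
    unfolding smooth_on_def
    by (intro allI Ck_on_pmob Ck_on_add Ck_on_scaleR Ck_on_const Ck_on_id) (use n x in auto)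
  moreover have "?c ` {-e<..<e} \<subseteq> H"
  proof (clarify)
    fix t assume t: "t \<in> {-e<..<e}"
    have "pmob x (?c t) = W + t *\<^sub>R ?k" by (rule pmob_inverse(2)[OF x n[OF t]])
    moreover have "norm (?c t) < 1" using x n[OF t] by (intro norm_pmob) auto
    ultimately show "?c t \<in> H" using k Wv by (simp add: hyp_hyperplane_eq[OF x] inner_add_left)
  qed
  moreover have "?c 0 = p" using pW by simp
  moreover have "(?c has_vector_derivative h) (at 0)"
  proof -
    have "((\<lambda>t. W + t *\<^sub>R ?k) has_derivative (\<lambda>r. r *\<^sub>R ?k)) (at 0)" by (auto intro!: derivative_eq_intros)
    from has_derivative_compose[OF this, of "pmob (- x)" "pmob' (- x) W"] has_derivative_pmob[of "- x" W] x Wn1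
    show ?thesis by (simp add: has_vector_derivative_def pmob'_smult M_N)
  qed
  ultimately show ?thesis unfolding tangent_space_def using e by blast
qed

lemma line_deriv:
  fixes f :: "real^('n::{finite,linorder}) \<Rightarrow> real"
  assumes "(f has_derivative f') (at q)"
  shows "((\<lambda>s. f (q + s *\<^sub>R w)) has_real_derivative f' w) (at 0)"
proof -
  have lin: "linear f'" using assms has_derivative_linear by blast
  have "((\<lambda>s. q + s *\<^sub>R w) has_derivative (\<lambda>r. r *\<^sub>R w)) (at 0)" by (auto intro!: derivative_eq_intros)
  from has_derivative_compose[OF this, of f f'] assms show ?thesis
    by (simp add: has_field_derivative_def linear_cmul[OF lin] mult_commute_abs)
qed

lemma near_in_ball:
  fixes q w :: "real^('n::{finite,linorder})"
  assumes "norm q < 1"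
  shows "\<exists>e>0. \<forall>s. 0 < s \<longrightarrow> s < e \<longrightarrow> norm (q + s *\<^sub>R w) < 1"
proof -
  let ?e = "(1 - norm q) / (norm w + 1)"
  have "norm (q + s *\<^sub>R w) < 1" if "0 < s" "s < ?e" for s
  proof -
    have "norm (q + s *\<^sub>R w) \<le> norm q + s * norm w" using norm_triangle_ineq[of q "s *\<^sub>R w"] that by simp
    moreover have "s * norm w \<le> s * (norm w + 1)" using that by (intro mult_left_mono) auto
    moreover have "s * (norm w + 1) < ?e * (norm w + 1)"
      using that by (intro mult_strict_right_mono) (auto simp: add_nonneg_pos)
    moreover have "?e * (norm w + 1) = 1 - norm q" by (simp add: add_nonneg_eq_0_iff)
    ultimately show ?thesis by linarith
  qed
  moreover have "?e > 0" using assms by (simp add: add_nonneg_pos)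
  ultimately show ?thesis by blast
qed

abbreviation "Hpos \<equiv> {q. norm q < 1 \<and> pmob x q \<bullet> y > 0}"

lemma connected_Hpos: "connected Hpos"
proof -
  have "Hpos = pmob (- x) ` (ball 0 1 \<inter> {q. y \<bullet> q > 0})"
  proof (intro set_eqI iffI)
    fix q assume q: "q \<in> Hpos"
    then have "q = pmob (- x) (pmob x q)" using pmob_inverse(1)[OF x] by simp
    then show "q \<in> pmob (- x) ` (ball 0 1 \<inter> {q. y \<bullet> q > 0})" using q norm_pmob[OF x] by (auto simp: inner_commute)
  next
    fix q assume "q \<in> pmob (- x) ` (ball 0 1 \<inter> {q. y \<bullet> q > 0})"
    then show "q \<in> Hpos" using pmob_inverse(2)[OF x] norm_pmob[of "- x"] x by (auto simp: inner_commute)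
  qed
  moreover have "connected (ball 0 1 \<inter> {q. y \<bullet> q > 0})"
    by (intro convex_connected convex_Int convex_ball convex_halfspace_gt)
  moreover have "continuous_on (ball 0 1 \<inter> {q. y \<bullet> q > 0}) (pmob (- x))"
    using has_derivative_pmob[of "- x"] x has_derivative_continuous
    by (intro continuous_at_imp_continuous_on) fastforce
  ultimately show ?thesis using connected_continuous_image by metis
qed

lemma Hpos_subset: "Hpos \<subseteq> B1 - H"
proof
  fix q assume q: "q \<in> Hpos"
  have "pmob x q \<bullet> v \<noteq> 0"
  proof
    assume "pmob x q \<bullet> v = 0"
    then have "pmob x q \<bullet> y = 0" using ty_inner_zero[OF x, of "pmob x q" v] by (simp add: y_def)
    then show False using q by simp
  qed
  then show "q \<in> B1 - H" using q by (simp add: hyp_hyperplane_eq[OF x])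
qed

lemma x_side: "\<exists>e>0. \<forall>s\<in>{0<..<e}. x + s *\<^sub>R v \<in> Hpos"
proof -
  have "((\<lambda>q. pmob x q \<bullet> y) has_derivative (\<lambda>h. pmob' x x h \<bullet> y)) (at x)"
    by (rule bounded_linear.has_derivative[OF bounded_linear_inner_left has_derivative_pmob[OF x x]])
  note d = line_deriv[OF this, of v]
  have "pmob' x x v \<bullet> y > 0"
    using y_pos xx v by (auto simp: pmob'_self[OF x])
  from DERIV_pos_inc_right[OF d this] obtain e where e: "e > 0" "\<And>s. 0 < s \<Longrightarrow> s < e \<Longrightarrow> pmob x (x + s *\<^sub>R v) \<bullet> y > 0"
    by auto
  obtain e' where "e' > 0" "\<And>s. 0 < s \<Longrightarrow> s < e' \<Longrightarrow> norm (x + s *\<^sub>R v) < 1" using near_in_ball[OF x, of "v"] by blast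
  then show ?thesis using e by (intro exI[of _ "min e e'"]) auto
qed

lemma normal_N1: "hyperplane_normal x v p N1"
  unfolding hyperplane_normal_def
proof (intro conjI ballI)
  show "N1 \<noteq> 0" by (rule N0)
  show "pmet p N1 u = 0" if "u \<in> tangent_space H p" for u
    using tangent_H[OF that] by (simp add: poincare_metric_def inner_commute)
  have "pmob' x p N1 \<bullet> y > 0" using yy by (simp add: M_N)
  from DERIV_pos_inc_right[OF line_deriv[OF d_f] this] obtain e1 where
    e1: "e1 > 0" "\<And>s. 0 < s \<Longrightarrow> s < e1 \<Longrightarrow> pmob x (p + s *\<^sub>R N1) \<bullet> y > 0"
    using Wy by (auto simp: W_def)
  obtain e2 where e2: "e2 > 0" "\<And>s. 0 < s \<Longrightarrow> s < e2 \<Longrightarrow> norm (p + s *\<^sub>R N1) < 1" using near_in_ball[OF pn, of "N1"] by blast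
  obtain e3 where e3: "e3 > 0" "\<forall>s\<in>{0<..<e3}. x + s *\<^sub>R v \<in> Hpos" using x_side by blast
  have "connected_component (B1 - H) (x + s *\<^sub>R v) (p + s *\<^sub>R N1)" if "s \<in> {0<..<min e1 (min e2 e3)}" for s
    unfolding connected_component_def
    using connected_Hpos Hpos_subset e1(2)[of s] e2(2)[of s] e3(2) that by (intro exI[of _ Hpos]) auto
  then show "\<exists>e>0. \<forall>s\<in>{0<..<e}. connected_component (B1 - H) (x + s *\<^sub>R v) (p + s *\<^sub>R N1)"
    using e1 e2 e3 by (intro exI[of _ "min e1 (min e2 e3)"]) auto
qed

text \<open>Orthogonality to the tangent space of the hyperplane leaves only multiples of
  \<open>N1\<close>. For the sign: a connected set joining \<open>p + s *\<^sub>R w\<close> to the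
  side of \<open>v\<close> cannot meet the hyperplane, so the product of \<open>pmob x\<close> with
  \<open>y\<close> stays positive on it.\<close>

lemma normal_unique:
  assumes "hyperplane_normal x v p w"
  shows "\<exists>a>0. w = a *\<^sub>R N1"
proof -
  define a where "a = (w \<bullet> N1) / (N1 \<bullet> N1)"
  define h where "h = w - a *\<^sub>R N1"
  have hN: "h \<bullet> N1 = 0" using NN(2) by (simp add: h_def a_def inner_diff_left)
  from assms have w: "w \<noteq> 0" "\<And>u. u \<in> tangent_space H p \<Longrightarrow> pmet p w u = 0"
    unfolding hyperplane_normal_def by auto
  have "w \<bullet> h = 0"
    using w(2)[OF tangent_H_converse[OF hN]] ball_inner(2)[OF pn] by (simp add: poincare_metric_def power2_norm_eq_inner)
  then have "h \<bullet> h = 0" using hN unfolding h_def by (simp add: inner_diff_left inner_diff_right inner_commute)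
  then have wa: "w = a *\<^sub>R N1" by (simp add: h_def)
  obtain e where e: "e > 0" "\<And>s. s \<in> {0<..<e} \<Longrightarrow> connected_component (B1 - H) (x + s *\<^sub>R v) (p + s *\<^sub>R w)"
    using assms unfolding hyperplane_normal_def by auto
  obtain e' where e': "e' > 0" "\<forall>s\<in>{0<..<e'}. x + s *\<^sub>R v \<in> Hpos" using x_side by blast
  have pos: "pmob x (p + s *\<^sub>R w) \<bullet> y > 0" if s: "0 < s" "s < min e e'" for s
  proof (rule ccontr)
    assume neg: "\<not> ?thesis"
    obtain C where C: "connected C" "C \<subseteq> B1 - H" "x + s *\<^sub>R v \<in> C" "p + s *\<^sub>R w \<in> C"
      using e(2)[of s] s unfolding connected_component_def by auto
    have "continuous_on C (\<lambda>q. pmob x q \<bullet> y)"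
    proof (intro continuous_on_inner continuous_on_const continuous_at_imp_continuous_on ballI)
      fix q assume "q \<in> C"
      then have "norm q < 1" using C(2) by auto
      then show "isCont (pmob x) q" using has_derivative_pmob[OF x] has_derivative_continuous by blast
    qed
    then have con: "connected ((\<lambda>q. pmob x q \<bullet> y) ` C)" using C(1) connected_continuous_image by blast
    have "x + s *\<^sub>R v \<in> Hpos" using e'(2) s by auto
    then have "0 \<in> (\<lambda>q. pmob x q \<bullet> y) ` C"
      using connectedD_interval[OF con imageI[OF C(4)] imageI[OF C(3)], of 0] neg by simp
    then obtain q where "q \<in> C" "pmob x q \<bullet> y = 0" by auto
    then show False using C(2) ty_inner_zero[OF x] by (auto simp: hyp_hyperplane_eq[OF x] y_def)
  qed
  have "\<not> pmob' x p w \<bullet> y < 0"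
  proof
    assume "pmob' x p w \<bullet> y < 0"
    from DERIV_neg_dec_right[OF line_deriv[OF d_f] this] obtain r where
      r: "r > 0" "\<And>s. 0 < s \<Longrightarrow> s < r \<Longrightarrow> pmob x (p + s *\<^sub>R w) \<bullet> y < 0"
      using Wy by (auto simp: W_def)
    define s where "s = min r (min e e') / 2"
    have "0 < s" "s < r" "s < min e e'" using r e e' by (auto simp: s_def)
    then show False using pos[of s] r(2)[of s] by simp
  qed
  then have "w \<bullet> N1 \<ge> 0" using l2 by (simp add: inner_N mult_less_0_iff not_less)
  then have "a \<ge> 0" using NN(2) by (simp add: a_def)
  moreover have "a \<noteq> 0" using w(1) wa by auto
  ultimately show ?thesis using wa by (intro exI[of _ a]) auto
qed

lemma dist_gt_iff: "norm q < 1 \<Longrightarrow> riem_dist B1 pmet x q > sqrt (pmet x v v) \<longleftrightarrow> pmob x q \<bullet> pmob x q > W \<bullet> W"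
proof -
  assume q: "norm q < 1"
  have "artanh (norm (pmob x q)) > norm v / (1 - x \<bullet> x) \<longleftrightarrow> tanh (artanh (norm (pmob x q))) > tanh (norm v / (1 - x \<bullet> x))"
    by simp
  also have "\<dots> \<longleftrightarrow> norm (pmob x q) > norm W"
    using norm_pmob[OF x q] by (simp add: tanh_artanh_real Wn y_def norm_ty_eq[OF x])
  also have "\<dots> \<longleftrightarrow> pmob x q \<bullet> pmob x q > W \<bullet> W"
    by (simp add: norm_eq_sqrt_inner)
  finally show ?thesis by (simp add: riem_dist_poincare[OF x q] sqrt_pmet[OF x])
qed

lemma external_N2: "external_normal x v p N2"
  unfolding external_normal_def
proof (intro conjI ballI)
  show "N2 \<noteq> 0" by (rule N0)
  show "N2 \<in> tangent_space H p" by (rule tangent_H_converse) (use NN(1) inner_commute[of N2 N1] in simp)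
  show "pmet p N2 u = 0" if "u \<in> tangent_space A p" for u
    using tangent_A[OF that] by (simp add: poincare_metric_def inner_commute)
  have "2 * l2 * (N2 \<bullet> N2) > 0" using l2 NN(3) by simp
  from DERIV_pos_inc_right[OF line_deriv[OF d_G] this] obtain e1 where
    e1: "e1 > 0" "\<And>s. 0 < s \<Longrightarrow> s < e1 \<Longrightarrow> pmob x (p + s *\<^sub>R N2) \<bullet> pmob x (p + s *\<^sub>R N2) > W \<bullet> W"
    by (auto simp: W_def)
  obtain e2 where e2: "e2 > 0" "\<And>s. 0 < s \<Longrightarrow> s < e2 \<Longrightarrow> norm (p + s *\<^sub>R N2) < 1" using near_in_ball[OF pn, of "N2"] by blast
  show "\<exists>e>0. \<forall>s\<in>{0<..<e}. p + s *\<^sub>R N2 \<in> B1 \<and> sqrt (pmet x v v) < riem_dist B1 pmet x (p + s *\<^sub>R N2)"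
    using e1 e2 dist_gt_iff by (intro exI[of _ "min e1 e2"]) auto
qed

text \<open>\<open>tangent_A\<close> bounds the tangent space of the sphere from above only. The
  basis \<open>b\<close> of length \<open>n - 2\<close> shows that it fills the complement of
  \<open>N1\<close> and \<open>N2\<close>, so orthogonality to it fixes the line of
  \<open>\<nu>\<close>; the growth of the distance decides the sign.\<close>

lemma external_unique:
  assumes n: "external_normal x v p \<nu>" and b: "ordered_basis (tangent_space A p) b" "length b + 2 = CARD('n)"
  shows "\<exists>a>0. \<nu> = a *\<^sub>R N2"
proof -
  from n have \<nu>: "\<nu> \<noteq> 0" "\<nu> \<bullet> N1 = 0" "\<And>u. u \<in> tangent_space A p \<Longrightarrow> \<nu> \<bullet> u = 0"
    using ball_inner(2)[OF pn] tangent_H by (auto simp: external_normal_def poincare_metric_def power2_norm_eq_inner)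
  define a where "a = (\<nu> \<bullet> N2) / (N2 \<bullet> N2)"
  define h where "h = \<nu> - a *\<^sub>R N2"
  have hN: "h \<bullet> N1 = 0" "h \<bullet> N2 = 0" using NN \<nu>(2) by (simp_all add: h_def a_def inner_diff_left inner_commute[of N2 N1])
  have B: "independent (set b)" "card (set b) + 2 = CARD('n)" "set b \<subseteq> tangent_space A p"
    using b by (auto simp: ordered_basis_def distinct_card)
  have "h \<in> span (set b)"
    by (rule independent_complement_two[OF N0 NN(1) B(1,2) _ hN]) (use tangent_A B(3) in blast)
  moreover have "orthogonal h u" if "u \<in> set b" for u
    using \<nu>(3)[of u] tangent_A[of u] B(3) that by (auto simp: orthogonal_def h_def inner_diff_left inner_commute[of N2])
  ultimately have "orthogonal h h" by (metis orthogonal_to_span orthogonal_commute)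
  then have na: "\<nu> = a *\<^sub>R N2" by (simp add: orthogonal_def h_def)
  obtain e where e: "e > 0" "\<And>s. s \<in> {0<..<e} \<Longrightarrow> norm (p + s *\<^sub>R \<nu>) < 1 \<and> sqrt (pmet x v v) < riem_dist B1 pmet x (p + s *\<^sub>R \<nu>)"
    using n unfolding external_normal_def by auto
  have "\<not> 2 * l2 * (\<nu> \<bullet> N2) < 0"
  proof
    assume "2 * l2 * (\<nu> \<bullet> N2) < 0"
    from DERIV_neg_dec_right[OF line_deriv[OF d_G] this] obtain r where
      r: "r > 0" "\<And>s. 0 < s \<Longrightarrow> s < r \<Longrightarrow> pmob x (p + s *\<^sub>R \<nu>) \<bullet> pmob x (p + s *\<^sub>R \<nu>) < W \<bullet> W"
      by (auto simp: W_def)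
    define s where "s = min r e / 2"
    have "0 < s" "s < r" "s < e" using r e by (auto simp: s_def)
    then show False using e(2)[of s] r(2)[of s] dist_gt_iff[of "p + s *\<^sub>R \<nu>"] by auto
  qed
  then have "a \<ge> 0" using l2 NN(3) by (simp add: a_def not_less zero_le_mult_iff)
  moreover have "a \<noteq> 0" using \<nu>(1) na by auto
  ultimately show ?thesis using na by (intro exI[of _ a]) auto
qed

abbreviation "z \<equiv> Th x v"
abbreviation "d \<equiv> im_vec z"
abbreviation "e \<equiv> p - re_vec z"

text \<open>\<open>mob_sphere_relation\<close> is differentiated at a zero of its right-hand side,
  so of the factor only its value \<open>K\<close> survives. Comparing real and imaginary parts
  shows that \<open>(N1, N2)\<close> arises from \<open>(d, e)\<close> by multiplication with
  \<open>K\<close> up to the positive scale \<open>l2\<close>; the determinant of this change of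
  frame is \<open>a\<^sup>2 + b\<^sup>2\<close>.\<close>

lemma frame_relation: "\<exists>a b. a\<^sup>2 + b\<^sup>2 > 0 \<and> N1 = a *\<^sub>R d - b *\<^sub>R e \<and> N2 = b *\<^sub>R d + a *\<^sub>R e"
proof -
  define C where "C = (of_real (1 - x \<bullet> x))\<^sup>2 / mob_den x z"
  define K where "K = C * inverse (of_real (pden x p))"
  have C0: "C \<noteq> 0"
    using xx mob_den_nz[OF x Th_lie_ball[OF x]] by (simp add: C_def del: of_real_diff)
  have K0: "K \<noteq> 0" using C0 pden_pos[OF x pn] by (simp add: K_def)
  have zero: "cdot (ofr p - z) (ofr p - z) = 0"
    using p by (simp add: sphere_pts_iff[symmetric] sphere_pts_Th[OF x])
  have dp: "(pden x has_derivative (\<lambda>h. - 2 * (h \<bullet> x) + 2 * (p \<bullet> h) * (x \<bullet> x))) (at p)"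
    unfolding pden_def[abs_def]
    by (auto intro!: derivative_eq_intros simp: inner_commute[of _ p])
  have dK: "((\<lambda>q. C * inverse (complex_of_real (pden x q))) has_derivative
      (\<lambda>h. C * - (inverse (complex_of_real (pden x p)) * of_real (- 2 * (h \<bullet> x) + 2 * (p \<bullet> h) * (x \<bullet> x)) * inverse (complex_of_real (pden x p))))) (at p)"
    using pden_pos[OF x pn] by (intro has_derivative_mult_right Deriv.has_derivative_inverse has_derivative_of_real dp) auto
  have dz: "((\<lambda>q. cdot (ofr q - z) (ofr q - z)) has_derivative (\<lambda>h. 2 * cdot (ofr p - z) (ofr h))) (at p)"
    by (rule has_derivative_eq_rhs[OF has_derivative_cdot[OF
            has_derivative_diff[OF has_derivative_ofr[OF has_derivative_ident] has_derivative_const]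
            has_derivative_diff[OF has_derivative_ofr[OF has_derivative_ident] has_derivative_const]]])
      (simp add: fun_eq_iff cdot_commute[of _ "ofr p - z"])
  have L: "((\<lambda>q. C * inverse (of_real (pden x q)) * cdot (ofr q - z) (ofr q - z)) has_derivative
      (\<lambda>h. K * (2 * cdot (ofr p - z) (ofr h)))) (at p)"
    by (rule has_derivative_eq_rhs[OF has_derivative_mult[OF dK dz]]) (simp add: zero K_def fun_eq_iff)
  have X: "((\<lambda>q. Complex (pmob x q \<bullet> pmob x q - y \<bullet> y) (- 2 * (pmob x q \<bullet> y))) has_derivative
      (\<lambda>h. K * (2 * cdot (ofr p - z) (ofr h)))) (at p)"
    by (rule has_derivative_transform_within_open[OF L open_ball[of 0 1]])
      (use pn mob_sphere_relation[OF x] in \<open>auto simp: C_def y_def\<close>)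
  have R: "((\<lambda>q. pmob x q \<bullet> pmob x q - y \<bullet> y) has_derivative (\<lambda>h. Re (K * (2 * cdot (ofr p - z) (ofr h))))) (at p)"
    "((\<lambda>q. - 2 * (pmob x q \<bullet> y)) has_derivative (\<lambda>h. Im (K * (2 * cdot (ofr p - z) (ofr h))))) (at p)"
    using has_derivative_Re[OF X] has_derivative_Im[OF X] by simp_all
  have "((\<lambda>q. pmob x q \<bullet> pmob x q - y \<bullet> y) has_derivative (\<lambda>h. 2 * l2 * (h \<bullet> N2))) (at p)"
    using has_derivative_diff[OF d_G has_derivative_const] by simp
  from has_derivative_unique[OF this R(1)] have 2: "2 * l2 * (h \<bullet> N2) = Re (K * (2 * cdot (ofr p - z) (ofr h)))" for h
    by metis
  have "((\<lambda>q. - 2 * (pmob x q \<bullet> y)) has_derivative (\<lambda>h. - 2 * (l2 * (h \<bullet> N1)))) (at p)"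
    using has_derivative_mult_right[OF d_f[of y], of "- 2"] by (simp add: inner_N)
  from has_derivative_unique[OF this R(2)] have 1: "- 2 * (l2 * (h \<bullet> N1)) = Im (K * (2 * cdot (ofr p - z) (ofr h)))" for h
    by metis
  have cd: "cdot (ofr p - z) (ofr h) = Complex (h \<bullet> e) (- (h \<bullet> d))" for h
  proof -
    have "ofr p - z = ofr e - \<i> *s ofr d"
      by (subst re_im_decomp[of z]) (simp add: ofr_simps)
    then show ?thesis by (simp add: cdot_simps cdot_ofr complex_eq_iff inner_commute)
  qed
  define a where "a = Re K / l2"
  define b where "b = Im K / l2"
  have ari: "2 * l * X = Re (k * (2 * Complex u (- w))) \<Longrightarrow> X = Im k / l * w + Re k / l * u"
    "- 2 * (l * X) = Im (k * (2 * Complex u (- w))) \<Longrightarrow> X = Re k / l * w - Im k / l * u" if "l > 0" for l X u w :: real and k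
    using that by (simp_all add: field_simps)
  have "h \<bullet> N2 = h \<bullet> (b *\<^sub>R d + a *\<^sub>R e)" for h
    using ari(1)[OF l2 2[of h, unfolded cd]] by (simp only: a_def b_def inner_add_right inner_scaleR_right)
  then have n2: "N2 = b *\<^sub>R d + a *\<^sub>R e" using vector_eq_ldot by blast
  have "h \<bullet> N1 = h \<bullet> (a *\<^sub>R d - b *\<^sub>R e)" for h
    using ari(2)[OF l2 1[of h, unfolded cd]] by (simp only: a_def b_def inner_diff_right inner_scaleR_right)
  then have n1: "N1 = a *\<^sub>R d - b *\<^sub>R e" using vector_eq_ldot by blast
  have "a \<noteq> 0 \<or> b \<noteq> 0" using K0 l2 by (auto simp: a_def b_def complex_eq_iff)
  then have "a\<^sup>2 + b\<^sup>2 > 0" by (auto simp: sum_power2_gt_zero_iff)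
  with n1 n2 show ?thesis by blast
qed

lemma orientation_iff:
  assumes b: "ordered_basis (tangent_space A p) b"
  shows "direct_basis (d # (e /\<^sub>R norm d) # b) \<longleftrightarrow>
    (\<exists>w \<nu>. hyperplane_normal x v p w \<and> external_normal x v p \<nu> \<and> direct_basis (w # \<nu> # b))"
proof (cases "length b + 2 = CARD('n)")
  case False
  then show ?thesis by (auto simp: direct_basis_def)
next
  case True
  obtain D where D: "\<And>u w. direct_basis (u # w # b) \<longleftrightarrow> D u w > 0"
    "\<And>a c a' c' u w. D (a *\<^sub>R u + c *\<^sub>R w) (a' *\<^sub>R u + c' *\<^sub>R w) = (a * c' - c * a') * D u w"
    using direct_basis_first_two[OF True] by metis
  obtain a c where ac: "a\<^sup>2 + c\<^sup>2 > 0" "N1 = a *\<^sub>R d - c *\<^sub>R e" "N2 = c *\<^sub>R d + a *\<^sub>R e"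
    using frame_relation by blast
  have "D N1 N2 = (a\<^sup>2 + c\<^sup>2) * D d e"
    using D(2)[of a d "- c" e c a] by (simp add: ac(2,3) power2_eq_square)
  then have 1: "D N1 N2 > 0 \<longleftrightarrow> D d e > 0" using ac(1) by (simp add: zero_less_mult_iff)
  have dn: "norm d > 0"
  proof -
    have "d \<noteq> 0"
    proof
      assume d0: "d = 0"
      have "e \<bullet> e = d \<bullet> d"
        using p unfolding sphere_pts_Th[OF x, of v, symmetric] by (simp add: sphere_pts_def dist_eq_norm_iff)
      then have "e = 0" using d0 by simp
      then show False using ac(2) d0 N0(1) by simp
    qed
    then show ?thesis by simp
  qed
  have "D d (e /\<^sub>R norm d) = inverse (norm d) * D d e"
    using D(2)[of 1 d 0 e 0 "inverse (norm d)"] by simp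
  then have 2: "D d (e /\<^sub>R norm d) > 0 \<longleftrightarrow> D d e > 0" using dn by (simp add: zero_less_mult_iff)
  have 3: "D w \<nu> > 0 \<longleftrightarrow> D N1 N2 > 0" if w: "hyperplane_normal x v p w" and n: "external_normal x v p \<nu>" for w \<nu>
  proof -
    obtain r where r: "r > 0" "w = r *\<^sub>R N1" using normal_unique[OF w] by blast
    obtain s where s: "s > 0" "\<nu> = s *\<^sub>R N2" using external_unique[OF n b True] by blast
    have "D w \<nu> = r * s * D N1 N2" using D(2)[of r N1 0 N2 0 s] by (simp add: r s)
    moreover have "r * s > 0" using r s by simp
    ultimately show ?thesis by (metis mult_pos_pos zero_less_mult_pos)
  qed
  show ?thesis
    unfolding D 2 using 1 3 normal_N1 external_N2 by metis
qed

end

section \<open>Agreement of the two oriented spheres for n >= 3\<close>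

lemma tangent_space_singleton: "tangent_space {q} p \<subseteq> {0}"
proof
  fix w assume w: "w \<in> tangent_space {q} p"
  then obtain c e where c: "e > 0" "c ` {-e<..<e} \<subseteq> {q}" "(c has_vector_derivative w) (at (0::real))"
    unfolding tangent_space_def by blast
  have "(c has_vector_derivative 0) (at 0)"
    by (rule has_vector_derivative_transform_within_open[of "\<lambda>_. q" _ _ "{-e<..<e}"])
      (use c in \<open>auto simp: image_subset_iff\<close>)
  then show "w \<in> {0}" using c(3) vector_derivative_unique_at by blast
qed

lemma sphere_T_Th_higher:
  fixes x :: "real^('n::{finite,linorder})"
  assumes x: "norm x < 1" and n: "CARD('n) \<ge> 3"
  shows "sphere_T (Th x v) = sphere_S (x, v)"
proof -
  let ?A = "hyp_sphere x v" and ?z = "Th x v"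
  have iff: "direct_basis (im_vec ?z # ((p - re_vec ?z) /\<^sub>R norm (im_vec ?z)) # b) \<longleftrightarrow>
      (\<exists>w \<nu>. hyperplane_normal x v p w \<and> external_normal x v p \<nu> \<and> direct_basis (w # \<nu> # b))"
    if p: "p \<in> ?A" and b: "ordered_basis (tangent_space ?A p) b" for p b
  proof (cases "v = 0")
    case False
    interpret sphere_point x v p using x False p by unfold_locales
    show ?thesis by (rule orientation_iff[OF b])
  next
    \<comment> \<open>Radius 0: the tangent space of a point is trivial, so \<open>b\<close> is
      empty, and two vectors are too few for a direct basis when \<open>n \<ge> 3\<close>.\<close>
    case True
    have "pmob x q = 0 \<longleftrightarrow> q = x" if "norm q < 1" for q
      using pmob_inverse(1)[OF x that] by auto
    then have A: "?A = {x}" using x by (auto simp: hyp_sphere_eq[OF x] True ty_def)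
    have "set b \<subseteq> tangent_space ?A p" "independent (set b)" using b by (auto simp: ordered_basis_def)
    then have "set b \<subseteq> {0}" "independent (set b)" unfolding A using tangent_space_singleton by blast+
    then have "set b = {}" using dependent_zero[of "set b"] subset_singletonD[of "set b" 0] by auto
    then show ?thesis using n by (auto simp: direct_basis_def)
  qed
  have "{p. dist (re_vec ?z) p = norm (im_vec ?z) \<and> (p - re_vec ?z) \<bullet> im_vec ?z = 0} = ?A"
    using sphere_pts_Th[OF x, of v] by (simp add: sphere_pts_def)
  moreover have "{(p, b). p \<in> ?A \<and> ordered_basis (tangent_space ?A p) b \<and>
      direct_basis (im_vec ?z # ((p - re_vec ?z) /\<^sub>R norm (im_vec ?z)) # b)} =
    {(p, b). p \<in> ?A \<and> ordered_basis (tangent_space ?A p) b \<and>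
      (\<exists>w \<nu>. hyperplane_normal x v p w \<and> external_normal x v p \<nu> \<and> direct_basis (w # \<nu> # b))}"
    using iff by blast
  ultimately show ?thesis
    using n unfolding sphere_T_def sphere_S_def Let_def by simp
qed

section \<open>Injectivity of T for n >= 3\<close>

lemma orthogonal_complement_witness:
  fixes d :: "real^'n"
  assumes n: "CARD('n) \<ge> 2"
  shows "\<exists>e. e \<bullet> d = 0 \<and> norm e = norm d"
proof -
  have "DIM(real^'n) \<ge> 2" using n by simp
  then obtain u where u: "u \<noteq> 0" "orthogonal d u"
    using orthogonal_to_vector_exists[of d] by blast
  show ?thesis
  proof (intro exI conjI)
    show "(norm d *\<^sub>R sgn u) \<bullet> d = 0"
      using u(2) by (simp add: orthogonal_def sgn_div_norm inner_commute[of u d])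
    show "norm (norm d *\<^sub>R sgn u) = norm d" using u(1) by (simp add: norm_sgn)
  qed
qed

lemma sphere_pts_iff_inner:
  "p \<in> sphere_pts z \<longleftrightarrow> (p - re_vec z) \<bullet> (p - re_vec z) = im_vec z \<bullet> im_vec z \<and> (p - re_vec z) \<bullet> im_vec z = 0"
  by (simp add: sphere_pts_def dist_eq_norm_iff)

lemma sphere_pts_add_iff:
  "re_vec z + e \<in> sphere_pts z \<longleftrightarrow> e \<bullet> e = im_vec z \<bullet> im_vec z \<and> e \<bullet> im_vec z = 0"
  by (simp add: sphere_pts_iff_inner)

text \<open>Together with \<open>re_vec z + e\<close> a sphere contains the antipodal point
  \<open>re_vec z - e\<close>. Adding and subtracting the equations of the other sphere at the two
  points separates the centers from \<open>e\<close>.\<close>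

lemma sphere_pts_center_le:
  fixes z z' :: "complex^'n"
  assumes n: "CARD('n) \<ge> 2" and eq: "sphere_pts z \<subseteq> sphere_pts z'"
  shows "(re_vec z - re_vec z') \<bullet> (re_vec z - re_vec z') + im_vec z \<bullet> im_vec z = im_vec z' \<bullet> im_vec z'"
    "\<And>e. e \<bullet> im_vec z = 0 \<Longrightarrow> norm e = norm (im_vec z) \<Longrightarrow> e \<bullet> im_vec z' = 0"
proof -
  have *: "(re_vec z - re_vec z') \<bullet> (re_vec z - re_vec z') + im_vec z \<bullet> im_vec z = im_vec z' \<bullet> im_vec z' \<and>
      e \<bullet> im_vec z' = 0" if e: "e \<bullet> im_vec z = 0" "norm e = norm (im_vec z)" for e
  proof -
    let ?k = "re_vec z - re_vec z'"
    have ee: "e \<bullet> e = im_vec z \<bullet> im_vec z" using e(2) by (metis power2_norm_eq_inner)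
    have "re_vec z + e \<in> sphere_pts z'" "re_vec z + (- e) \<in> sphere_pts z'"
      by (rule subsetD[OF eq], simp add: sphere_pts_add_iff e(1) ee del: add_uminus_conv_diff)+
    moreover have "re_vec z + e - re_vec z' = ?k + e" "re_vec z + (- e) - re_vec z' = ?k - e" by simp_all
    ultimately have 1: "(?k + e) \<bullet> (?k + e) = im_vec z' \<bullet> im_vec z'" "(?k + e) \<bullet> im_vec z' = 0"
      "(?k - e) \<bullet> (?k - e) = im_vec z' \<bullet> im_vec z'" "(?k - e) \<bullet> im_vec z' = 0"
      unfolding sphere_pts_iff_inner by (simp_all only:)
    have "(?k + e) \<bullet> (?k + e) + (?k - e) \<bullet> (?k - e) = 2 * (?k \<bullet> ?k + e \<bullet> e)"
      by (simp add: inner_add_left inner_add_right inner_diff_left inner_diff_right)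
    moreover have "(?k + e) \<bullet> im_vec z' - (?k - e) \<bullet> im_vec z' = 2 * (e \<bullet> im_vec z')"
      by (simp add: inner_add_left inner_diff_left)
    ultimately show ?thesis using 1 ee by simp
  qed
  show "(re_vec z - re_vec z') \<bullet> (re_vec z - re_vec z') + im_vec z \<bullet> im_vec z = im_vec z' \<bullet> im_vec z'"
    using * orthogonal_complement_witness[OF n, of "im_vec z"] by blast
  show "\<And>e. e \<bullet> im_vec z = 0 \<Longrightarrow> norm e = norm (im_vec z) \<Longrightarrow> e \<bullet> im_vec z' = 0"
    using * by blast
qed

text \<open>The two inclusions give opposite inequalities for the radii, so centers and radii agree.
  The normal is found only up to sign; the orientation resolves this ambiguity.\<close>

lemma sphere_pts_eq:
  fixes z z' :: "complex^'n"
  assumes n: "CARD('n) \<ge> 2" and eq: "sphere_pts z = sphere_pts z'"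
  shows "re_vec z = re_vec z' \<and> (im_vec z' = im_vec z \<or> im_vec z' = - im_vec z)"
proof -
  let ?c = "re_vec z" and ?c' = "re_vec z'" and ?d = "im_vec z" and ?d' = "im_vec z'"
  have 1: "(?c - ?c') \<bullet> (?c - ?c') + ?d \<bullet> ?d = ?d' \<bullet> ?d'" "(?c' - ?c) \<bullet> (?c' - ?c) + ?d' \<bullet> ?d' = ?d \<bullet> ?d"
    using sphere_pts_center_le(1)[OF n] eq by auto
  have "(?c - ?c') \<bullet> (?c - ?c') \<ge> 0" "(?c' - ?c) \<bullet> (?c' - ?c) \<ge> 0" by simp_all
  with 1 have "(?c - ?c') \<bullet> (?c - ?c') = 0" by linarith
  then have c: "?c = ?c'" by simp
  with 1 have dd: "?d' \<bullet> ?d' = ?d \<bullet> ?d" by simp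
  show ?thesis
  proof (cases "?d = 0")
    case True
    then show ?thesis using c dd by simp
  next
    case False
    define k where "k = (?d' \<bullet> ?d) / (?d \<bullet> ?d)"
    define h where "h = ?d' - k *\<^sub>R ?d"
    have hd: "h \<bullet> ?d = 0" using False by (simp add: h_def k_def inner_diff_left)
    have "(norm ?d *\<^sub>R sgn h) \<bullet> ?d' = 0" if "h \<noteq> 0"
      using sphere_pts_center_le(2)[OF n equalityD1[OF eq], of "norm ?d *\<^sub>R sgn h"] hd that
      by (simp add: sgn_div_norm)
    then have "h \<bullet> ?d' = 0" using False by (cases "h = 0") (auto simp: sgn_div_norm)
    then have "h \<bullet> h = 0" using hd unfolding h_def inner_diff_right[of _ ?d'] by (simp add: h_def)
    then have d': "?d' = k *\<^sub>R ?d" by (simp add: h_def)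
    then have "k * k * (?d \<bullet> ?d) = ?d \<bullet> ?d" using dd by simp
    then have "k * k = 1" using False by simp
    then have "k = 1 \<or> k = - 1" using square_eq_1_iff by blast
    then show ?thesis using c d' by auto
  qed
qed

lemma tangent_space_sphere_pts:
  assumes p: "p \<in> sphere_pts z" and False: "im_vec z \<noteq> 0"
  shows "tangent_space (sphere_pts z) p = {h. h \<bullet> im_vec z = 0 \<and> h \<bullet> (p - re_vec z) = 0}"
proof (intro set_eqI iffI)
  let ?c = "re_vec z" and ?d = "im_vec z"
  fix h assume h: "h \<in> tangent_space (sphere_pts z) p"
  have "((\<lambda>q. (q - ?c) \<bullet> ?d) has_derivative (\<lambda>h. h \<bullet> ?d)) (at p)" by (auto intro!: derivative_eq_intros)
  from tangent_space_const[OF h _ this, of 0] have 1: "h \<bullet> ?d = 0" by (auto simp: sphere_pts_iff_inner)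
  have "((\<lambda>q. (q - ?c) \<bullet> (q - ?c)) has_derivative (\<lambda>h. 2 * (h \<bullet> (p - ?c)))) (at p)"
    by (rule has_derivative_eq_rhs[OF has_derivative_inner[OF
          has_derivative_diff[OF has_derivative_ident has_derivative_const]
          has_derivative_diff[OF has_derivative_ident has_derivative_const]]])
      (simp add: fun_eq_iff inner_commute)
  from tangent_space_const[OF h _ this, of "?d \<bullet> ?d"] have 2: "h \<bullet> (p - ?c) = 0"
    by (auto simp: sphere_pts_iff_inner)
  show "h \<in> {h. h \<bullet> ?d = 0 \<and> h \<bullet> (p - ?c) = 0}" using 1 2 by simp
next
  let ?c = "re_vec z" and ?d = "im_vec z"
  fix h assume "h \<in> {h. h \<bullet> ?d = 0 \<and> h \<bullet> (p - ?c) = 0}"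
  then have h: "h \<bullet> ?d = 0" "h \<bullet> (p - ?c) = 0" by auto
  define e where "e = p - ?c"
  have e: "e \<bullet> e = ?d \<bullet> ?d" "e \<bullet> ?d = 0" using p by (auto simp: e_def sphere_pts_iff_inner)
  show "h \<in> tangent_space (sphere_pts z) p"
  proof (cases "h = 0")
    case True
    show ?thesis unfolding tangent_space_def smooth_on_def using p True
      by (intro CollectI exI[of _ "\<lambda>_. p"] exI[of _ 1] conjI allI Ck_on_const) auto
  next
    case hn: False
      \<comment> \<open>\<open>s\<close> is an angular speed: it gives \<open>k\<close> the length
        of the radius, and the circle through \<open>e\<close> and \<open>k\<close> then has
        velocity \<open>s *\<^sub>R k = h\<close> at 0.\<close>
      define s where "s = norm h / norm ?d"
      have s: "s > 0" using False hn by (simp add: s_def)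
      define k where "k = (1 / s) *\<^sub>R h"
      have "k \<bullet> k = (h \<bullet> h) / (s * s)" by (simp add: k_def)
      also have "\<dots> = ?d \<bullet> ?d"
        using False hn by (simp add: s_def power2_norm_eq_inner[symmetric] power2_eq_square)
      finally have kk: "k \<bullet> k = ?d \<bullet> ?d" .
      have ke: "k \<bullet> ?d = 0" "k \<bullet> e = 0" using h by (simp_all add: k_def e_def)
      let ?f = "\<lambda>t. ?c + (cos (s * t) *\<^sub>R e + sin (s * t) *\<^sub>R k)"
      have lin: "Ck_on j {-1<..<1} ((*) s)" for j :: nat
        by (rule Ck_on_bounded_linear) (auto intro: bounded_linear_mult_right)
      have tr: "Ck_on j {-1<..<1} (\<lambda>t. cos (s * t))" "Ck_on j {-1<..<1} (\<lambda>t. sin (s * t))" for j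
        using Ck_on_compose[OF _ open_UNIV lin Ck_on_cos] Ck_on_compose[OF _ open_UNIV lin Ck_on_sin] by auto
      have "smooth_on {-1<..<1} ?f"
        unfolding smooth_on_def by (intro allI Ck_on_add Ck_on_scaleR Ck_on_const tr) auto
      moreover have "?f ` {-1<..<1} \<subseteq> sphere_pts z"
      proof (clarify)
        fix t :: real
        let ?g = "cos (s * t) *\<^sub>R e + sin (s * t) *\<^sub>R k"
        have "?g \<bullet> ?g = (cos (s * t))\<^sup>2 * (?d \<bullet> ?d) + (sin (s * t))\<^sup>2 * (?d \<bullet> ?d)"
          using ke by (simp add: inner_add_left inner_add_right e kk inner_commute[of e k] power2_eq_square)
        also have "\<dots> = ?d \<bullet> ?d" unfolding distrib_right[symmetric] by simp
        finally show "?f t \<in> sphere_pts z"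
          using ke e by (simp only: sphere_pts_add_iff) (simp add: inner_add_left)
      qed
      moreover have "?f 0 = p" by (simp add: e_def)
      moreover have "(?f has_vector_derivative h) (at 0)"
      proof -
        have "((\<lambda>t. cos (s * t)) has_real_derivative 0) (at 0)" "((\<lambda>t. sin (s * t)) has_real_derivative s) (at 0)"
          by (auto intro!: derivative_eq_intros)
        then show ?thesis
          unfolding has_vector_derivative_def has_field_derivative_def
          using s by (auto intro!: derivative_eq_intros simp: k_def)
      qed
      ultimately show ?thesis unfolding tangent_space_def
        by (intro CollectI exI[of _ ?f] exI[of _ 1]) auto
  qed
qed


text \<open>Separates a normal from its negative. A basis of the common complement of the normal and
  a radius completes these to a basis of the whole space, so the determinant is nonzero; if it is
  negative, passing to the antipodal point makes it positive.\<close>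

lemma direct_basis_sphere_pts:
  fixes z :: "complex^('n::{finite,linorder})"
  assumes n: "CARD('n) \<ge> 3" and d0: "im_vec z \<noteq> 0"
  shows "\<exists>p b. p \<in> sphere_pts z \<and> ordered_basis (tangent_space (sphere_pts z) p) b \<and>
    direct_basis (im_vec z # ((p - re_vec z) /\<^sub>R norm (im_vec z)) # b) \<and>
    \<not> direct_basis (- im_vec z # ((p - re_vec z) /\<^sub>R norm (im_vec z)) # b)"
proof -
  let ?c = "re_vec z" and ?d = "im_vec z"
  obtain e where e: "e \<bullet> ?d = 0" "norm e = norm ?d"
    using orthogonal_complement_witness[of ?d] n by auto
  have ee: "e \<bullet> e = ?d \<bullet> ?d" using e(2) by (metis power2_norm_eq_inner)
  have e0: "e \<noteq> 0" "e \<noteq> ?d" using e d0 by auto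
  define V where "V = {h. h \<bullet> ?d = 0 \<and> h \<bullet> e = 0}"
  obtain B where B: "B \<subseteq> V" "independent B" "V \<subseteq> span B" "card B = dim V" using basis_exists by blast
  have ind: "independent {?d, e}"
    using e e0 d0 by (intro pairwise_orthogonal_independent) (auto simp: pairwise_def orthogonal_def inner_commute[of ?d e])
  have "V = {y \<in> UNIV. \<forall>x\<in>span {?d, e}. orthogonal x y}"
  proof (intro set_eqI iffI)
    fix y assume y: "y \<in> V"
    have "orthogonal x y" if x: "x \<in> span {?d, e}" for x
    proof -
      have "orthogonal y w" if "w \<in> {?d, e}" for w using y that unfolding V_def orthogonal_def by blast
      from orthogonal_to_span[OF x this] show ?thesis by (simp only: orthogonal_commute)
    qed
    then show "y \<in> {y \<in> UNIV. \<forall>x\<in>span {?d, e}. orthogonal x y}" by blast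
  next
    fix y assume "y \<in> {y \<in> UNIV. \<forall>x\<in>span {?d, e}. orthogonal x y}"
    then have "orthogonal ?d y" "orthogonal e y" using span_base[of _ "{?d, e}"] by auto
    then show "y \<in> V" by (simp add: V_def orthogonal_def inner_commute)
  qed
  then have "dim V + dim (span {?d, e}) = dim (UNIV :: (real^('n::{finite,linorder})) set)"
    using dim_subspace_orthogonal_to_vectors[of "span {?d, e}" "UNIV :: (real^('n::{finite,linorder})) set"] by simp
  moreover have "dim (span {?d, e}) = 2" using ind e0 dim_eq_card_independent[OF ind] by (simp only: dim_span) simp
  ultimately have cB: "card B + 2 = CARD('n)" using B(4) by simp
  have "finite B" using B(2) independent_imp_finite by blast
  then obtain b where b: "set b = B" "distinct b" using finite_distinct_list by blast
  have len: "length b + 2 = CARD('n)" using b cB distinct_card by metis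
  obtain D where D: "\<And>u w. direct_basis (u # w # b) \<longleftrightarrow> D u w > 0"
    "\<And>a c a' c' u w. D (a *\<^sub>R u + c *\<^sub>R w) (a' *\<^sub>R u + c' *\<^sub>R w) = (a * c' - c * a') * (D u w :: real)"
    "\<And>u w. D u w = det (\<chi> i. (u # w # b) ! card {k. k < i})"
    using direct_basis_first_two[OF len] by metis
  let ?A = "\<chi> i::'n. (?d # e # b) ! card {k. k < i}"
  have "x = 0" if x: "?A *v x = 0" for x
  proof -
    have row: "(?d # e # b) ! card {k. k < i} \<bullet> x = 0" for i :: 'n
    proof -
      have "(?A *v x) $ i = 0" using x by simp
      then show ?thesis by (simp add: matrix_vector_mult_def inner_vec_def)
    qed
    have all: "r \<bullet> x = 0" if r: "r \<in> set (?d # e # b)" for r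
    proof -
      obtain j where j: "j < length (?d # e # b)" "r = (?d # e # b) ! j" using r by (metis in_set_conv_nth)
      then have "j \<in> (\<lambda>i::'n. card {k. k < i}) ` UNIV"
        using bij_betw_card_less[where 'n = 'n] len by (auto simp: bij_betw_def)
      then obtain i :: 'n where "j = card {k. k < i}" by blast
      then show ?thesis using row[of i] j by simp
    qed
    have "x \<in> V" using all[of ?d] all[of e] by (simp add: V_def inner_commute)
    then have "x \<in> span B" using B(3) by blast
    moreover have "orthogonal x w" if "w \<in> B" for w
      using all[of w] b(1) that by (simp add: orthogonal_def inner_commute[of x w])
    ultimately have "orthogonal x x" by (rule orthogonal_to_span)
    then show ?thesis by (simp add: orthogonal_def)
  qed
  then have "invertible ?A" using invertible_left_inverse[of ?A] matrix_left_invertible_ker[of ?A] by blast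
  then have "D ?d e \<noteq> 0" unfolding D(3) using invertible_det_nz by blast
  moreover have "D ?d (- e) = - D ?d e" using D(2)[of 1 ?d 0 e 0 "-1"] by simp
  ultimately have "D ?d e > 0 \<or> D ?d (- e) > 0" by linarith
  then obtain e' where e': "e' = e \<or> e' = - e" "D ?d e' > 0" by blast
  define p where "p = ?c + e'"
  have p: "p \<in> sphere_pts z" unfolding p_def sphere_pts_add_iff using e' e(1) ee by auto
  have "tangent_space (sphere_pts z) p = V"
    unfolding tangent_space_sphere_pts[OF p d0] V_def using e'(1) by (auto simp: p_def)
  then have ob: "ordered_basis (tangent_space (sphere_pts z) p) b"
    using B b by (simp add: ordered_basis_def)
  have dn: "norm ?d > 0" using d0 by simp
  have "D ?d (e' /\<^sub>R norm ?d) = inverse (norm ?d) * D ?d e'"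
    "D (- ?d) (e' /\<^sub>R norm ?d) = - (inverse (norm ?d) * D ?d e')"
    using D(2)[of 1 ?d 0 e' 0 "inverse (norm ?d)"] D(2)[of "-1" ?d 0 e' 0 "inverse (norm ?d)"] by simp_all
  moreover have "inverse (norm ?d) * D ?d e' > 0" using dn e'(2) by simp
  ultimately have "D ?d (e' /\<^sub>R norm ?d) > 0" "\<not> D (- ?d) (e' /\<^sub>R norm ?d) > 0" by linarith+
  moreover have "p - ?c = e'" by (simp add: p_def)
  ultimately show ?thesis using p ob D(1) by (intro exI[of _ p] exI[of _ b]) simp
qed

lemma sphere_T_inj_higher:
  fixes z z' :: "complex^('n::{finite,linorder})"
  assumes n: "CARD('n) \<ge> 3" and eq: "sphere_T z = sphere_T z'"
  shows "z = z'"
proof -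
  have e: "sphere_pts z = sphere_pts z'" "p \<in> sphere_pts z \<and> ordered_basis (tangent_space (sphere_pts z) p) b \<and>
      direct_basis (im_vec z # ((p - re_vec z) /\<^sub>R norm (im_vec z)) # b) \<longleftrightarrow>
      p \<in> sphere_pts z' \<and> ordered_basis (tangent_space (sphere_pts z') p) b \<and>
      direct_basis (im_vec z' # ((p - re_vec z') /\<^sub>R norm (im_vec z')) # b)" for p b
  proof -
    have "sphere_T \<zeta> = Oriented_Sphere (sphere_pts \<zeta>) {(p, b). p \<in> sphere_pts \<zeta> \<and>
        ordered_basis (tangent_space (sphere_pts \<zeta>) p) b \<and>
        direct_basis (im_vec \<zeta> # ((p - re_vec \<zeta>) /\<^sub>R norm (im_vec \<zeta>)) # b)}" for \<zeta> :: "complex^('n::{finite,linorder})"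
      using n unfolding sphere_T_def Let_def sphere_pts_def by simp
    then have eq': "Oriented_Sphere (sphere_pts z) {(p, b). p \<in> sphere_pts z \<and> ordered_basis (tangent_space (sphere_pts z) p) b \<and>
        direct_basis (im_vec z # ((p - re_vec z) /\<^sub>R norm (im_vec z)) # b)} =
       Oriented_Sphere (sphere_pts z') {(p, b). p \<in> sphere_pts z' \<and> ordered_basis (tangent_space (sphere_pts z') p) b \<and>
        direct_basis (im_vec z' # ((p - re_vec z') /\<^sub>R norm (im_vec z')) # b)}"
      using eq by (simp only:)
    note 1 = oriented_sphere.inject(2)[THEN iffD1, OF eq', THEN conjunct1]
    note 2 = oriented_sphere.inject(2)[THEN iffD1, OF eq', THEN conjunct2]
    from 2 have "(p, b) \<in> {(p, b). p \<in> sphere_pts z \<and> ordered_basis (tangent_space (sphere_pts z) p) b \<and>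
        direct_basis (im_vec z # ((p - re_vec z) /\<^sub>R norm (im_vec z)) # b)} \<longleftrightarrow>
       (p, b) \<in> {(p, b). p \<in> sphere_pts z' \<and> ordered_basis (tangent_space (sphere_pts z') p) b \<and>
        direct_basis (im_vec z' # ((p - re_vec z') /\<^sub>R norm (im_vec z')) # b)}" for p b
      by (simp only:)
    then show "sphere_pts z = sphere_pts z'" "p \<in> sphere_pts z \<and> ordered_basis (tangent_space (sphere_pts z) p) b \<and>
      direct_basis (im_vec z # ((p - re_vec z) /\<^sub>R norm (im_vec z)) # b) \<longleftrightarrow>
      p \<in> sphere_pts z' \<and> ordered_basis (tangent_space (sphere_pts z') p) b \<and>
      direct_basis (im_vec z' # ((p - re_vec z') /\<^sub>R norm (im_vec z')) # b)" for p b
      using 1 by (simp_all only: mem_Collect_eq prod.case)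
  qed
  have 1: "re_vec z = re_vec z'" "im_vec z' = im_vec z \<or> im_vec z' = - im_vec z"
    using sphere_pts_eq[OF _ e(1)] n by auto
  have "im_vec z' = im_vec z"
  proof (rule ccontr)
    assume neq: "im_vec z' \<noteq> im_vec z"
    then have m: "im_vec z' = - im_vec z" using 1(2) by blast
    then have d0: "im_vec z \<noteq> 0" using neq by auto
    obtain p b where pb: "p \<in> sphere_pts z" "ordered_basis (tangent_space (sphere_pts z) p) b"
      "direct_basis (im_vec z # ((p - re_vec z) /\<^sub>R norm (im_vec z)) # b)"
      "\<not> direct_basis (- im_vec z # ((p - re_vec z) /\<^sub>R norm (im_vec z)) # b)"
      using direct_basis_sphere_pts[OF n d0] by blast
    then have "direct_basis (im_vec z' # ((p - re_vec z') /\<^sub>R norm (im_vec z')) # b)" using e(2)[of p b] by blast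
    then show False using pb(4) m 1(1) by simp
  qed
  then show ?thesis using re_im_decomp[of z] re_im_decomp[of z'] 1(1) by simp
qed

section \<open>Dimension two\<close>

text \<open>For \<open>n = 2\<close>, \<open>calpha\<close> and \<open>cbeta\<close> are null
  coordinates of \<open>cdot\<close>. \<open>calpha z\<close> is the first point of
  \<open>sphere_T z\<close>, and Moebius maps act on it by a fractional linear map that does not
  involve \<open>cbeta z\<close>.\<close>

definition calpha :: "complex^('n::{finite,linorder}) \<Rightarrow> complex" where
  "calpha z = z $ Min UNIV + \<i> * z $ Max UNIV"

definition cbeta :: "complex^('n::{finite,linorder}) \<Rightarrow> complex" where
  "cbeta z = z $ Min UNIV - \<i> * z $ Max UNIV"

lemma UNIV_card_2:
  assumes "CARD('n::{finite,linorder}) = 2"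
  shows "(UNIV :: 'n set) = {Min UNIV, Max UNIV}" "Min (UNIV :: 'n set) \<noteq> Max UNIV"
proof -
  obtain a b :: 'n where ab: "UNIV = {a, b}" "a \<noteq> b" using assms card_2_iff by metis
  have "Min (UNIV :: 'n set) = min a b" "Max (UNIV :: 'n set) = max a b" unfolding ab(1) by simp_all
  then show "(UNIV :: 'n set) = {Min UNIV, Max UNIV}" "Min (UNIV :: 'n set) \<noteq> Max UNIV"
    using ab by (auto simp: min_def max_def)
qed

lemma cdot_alpha_beta:
  fixes z w :: "complex^('n::{finite,linorder})"
  assumes "CARD('n) = 2"
  shows "2 * cdot z w = calpha z * cbeta w + cbeta z * calpha w"
proof -
  have "cdot z w = z $ Min UNIV * w $ Min UNIV + z $ Max UNIV * w $ Max UNIV"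
    unfolding cdot_def by (subst UNIV_card_2(1)[OF assms]) (use UNIV_card_2(2)[OF assms] in simp)
  moreover have "\<i> * \<i> * t = - t" for t :: complex by simp
  ultimately show ?thesis by (simp add: calpha_def cbeta_def algebra_simps)
qed

lemma calpha_simps: "calpha (z + w) = calpha z + calpha w" "calpha (c *s z) = c * calpha z"
  by (simp_all add: calpha_def algebra_simps)

text \<open>Numerator and denominator split in the null coordinates, and the common factor
  containing \<open>\<beta>\<close> cancels.\<close>

lemma calpha_mob:
  fixes w :: "complex^('n::{finite,linorder})"
  assumes n: "CARD('n) = 2" and d: "mob_den a w \<noteq> 0"
  shows "calpha (mob a w) = (calpha w - calpha (ofr a)) / (1 - cbeta (ofr a) * calpha w)"
proof -
  define A where "A = calpha (ofr a)"
  define B where "B = cbeta (ofr a)"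
  define \<alpha> where "\<alpha> = calpha w"
  define \<beta> where "\<beta> = cbeta w"
  have c1: "2 * cdot w (ofr a) = \<alpha> * B + \<beta> * A"
    using cdot_alpha_beta[OF n, of w "ofr a"] by (simp add: A_def B_def \<alpha>_def \<beta>_def)
  have c2: "cdot w w = \<alpha> * \<beta>" using cdot_alpha_beta[OF n, of w w] by (simp add: \<alpha>_def \<beta>_def)
  have "2 * of_real (a \<bullet> a) = 2 * (A * B)"
    using cdot_alpha_beta[OF n, of "ofr a" "ofr a"] by (simp add: A_def B_def cdot_ofr)
  then have c3: "of_real (a \<bullet> a) = A * B" by simp
  have den: "mob_den a w = (1 - B * \<alpha>) * (1 - A * \<beta>)"
    unfolding mob_den_def c1 c2 c3 by (simp add: algebra_simps)
  have num: "calpha (mob_num a w) = (\<alpha> - A) * (1 - A * \<beta>)"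
    unfolding mob_num_def calpha_simps of_real_diff of_real_1 c1 c2 c3 \<alpha>_def[symmetric] A_def[symmetric]
    by (simp add: algebra_simps)
  have "1 - A * \<beta> \<noteq> 0" using d den by auto
  then show ?thesis
    unfolding mob_def calpha_simps num den A_def[symmetric] B_def[symmetric] \<alpha>_def[symmetric]
    by (simp add: mult.commute[of "1 - B * \<alpha>"] divide_inverse[symmetric])
qed

lemma plane_of_complex_inj:
  assumes "CARD('n::{finite,linorder}) = 2"
    "(plane_of_complex c :: real^('n::{finite,linorder})) = plane_of_complex c'"
  shows "c = c'"
proof -
  have "(plane_of_complex c :: real^('n::{finite,linorder})) $ i = plane_of_complex c' $ i" for i using assms(2) by simp
  from this[of "Min UNIV"] this[of "Max UNIV"] show ?thesis
    using UNIV_card_2(2)[OF assms(1)] by (simp add: plane_of_complex_def complex_eq_iff split: if_splits)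
qed

lemma sphere_T_inj_two:
  fixes z z' :: "complex^('n::{finite,linorder})"
  assumes n: "CARD('n) = 2" and eq: "sphere_T z = sphere_T z'"
  shows "z = z'"
proof -
  have "calpha z = calpha z'" "cnj (z $ Min UNIV) + \<i> * cnj (z $ Max UNIV) = cnj (z' $ Min UNIV) + \<i> * cnj (z' $ Max UNIV)"
    using eq n plane_of_complex_inj[OF n] by (auto simp: sphere_T_def calpha_def)
  then have "z $ Min UNIV + \<i> * z $ Max UNIV = z' $ Min UNIV + \<i> * z' $ Max UNIV"
    "z $ Min UNIV - \<i> * z $ Max UNIV = z' $ Min UNIV - \<i> * z' $ Max UNIV"
    by (auto simp: calpha_def complex_eq_iff)
  then have "z $ Min UNIV = z' $ Min UNIV" "z $ Max UNIV = z' $ Max UNIV"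
    by (auto simp: complex_eq_iff)
  moreover have "i = Min UNIV \<or> i = Max UNIV" for i :: 'n using UNIV_card_2(1)[OF n] by auto
  ultimately show ?thesis by (metis vec_eq_iff)
qed

lemma sphere_T_Th_two:
  fixes x :: "real^('n::{finite,linorder})"
  assumes x: "norm x < 1" and n: "CARD('n) = 2"
  shows "sphere_T (Th x v) = sphere_S (x, v)"
proof -
  define J :: "real^('n::{finite,linorder}) \<Rightarrow> real^('n::{finite,linorder})" where "J = (\<lambda>v. plane_of_complex (\<i> * complex_of_plane v))"
  note U = UNIV_card_2[OF n]
  have Jc: "J v $ Min UNIV = - v $ Max UNIV" "J v $ Max UNIV = v $ Min UNIV" for v
    using U(2) by (auto simp: J_def plane_of_complex_def complex_of_plane_def)
  have ext: "u = w" if "u $ Min UNIV = w $ Min UNIV" "u $ Max UNIV = w $ Max UNIV" for u w :: "real^('n::{finite,linorder})"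
  proof -
    have "i = Min UNIV \<or> i = Max UNIV" for i :: 'n using U(1) by blast
    then show ?thesis using that by (metis vec_eq_iff)
  qed
  have Jlin: "J (r *\<^sub>R v) = r *\<^sub>R J v" for r v by (rule ext) (simp_all add: Jc)
  have Jneg: "J (- v) = - J v" for v by (rule ext) (simp_all add: Jc)
  have "J v \<bullet> J v = v \<bullet> v" for v :: "real^('n::{finite,linorder})"
    unfolding inner_vec_def by (subst (1 2) U(1)) (use U(2) in \<open>simp add: Jc\<close>)
  then have Jn: "norm (J v) = norm v" for v by (simp add: norm_eq_sqrt_inner)
  have Jty: "ty x (J v) = J (ty x v)" for v by (simp add: ty_def Jn sgn_div_norm Jlin)
  \<comment> \<open>\<open>calpha\<close> does not distinguish \<open>\<i> *s ofr y\<close> from the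
    real vector \<open>J y\<close>. Hence the first point of the sphere is the image of a real
    point, the one in the direction rotated by a quarter turn.\<close>
  have al: "calpha (\<i> *s ofr y) = calpha (ofr (J y))" for y :: "real^('n::{finite,linorder})"
    by (simp add: calpha_def of_real_vec_def Jc algebra_simps)
  have poc: "plane_of_complex (calpha (ofr y)) = y" for y :: "real^('n::{finite,linorder})"
    by (rule ext) (use U(2) in \<open>simp_all add: plane_of_complex_def calpha_def of_real_vec_def\<close>)
  have key: "plane_of_complex (calpha (Th x v)) = riem_exp B1 pmet x (J v)" for v
  proof -
    let ?y = "ty x v"
    have "norm (- x) < 1" using x by simp
    then have d: "mob_den (- x) (\<i> *s ofr ?y) \<noteq> 0" "mob_den (- x) (ofr (J ?y)) \<noteq> 0"
      using mob_den_nz[OF _ imag_lie_ball[OF norm_ty[of x v]]] mob_den_nz[OF _ ofr_lie_ball[of "J ?y"]] norm_ty[of x v]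
      by (simp_all add: Jn)
    have "calpha (Th x v) = calpha (mob (- x) (ofr (J ?y)))"
      unfolding Th_def calpha_mob[OF n d(1)] calpha_mob[OF n d(2)] al ..
    also have "\<dots> = calpha (ofr (pmob (- x) (ty x (J v))))" by (simp only: ofr_pmob Jty)
    finally show ?thesis by (simp only: poc riem_exp_pmob[OF x])
  qed
  \<comment> \<open>Conjugation corresponds to \<open>v \<mapsto> - v\<close>, which exchanges the
    two points.\<close>
  have "ty x (- v) = - ty x v" by (simp add: ty_def sgn_minus)
  then have "cnjv (Th x v) = Th x (- v)"
    by (simp add: Th_def mob_cnjv(1)[symmetric] ofr_simps)
  moreover have "cnj (Th x v $ Min UNIV) + \<i> * cnj (Th x v $ Max UNIV) = calpha (cnjv (Th x v))"
    by (simp add: calpha_def cnjv_def)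
  ultimately have "plane_of_complex (cnj (Th x v $ Min UNIV) + \<i> * cnj (Th x v $ Max UNIV)) = riem_exp B1 pmet x (- J v)"
    using key[of "- v"] by (simp add: Jneg)
  then show ?thesis
    using n key[of v] by (simp add: sphere_T_def sphere_S_def Let_def calpha_def[symmetric] J_def)
qed

lemma theta_eq:
  fixes x :: "real^('n::{finite,linorder})"
  assumes x: "norm x < 1" and n: "CARD('n) \<ge> 2"
  shows "theta (x, v) = Th x v"
proof -
  have eq: "sphere_S (x, v) = sphere_T (Th x v)"
    using sphere_T_Th_two[OF x] sphere_T_Th_higher[OF x] n by (cases "CARD('n) = 2") auto
  have "inj_on (sphere_T :: complex^('n::{finite,linorder}) \<Rightarrow> _) LB"
  proof (rule inj_onI)
    fix z z' :: "complex^('n::{finite,linorder})" assume eq: "sphere_T z = sphere_T z'"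
    show "z = z'"
    proof (cases "CARD('n) = 2")
      case True
      then show ?thesis using eq by (rule sphere_T_inj_two)
    next
      case False
      then have "CARD('n) \<ge> 3" using n by simp
      then show ?thesis using eq by (rule sphere_T_inj_higher)
    qed
  qed
  then show ?thesis unfolding theta_def comp_def eq using Th_lie_ball[OF x] by (rule inv_into_f_f)
qed

section \<open>The structure of the map on tangent vectors\<close>

lemma Ck_on_entire_series:
  fixes c :: "nat \<Rightarrow> real"
  assumes "\<And>x. summable (\<lambda>n. c n * x ^ n)"
  shows "Ck_on k UNIV (\<lambda>x. \<Sum>n. c n * x ^ n)"
proof -
  have s: "summable (\<lambda>n. (diffs ^^ j) c n * x ^ n)" for j and x :: real
  proof (induction j arbitrary: x)
    case (Suc j)
    then show ?case using termdiff_converges_all[of "(diffs ^^ j) c" x] by simp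
  qed (use assms in simp)
  have "Ck_on k UNIV (\<lambda>x. \<Sum>n. (diffs ^^ 0) c n * x ^ n)"
  proof (rule Ck_on_derivative_seq[where f = "\<lambda>j x. \<Sum>n. (diffs ^^ j) c n * x ^ n"])
    show "((\<lambda>x. \<Sum>n. (diffs ^^ j) c n * x ^ n) has_real_derivative (\<Sum>n. (diffs ^^ Suc j) c n * x ^ n)) (at x)" for j x
      using termdiffs_strong_converges_everywhere[of "(diffs ^^ j) c" x, OF s] by simp
  qed simp
  then show ?thesis by simp
qed

text \<open>\<open>coshsq (r\<^sup>2) = cosh r\<close> and \<open>sinhsq (r\<^sup>2) = sinh r / r\<close>.\<close>

definition coshsq :: "real \<Rightarrow> real" where
  "coshsq q = (\<Sum>n. (1 / fact (2 * n)) * q ^ n)"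

definition sinhsq :: "real \<Rightarrow> real" where
  "sinhsq q = (\<Sum>n. (1 / fact (2 * n + 1)) * q ^ n)"

lemma summable_fact_double:
  "summable (\<lambda>n. (1 / fact (2 * n)) * (q::real) ^ n)" "summable (\<lambda>n. (1 / fact (2 * n + 1)) * (q::real) ^ n)"
proof -
  have s: "summable (\<lambda>n. inverse (fact n) * \<bar>q\<bar> ^ n)" using summable_exp[of "\<bar>q\<bar>"] .
  have f: "inverse (fact m) \<le> (inverse (fact n) :: real)" if "n \<le> m" for n m :: nat
    using fact_mono[OF that, where 'a = real] by (simp add: le_imp_inverse_le)
  show "summable (\<lambda>n. (1 / fact (2 * n)) * q ^ n)" "summable (\<lambda>n. (1 / fact (2 * n + 1)) * q ^ n)"
    by (rule summable_comparison_test'[OF s, of 0], simp add: abs_mult power_abs inverse_eq_divide[symmetric] del: fact_Suc,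
        rule mult_right_mono[OF f], simp, simp)+
qed

lemma sinhsq_has_derivative: "(coshsq has_real_derivative sinhsq q / 2) (at q)"
proof -
  have "(coshsq has_real_derivative (\<Sum>n. diffs (\<lambda>n. 1 / fact (2 * n)) n * q ^ n)) (at q)"
    unfolding coshsq_def[abs_def]
    by (rule termdiffs_strong_converges_everywhere[OF summable_fact_double(1)])
  moreover have "diffs (\<lambda>n. 1 / fact (2 * n)) n = (1 / 2) * (1 / fact (2 * n + 1) :: real)" for n
    by (simp add: diffs_def divide_simps del: of_nat_Suc) (simp add: algebra_simps)
  then have "(\<Sum>n. diffs (\<lambda>n. 1 / fact (2 * n)) n * q ^ n) = (\<Sum>n. (1 / 2) * ((1 / fact (2 * n + 1)) * q ^ n))"
    by (simp only: mult.assoc)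
  then have "(\<Sum>n. diffs (\<lambda>n. 1 / fact (2 * n)) n * q ^ n) = sinhsq q / 2"
    using suminf_mult[OF summable_fact_double(2)[of q], of "1 / 2"] by (simp add: sinhsq_def)
  ultimately show ?thesis by simp
qed

lemma coshsq_power2: "coshsq (r\<^sup>2) = cosh r"
proof -
  have "(\<lambda>n. if even n then r ^ n / fact n else 0) sums cosh r"
    using cosh_converges[of r] by (simp add: scaleR_conv_of_real divide_inverse mult.commute if_distrib cong: if_cong)
  then have "(\<lambda>n. r ^ (2 * n) / fact (2 * n)) sums cosh r"
  proof (subst (asm) sums_mono_reindex[of "\<lambda>n. 2 * n", symmetric])
    show "(if even n then r ^ n / fact n else 0) = 0" if "n \<notin> range (\<lambda>n. 2 * n)" for n :: nat
      using that by (metis dvdE rangeI)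
  qed (simp_all add: strict_mono_def)
  then have "(\<lambda>n. 1 / fact (2 * n) * (r\<^sup>2) ^ n) sums cosh r" by (simp add: power_mult)
  then show ?thesis unfolding coshsq_def by (rule sums_unique[symmetric])
qed

lemma sinhsq_power2: "r * sinhsq (r\<^sup>2) = sinh r"
proof -
  have "(\<lambda>n. if even n then 0 else r ^ n / fact n) sums sinh r"
    using sinh_converges[of r] by (simp add: scaleR_conv_of_real divide_inverse mult.commute if_distrib cong: if_cong)
  then have "(\<lambda>n. r ^ (2 * n + 1) / fact (2 * n + 1)) sums sinh r"
  proof (subst (asm) sums_mono_reindex[of "\<lambda>n. 2 * n + 1", symmetric])
    show "(if even n then 0 else r ^ n / fact n) = 0" if "n \<notin> range (\<lambda>n. 2 * n + 1)" for n :: nat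
      using that by (metis oddE rangeI)
  qed (simp_all add: strict_mono_def del: fact_Suc)
  then have "(\<lambda>n. r * ((1 / fact (2 * n + 1)) * (r\<^sup>2) ^ n)) sums sinh r"
    by (simp add: power_mult[symmetric] del: fact_Suc)
  moreover have "(\<lambda>n. r * ((1 / fact (2 * n + 1)) * (r\<^sup>2) ^ n)) sums (r * sinhsq (r\<^sup>2))"
    unfolding sinhsq_def by (intro sums_mult summable_sums summable_fact_double)
  ultimately show ?thesis by (rule sums_unique2[symmetric])
qed

lemma coshsq_pos: "q \<ge> 0 \<Longrightarrow> coshsq q > 0"
  using coshsq_power2[of "sqrt q"] by simp

lemma sinhsq_pos: "q \<ge> 0 \<Longrightarrow> sinhsq q > 0"
proof (cases "q = 0")
  case True
  then show ?thesis by (simp only: sinhsq_def powser_zero) simp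
next
  case False
  assume "q \<ge> 0"
  then have "sqrt q * sinhsq q = sinh (sqrt q)" "sqrt q > 0" using sinhsq_power2[of "sqrt q"] False by simp_all
  then show ?thesis by (metis sinh_real_pos_iff zero_less_mult_pos)
qed

text \<open>Rewrites \<open>tanh (norm u) *\<^sub>R sgn u\<close> through functions of
  \<open>u \<bullet> u\<close>, as \<open>norm\<close> is not differentiable at 0:
  \<open>tanh r / r\<close> is a quotient of entire functions of \<open>r\<^sup>2\<close> whose
  denominator is positive at nonnegative arguments.\<close>

definition tanh_vec :: "'a::real_inner \<Rightarrow> 'a" where
  "tanh_vec u = (sinhsq (u \<bullet> u) / coshsq (u \<bullet> u)) *\<^sub>R u"

lemma tanh_vec_eq: "tanh_vec u = tanh (norm u) *\<^sub>R sgn u"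
proof (cases "u = 0")
  case False
  have "sinhsq (u \<bullet> u) = sinh (norm u) / norm u"
    using sinhsq_power2[of "norm u"] False by (simp add: power2_norm_eq_inner field_simps)
  moreover have "coshsq (u \<bullet> u) = cosh (norm u)" using coshsq_power2[of "norm u"] by (simp add: power2_norm_eq_inner)
  ultimately show ?thesis by (simp add: tanh_vec_def tanh_def sgn_div_norm divide_inverse)
qed (simp add: tanh_vec_def)

lemma ty_tanh_vec: "norm x < 1 \<Longrightarrow> ty x v = tanh_vec ((1 / (1 - x \<bullet> x)) *\<^sub>R v)"
  using ball_inner(2)[of x] by (simp add: tanh_vec_eq ty_def sgn_scaleR)

lemma norm_tanh_vec: "1 - tanh_vec u \<bullet> tanh_vec u = 1 / (coshsq (u \<bullet> u))\<^sup>2"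
proof -
  have "tanh_vec u \<bullet> tanh_vec u = (tanh (norm u))\<^sup>2"
    by (cases "u = 0") (simp_all add: tanh_vec_eq power2_norm_eq_inner[symmetric] power_mult_distrib norm_sgn)
  moreover have "coshsq (u \<bullet> u) = cosh (norm u)" using coshsq_power2[of "norm u"] by (simp add: power2_norm_eq_inner)
  ultimately show ?thesis using sech2[of "norm u"] by simp
qed

lemma Ck_on_tanh_vec:
  fixes f :: "'a::real_normed_vector \<Rightarrow> 'b::euclidean_space"
  assumes "open U" "Ck_on k U f"
  shows "Ck_on k U (\<lambda>x. tanh_vec (f x))"
proof -
  have "Ck_on k UNIV coshsq" "Ck_on k UNIV sinhsq"
    unfolding coshsq_def[abs_def] sinhsq_def[abs_def] by (intro Ck_on_entire_series summable_fact_double)+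
  then have "Ck_on k U (\<lambda>x. coshsq (f x \<bullet> f x))" "Ck_on k U (\<lambda>x. sinhsq (f x \<bullet> f x))"
    using Ck_on_compose[OF assms(1) open_UNIV Ck_on_inner[OF assms(1) assms(2) assms(2)]] by blast+
  moreover have "coshsq (f x \<bullet> f x) \<noteq> 0" for x using coshsq_pos[of "f x \<bullet> f x"] by simp
  ultimately show ?thesis
    unfolding tanh_vec_def by (intro Ck_on_scaleR Ck_on_divide assms)
qed

text \<open>Differentiating \<open>(1 - tanh_vec u \<bullet> tanh_vec u) * (coshsq (u \<bullet>
  u))\<^sup>2 = 1\<close> shows that a kernel vector \<open>h\<close> is orthogonal to
  \<open>u\<close>. The derivative of \<open>coshsq (u \<bullet> u) *\<^sub>R tanh_vec u = sinhsq (u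
  \<bullet> u) *\<^sub>R u\<close> then leaves
  \<open>sinhsq (u \<bullet> u) *\<^sub>R h = 0\<close>.\<close>

lemma tanh_vec_immersion:
  fixes f' :: "'a::euclidean_space \<Rightarrow> 'a"
  assumes d: "(tanh_vec has_derivative f') (at u)" and z: "f' h = 0"
  shows "h = 0"
proof -
  let ?q = "\<lambda>u::'a. u \<bullet> u"
  have dq: "(?q has_derivative (\<lambda>h. 2 * (u \<bullet> h))) (at u)"
    by (auto intro!: derivative_eq_intros simp: inner_commute)
  have c0: "coshsq (?q u) > 0" and s0: "sinhsq (?q u) > 0" by (simp_all add: coshsq_pos sinhsq_pos)
  have dc: "((\<lambda>u. coshsq (?q u)) has_derivative (\<lambda>h. sinhsq (?q u) / 2 * (2 * (u \<bullet> h)))) (at u)"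
    using has_derivative_compose[OF dq] sinhsq_has_derivative[of "?q u"] unfolding has_field_derivative_def by blast
  have L: "((\<lambda>u. (1 - tanh_vec u \<bullet> tanh_vec u) * (coshsq (?q u))\<^sup>2) has_derivative
      (\<lambda>h. (1 - tanh_vec u \<bullet> tanh_vec u) * (2 * coshsq (?q u) * (sinhsq (?q u) / 2 * (2 * (u \<bullet> h))))
        + (- 2 * (tanh_vec u \<bullet> f' h)) * (coshsq (?q u))\<^sup>2)) (at u)"
    by (rule has_derivative_eq_rhs[OF has_derivative_mult[OF
            has_derivative_diff[OF has_derivative_const has_derivative_inner[OF d d]] has_derivative_power[OF dc, of 2]]])
      (simp add: fun_eq_iff inner_commute)
  have one: "(1 - tanh_vec v \<bullet> tanh_vec v) * (coshsq (?q v))\<^sup>2 = 1" for v :: 'a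
    using coshsq_pos[of "?q v"] by (simp add: norm_tanh_vec)
  have "((\<lambda>u. (1 - tanh_vec u \<bullet> tanh_vec u) * (coshsq (?q u))\<^sup>2) has_derivative (\<lambda>h. 0)) (at u)"
    unfolding one by simp
  from has_derivative_unique[OF L this] have
    "(1 - tanh_vec u \<bullet> tanh_vec u) * (2 * coshsq (?q u) * (sinhsq (?q u) / 2 * (2 * (u \<bullet> h))))
        + (- 2 * (tanh_vec u \<bullet> f' h)) * (coshsq (?q u))\<^sup>2 = 0" by meson
  then have uh: "u \<bullet> h = 0" using z c0 s0 by (simp add: norm_tanh_vec)
  have s1: "((\<lambda>u. coshsq (?q u) *\<^sub>R tanh_vec u) has_derivative
      (\<lambda>h. coshsq (?q u) *\<^sub>R f' h + (sinhsq (?q u) / 2 * (2 * (u \<bullet> h))) *\<^sub>R tanh_vec u)) (at u)"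
    by (rule has_derivative_scaleR[OF dc d])
  have "Ck_on (Suc 0) UNIV sinhsq"
    unfolding sinhsq_def[abs_def] by (intro Ck_on_entire_series summable_fact_double)
  from Ck_on_SucD[OF open_UNIV this UNIV_I]
  have ds: "((\<lambda>u. sinhsq (?q u)) has_derivative (\<lambda>h. frechet_derivative sinhsq (at (?q u)) (2 * (u \<bullet> h)))) (at u)"
    by (rule has_derivative_compose[OF dq])
  have l0: "frechet_derivative sinhsq (at (?q u)) 0 = 0"
    using Ck_on_SucD[OF open_UNIV \<open>Ck_on (Suc 0) UNIV sinhsq\<close> UNIV_I] has_derivative_linear linear_0 by blast
  have s2: "((\<lambda>u. sinhsq (?q u) *\<^sub>R u) has_derivative
      (\<lambda>h. sinhsq (?q u) *\<^sub>R h + (frechet_derivative sinhsq (at (?q u)) (2 * (u \<bullet> h))) *\<^sub>R u)) (at u)"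
    by (rule has_derivative_scaleR[OF ds has_derivative_ident])
  have "coshsq (?q v) *\<^sub>R tanh_vec v = sinhsq (?q v) *\<^sub>R v" for v :: 'a
    using coshsq_pos[of "?q v"] by (simp add: tanh_vec_def)
  with s1 have "((\<lambda>u. sinhsq (?q u) *\<^sub>R u) has_derivative
      (\<lambda>h. coshsq (?q u) *\<^sub>R f' h + (sinhsq (?q u) / 2 * (2 * (u \<bullet> h))) *\<^sub>R tanh_vec u)) (at u)" by simp
  from has_derivative_unique[OF s2 this] have
    "sinhsq (?q u) *\<^sub>R h + (frechet_derivative sinhsq (at (?q u)) (2 * (u \<bullet> h))) *\<^sub>R u
      = coshsq (?q u) *\<^sub>R f' h + (sinhsq (?q u) / 2 * (2 * (u \<bullet> h))) *\<^sub>R tanh_vec u" by meson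
  then have "sinhsq (?q u) *\<^sub>R h = 0" using uh z by (simp add: l0)
  then show ?thesis using s0 by simp
qed

section \<open>Smoothness and injective derivative of the map\<close>

abbreviation thp :: "(real^'n) \<times> (real^'n) \<Rightarrow> complex^'n" where "thp \<equiv> \<lambda>q. Th (fst q) (snd q)"
abbreviation TB :: "((real^'n) \<times> (real^'n)) set" where "TB \<equiv> ball_tangent_bundle"

lemma open_TB: "open TB"
  unfolding ball_tangent_bundle_def by (intro open_Times) auto

lemma TB_iff: "q \<in> TB \<longleftrightarrow> norm (fst q) < 1"
  by (cases q) (simp add: ball_tangent_bundle_def)

lemma Ck_on_of_real:
  "open U \<Longrightarrow> Ck_on k U f \<Longrightarrow> Ck_on k U (\<lambda>x. complex_of_real (f x))"
  by (rule Ck_on_linear_comp[OF _ bounded_linear_of_real])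

lemma Ck_on_mob_joint:
  assumes "open U" "Ck_on k U f" "Ck_on k U a" "\<And>x. x \<in> U \<Longrightarrow> mob_den (a x) (f x) \<noteq> 0"
  shows "Ck_on k U (\<lambda>x. mob (a x) (f x))"
  unfolding mob_def
proof (intro Ck_on_smult Ck_on_inverse assms)
  show "Ck_on k U (\<lambda>x. mob_den (a x) (f x))"
    unfolding mob_den_def
    by (intro Ck_on_add Ck_on_diff Ck_on_mult Ck_on_cdot Ck_on_const Ck_on_ofr Ck_on_of_real Ck_on_inner assms)
  show "Ck_on k U (\<lambda>x. mob_num (a x) (f x))"
    unfolding mob_num_def
    by (intro Ck_on_add Ck_on_diff Ck_on_mult Ck_on_cdot Ck_on_const Ck_on_ofr Ck_on_of_real Ck_on_inner Ck_on_smult assms)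
qed

lemma Ck_on_thp: "Ck_on k TB thp"
proof -
  have p: "Ck_on k TB fst" "Ck_on k TB snd"
    using Ck_on_bounded_linear[OF open_TB] bounded_linear_fst bounded_linear_snd by blast+
  have d: "1 - fst q \<bullet> fst q \<noteq> 0" if "q \<in> TB" for q :: "(real^'n) \<times> (real^'n)"
    using ball_inner(2)[of "fst q"] that by (simp add: TB_iff)
  have "Ck_on k TB (\<lambda>q. mob (- fst q) (\<i> *s ofr (tanh_vec ((1 / (1 - fst q \<bullet> fst q)) *\<^sub>R snd q))))"
  proof (intro Ck_on_mob_joint Ck_on_smult Ck_on_ofr Ck_on_tanh_vec Ck_on_scaleR Ck_on_divide Ck_on_const Ck_on_minus
      Ck_on_diff Ck_on_inner open_TB p d)
    fix q :: "(real^'n) \<times> (real^'n)" assume "q \<in> TB"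
    then have q: "norm (fst q) < 1" by (simp add: TB_iff)
    show "mob_den (- fst q) (\<i> *s ofr (tanh_vec ((1 / (1 - fst q \<bullet> fst q)) *\<^sub>R snd q))) \<noteq> 0"
      unfolding ty_tanh_vec[OF q, symmetric] using q by (intro mob_den_nz imag_lie_ball norm_ty) simp
  qed auto
  then show ?thesis
    by (rule Ck_on_cong[OF open_TB, THEN iffD1, rotated]) (simp add: TB_iff Th_def ty_tanh_vec)
qed

lemma thp_LB: "q \<in> TB \<Longrightarrow> thp q \<in> LB"
  by (simp add: TB_iff Th_lie_ball)

lemma thp_has_derivative: "q \<in> TB \<Longrightarrow> (thp has_derivative frechet_derivative thp (at q)) (at q)"
  by (rule Ck_on_SucD[OF open_TB Ck_on_thp[of "Suc 0"]])

lemma kleinV_Th: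
  assumes "norm x < 1"
  shows "kleinV (Th x v) /\<^sub>R klein0 (Th x v) = (2 / (1 + x \<bullet> x)) *\<^sub>R x"
proof -
  have "re_vec (mob x (Th x v)) = 0" by (simp add: mob_Th[OF assms] re_vec_simps)
  then show ?thesis using re_vec_mob_eq_0_iff_klein[OF assms Th_lie_ball[OF assms]] by blast
qed

text \<open>The Klein coordinate of the image recovers the base point, so the fibre over
  \<open>x'\<close> is recognized by the values that \<open>mob x'\<close> makes imaginary.\<close>

lemma Th_eqD:
  assumes x: "norm x < 1" and x': "norm x' < 1" and z: "z = Th x v" "re_vec (mob x' z) = 0"
  shows "x' = x"
  using re_vec_mob_eq_0_iff_klein[OF x' Th_lie_ball[OF x, of v]] kleinV_Th[OF x, of v] klein_inj[OF x' x] z by simp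

lemma mob'_eq_0:
  assumes a: "norm a < 1" and z: "z \<in> LB" and "mob' a z u = 0"
  shows "u = 0"
proof -
  have nz: "mob_den a z \<noteq> 0" by (rule mob_den_nz[OF a z])
  have "(of_real (1 - a \<bullet> a) / mob_den a z)\<^sup>2 * cdot u v = 0" for v
    using cdot_mob'[OF nz, of u v] assms(3) by simp
  then have "cdot u v = 0" for v using nz ball_inner(2)[OF a] by (simp del: of_real_diff)
  from this[of "cnjv u"] show ?thesis by (simp add: cdot_cnjv_self)
qed

lemma differentiable_klein:
  assumes "z \<in> LB"
  shows "(\<lambda>z. kleinV z /\<^sub>R klein0 z) differentiable (at z)"
proof -
  have 1: "Ck_on (Suc 0) LB (\<lambda>z::complex^'n. cdot z z)"
    by (intro Ck_on_cdot Ck_on_id open_lie_ball)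
  have 2: "Ck_on (Suc 0) LB (kleinV :: complex^'n \<Rightarrow> _)"
    unfolding kleinV_def[abs_def]
    by (intro Ck_on_re_vec Ck_on_smult Ck_on_mult Ck_on_diff Ck_on_const Ck_on_id open_lie_ball
        Ck_on_linear_comp[OF open_lie_ball bounded_linear_cnj 1])
  have "klein0 = (\<lambda>z::complex^'n. 1 - cdot z z \<bullet> cdot z z)"
    by (auto simp: klein0_def power2_norm_eq_inner)
  note eq = this
  have 3: "Ck_on (Suc 0) LB (klein0 :: complex^'n \<Rightarrow> _)"
    unfolding eq by (rule Ck_on_diff[OF open_lie_ball Ck_on_const[OF open_lie_ball] Ck_on_inner[OF open_lie_ball 1 1]])
  have "Ck_on (Suc 0) LB (\<lambda>z::complex^'n. kleinV z /\<^sub>R klein0 z)"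
    by (intro Ck_on_scaleR Ck_on_inverse open_lie_ball 2 3) (use klein0_pos in force)
  then show ?thesis using Ck_on_SucD[OF open_lie_ball _ assms] differentiableI by blast
qed

text \<open>The Klein coordinate of the image depends on the base point alone, through a map with
  injective derivative, so a kernel vector has no base component. What remains is the derivative
  along the fibre, that of a rescaled \<open>tanh_vec\<close> followed by a Moebius map.\<close>

lemma thp_immersion:
  assumes q: "q \<in> TB" and z: "frechet_derivative thp (at q) h = 0"
  shows "h = 0"
proof -
  obtain x v where qe: "q = (x, v)" by (cases q)
  obtain \<xi> \<eta> where he: "h = (\<xi>, \<eta>)" by (cases h)
  have x: "norm x < 1" using q by (simp add: qe TB_iff)
  let ?D = "frechet_derivative thp (at q)"
  have lin: "linear ?D" using thp_has_derivative[OF q] has_derivative_linear by blast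
  obtain K where K: "((\<lambda>z. kleinV z /\<^sub>R klein0 z) has_derivative K) (at (thp q))"
    using differentiable_klein[OF thp_LB[OF q]] by (auto simp: differentiable_def)
  have "K 0 = 0" using K has_derivative_linear linear_0 by blast
  have "((\<lambda>q. kleinV (thp q) /\<^sub>R klein0 (thp q)) has_derivative (\<lambda>h. K (?D h))) (at q)"
    by (rule has_derivative_compose[OF thp_has_derivative[OF q] K])
  then have "((\<lambda>q. (2 / (1 + fst q \<bullet> fst q)) *\<^sub>R fst q) has_derivative (\<lambda>h. K (?D h))) (at q)"
    by (rule has_derivative_transform_within_open[OF _ open_TB q]) (simp add: TB_iff kleinV_Th)
  moreover have "((\<lambda>q. (1 + fst q \<bullet> fst q) *\<^sub>R ((2 / (1 + fst q \<bullet> fst q)) *\<^sub>R fst q)) has_derivative (\<lambda>h. 2 *\<^sub>R fst h)) (at q)"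
  proof -
    have "(1 + fst q \<bullet> fst q) *\<^sub>R ((2 / (1 + fst q \<bullet> fst q)) *\<^sub>R fst q) = 2 *\<^sub>R fst q" for q :: "(real^'n) \<times> (real^'n)"
      using inner_ge_zero[of "fst q"] by (simp add: add_nonneg_eq_0_iff field_simps)
    note eq = this
    show ?thesis unfolding eq by (auto intro!: derivative_eq_intros)
  qed
  moreover have dn: "((\<lambda>q. 1 + fst q \<bullet> fst q) has_derivative (\<lambda>h. 2 * (x \<bullet> fst h))) (at q)"
    by (auto intro!: derivative_eq_intros simp: qe inner_commute)
  ultimately have "(\<lambda>h. 2 *\<^sub>R fst h) = (\<lambda>h. (1 + fst q \<bullet> fst q) *\<^sub>R K (?D h) + (2 * (x \<bullet> fst h)) *\<^sub>R ((2 / (1 + fst q \<bullet> fst q)) *\<^sub>R fst q))"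
    by (intro has_derivative_unique[OF _ has_derivative_scaleR[OF dn]]) auto
  from fun_cong[OF this, of h] have "2 *\<^sub>R \<xi> = (2 * (x \<bullet> \<xi>)) *\<^sub>R ((2 / (1 + x \<bullet> x)) *\<^sub>R x)"
    using z \<open>K 0 = 0\<close> by (simp add: he qe)
  then have "(1 / 2) *\<^sub>R (2 *\<^sub>R \<xi>) = (1 / 2) *\<^sub>R ((2 * (x \<bullet> \<xi>)) *\<^sub>R ((2 / (1 + x \<bullet> x)) *\<^sub>R x))" by (simp only:)
  then have xi: "\<xi> = (2 * (x \<bullet> \<xi>) / (1 + x \<bullet> x)) *\<^sub>R x" by simp
  have "x \<bullet> \<xi> = x \<bullet> ((2 * (x \<bullet> \<xi>) / (1 + x \<bullet> x)) *\<^sub>R x)" by (rule arg_cong[OF xi])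
  also have "\<dots> = (2 * (x \<bullet> \<xi>) / (1 + x \<bullet> x)) * (x \<bullet> x)" by (rule inner_scaleR_right)
  finally have "(x \<bullet> \<xi>) * (1 - x \<bullet> x) = 0"
    using inner_ge_zero[of x] by (simp add: field_simps add_nonneg_eq_0_iff)
  then have "x \<bullet> \<xi> = 0" using ball_inner(2)[OF x] by simp
  then have xi0: "\<xi> = 0" using xi by simp
  let ?u = "\<lambda>v. (1 / (1 - x \<bullet> x)) *\<^sub>R v"
  have "Ck_on (Suc 0) UNIV (tanh_vec :: real^'n \<Rightarrow> _)"
    using Ck_on_tanh_vec[OF open_UNIV Ck_on_id[OF open_UNIV]] .
  then obtain T where T: "(tanh_vec has_derivative T) (at (?u v))"
    using Ck_on_SucD[OF open_UNIV _ UNIV_I] by blast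
  have du: "(?u has_derivative ?u) (at v)" by (auto intro!: derivative_eq_intros)
  have dT: "((\<lambda>v. \<i> *s ofr (tanh_vec (?u v))) has_derivative (\<lambda>h. \<i> *s ofr (T (?u h)))) (at v)"
    by (rule bounded_linear.has_derivative[OF bounded_bilinear.bounded_linear_right[OF bounded_bilinear_smult]
          has_derivative_ofr[OF has_derivative_compose[OF du T]]])
  have L: "\<i> *s ofr (tanh_vec (?u v)) \<in> LB" "norm (- x) < 1"
    using imag_lie_ball[OF norm_ty, of x v] x by (simp_all add: ty_tanh_vec)
  have "((\<lambda>v. mob (- x) (\<i> *s ofr (tanh_vec (?u v)))) has_derivative
      (\<lambda>h. mob' (- x) (\<i> *s ofr (tanh_vec (?u v))) (\<i> *s ofr (T (?u h))))) (at v)"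
    using has_derivative_compose[OF dT] has_derivative_mob[OF mob_den_nz[OF L(2,1)]] by blast
  then have 1: "((\<lambda>v. Th x v) has_derivative
      (\<lambda>h. mob' (- x) (\<i> *s ofr (tanh_vec (?u v))) (\<i> *s ofr (T (?u h))))) (at v)"
    by (simp only: Th_def ty_tanh_vec[OF x])
  have dp: "((\<lambda>v. (x, v)) has_derivative (\<lambda>h. (0, h))) (at v)" by (auto intro!: derivative_eq_intros)
  have "((\<lambda>v. thp (x, v)) has_derivative (\<lambda>h. ?D (0, h))) (at v)"
    using has_derivative_compose[OF dp, of thp ?D] thp_has_derivative[OF q] by (simp add: qe)
  from has_derivative_unique[OF this] 1 have
    "?D (0, \<eta>) = mob' (- x) (\<i> *s ofr (tanh_vec (?u v))) (\<i> *s ofr (T (?u \<eta>)))" by (simp add: fun_eq_iff)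
  then have "mob' (- x) (\<i> *s ofr (tanh_vec (?u v))) (\<i> *s ofr (T (?u \<eta>))) = 0" using z by (simp add: he xi0)
  then have "\<i> *s ofr (T (?u \<eta>)) = 0" by (rule mob'_eq_0[OF L(2,1)])
  then have "T (?u \<eta>) = 0" using ofr_eq_iff[of "T (?u \<eta>)" 0] by (simp add: ofr_simps)
  then have "?u \<eta> = 0" by (rule tanh_vec_immersion[OF T])
  then show ?thesis using ball_inner(2)[OF x] by (simp add: he xi0 zero_prod_def)
qed

section \<open>The connection of the tangent bundle\<close>

text \<open>Transport to an imaginary point, where the metric is definite.\<close>

lemma lieG_nondegenerate:
  fixes z :: "complex^'n"
  assumes z: "z \<in> LB" and c: "\<And>u. lieG z c u = 0"
  shows "c = 0"
proof -
  obtain x y where xy: "norm x < 1" "norm y < 1" "z = mob (- x) (\<i> *s ofr y)"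
    using lie_ball_mob_imag[OF z] by blast
  have m: "mob x z = \<i> *s ofr y" unfolding xy(3) using xy by (intro mob_inverse_lie_ball imag_lie_ball)
  have "lieG (\<i> *s ofr y) (mob' x z c) (mob' x z c) = 0"
    using lieG_mob[OF xy(1) z, of c c] c by (simp add: m)
  then have "mob' x z c = 0" using ball_inner(2)[OF xy(2)] by (simp add: lieG_imag[OF xy(2)])
  then show ?thesis by (rule mob'_eq_0[OF xy(1) z])
qed

text \<open>The map recentred at \<open>p\<close>. As \<open>mob p\<close> is an isometry, the
  pulled back metric is the same for every \<open>p\<close>, and each argument may choose the
  \<open>p\<close> whose fibre becomes imaginary.\<close>

abbreviation TF :: "real^'n \<Rightarrow> (real^'n) \<times> (real^'n) \<Rightarrow> complex^'n" where
  "TF p \<equiv> \<lambda>q. mob p (thp q)"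

lemma TF_LB: "norm p < 1 \<Longrightarrow> q \<in> TB \<Longrightarrow> TF p q \<in> LB"
  using mob_lie_ball thp_LB by blast

lemma TF_setting:
  assumes p: "norm p < 1"
  shows "pullback_setting TB LB (TF p) lieG"
proof
  show "Ck_on (Suc (Suc 0)) TB (TF p)"
    by (intro Ck_on_mob open_TB Ck_on_thp mob_den_nz p thp_LB)
  show "TF p ` TB \<subseteq> LB" using TF_LB[OF p] by blast
qed (auto intro: open_TB open_lie_ball lieG_bilinear lieG_sym lieG_differentiable)

lemma TF_derivative:
  assumes p: "norm p < 1" and q: "q \<in> TB"
  shows "frechet_derivative (TF p) (at q) = (\<lambda>h. mob' p (thp q) (frechet_derivative thp (at q) h))"
    "(TF p has_derivative (\<lambda>h. mob' p (thp q) (frechet_derivative thp (at q) h))) (at q)"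
proof -
  show d: "(TF p has_derivative (\<lambda>h. mob' p (thp q) (frechet_derivative thp (at q) h))) (at q)"
    by (rule has_derivative_compose[OF thp_has_derivative[OF q] has_derivative_mob[OF mob_den_nz[OF p thp_LB[OF q]]]])
  show "frechet_derivative (TF p) (at q) = (\<lambda>h. mob' p (thp q) (frechet_derivative thp (at q) h))"
    using frechet_derivative_at[OF d] by simp
qed

lemma bij_TF_derivative:
  fixes p :: "real^'n"
  assumes p: "norm p < 1" and q: "q \<in> TB"
  shows "bij (frechet_derivative (TF p) (at q))"
proof -
  let ?D = "frechet_derivative (TF p) (at q)"
  have lin: "linear ?D" unfolding TF_derivative(1)[OF p q] by (rule has_derivative_linear[OF TF_derivative(2)[OF p q]])
  have "h = 0" if "?D h = 0" for h
    using that mob'_eq_0[OF p thp_LB[OF q]] thp_immersion[OF q] by (simp add: TF_derivative(1)[OF p q])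
  then have inj: "inj ?D" using linear_injective_0[OF lin] by blast
  have "dim (range ?D) = dim (UNIV :: ((real^'n) \<times> (real^'n)) set)" by (rule dim_image_eq[OF lin]) (use inj in auto)
  also have "\<dots> = dim (UNIV :: (complex^'n) set)" by simp
  finally have "range ?D = UNIV"
    by (intro subspace_dim_equal linear_subspace_image lin) auto
  then show ?thesis using inj by (simp add: bij_def)
qed

lemma christoffel_cong:
  assumes U: "open U" "x \<in> U" and eq: "\<And>y u v. y \<in> U \<Longrightarrow> g y u v = g' y u v"
  shows "christoffel g x u w = christoffel g' x u w"
proof -
  have "frechet_derivative (\<lambda>y. g y a b) (at x) = frechet_derivative (\<lambda>y. g' y a b) (at x)" for a b
    by (rule frechet_derivative_apply_cong[OF U]) (rule eq)
  then show ?thesis using eq[OF U(2)] unfolding christoffel_def by simp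
qed

lemma theta_derivative:
  fixes q :: "(real^('n::{finite,linorder})) \<times> (real^('n::{finite,linorder}))"
  assumes n: "CARD('n) \<ge> 2" and q: "q \<in> TB"
  shows "theta q = thp q" "frechet_derivative theta (at q) = frechet_derivative thp (at q)"
proof -
  have eq: "theta y = thp y" if "y \<in> TB" for y :: "(real^('n::{finite,linorder})) \<times> (real^('n::{finite,linorder}))"
    using theta_eq[OF _ n, of "fst y" "snd y"] that by (simp add: TB_iff)
  show "theta q = thp q" by (rule eq[OF q])
  show "frechet_derivative theta (at q) = frechet_derivative thp (at q)"
    by (rule frechet_derivative_apply_cong[OF open_TB q eq])
qed

lemma tangent_bundle_metric_eq:
  fixes q :: "(real^('n::{finite,linorder})) \<times> (real^('n::{finite,linorder}))"
  assumes n: "CARD('n) \<ge> 2" and q: "q \<in> TB"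
  shows "tangent_bundle_metric q u v = lieG (thp q) (frechet_derivative thp (at q) u) (frechet_derivative thp (at q) v)"
  unfolding tangent_bundle_metric_def pullback_metric_def theta_derivative[OF n q]
  by (rule lie_metric_eq[OF thp_LB[OF q]])

lemma tangent_bundle_metric_TF:
  fixes q :: "(real^('n::{finite,linorder})) \<times> (real^('n::{finite,linorder}))"
  assumes n: "CARD('n) \<ge> 2" and q: "q \<in> TB" and p: "norm p < 1"
  shows "tangent_bundle_metric q u v = pullback_metric (TF p) lieG q u v"
  unfolding tangent_bundle_metric_eq[OF n q] pullback_metric_def TF_derivative(1)[OF p q]
  by (rule lieG_mob[OF p thp_LB[OF q], symmetric])

lemma TF_christoffel:
  fixes q :: "(real^('n::{finite,linorder})) \<times> (real^('n::{finite,linorder}))"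
  assumes n: "CARD('n) \<ge> 2" and q: "q \<in> TB" and p: "norm p < 1"
  shows "frechet_derivative (TF p) (at q) (christoffel tangent_bundle_metric q u w)
    = lieGamma (TF p q) (frechet_derivative (TF p) (at q) u) (frechet_derivative (TF p) (at q) w) + deriv2 (TF p) q u w"
proof -
  interpret pullback_setting TB LB "TF p" lieG by (rule TF_setting[OF p])
  have "christoffel tangent_bundle_metric q u w = christoffel (pullback_metric (TF p) lieG) q u w"
    by (rule christoffel_cong[OF open_TB q]) (rule tangent_bundle_metric_TF[OF n _ p])
  then show ?thesis
    using christoffel_pullback[OF q _ bij_TF_derivative[OF p q], of "lieGamma (TF p q)"]
      lieG_nondegenerate[OF TF_LB[OF p q]] lieG_lieGamma[OF TF_LB[OF p q]] by auto
qed

text \<open>The terms with \<open>deriv2\<close> from \<open>curve_derivatives\<close> and from the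
  transformation law cancel, so images of geodesics solve the explicit system for
  \<open>lieGamma\<close>.\<close>

lemma TF_geodesic:
  fixes \<gamma> :: "real \<Rightarrow> (real^('n::{finite,linorder})) \<times> (real^('n::{finite,linorder}))"
  assumes n: "CARD('n) \<ge> 2" and p: "norm p < 1" and I: "open I" "\<And>t. t \<in> I \<Longrightarrow> \<gamma> t \<in> TB"
    and g1: "\<And>t. t \<in> I \<Longrightarrow> (\<gamma> has_vector_derivative \<gamma>' t) (at t)"
    and g2: "\<And>t. t \<in> I \<Longrightarrow> (\<gamma>' has_vector_derivative - christoffel tangent_bundle_metric (\<gamma> t) (\<gamma>' t) (\<gamma>' t)) (at t)"
    and t: "t \<in> I"
  shows "((\<lambda>s. TF p (\<gamma> s)) has_vector_derivative frechet_derivative (TF p) (at (\<gamma> t)) (\<gamma>' t)) (at t)"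
    "((\<lambda>s. frechet_derivative (TF p) (at (\<gamma> s)) (\<gamma>' s)) has_vector_derivative
      - lieGamma (TF p (\<gamma> t)) (frechet_derivative (TF p) (at (\<gamma> t)) (\<gamma>' t)) (frechet_derivative (TF p) (at (\<gamma> t)) (\<gamma>' t))) (at t)"
proof -
  interpret pullback_setting TB LB "TF p" lieG by (rule TF_setting[OF p])
  note c = curve_derivatives[OF I(2)[OF t] I(1) t g1 g2[OF t]]
  show "((\<lambda>s. TF p (\<gamma> s)) has_vector_derivative frechet_derivative (TF p) (at (\<gamma> t)) (\<gamma>' t)) (at t)"
    by (rule c(1))
  have "linear (F' (\<gamma> t))" using F_has_derivative[OF I(2)[OF t]] has_derivative_linear by blast
  then have "deriv2 (TF p) (\<gamma> t) (\<gamma>' t) (\<gamma>' t) + F' (\<gamma> t) (- christoffel tangent_bundle_metric (\<gamma> t) (\<gamma>' t) (\<gamma>' t))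
      = - lieGamma (TF p (\<gamma> t)) (F' (\<gamma> t) (\<gamma>' t)) (F' (\<gamma> t) (\<gamma>' t))"
    by (simp only: linear_neg TF_christoffel[OF n I(2)[OF t] p]) simp
  then show "((\<lambda>s. F' (\<gamma> s) (\<gamma>' s)) has_vector_derivative
      - lieGamma (TF p (\<gamma> t)) (F' (\<gamma> t) (\<gamma>' t)) (F' (\<gamma> t) (\<gamma>' t))) (at t)"
    using c(2) by simp
qed

section \<open>Vector lines\<close>

lemma lieGamma_imag_line:
  assumes e: "norm e = 1" and t: "\<bar>\<tau>\<bar> < 1"
  shows "lieGamma ((\<i> * of_real \<tau>) *s ofr e) ((\<i> * of_real \<sigma>) *s ofr e) ((\<i> * of_real \<sigma>) *s ofr e)
    = (\<i> * of_real (2 * \<sigma>\<^sup>2 * \<tau> / (1 - \<tau>\<^sup>2))) *s ofr e"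
proof -
  have ee: "cdot (ofr e) (ofr e) = 1" using e by (simp add: cdot_ofr norm_eq_1)
  have "\<tau>\<^sup>2 < 1" using t by (simp add: abs_square_less_1)
  then have nz: "complex_of_real (1 - \<tau>\<^sup>2) \<noteq> 0" by (simp del: of_real_diff)
  define T where "T = complex_of_real \<tau>"
  define S where "S = complex_of_real \<sigma>"
  have nz': "1 - T\<^sup>2 \<noteq> 0" using nz by (simp add: T_def)
  let ?z = "(\<i> * T) *s ofr e"
  have cz: "cnjv ?z = (- (\<i> * T)) *s ofr e" by (simp add: T_def)
  have ii: "\<i> * (\<i> * x) = - x" for x :: complex by (simp add: mult.assoc[symmetric])
  have hb: "hb ?z (cnjv ?z) = (1 - T\<^sup>2)\<^sup>2"
    unfolding hb_def cz by (simp add: cdot_simps ee power2_eq_square algebra_simps ii)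
  have hb1: "hb1 ?z (cnjv ?z) ((\<i> * S) *s ofr e) = - (2 * S * T * (1 - T\<^sup>2))"
    unfolding hb1_def cz by (simp add: cdot_simps ee power2_eq_square algebra_simps ii)
  have k: "cnjv ?z + (- cdot (cnjv ?z) (cnjv ?z)) *s ?z = (- (\<i> * T * (1 - T\<^sup>2))) *s ofr e"
    unfolding cz by (simp add: cdot_simps ee vector_sadd_rdistrib[symmetric] power2_eq_square algebra_simps ii)
  have uu: "cdot ((\<i> * S) *s ofr e) ((\<i> * S) *s ofr e) = - S\<^sup>2"
    by (simp add: cdot_simps ee power2_eq_square ii mult.assoc mult.left_commute[of S])
  have "lieGamma ?z ((\<i> * S) *s ofr e) ((\<i> * S) *s ofr e) =
     ((- (- (2 * S * T * (1 - T\<^sup>2)) / (1 - T\<^sup>2)\<^sup>2)) * (\<i> * S) + (- (- (2 * S * T * (1 - T\<^sup>2)) / (1 - T\<^sup>2)\<^sup>2)) * (\<i> * S)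
      + (- (2 * (- S\<^sup>2) / (1 - T\<^sup>2)\<^sup>2)) * (- (\<i> * T * (1 - T\<^sup>2)))) *s ofr e"
    unfolding lieGamma_def hb hb1 k uu by (simp only: vector_smult_assoc vector_sadd_rdistrib)
  also have "(- (- (2 * S * T * (1 - T\<^sup>2)) / (1 - T\<^sup>2)\<^sup>2)) * (\<i> * S) + (- (- (2 * S * T * (1 - T\<^sup>2)) / (1 - T\<^sup>2)\<^sup>2)) * (\<i> * S)
      + (- (2 * (- S\<^sup>2) / (1 - T\<^sup>2)\<^sup>2)) * (- (\<i> * T * (1 - T\<^sup>2))) = \<i> * (2 * S\<^sup>2 * T / (1 - T\<^sup>2))"
  proof -
    have "(- (- (2 * S * T * W) / W\<^sup>2)) * (\<i> * S) + (- (- (2 * S * T * W) / W\<^sup>2)) * (\<i> * S)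
      + (- (2 * (- S\<^sup>2) / W\<^sup>2)) * (- (\<i> * T * W)) = \<i> * (2 * S\<^sup>2 * T / W)" if "W \<noteq> 0" for W
      using that by (simp add: field_simps power2_eq_square)
    from this[OF nz'] show ?thesis .
  qed
  finally show ?thesis by (simp add: T_def S_def)
qed

text \<open>The image of \<open>t \<mapsto> (p, t *\<^sub>R w)\<close> runs along the unit vector
  \<open>e\<close> with coordinate \<open>\<i> * tanh (t * c)\<close>, where \<open>c\<close> is the
  hyperbolic length of \<open>w\<close>. Its acceleration is minus the value of
  \<open>lieGamma\<close> on its velocity, so the transformation law leaves nothing for the bundle:
  the lines are geodesics in their linear parameter.\<close>

lemma christoffel_vector_line:
  fixes p w :: "real^('n::{finite,linorder})"
  assumes n: "CARD('n) \<ge> 2" and p: "norm p < 1" and w: "w \<noteq> 0"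
  shows "christoffel tangent_bundle_metric (p, t *\<^sub>R w) (0, w) (0, w) = 0"
proof -
  interpret pullback_setting TB LB "TF p" lieG by (rule TF_setting[OF p])
  define c where "c = norm w / (1 - p \<bullet> p)"
  define e where "e = sgn w"
  have c: "c > 0" using ball_inner(2)[OF p] w by (simp add: c_def)
  have e: "norm e = 1" using w by (simp add: e_def norm_sgn)
  have TFt: "TF p (p, t *\<^sub>R w) = (\<i> * of_real (tanh (t * c))) *s ofr e" for t
  proof -
    have "sgn (t *\<^sub>R w) = sgn t *\<^sub>R e" by (simp add: e_def sgn_scaleR)
    moreover have "tanh (\<bar>t\<bar> * c) * sgn t = tanh (t * c)" by (cases "t \<ge> 0") (auto simp: sgn_if)
    ultimately have "ty p (t *\<^sub>R w) = tanh (t * c) *\<^sub>R e" by (simp add: ty_def c_def)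
    then show ?thesis using mob_Th[OF p, of "t *\<^sub>R w"] by (simp add: ofr_simps vector_smult_assoc)
  qed
  have dt: "((\<lambda>t. tanh (t * c)) has_real_derivative c * (1 - (tanh (t * c))\<^sup>2)) (at t)" for t :: real
    by (auto intro!: derivative_eq_intros)
  have dl: "((\<lambda>t. (\<i> * of_real (f t)) *s ofr e) has_vector_derivative (\<i> * of_real f') *s ofr e) (at t)"
    if "(f has_real_derivative f') (at t)" for f f' t
  proof -
    have bl: "bounded_linear (\<lambda>r. (\<i> * complex_of_real r) *s ofr e)"
    proof (rule bounded_linear_compose[of "\<lambda>c. c *s ofr e" "\<lambda>r. \<i> * complex_of_real r"])
      show "bounded_linear (\<lambda>c. c *s ofr e)" by (rule bounded_bilinear.bounded_linear_left[OF bounded_bilinear_smult])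
    qed (intro bounded_linear_const_mult bounded_linear_of_real)
    show ?thesis
      by (rule bounded_linear.has_vector_derivative[OF bl])
        (use that in \<open>simp add: has_real_derivative_iff_has_vector_derivative\<close>)
  qed
  let ?g = "\<lambda>t. (p, t *\<^sub>R w)"
  have in_TB: "?g t \<in> TB" for t using p by (simp add: TB_iff)
  have g1: "(?g has_vector_derivative (0, w)) (at t)" for t
    unfolding has_vector_derivative_def by (auto intro!: derivative_eq_intros simp: fun_eq_iff)
  have g2: "((\<lambda>t. (0, w)) has_vector_derivative 0) (at t)" for t by simp
  note cd = curve_derivatives[OF in_TB open_UNIV UNIV_I g1 g2]
  have X': "F' (?g t) (0, w) = (\<i> * of_real (c * (1 - (tanh (t * c))\<^sup>2))) *s ofr e" for t
  proof -
    have "((\<lambda>t. TF p (?g t)) has_vector_derivative (\<i> * of_real (c * (1 - (tanh (t * c))\<^sup>2))) *s ofr e) (at t)"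
      unfolding TFt by (rule dl[OF dt])
    then show ?thesis using cd(1)[of t] vector_derivative_unique_at by blast
  qed
  have "((\<lambda>t. c * (1 - (tanh (t * c))\<^sup>2)) has_real_derivative - (2 * c\<^sup>2 * tanh (t * c) * (1 - (tanh (t * c))\<^sup>2))) (at t)"
    by (auto intro!: derivative_eq_intros dt simp: power2_eq_square algebra_simps)
  note dl[OF this]
  then have "((\<lambda>s. F' (?g s) (0, w)) has_vector_derivative
      (\<i> * of_real (- (2 * c\<^sup>2 * tanh (t * c) * (1 - (tanh (t * c))\<^sup>2)))) *s ofr e) (at t)" by (simp only: X')
  moreover have "F' (?g t) 0 = 0"
    using F_has_derivative[OF in_TB[of t]] has_derivative_linear linear_0 by blast
  ultimately have d2: "deriv2 (TF p) (?g t) (0, w) (0, w) = (\<i> * of_real (- (2 * c\<^sup>2 * tanh (t * c) * (1 - (tanh (t * c))\<^sup>2)))) *s ofr e"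
    using cd(2)[of t] vector_derivative_unique_at by fastforce
  have "(tanh (t * c))\<^sup>2 < 1" using tanh_real_bounds[of "t * c"] by (simp add: abs_square_less_1 abs_less_iff)
  then have "2 * (c * (1 - (tanh (t * c))\<^sup>2))\<^sup>2 * tanh (t * c) / (1 - (tanh (t * c))\<^sup>2) = 2 * c\<^sup>2 * tanh (t * c) * (1 - (tanh (t * c))\<^sup>2)"
    by (simp add: power2_eq_square[of "_ * _"] power2_eq_square[of c])
  moreover have "\<bar>tanh (t * c)\<bar> < 1" using tanh_real_bounds[of "t * c"] by (simp add: abs_less_iff)
  ultimately have "lieGamma (TF p (?g t)) (F' (?g t) (0, w)) (F' (?g t) (0, w))
      = (\<i> * of_real (2 * c\<^sup>2 * tanh (t * c) * (1 - (tanh (t * c))\<^sup>2))) *s ofr e"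
    unfolding X' TFt by (simp only: lieGamma_imag_line[OF e])
  then have "F' (?g t) (christoffel tangent_bundle_metric (?g t) (0, w) (0, w)) = 0"
    unfolding TF_christoffel[OF n in_TB p] d2 by (simp add: vector_sadd_rdistrib[symmetric])
  then show ?thesis
    using injD[OF bij_is_inj[OF bij_TF_derivative[OF p in_TB[of t]]], of _ 0] \<open>F' (?g t) 0 = 0\<close> by simp
qed

lemma geodesic_line_vector_line:
  fixes p :: "real^('n::{finite,linorder})"
  assumes n: "CARD('n) \<ge> 2" and p: "norm p < 1" and L: "subspace L" "dim L = 1"
  shows "geodesic_line TB tangent_bundle_metric ({p} \<times> L)"
proof -
  obtain B where B: "B \<subseteq> L" "independent B" "span B = L" "card B = 1"
    using basis_exists[of L] L span_minimal[of _ L] by (metis subset_antisym)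
  then obtain w where w: "B = {w}" using card_1_singletonE by blast
  have w0: "w \<noteq> 0" using B(2) w by auto
  have Lw: "L = range (\<lambda>t. t *\<^sub>R w)" using B(3) w span_singleton by metis
  let ?g = "\<lambda>t. (p, t *\<^sub>R w)"
  have "geodesic_on TB tangent_bundle_metric UNIV ?g"
    unfolding geodesic_on_def
  proof (intro conjI exI[of _ "\<lambda>t. (0, w)"] ballI)
    show "?g ` UNIV \<subseteq> TB" using p by (auto simp: TB_iff)
    show "(?g has_vector_derivative (0, w)) (at t)" for t
      unfolding has_vector_derivative_def by (auto intro!: derivative_eq_intros simp: fun_eq_iff)
    show "((\<lambda>t. (0, w)) has_vector_derivative - christoffel tangent_bundle_metric (?g t) (0, w) (0, w)) (at t)" for t
      by (simp add: christoffel_vector_line[OF n p w0])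
  qed auto
  moreover have "\<not> ?g constant_on UNIV"
  proof
    assume "?g constant_on UNIV"
    then obtain y where y: "\<And>t. ?g t = y" unfolding constant_on_def by blast
    from y[of 0] y[of 1] show False using w0 by auto
  qed
  moreover have "{p} \<times> L = range ?g" unfolding Lw by auto
  ultimately show ?thesis unfolding geodesic_line_def by blast
qed

section \<open>Tangent spaces as totally geodesic submanifolds\<close>

lemma tangent_space_vertical:
  fixes p :: "'a::euclidean_space"
  assumes "w \<in> tangent_space ({p} \<times> (UNIV :: 'b::real_normed_vector set)) q"
  shows "fst w = 0"
proof -
  have "((\<lambda>x. fst x \<bullet> fst w) has_derivative (\<lambda>h. fst h \<bullet> fst w)) (at q)" by (auto intro!: derivative_eq_intros)
  from tangent_space_const[OF assms _ this, of "p \<bullet> fst w"] show ?thesis by auto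
qed

lemma embedded_submanifold_vertical:
  "embedded_submanifold ({p} \<times> (UNIV :: 'b::euclidean_space set) :: ('a::euclidean_space \<times> 'b) set)"
  unfolding embedded_submanifold_def
proof (rule exI[of _ "{0} \<times> UNIV"], intro conjI ballI)
  show "subspace ({0} \<times> UNIV :: ('a \<times> 'b) set)"
    by (intro subspace_Times) auto
  fix x :: "'a \<times> 'b" assume "x \<in> {p} \<times> UNIV"
  define t :: "'a \<times> 'b \<Rightarrow> 'a \<times> 'b" where "t = (\<lambda>q. q - (p, 0))"
  define s :: "'a \<times> 'b \<Rightarrow> 'a \<times> 'b" where "s = (\<lambda>q. q + (p, 0))"
  have "homeomorphism UNIV UNIV t s"
    by (rule homeomorphismI) (auto simp: t_def s_def intro!: continuous_intros)
  moreover have "smooth_on UNIV t" "smooth_on UNIV s"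
    unfolding smooth_on_def t_def s_def by (intro allI Ck_on_diff Ck_on_add Ck_on_id Ck_on_const open_UNIV)+
  moreover have "t ` (({p} \<times> UNIV) \<inter> UNIV) = ({0} \<times> UNIV) \<inter> UNIV"
  proof -
    have "(0, y) \<in> t ` ({p} \<times> UNIV)" for y by (rule image_eqI[of _ _ "(p, y)"]) (auto simp: t_def)
    then show ?thesis by (auto simp: t_def)
  qed
  ultimately show "\<exists>V W \<phi> \<psi>. open V \<and> x \<in> V \<and> open W \<and> homeomorphism V W \<phi> \<psi> \<and> smooth_on V \<phi> \<and>
      smooth_on W \<psi> \<and> \<phi> ` (({p} \<times> UNIV) \<inter> V) = ({0} \<times> UNIV :: ('a \<times> 'b) set) \<inter> W"
    using open_UNIV UNIV_I by blast
qed

lemma totally_geodesic_vertical: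
  fixes p :: "real^('n::{finite,linorder})"
  assumes n: "CARD('n) \<ge> 2" and p: "norm p < 1"
  shows "totally_geodesic TB tangent_bundle_metric ({p} \<times> UNIV)"
  unfolding totally_geodesic_def
proof (intro conjI allI impI, goal_cases)
  case 1
  show ?case using p by (auto simp: TB_iff)
next
  case 2
  show ?case by (rule embedded_submanifold_vertical)
next
  case (3 I \<gamma> w)
  let ?N = "{p} \<times> (UNIV :: (real^('n::{finite,linorder})) set)"
  from 3 have I: "open I" "0 \<in> I" "\<And>t. t \<in> I \<Longrightarrow> \<gamma> t \<in> TB" and g0: "\<gamma> 0 \<in> ?N"
    and w: "(\<gamma> has_vector_derivative w) (at 0)" "fst w = 0"
    by (auto simp: geodesic_on_def intro: tangent_space_vertical)
  obtain \<gamma>' where g1: "\<And>t. t \<in> I \<Longrightarrow> (\<gamma> has_vector_derivative \<gamma>' t) (at t)"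
    and g2: "\<And>t. t \<in> I \<Longrightarrow> (\<gamma>' has_vector_derivative - christoffel tangent_bundle_metric (\<gamma> t) (\<gamma>' t) (\<gamma>' t)) (at t)"
    using 3 unfolding geodesic_on_def by metis
  have w0: "\<gamma>' 0 = w" using g1[OF I(2)] w(1) vector_derivative_unique_at by blast
  define X where "X = (\<lambda>t. TF p (\<gamma> t))"
  define X' where "X' = (\<lambda>t. frechet_derivative (TF p) (at (\<gamma> t)) (\<gamma>' t))"
  have X: "(X has_vector_derivative X' t) (at t)"
    "(X' has_vector_derivative - lieGamma (X t) (X' t) (X' t)) (at t)" if "t \<in> I" for t
    using TF_geodesic[OF n p I(1,3) g1 g2 that] by (simp_all add: X_def X'_def)
  let ?r = "\<lambda>z. - cnjv z"
  have blr: "bounded_linear ?r" by (intro bounded_linear_minus bounded_linear_cnjv)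
  have Y: "((\<lambda>t. ?r (X t)) has_vector_derivative ?r (X' t)) (at t)"
    "((\<lambda>t. ?r (X' t)) has_vector_derivative - lieGamma (?r (X t)) (?r (X' t)) (?r (X' t))) (at t)" if "t \<in> I" for t
    using bounded_linear.has_vector_derivative[OF blr X(1)[OF that]] bounded_linear.has_vector_derivative[OF blr X(2)[OF that]]
    by (simp_all add: lieGamma_reflect)
  have im: "mob p (Th p u) = \<i> *s ofr (ty p u)" for u by (rule mob_Th[OF p])
  have X0: "?r (X 0) = X 0" using g0 by (auto simp: X_def im)
  \<comment> \<open>Along the vertical line through \<open>\<gamma> 0\<close> with velocity
    \<open>w\<close> the map takes imaginary values, so its derivative on \<open>w\<close> is fixed
    by the reflection.\<close>
  have X'0: "?r (X' 0) = X' 0"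
  proof -
    obtain v0 where v0: "\<gamma> 0 = (p, v0)" using g0 by auto
    let ?D = "frechet_derivative (TF p) (at (\<gamma> 0))"
    have "(TF p has_derivative ?D) (at (p, v0))" using TF_derivative[OF p I(3)[OF I(2)]] v0 by simp
    moreover have "((\<lambda>s. (p, v0 + s *\<^sub>R snd w)) has_derivative (\<lambda>r. r *\<^sub>R w)) (at 0)"
      using w(2) by (auto intro!: derivative_eq_intros simp: fun_eq_iff prod_eq_iff)
    ultimately have "((\<lambda>s::real. TF p (p, v0 + s *\<^sub>R snd w)) has_derivative (\<lambda>r. ?D (r *\<^sub>R w))) (at 0)"
      using has_derivative_compose[of "\<lambda>s. (p, v0 + s *\<^sub>R snd w)" "\<lambda>r. r *\<^sub>R w" 0 UNIV "TF p" ?D] by simp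
    note d = this
    have "((\<lambda>s::real. ?r (TF p (p, v0 + s *\<^sub>R snd w))) has_derivative (\<lambda>r. ?r (?D (r *\<^sub>R w)))) (at 0)"
      by (rule bounded_linear.has_derivative[OF blr d])
    then have "((\<lambda>s::real. TF p (p, v0 + s *\<^sub>R snd w)) has_derivative (\<lambda>r. ?r (?D (r *\<^sub>R w)))) (at 0)"
      by (simp add: im)
    from has_derivative_unique[OF this d] have "?r (?D (1 *\<^sub>R w)) = ?D (1 *\<^sub>R w)" by meson
    then show ?thesis by (simp add: X'_def w0)
  qed
  let ?G = "\<lambda>(z, u). (u, - lieGamma z u u)"
  have "\<exists>e>0. \<forall>t. \<bar>t - 0\<bar> < e \<longrightarrow> t \<in> I \<and> (X t, X' t) = (?r (X t), ?r (X' t))"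
  proof (rule ode_unique_local[OF I(1,2), where G = ?G])
    show "((\<lambda>t. (X t, X' t)) has_vector_derivative ?G (X t, X' t)) (at t)" if "t \<in> I" for t
      using has_vector_derivative_Pair[OF X[OF that]] by simp
    show "((\<lambda>t. (?r (X t), ?r (X' t))) has_vector_derivative ?G (?r (X t), ?r (X' t))) (at t)" if "t \<in> I" for t
      using has_vector_derivative_Pair[OF Y[OF that]] by simp
    show "(X 0, X' 0) = (?r (X 0), ?r (X' 0))" using X0 X'0 by simp
    show "loc_lipschitz_at (X 0, X' 0) ?G"
      by (rule loc_lipschitz_lieGamma) (use TF_LB[OF p I(3)[OF I(2)]] in \<open>simp add: X_def\<close>)
  qed
  then obtain e where e: "e > 0" "\<And>t. \<bar>t\<bar> < e \<Longrightarrow> t \<in> I \<and> X t = ?r (X t)" by auto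
  have "\<gamma> t \<in> ?N" if t: "\<bar>t\<bar> < e" for t
  proof -
    have "re_vec (X t) = re_vec (?r (X t))" using e(2)[OF t] by simp
    moreover have "re_vec (?r (X t)) = - re_vec (X t)" by (simp add: re_vec_def cnjv_def vec_eq_iff)
    ultimately have "re_vec (X t) + re_vec (X t) = 0" by simp
    then have "re_vec (X t) = 0" by (simp add: scaleR_2[symmetric])
    \<comment> \<open>An imaginary value of \<open>TF p\<close> occurs only over the base point
      \<open>p\<close>.\<close>
    then have "p = fst (\<gamma> t)"
      using Th_eqD[of "fst (\<gamma> t)" p _ "snd (\<gamma> t)"] I(3) e(2)[OF t] p by (simp add: X_def TB_iff)
    then show ?thesis by (cases "\<gamma> t") simp
  qed
  then show ?case using e by blast
qed

section \<open>Geodesic disks\<close>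

text \<open>
  Compositions of Moebius maps multiply \<open>cdot (z - w) (z - w)\<close> and \<open>hb z w\<close> by the same factor
  \<open>j z * j w\<close>. If moreover \<open>0\<close> is fixed, the second form shows \<open>j z * j w = 1\<close>, and the first one
  that the composition preserves \<open>cdot\<close>; this stands in for its linearity.
\<close>

definition mobius_like :: "(complex^'n \<Rightarrow> complex^'n) \<Rightarrow> bool" where
  "mobius_like G \<longleftrightarrow> (\<exists>j. \<forall>z\<in>LB. \<forall>w\<in>LB. G z \<in> LB \<and>
     cdot (G z - G w) (G z - G w) = j z * j w * cdot (z - w) (z - w) \<and> hb (G z) (G w) = j z * j w * hb z w)"

lemma mobius_like_mob:
  fixes a :: "real^'n"
  assumes a: "norm a < 1"
  shows "mobius_like (mob a)"
  unfolding mobius_like_def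
proof (intro exI[of _ "\<lambda>z. of_real (1 - a \<bullet> a) / mob_den a z"] ballI conjI)
  fix z w :: "complex^'n" assume zw: "z \<in> LB" "w \<in> LB"
  show "mob a z \<in> LB" by (rule mob_lie_ball[OF a zw(1)])
  note d = mob_den_nz[OF a zw(1)] mob_den_nz[OF a zw(2)]
  show "cdot (mob a z - mob a w) (mob a z - mob a w)
      = of_real (1 - a \<bullet> a) / mob_den a z * (of_real (1 - a \<bullet> a) / mob_den a w) * cdot (z - w) (z - w)"
    unfolding cdot_mob_diff[OF d] by (simp add: power2_eq_square)
  show "hb (mob a z) (mob a w) = of_real (1 - a \<bullet> a) / mob_den a z * (of_real (1 - a \<bullet> a) / mob_den a w) * hb z w"
    unfolding hb_mob[OF d] by (simp add: power2_eq_square)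
qed

lemma mobius_like_compose:
  fixes F G :: "complex^'n \<Rightarrow> complex^'n"
  assumes "mobius_like F" "mobius_like G"
  shows "mobius_like (\<lambda>z. F (G z))"
proof -
  obtain j where j: "\<And>z w. z \<in> LB \<Longrightarrow> w \<in> LB \<Longrightarrow> F z \<in> LB \<and>
     cdot (F z - F w) (F z - F w) = j z * j w * cdot (z - w) (z - w) \<and> hb (F z) (F w) = j z * j w * hb z w"
    using assms(1) unfolding mobius_like_def by blast
  obtain k where k: "\<And>z w. z \<in> LB \<Longrightarrow> w \<in> LB \<Longrightarrow> G z \<in> LB \<and>
     cdot (G z - G w) (G z - G w) = k z * k w * cdot (z - w) (z - w) \<and> hb (G z) (G w) = k z * k w * hb z w"
    using assms(2) unfolding mobius_like_def by blast
  show ?thesis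
    unfolding mobius_like_def
  proof (intro exI[of _ "\<lambda>z. j (G z) * k z"] ballI)
    fix z w :: "complex^'n" assume zw: "z \<in> LB" "w \<in> LB"
    show "F (G z) \<in> LB \<and> cdot (F (G z) - F (G w)) (F (G z) - F (G w)) = j (G z) * k z * (j (G w) * k w) * cdot (z - w) (z - w)
        \<and> hb (F (G z)) (F (G w)) = j (G z) * k z * (j (G w) * k w) * hb z w"
      using j[of "G z" "G w"] k[OF zw] k[OF zw(2,1)] by simp
  qed
qed

lemma mobius_like_fixes_zero:
  assumes G: "mobius_like G" "G 0 = 0" and z: "z \<in> LB" and w: "w \<in> LB"
  shows "cdot (G z) (G w) = cdot z w"
proof -
  obtain j where j: "\<And>z w. z \<in> LB \<Longrightarrow> w \<in> LB \<Longrightarrow>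
     cdot (G z - G w) (G z - G w) = j z * j w * cdot (z - w) (z - w) \<and> hb (G z) (G w) = j z * j w * hb z w"
    using G(1) unfolding mobius_like_def by blast
  have z0: "(0 :: complex^'a) \<in> LB" by simp
  have h0: "hb u 0 = 1" for u :: "complex^'a" by (simp add: hb_def)
  have j0: "j u * j 0 = 1" if "u \<in> LB" for u using j[OF that z0] by (simp add: h0 G(2))
  have jj: "j u * j v = 1" if "u \<in> LB" "v \<in> LB" for u v
  proof -
    have "(j u * j v) * (j 0 * j 0) = (j u * j 0) * (j v * j 0)" by (simp add: ac_simps)
    then show ?thesis using j0[OF that(1)] j0[OF that(2)] j0[OF z0] by simp
  qed
  have self: "cdot (G u) (G u) = cdot u u" if "u \<in> LB" for u using j[OF that z0] jj[OF that z0] by (simp add: G(2))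
  have pol: "cdot (a - b) (a - b) = cdot a a + cdot b b - 2 * cdot a b" for a b :: "complex^'a"
    by (simp add: cdot_diff_left cdot_diff_right cdot_commute[of b a])
  have "cdot (G z - G w) (G z - G w) = cdot (z - w) (z - w)" using j[OF z w] jj[OF z w] by simp
  then show ?thesis unfolding pol self[OF z] self[OF w] by simp
qed

section \<open>Diameters and the complex disks over them\<close>

lemma mob_line:
  assumes e: "norm e = 1" and d: "1 - of_real s * \<zeta> \<noteq> 0"
  shows "mob (s *\<^sub>R e) (\<zeta> *s ofr e) = ((\<zeta> - of_real s) / (1 - of_real s * \<zeta>)) *s ofr e"
proof -
  have ee: "e \<bullet> e = 1" "cdot (ofr e) (ofr e) = 1" using e by (simp_all add: cdot_ofr norm_eq_1)
  have den: "mob_den (s *\<^sub>R e) (\<zeta> *s ofr e) = (1 - of_real s * \<zeta>)\<^sup>2"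
    by (simp add: mob_den_def ofr_simps cdot_simps ee power2_eq_square algebra_simps)
  have "mob_num (s *\<^sub>R e) (\<zeta> *s ofr e) = (of_real (1 - s * s) * \<zeta>) *s ofr e
      + ((2 * (\<zeta> * of_real s) - 1 - \<zeta> * \<zeta>) * of_real s) *s ofr e"
    by (simp add: mob_num_def ofr_simps cdot_simps ee)
  also have "\<dots> = ((\<zeta> - of_real s) * (1 - of_real s * \<zeta>)) *s ofr e"
    unfolding vector_sadd_rdistrib[symmetric] by (rule arg_cong[where f = "\<lambda>c. c *s ofr e"]) (simp add: algebra_simps)
  finally have num: "mob_num (s *\<^sub>R e) (\<zeta> *s ofr e) = ((\<zeta> - of_real s) * (1 - of_real s * \<zeta>)) *s ofr e" .
  have "inverse (D\<^sup>2) * (N * D) = N / D" if "D \<noteq> 0" for D N :: complex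
    using that by (simp add: power2_eq_square field_simps)
  then show ?thesis unfolding mob_def den num vector_smult_assoc using d by simp
qed

lemma disk_lie_ball: "norm e = 1 \<Longrightarrow> cmod \<zeta> < 1 \<Longrightarrow> \<zeta> *s ofr e \<in> LB"
proof -
  assume e: "norm e = 1" and z: "cmod \<zeta> < 1"
  obtain r where r: "cmod \<zeta> < r" "r < 1" using dense[OF z] by blast
  then have r0: "r > 0" using norm_ge_zero[of \<zeta>] by linarith
  have "(\<zeta> / of_real r) *s ofr (r *\<^sub>R e) \<in> LB"
    by (intro smult_lie_ball ofr_lie_ball) (use r r0 e in \<open>simp_all add: norm_divide\<close>)
  then show ?thesis using r0 by (simp add: ofr_simps vector_smult_assoc)
qed

definition dline :: "real^'n \<Rightarrow> real^'n \<Rightarrow> real \<Rightarrow> real^'n" where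
  "dline x e s = pmob (- x) (s *\<^sub>R e)"

text \<open>The factor \<open>1 - s\<^sup>2\<close> makes this tangent vector of the line a
  hyperbolic unit vector.\<close>

definition dvel :: "real^'n \<Rightarrow> real^'n \<Rightarrow> real \<Rightarrow> real^'n" where
  "dvel x e s = pmob' (- x) (s *\<^sub>R e) ((1 - s\<^sup>2) *\<^sub>R e)"

lemma norm_dline: "norm x < 1 \<Longrightarrow> norm e = 1 \<Longrightarrow> \<bar>s\<bar> < 1 \<Longrightarrow> norm (dline x e s) < 1"
  unfolding dline_def by (rule norm_pmob) auto

text \<open>\<open>mob q\<close>, \<open>mob (- x)\<close> and
  \<open>mob (- (s *\<^sub>R e))\<close> compose to a map fixing 0, which preserves
  \<open>cdot\<close> and therefore acts linearly on the disk spanned by \<open>e\<close>, with a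
  unit vector \<open>a\<close> as the image direction. Removing the innermost map turns
  multiplication by \<open>\<zeta>\<close> into the disk automorphism that moves \<open>s\<close> to
  0.\<close>

lemma line_chart:
  fixes x e :: "real^'n"
  assumes x: "norm x < 1" and e: "norm e = 1" and s: "\<bar>s\<bar> < 1" and q: "q = dline x e s"
  shows "\<exists>a. norm a = 1 \<and> dvel x e s = (1 - q \<bullet> q) *\<^sub>R a \<and>
    (\<forall>\<zeta>. cmod \<zeta> < 1 \<longrightarrow> mob q (mob (- x) (\<zeta> *s ofr e)) = ((\<zeta> - of_real s) / (1 - of_real s * \<zeta>)) *s ofr a)"
proof -
  have qn: "norm q < 1" unfolding q by (rule norm_dline[OF x e s])
  have xn: "norm (- x) < 1" using x by simp
  have sn: "norm (s *\<^sub>R e) < 1" "norm (- (s *\<^sub>R e)) < 1" using s e by simp_all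
  define G where "G = (\<lambda>z. mob q (mob (- x) (mob (- (s *\<^sub>R e)) z)))"
  have G: "mobius_like G"
    unfolding G_def
    by (rule mobius_like_compose[OF mobius_like_mob[OF qn]
          mobius_like_compose[OF mobius_like_mob[OF xn] mobius_like_mob[OF sn(2)]]])
  have G0: "G 0 = 0"
  proof -
    have "mob (- (s *\<^sub>R e)) 0 = ofr (s *\<^sub>R e)" by (simp add: ofr_simps)
    moreover have "mob (- x) (ofr (s *\<^sub>R e)) = ofr q" by (simp only: q dline_def ofr_pmob)
    ultimately show ?thesis unfolding G_def by (simp only: mob_self)
  qed
  note pres = mobius_like_fixes_zero[OF G G0]
  have surj: "\<exists>z\<in>LB. G z = w" if w: "w \<in> LB" for w
  proof
    let ?z = "mob (s *\<^sub>R e) (mob x (mob (- q) w))"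
    have 1: "mob (- q) w \<in> LB" by (rule mob_lie_ball) (use qn w in auto)
    have 2: "mob x (mob (- q) w) \<in> LB" by (rule mob_lie_ball[OF x 1])
    show "?z \<in> LB" by (rule mob_lie_ball[OF sn(1) 2])
    show "G ?z = w"
      unfolding G_def mob_inverse_lie_ball(1)[OF sn(1) 2] mob_inverse_lie_ball(1)[OF x 1]
      by (rule mob_inverse_lie_ball(2)[OF qn w])
  qed
  \<comment> \<open>\<open>e\<close> itself is on the boundary, so \<open>a\<close> is obtained by
    doubling the image of its half.\<close>
  have h0: "norm ((1 / 2) *\<^sub>R e) < 1" using e by simp
  define b where "b = pmob q (pmob (- x) (pmob (- (s *\<^sub>R e)) ((1 / 2) *\<^sub>R e)))"
  have Gb: "G (ofr ((1 / 2) *\<^sub>R e)) = ofr b" by (simp add: G_def b_def ofr_pmob)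
  define a where "a = 2 *\<^sub>R b"
  have hl: "ofr ((1 / 2) *\<^sub>R e) \<in> LB" by (rule ofr_lie_ball[OF h0])
  have "cdot (ofr b) (ofr b) = cdot (ofr ((1 / 2) *\<^sub>R e)) (ofr ((1 / 2) *\<^sub>R e))"
    using pres[OF hl hl] by (simp only: Gb)
  then have "complex_of_real (b \<bullet> b) = complex_of_real (1 / 4 * (e \<bullet> e))" by (simp only: cdot_ofr) simp
  then have "b \<bullet> b = 1 / 4 * (e \<bullet> e)" by (simp only: of_real_eq_iff)
  then have "a \<bullet> a = 1" using e[unfolded norm_eq_1] by (simp add: a_def)
  then have na: "norm a = 1" by (simp only: norm_eq_1)
  have lin: "G (\<zeta> *s ofr e) = \<zeta> *s ofr a" if z: "\<zeta> *s ofr e \<in> LB" for \<zeta>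
  proof -
    \<comment> \<open>\<open>G\<close> is onto and preserves \<open>cdot\<close>, so
      \<open>h\<close> is orthogonal under \<open>cdot\<close> to the whole Lie ball, which contains
      a multiple of each coordinate vector.\<close>
    define h where "h = G (\<zeta> *s ofr e) - \<zeta> *s ofr a"
    have hw: "cdot h w = 0" if w: "w \<in> LB" for w
    proof -
      obtain v where v: "v \<in> LB" "G v = w" using surj[OF w] by blast
      have "cdot (ofr a) w = 2 * cdot (ofr b) w" by (simp add: a_def ofr_simps cdot_smult_left)
      also have "cdot (ofr b) w = cdot (ofr ((1 / 2) *\<^sub>R e)) v" using pres[OF hl v(1)] by (simp only: Gb v(2))
      also have "2 * cdot (ofr ((1 / 2) *\<^sub>R e)) v = cdot (ofr e) v" by (simp add: ofr_simps cdot_smult_left)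
      finally show ?thesis using pres[OF z v(1)] by (simp add: h_def cdot_diff_left cdot_smult_left v)
    qed
    have "h $ i = 0" for i
    proof -
      have "norm ((1 / 2) *\<^sub>R axis i 1 :: real^'n) < 1" by simp
      from hw[OF ofr_lie_ball[OF this]] have "cdot h (ofr (axis i 1)) = 0" by (simp add: ofr_simps cdot_smult_right)
      moreover have "cdot h (ofr (axis i 1)) = (\<Sum>k\<in>UNIV. if k = i then h $ k else 0)"
        unfolding cdot_def by (rule sum.cong) (auto simp: of_real_vec_def axis_def)
      ultimately show ?thesis by simp
    qed
    then have "h = 0" by (simp add: vec_eq_iff)
    then show ?thesis by (simp add: h_def)
  qed
  have chart: "mob q (mob (- x) (\<zeta> *s ofr e)) = ((\<zeta> - of_real s) / (1 - of_real s * \<zeta>)) *s ofr a" if z: "cmod \<zeta> < 1" for \<zeta>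
  proof -
    have zL: "\<zeta> *s ofr e \<in> LB" by (rule disk_lie_ball[OF e z])
    have "cmod (of_real s * \<zeta>) < 1"
      using s z by (simp add: norm_mult) (metis abs_ge_zero mult_less_cancel_right2 mult_le_one norm_ge_zero less_eq_real_def mult_strict_mono' mult_1_right)
    then have d: "1 - of_real s * \<zeta> \<noteq> 0" by auto
    note ml = mob_line[OF e d]
    have "mob (s *\<^sub>R e) (\<zeta> *s ofr e) \<in> LB" by (rule mob_lie_ball[OF sn(1) zL])
    then have "G (mob (s *\<^sub>R e) (\<zeta> *s ofr e)) = ((\<zeta> - of_real s) / (1 - of_real s * \<zeta>)) *s ofr a"
      unfolding ml by (rule lin)
    then show ?thesis by (simp only: G_def mob_inverse_lie_ball(1)[OF sn(1) zL])
  qed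
  have s2: "1 - s\<^sup>2 > 0" using s by (simp add: abs_square_less_1)
  \<comment> \<open>On real parameters the chart is a curve in the ball; its derivative at
    \<open>r = s\<close> identifies \<open>dvel\<close> as a multiple of \<open>a\<close>.\<close>
  have "pmob q (pmob (- x) (r *\<^sub>R e)) = ((r - s) / (1 - s * r)) *\<^sub>R a" if r: "\<bar>r\<bar> < 1" for r
  proof -
    have "ofr (pmob q (pmob (- x) (r *\<^sub>R e))) = mob q (mob (- x) (of_real r *s ofr e))"
      by (simp only: ofr_pmob ofr_simps)
    also have "\<dots> = ofr (((r - s) / (1 - s * r)) *\<^sub>R a)"
      using chart[of "of_real r"] r by (simp add: ofr_simps)
    finally show ?thesis by simp
  qed
  note eq = this
  have d1: "((\<lambda>r. pmob (- x) (r *\<^sub>R e)) has_derivative (\<lambda>r. r *\<^sub>R pmob' (- x) (s *\<^sub>R e) e)) (at s)"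
  proof -
    have "((\<lambda>r. r *\<^sub>R e) has_derivative (\<lambda>r. r *\<^sub>R e)) (at s)" by (auto intro!: derivative_eq_intros)
    from has_derivative_compose[OF this has_derivative_pmob[OF xn sn(1)]] show ?thesis by (simp only: pmob'_smult)
  qed
  have "((\<lambda>r. pmob q (pmob (- x) (r *\<^sub>R e))) has_derivative (\<lambda>r. pmob' q q (r *\<^sub>R pmob' (- x) (s *\<^sub>R e) e))) (at s)"
    using has_derivative_compose[OF d1, of "pmob q" "pmob' q q"] has_derivative_pmob[OF qn qn] by (simp add: q dline_def)
  moreover have "((\<lambda>r. pmob q (pmob (- x) (r *\<^sub>R e))) has_derivative (\<lambda>r. (r * (1 / (1 - s\<^sup>2))) *\<^sub>R a)) (at s)"
  proof (rule has_derivative_transform_within_open[of "\<lambda>r. ((r - s) / (1 - s * r)) *\<^sub>R a" _ _ _ "{-1<..<1}"])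
    have "((\<lambda>r. (r - s) / (1 - s * r)) has_real_derivative 1 / (1 - s\<^sup>2)) (at s)"
      using s2 by (auto intro!: derivative_eq_intros simp: power2_eq_square)
    then have "((\<lambda>r. (r - s) / (1 - s * r)) has_derivative (\<lambda>r. r * (1 / (1 - s\<^sup>2)))) (at s)"
      unfolding has_field_derivative_def by (rule has_derivative_eq_rhs) (simp add: fun_eq_iff)
    then show "((\<lambda>r. ((r - s) / (1 - s * r)) *\<^sub>R a) has_derivative (\<lambda>r. (r * (1 / (1 - s\<^sup>2))) *\<^sub>R a)) (at s)"
      by (rule has_derivative_scaleR_left)
  qed (use s eq in auto)
  ultimately have "(\<lambda>r. pmob' q q (r *\<^sub>R pmob' (- x) (s *\<^sub>R e) e)) = (\<lambda>r. (r * (1 / (1 - s\<^sup>2))) *\<^sub>R a)"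
    by (rule has_derivative_unique)
  from fun_cong[OF this, of 1] have 1: "(1 / (1 - q \<bullet> q)) *\<^sub>R pmob' (- x) (s *\<^sub>R e) e = (1 / (1 - s\<^sup>2)) *\<^sub>R a"
    by (simp add: pmob'_self[OF qn])
  have q2: "1 - q \<bullet> q > 0" using ball_inner(2)[OF qn] by simp
  have "dvel x e s = (1 - s\<^sup>2) *\<^sub>R ((1 - q \<bullet> q) *\<^sub>R ((1 / (1 - q \<bullet> q)) *\<^sub>R pmob' (- x) (s *\<^sub>R e) e))"
    using q2 by (simp add: dvel_def pmob'_smult)
  also have "\<dots> = (1 - q \<bullet> q) *\<^sub>R a" unfolding 1 using s2 by simp
  finally show ?thesis using na chart by blast
qed

text \<open>The solution \<open>\<zeta>\<close> of
  \<open>(\<zeta> - s) / (1 - s * \<zeta>) = \<i> * tanh r\<close>, that is, the point of the disk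
  belonging to the tangent vector of signed hyperbolic length \<open>r\<close> at parameter
  \<open>s\<close>.\<close>

definition dpoint :: "real \<Rightarrow> real \<Rightarrow> complex" where
  "dpoint s r = (of_real s + \<i> * of_real (tanh r)) / (1 + \<i> * of_real (tanh r) * of_real s)"

lemma tanh_abs_less: "\<bar>tanh r\<bar> < (1::real)"
  using tanh_real_bounds[of r] by (simp add: abs_less_iff)

lemma dpoint_parts:
  fixes r s :: real
  defines "\<tau> \<equiv> tanh r"
  assumes s: "\<bar>s\<bar> < 1"
  shows "Re (dpoint s r) = s * (1 + \<tau>\<^sup>2) / (1 + \<tau>\<^sup>2 * s\<^sup>2)" "Im (dpoint s r) = \<tau> * (1 - s\<^sup>2) / (1 + \<tau>\<^sup>2 * s\<^sup>2)"
    "dpoint s r \<bullet> dpoint s r = (s\<^sup>2 + \<tau>\<^sup>2) / (1 + \<tau>\<^sup>2 * s\<^sup>2)" "cmod (dpoint s r) < 1"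
proof -
  have d: "1 + \<tau>\<^sup>2 * s\<^sup>2 > 0" by (simp add: add_pos_nonneg)
  show 1: "Re (dpoint s r) = s * (1 + \<tau>\<^sup>2) / (1 + \<tau>\<^sup>2 * s\<^sup>2)" "Im (dpoint s r) = \<tau> * (1 - s\<^sup>2) / (1 + \<tau>\<^sup>2 * s\<^sup>2)"
    unfolding dpoint_def \<tau>_def[symmetric]
    by (simp_all add: Re_divide Im_divide power2_eq_square algebra_simps)
  have "dpoint s r \<bullet> dpoint s r = ((s * (1 + \<tau>\<^sup>2))\<^sup>2 + (\<tau> * (1 - s\<^sup>2))\<^sup>2) / ((1 + \<tau>\<^sup>2 * s\<^sup>2) * (1 + \<tau>\<^sup>2 * s\<^sup>2))"
    unfolding inner_complex_def 1 by (simp add: power2_eq_square add_divide_distrib)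
  also have "(s * (1 + \<tau>\<^sup>2))\<^sup>2 + (\<tau> * (1 - s\<^sup>2))\<^sup>2 = (s\<^sup>2 + \<tau>\<^sup>2) * (1 + \<tau>\<^sup>2 * s\<^sup>2)"
    by (simp add: power2_eq_square algebra_simps)
  finally show 3: "dpoint s r \<bullet> dpoint s r = (s\<^sup>2 + \<tau>\<^sup>2) / (1 + \<tau>\<^sup>2 * s\<^sup>2)" using d by simp
  have "s\<^sup>2 < 1" "\<tau>\<^sup>2 < 1" using s tanh_abs_less[of r] by (simp_all add: \<tau>_def abs_square_less_1)
  then have "(1 - s\<^sup>2) * (1 - \<tau>\<^sup>2) > 0" by simp
  then have "s\<^sup>2 + \<tau>\<^sup>2 < 1 + \<tau>\<^sup>2 * s\<^sup>2" by (simp add: algebra_simps)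
  then have "dpoint s r \<bullet> dpoint s r < 1" unfolding 3 using d by simp
  then show "cmod (dpoint s r) < 1" by (simp add: norm_eq_sqrt_inner)
qed

lemma Th_dline:
  assumes x: "norm x < 1" and e: "norm e = 1" and s: "\<bar>s\<bar> < 1"
  shows "Th (dline x e s) (r *\<^sub>R dvel x e s) = mob (- x) (dpoint s r *s ofr e)"
proof -
  define q where "q = dline x e s"
  have qn: "norm q < 1" unfolding q_def by (rule norm_dline[OF x e s])
  obtain a where a: "norm a = 1" "dvel x e s = (1 - q \<bullet> q) *\<^sub>R a"
    "\<And>\<zeta>. cmod \<zeta> < 1 \<Longrightarrow> mob q (mob (- x) (\<zeta> *s ofr e)) = ((\<zeta> - of_real s) / (1 - of_real s * \<zeta>)) *s ofr a"
    using line_chart[OF x e s q_def] by blast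
  define \<tau> where "\<tau> = tanh r"
  have q2: "1 - q \<bullet> q > 0" using ball_inner(2)[OF qn] by simp
  have "ty q (r *\<^sub>R dvel x e s) = \<tau> *\<^sub>R a"
  proof -
    have 1: "norm (r *\<^sub>R dvel x e s) / (1 - q \<bullet> q) = \<bar>r\<bar>" using q2 a(1) by (simp add: a(2) abs_mult)
    have 2: "sgn (r *\<^sub>R dvel x e s) = sgn r *\<^sub>R a" 
    proof -
      have "sgn a = a" by (simp add: sgn_div_norm a(1))
      then show ?thesis using q2 by (simp add: a(2) sgn_scaleR sgn_mult)
    qed
    have "tanh \<bar>r\<bar> * sgn r = \<tau>" by (cases "r \<ge> 0") (auto simp: sgn_if \<tau>_def)
    then show ?thesis unfolding ty_def 1 2 by simp
  qed
  then have T: "Th q (r *\<^sub>R dvel x e s) = mob (- q) ((\<i> * of_real \<tau>) *s ofr a)"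
    by (simp add: Th_def ofr_simps vector_smult_assoc)
  have s2: "1 - of_real s * of_real s \<noteq> (0::complex)"
  proof -
    have "1 - s * s \<noteq> 0" using s abs_square_less_1[of s] by (simp add: power2_eq_square)
    then have "complex_of_real (1 - s * s) \<noteq> 0" by (simp only: of_real_eq_0_iff not_False_eq_True)
    then show ?thesis by simp
  qed
  have D: "1 + \<i> * of_real \<tau> * of_real s \<noteq> 0" by (simp add: complex_eq_iff)
  have z1: "cmod (dpoint s r) < 1" by (rule dpoint_parts(4)[OF s])
  have n1: "dpoint s r - of_real s = \<i> * of_real \<tau> * (1 - of_real s * of_real s) / (1 + \<i> * of_real \<tau> * of_real s)"
    unfolding dpoint_def \<tau>_def[symmetric] using D by (simp add: field_simps)
  have n2: "1 - of_real s * dpoint s r = (1 - of_real s * of_real s) / (1 + \<i> * of_real \<tau> * of_real s)"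
    unfolding dpoint_def \<tau>_def[symmetric] using D by (simp add: field_simps)
  have "(dpoint s r - of_real s) / (1 - of_real s * dpoint s r) = \<i> * of_real \<tau>"
    unfolding n1 n2 using D s2 by simp
  then have "mob q (mob (- x) (dpoint s r *s ofr e)) = (\<i> * of_real \<tau>) *s ofr a" using a(3)[OF z1] by simp
  moreover have "mob (- x) (dpoint s r *s ofr e) \<in> LB"
    by (rule mob_lie_ball[OF _ disk_lie_ball[OF e z1]]) (use x in simp)
  ultimately show ?thesis using T mob_inverse_lie_ball(1)[OF qn] by (metis q_def)
qed

text \<open>These invert \<open>dpoint\<close> smoothly. At \<open>dpoint s r\<close>,
  \<open>dA\<close> depends on \<open>s\<close> alone, as \<open>2 * s / (1 + s\<^sup>2)\<close>,
  and \<open>dB\<close> on \<open>r\<close> alone, as \<open>sinh (2 * r)\<close>; \<open>dS\<close>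
  and \<open>dR\<close> solve these equations for \<open>s\<close> and \<open>r\<close>.\<close>

definition dA :: "complex \<Rightarrow> real" where "dA \<zeta> = 2 * Re \<zeta> / (1 + \<zeta> \<bullet> \<zeta>)"
definition dB :: "complex \<Rightarrow> real" where "dB \<zeta> = 2 * Im \<zeta> / (1 - \<zeta> \<bullet> \<zeta>)"
definition dS :: "complex \<Rightarrow> real" where "dS \<zeta> = dA \<zeta> / (1 + sqrt (1 - (dA \<zeta>)\<^sup>2))"
definition dR :: "complex \<Rightarrow> real" where "dR \<zeta> = arsinh (dB \<zeta>) / 2"

lemma dA_bound:
  assumes "cmod \<zeta> < 1"
  shows "(dA \<zeta>)\<^sup>2 < 1"
proof -
  have "0 < (1 - cmod \<zeta>)\<^sup>2" using assms by simp
  then have "2 * cmod \<zeta> < 1 + \<zeta> \<bullet> \<zeta>" by (simp add: power2_diff power2_norm_eq_inner)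
  then have "2 * \<bar>Re \<zeta>\<bar> < 1 + \<zeta> \<bullet> \<zeta>" using abs_Re_le_cmod[of \<zeta>] by linarith
  then have "\<bar>dA \<zeta>\<bar> < 1" by (simp add: dA_def abs_mult add_pos_nonneg)
  then show ?thesis by (simp add: abs_square_less_1)
qed

lemma dA_dS:
  assumes "cmod \<zeta> < 1"
  shows "2 * dS \<zeta> / (1 + (dS \<zeta>)\<^sup>2) = dA \<zeta>" "\<bar>dS \<zeta>\<bar> < 1"
proof -
  define w where "w = sqrt (1 - (dA \<zeta>)\<^sup>2)"
  have w: "w > 0" "w\<^sup>2 = 1 - (dA \<zeta>)\<^sup>2" using dA_bound[OF assms] by (simp_all add: w_def)
  have S: "dS \<zeta> = dA \<zeta> / (1 + w)" by (simp add: dS_def w_def)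
  have "1 + (dS \<zeta>)\<^sup>2 = ((1 + w)\<^sup>2 + (dA \<zeta>)\<^sup>2) / (1 + w)\<^sup>2"
    using w(1) by (simp add: S power_divide add_divide_distrib)
  also have "(1 + w)\<^sup>2 + (dA \<zeta>)\<^sup>2 = 2 * (1 + w)" using w(2) by (simp add: power2_sum)
  also have "2 * (1 + w) / (1 + w)\<^sup>2 = 2 / (1 + w)" using w(1) by (simp add: divide_simps power2_eq_square)
  finally have "1 + (dS \<zeta>)\<^sup>2 = 2 / (1 + w)" .
  then show "2 * dS \<zeta> / (1 + (dS \<zeta>)\<^sup>2) = dA \<zeta>" using w(1) by (simp add: S)
  have "\<bar>dA \<zeta>\<bar> < 1" using dA_bound[OF assms] by (simp add: abs_square_less_1)
  then show "\<bar>dS \<zeta>\<bar> < 1" using w(1) by (simp add: S abs_divide)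
qed

lemma sinh_tanh_double: "2 * tanh r / (1 - (tanh r)\<^sup>2) = sinh (2 * r)" for r :: real
proof -
  have "2 * tanh r / (1 - (tanh r)\<^sup>2) = 2 * tanh r * (cosh r)\<^sup>2" unfolding sech2 by simp
  also have "\<dots> = sinh (2 * r)" by (simp add: tanh_def sinh_double power2_eq_square)
  finally show ?thesis .
qed

lemma dA_dpoint:
  assumes s: "\<bar>s\<bar> < 1"
  shows "dA (dpoint s r) = 2 * s / (1 + s\<^sup>2)" "dB (dpoint s r) = sinh (2 * r)"
proof -
  define \<tau> where "\<tau> = tanh r"
  define d where "d = 1 + \<tau>\<^sup>2 * s\<^sup>2"
  note p = dpoint_parts[OF s, of r, folded \<tau>_def, folded d_def]
  have d: "d > 0" by (simp add: d_def add_pos_nonneg)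
  have t: "1 - \<tau>\<^sup>2 > 0" "1 + \<tau>\<^sup>2 > 0" "1 + s\<^sup>2 > 0" "1 - s\<^sup>2 > 0"
    using s tanh_abs_less[of r] by (simp_all add: \<tau>_def abs_square_less_1 add_pos_nonneg)
  have "1 + dpoint s r \<bullet> dpoint s r = (1 + \<tau>\<^sup>2) * (1 + s\<^sup>2) / d"
    unfolding p using d by (simp add: divide_simps) (simp add: d_def algebra_simps)
  then show "dA (dpoint s r) = 2 * s / (1 + s\<^sup>2)"
    unfolding dA_def p(1) using d t by simp
  have "1 - dpoint s r \<bullet> dpoint s r = (1 - \<tau>\<^sup>2) * (1 - s\<^sup>2) / d"
    unfolding p using d by (simp add: divide_simps) (simp add: d_def algebra_simps)
  then have "dB (dpoint s r) = 2 * \<tau> / (1 - \<tau>\<^sup>2)"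
    unfolding dB_def p(2) using d t by simp
  then show "dB (dpoint s r) = sinh (2 * r)" by (simp add: \<tau>_def sinh_tanh_double)
qed

lemma dSR_dpoint:
  assumes s: "\<bar>s\<bar> < 1"
  shows "dS (dpoint s r) = s" "dR (dpoint s r) = r"
proof -
  have t: "1 + s\<^sup>2 > 0" "1 - s\<^sup>2 > 0" using s by (simp_all add: abs_square_less_1 add_pos_nonneg)
  have "1 - (2 * s / (1 + s\<^sup>2))\<^sup>2 = ((1 - s\<^sup>2) / (1 + s\<^sup>2))\<^sup>2"
    using t by (simp add: power_divide divide_simps) (simp add: power2_eq_square algebra_simps)
  then have "sqrt (1 - (dA (dpoint s r))\<^sup>2) = (1 - s\<^sup>2) / (1 + s\<^sup>2)"
    using t by (simp add: dA_dpoint[OF s])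
  then have "1 + sqrt (1 - (dA (dpoint s r))\<^sup>2) = 2 / (1 + s\<^sup>2)" using t by (simp add: field_simps)
  then show "dS (dpoint s r) = s" using t by (simp add: dS_def dA_dpoint[OF s])
  show "dR (dpoint s r) = r" by (simp add: dR_def dA_dpoint[OF s] arsinh_sinh_real)
qed

text \<open>\<open>N = \<zeta> \<bullet> \<zeta>\<close> satisfies the palindromic equation
  \<open>a * (1 + N\<^sup>2) = b * N\<close>. For \<open>a \<noteq> 0\<close> its roots are
  reciprocal, so at most one lies below 1; and \<open>dA\<close>, \<open>dB\<close> and
  \<open>N\<close> together determine \<open>\<zeta>\<close>.\<close>

lemma dAB_inj:
  assumes z: "cmod \<zeta> < 1" "cmod \<zeta>' < 1" and A: "dA \<zeta> = dA \<zeta>'" and B: "dB \<zeta> = dB \<zeta>'"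
  shows "\<zeta> = \<zeta>'"
proof -
  define a where "a = (dA \<zeta>)\<^sup>2 + (dB \<zeta>)\<^sup>2"
  define b where "b = 2 * (dB \<zeta>)\<^sup>2 - 2 * (dA \<zeta>)\<^sup>2 + 4"
  have c: "Re \<xi> = dA \<xi> * (1 + \<xi> \<bullet> \<xi>) / 2" "Im \<xi> = dB \<xi> * (1 - \<xi> \<bullet> \<xi>) / 2" "\<xi> \<bullet> \<xi> < 1" if "cmod \<xi> < 1" for \<xi>
  proof -
    show 1: "\<xi> \<bullet> \<xi> < 1" using ball_inner(2)[OF that] .
    have "1 + \<xi> \<bullet> \<xi> > 0" by (simp add: add_pos_nonneg)
    then show "Re \<xi> = dA \<xi> * (1 + \<xi> \<bullet> \<xi>) / 2" "Im \<xi> = dB \<xi> * (1 - \<xi> \<bullet> \<xi>) / 2"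
      using 1 by (simp_all add: dA_def dB_def)
  qed
  have e: "a * (1 + (\<xi> \<bullet> \<xi>)\<^sup>2) = b * (\<xi> \<bullet> \<xi>)" if "cmod \<xi> < 1" "dA \<xi> = dA \<zeta>" "dB \<xi> = dB \<zeta>" for \<xi>
  proof -
    define N where "N = \<xi> \<bullet> \<xi>"
    have r: "Re \<xi> = dA \<zeta> * (1 + N) / 2" "Im \<xi> = dB \<zeta> * (1 - N) / 2"
      unfolding N_def that(2,3)[symmetric] by (rule c[OF that(1)])+
    have "N = (Re \<xi>)\<^sup>2 + (Im \<xi>)\<^sup>2" by (simp add: N_def inner_complex_def power2_eq_square)
    then have "N = (dA \<zeta> * (1 + N) / 2)\<^sup>2 + (dB \<zeta> * (1 - N) / 2)\<^sup>2" unfolding r .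
    then have "4 * N = (dA \<zeta>)\<^sup>2 * (1 + N)\<^sup>2 + (dB \<zeta>)\<^sup>2 * (1 - N)\<^sup>2" by (simp add: power_divide power_mult_distrib)
    then show ?thesis unfolding N_def[symmetric] a_def b_def by (simp add: power2_eq_square algebra_simps)
  qed
  let ?N = "\<zeta> \<bullet> \<zeta>" and ?M = "\<zeta>' \<bullet> \<zeta>'"
  have "?N = ?M"
  proof (cases "a = 0")
    case True
    then have "dA \<zeta> = 0" "dB \<zeta> = 0" by (simp_all add: a_def sum_power2_eq_zero_iff)
    then have "\<zeta> = 0" "\<zeta>' = 0" using c[OF z(1)] c[OF z(2)] A B by (simp_all add: complex_eq_iff)
    then show ?thesis by simp
  next
    case False
    have "a * (1 + ?N\<^sup>2) * ?M = a * (1 + ?M\<^sup>2) * ?N"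
      using e[OF z(1)] e[OF z(2)] A B by simp
    then have "a * ((?M - ?N) * (1 - ?N * ?M)) = 0" by (simp add: power2_eq_square algebra_simps)
    moreover have "?N * ?M < 1" 
      using mult_left_mono[OF less_imp_le[OF c(3)[OF z(2)]] inner_ge_zero[of \<zeta>]] c(3)[OF z(1)] by simp
    ultimately show ?thesis using False by auto
  qed
  then show ?thesis using c(1,2)[OF z(1)] c(1,2)[OF z(2)] A B by (simp add: complex_eq_iff)
qed

text \<open>Both sides have the same \<open>dA\<close> and \<open>dB\<close>, which spares
  substituting the square root and \<open>arsinh\<close> into \<open>dpoint\<close>.\<close>

lemma dpoint_dSR:
  assumes z: "cmod \<zeta> < 1"
  shows "dpoint (dS \<zeta>) (dR \<zeta>) = \<zeta>"
proof (rule dAB_inj[OF dpoint_parts(4) z])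
  note S = dA_dS[OF z]
  show "\<bar>dS \<zeta>\<bar> < 1" by (rule S)
  show "dA (dpoint (dS \<zeta>) (dR \<zeta>)) = dA \<zeta>" using dA_dpoint(1)[OF S(2)] S(1) by simp
  show "dB (dpoint (dS \<zeta>) (dR \<zeta>)) = dB \<zeta>" using dA_dpoint(2)[OF S(2)] by (simp add: dR_def)
qed

section \<open>Smoothness and isometry of the chart\<close>

lemma Ck_on_mob':
  assumes U: "open U" and f: "Ck_on k U f" and u: "Ck_on k U u" and d: "\<And>x. x \<in> U \<Longrightarrow> mob_den a (f x) \<noteq> 0"
  shows "Ck_on k U (\<lambda>x. mob' a (f x) (u x))"
proof -
  have "Ck_on k U (\<lambda>x. mob_den a (f x))"
    unfolding mob_den_def by (intro Ck_on_add Ck_on_diff Ck_on_mult Ck_on_cdot Ck_on_const U f)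
  moreover have "Ck_on k U (\<lambda>x. mob_num' a (f x) (u x))"
    unfolding mob_num'_def by (intro Ck_on_add Ck_on_diff Ck_on_mult Ck_on_cdot Ck_on_const Ck_on_smult U f u)
  moreover have "Ck_on k U (\<lambda>x. mob_den' a (f x) (u x))"
    unfolding mob_den'_def by (intro Ck_on_add Ck_on_mult Ck_on_cdot Ck_on_const U f u)
  ultimately show ?thesis
    unfolding mob'_def by (intro Ck_on_smult Ck_on_diff Ck_on_inverse Ck_on_mob U d f)
qed

lemma Ck_on_dSR: "Ck_on k (ball 0 1) dS" "Ck_on k (ball 0 1) dR"
proof -
  let ?D = "ball (0::complex) 1"
  note o = open_ball[of "0::complex" 1]
  have RI: "Ck_on k ?D Re" "Ck_on k ?D Im"
    using Ck_on_bounded_linear[OF o] bounded_linear_Re bounded_linear_Im by blast+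
  have N: "Ck_on k ?D (\<lambda>z. z \<bullet> z)" by (intro Ck_on_inner Ck_on_id o)
  have p: "1 + z \<bullet> z \<noteq> 0" for z :: complex using inner_ge_zero[of z] by linarith
  have m: "1 - z \<bullet> z \<noteq> 0" if "z \<in> ?D" for z :: complex using ball_inner(1)[OF that] by simp
  have A: "Ck_on k ?D dA"
    unfolding dA_def[abs_def] by (intro Ck_on_divide Ck_on_mult Ck_on_add Ck_on_const RI N o p)
  have B: "Ck_on k ?D dB"
    unfolding dB_def[abs_def] by (intro Ck_on_divide Ck_on_mult Ck_on_diff Ck_on_const RI N o m)
  have sq: "Ck_on k ?D (\<lambda>z. sqrt (1 - (dA z)\<^sup>2))"
    by (rule Ck_on_compose[OF o open_greaterThan[of 0] _ Ck_on_sqrt])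
      (use dA_bound in \<open>auto intro!: Ck_on_diff Ck_on_const Ck_on_power A\<close>)
  have n: "1 + sqrt (1 - (dA z)\<^sup>2) \<noteq> 0" if "z \<in> ?D" for z
  proof -
    have "sqrt (1 - (dA z)\<^sup>2) \<ge> 0" using dA_bound[of z] that by simp
    then show ?thesis by linarith
  qed
  show "Ck_on k ?D dS"
    unfolding dS_def[abs_def] by (intro Ck_on_divide Ck_on_add Ck_on_const A sq n o)
  have sB: "Ck_on k ?D (\<lambda>z. sqrt ((dB z)\<^sup>2 + 1))"
    by (rule Ck_on_compose[OF o open_greaterThan[of 0] _ Ck_on_sqrt])
      (auto intro!: Ck_on_add Ck_on_const Ck_on_power B simp: add_nonneg_pos)
  have pos: "dB z + sqrt ((dB z)\<^sup>2 + 1) > 0" for z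
    using arsinh_real_aux[of "dB z"] by simp
  have "Ck_on k ?D (\<lambda>z. ln (dB z + sqrt ((dB z)\<^sup>2 + 1)))"
    by (rule Ck_on_compose[OF o open_greaterThan[of 0] _ Ck_on_ln])
      (auto intro!: Ck_on_add B sB pos)
  then show "Ck_on k ?D dR"
    unfolding dR_def[abs_def] arsinh_real_def by (intro Ck_on_divide Ck_on_const o) auto
qed

definition dchart :: "real^'n \<Rightarrow> real^'n \<Rightarrow> complex \<Rightarrow> (real^'n) \<times> (real^'n)" where
  "dchart x e \<zeta> = (dline x e (dS \<zeta>), dR \<zeta> *\<^sub>R dvel x e (dS \<zeta>))"

lemma Ck_on_dchart:
  assumes x: "norm x < 1" and e: "norm e = 1"
  shows "Ck_on k (ball 0 1) (dchart x e)"
proof -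
  let ?D = "ball (0::complex) 1"
  note o = open_ball[of "0::complex" 1]
  have Se: "Ck_on k ?D (\<lambda>\<zeta>. dS \<zeta> *\<^sub>R e)" by (intro Ck_on_scaleR Ck_on_const Ck_on_dSR o)
  have n: "norm (dS \<zeta> *\<^sub>R e) < 1" if "\<zeta> \<in> ?D" for \<zeta> using dA_dS(2)[of \<zeta>] that e by simp
  have "Ck_on k ?D (\<lambda>\<zeta>. dline x e (dS \<zeta>))"
    unfolding dline_def by (rule Ck_on_pmob[OF o Se _ n]) (use x in auto)
  moreover have "Ck_on k ?D (\<lambda>\<zeta>. dvel x e (dS \<zeta>))"
    unfolding dvel_def pmob'_def
  proof (intro Ck_on_re_vec Ck_on_mob' Ck_on_ofr Se Ck_on_scaleR Ck_on_diff Ck_on_power Ck_on_const Ck_on_dSR o)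
    show "mob_den (- x) (ofr (dS \<zeta> *\<^sub>R e)) \<noteq> 0" if "\<zeta> \<in> ?D" for \<zeta>
      by (rule mob_den_nz[OF _ ofr_lie_ball[OF n[OF that]]]) (use x in simp)
  qed
  ultimately show ?thesis
    unfolding dchart_def[abs_def] by (intro Ck_on_Pair Ck_on_scaleR Ck_on_dSR o)
qed

lemma dchart_TB: "norm x < 1 \<Longrightarrow> norm e = 1 \<Longrightarrow> cmod \<zeta> < 1 \<Longrightarrow> dchart x e \<zeta> \<in> TB"
  by (simp add: dchart_def TB_iff norm_dline dA_dS(2))

lemma thp_dchart:
  assumes "norm x < 1" "norm e = 1" "cmod \<zeta> < 1"
  shows "thp (dchart x e \<zeta>) = mob (- x) (\<zeta> *s ofr e)"
  using Th_dline[OF assms(1,2) dA_dS(2)[OF assms(3)], of "dR \<zeta>"] dpoint_dSR[OF assms(3)] by (simp add: dchart_def)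

text \<open>\<open>thp\<close> after the chart is the holomorphic map
  \<open>\<zeta> \<mapsto> mob (- x) (\<zeta> *s ofr e)\<close>. The chain rule moves the
  computation to this map, and invariance under \<open>mob\<close> reduces it to the disk through
  0.\<close>

lemma dchart_isometric:
  fixes x e :: "real^('n::{finite,linorder})"
  assumes n: "CARD('n) \<ge> 2" and x: "norm x < 1" and e: "norm e = 1" and z: "cmod \<zeta> < 1"
  shows "pullback_metric (dchart x e) tangent_bundle_metric \<zeta> h k = poincare_metric \<zeta> h k"
proof -
  let ?D = "frechet_derivative (dchart x e) (at \<zeta>)" and ?T = "frechet_derivative thp (at (dchart x e \<zeta>))"
  have zD: "\<zeta> \<in> ball 0 1" using z by simp
  have xn: "norm (- x) < 1" using x by simp
  have d1: "(dchart x e has_derivative ?D) (at \<zeta>)"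
    by (rule Ck_on_SucD[OF open_ball Ck_on_dchart[OF x e, of "Suc 0"] zD])
  note q = dchart_TB[OF x e z]
  have "((\<lambda>\<zeta>. thp (dchart x e \<zeta>)) has_derivative (\<lambda>h. ?T (?D h))) (at \<zeta>)"
    by (rule has_derivative_compose[OF d1 thp_has_derivative[OF q]])
  then have 1: "((\<lambda>\<zeta>. mob (- x) (\<zeta> *s ofr e)) has_derivative (\<lambda>h. ?T (?D h))) (at \<zeta>)"
    by (rule has_derivative_transform_within_open[OF _ open_ball zD]) (simp add: thp_dchart[OF x e])
  have zL: "\<zeta> *s ofr e \<in> LB" by (rule disk_lie_ball[OF e z])
  have "((\<lambda>\<zeta>. \<zeta> *s ofr e) has_derivative (\<lambda>h. h *s ofr e)) (at \<zeta>)"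
    by (rule bounded_linear_imp_has_derivative[OF bounded_bilinear.bounded_linear_left[OF bounded_bilinear_smult]])
  from has_derivative_compose[OF this has_derivative_mob[OF mob_den_nz[OF xn zL]]]
  have "(\<lambda>h. ?T (?D h)) = (\<lambda>h. mob' (- x) (\<zeta> *s ofr e) (h *s ofr e))"
    by (rule has_derivative_unique[OF 1])
  then have TD: "?T (?D h) = mob' (- x) (\<zeta> *s ofr e) (h *s ofr e)" for h by meson
  have "pullback_metric (dchart x e) tangent_bundle_metric \<zeta> h k
      = lieG (mob (- x) (\<zeta> *s ofr e)) (mob' (- x) (\<zeta> *s ofr e) (h *s ofr e)) (mob' (- x) (\<zeta> *s ofr e) (k *s ofr e))"
    unfolding pullback_metric_def tangent_bundle_metric_eq[OF n q] TD thp_dchart[OF x e z] ..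
  also have "\<dots> = poincare_metric \<zeta> h k"
    unfolding lieG_mob[OF xn zL] lieG_disk[OF e z] poincare_metric_def ..
  finally show ?thesis .
qed

section \<open>Geodesics and their tangent vectors\<close>

abbreviation gline :: "real^'n \<Rightarrow> real^'n \<Rightarrow> (real^'n) set" where "gline x e \<equiv> dline x e ` {-1<..<1}"

lemma tangent_space_gline:
  fixes x e :: "real^'n"
  assumes x: "norm x < 1" and e: "norm e = 1" and s: "\<bar>s\<bar> < 1"
  shows "tangent_space (gline x e) (dline x e s) = range (\<lambda>r. r *\<^sub>R dvel x e s)"
proof (intro set_eqI iffI)
  let ?q = "dline x e s"
  have qn: "norm ?q < 1" by (rule norm_dline[OF x e s])
  have xn: "norm (- x) < 1" using x by simp
  have sn: "norm (r *\<^sub>R e) < 1" if "\<bar>r\<bar> < 1" for r using that e by simp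
  have s2: "1 - s\<^sup>2 > 0" using s by (simp add: abs_square_less_1)
  have inv: "pmob x (dline x e r) = r *\<^sub>R e" if "\<bar>r\<bar> < 1" for r
    unfolding dline_def by (rule pmob_inverse(2)[OF x sn[OF that]])
  {
    fix w assume w: "w \<in> tangent_space (gline x e) ?q"
    define k where "k = pmob' x ?q w"
    have kh: "k \<bullet> h = 0" if h: "e \<bullet> h = 0" for h
    proof -
      have d: "((\<lambda>p. pmob x p \<bullet> h) has_derivative (\<lambda>v. pmob' x ?q v \<bullet> h)) (at ?q)"
        by (rule bounded_linear.has_derivative[OF bounded_linear_inner_left has_derivative_pmob[OF x qn]])
      show ?thesis unfolding k_def
        by (rule tangent_space_const[OF w _ d, of 0]) (use inv h in \<open>auto simp: abs_less_iff\<close>)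
    qed
    define h where "h = k - (k \<bullet> e) *\<^sub>R e"
    have "e \<bullet> h = 0" using e by (simp add: h_def inner_diff_right inner_commute[of e k] norm_eq_1)
    then have "h \<bullet> h = 0" using kh unfolding h_def[unfolded h_def, of] by (simp add: h_def inner_diff_left)
    then have "k = (k \<bullet> e) *\<^sub>R e" by (simp add: h_def)
    then have "k = ((k \<bullet> e) / (1 - s\<^sup>2)) *\<^sub>R ((1 - s\<^sup>2) *\<^sub>R e)" using s2 by simp
    then have "pmob' (- x) (s *\<^sub>R e) k = ((k \<bullet> e) / (1 - s\<^sup>2)) *\<^sub>R dvel x e s"
      unfolding dvel_def by (metis pmob'_smult)
    moreover have "pmob' (- x) (s *\<^sub>R e) k = w"
      unfolding k_def using pmob'_inverse(1)[OF x qn, of w] inv[OF s] by simp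
    ultimately show "w \<in> range (\<lambda>r. r *\<^sub>R dvel x e s)" by blast
  }
  {
    fix w assume "w \<in> range (\<lambda>r. r *\<^sub>R dvel x e s)"
    then obtain r where r: "w = r *\<^sub>R dvel x e s" by blast
    define v where "v = r * (1 - s\<^sup>2)"
    define \<epsilon> where "\<epsilon> = (1 - \<bar>s\<bar>) / (\<bar>v\<bar> + 1)"
    have eps: "\<epsilon> > 0" using s by (simp add: \<epsilon>_def add_nonneg_pos)
    have b: "\<bar>s + t * v\<bar> < 1" if "t \<in> {-\<epsilon><..<\<epsilon>}" for t
    proof -
      have "\<bar>t\<bar> * (\<bar>v\<bar> + 1) < \<epsilon> * (\<bar>v\<bar> + 1)" using that by (intro mult_strict_right_mono) (auto simp: add_nonneg_pos)
      moreover have "\<epsilon> * (\<bar>v\<bar> + 1) = 1 - \<bar>s\<bar>" by (simp add: \<epsilon>_def add_nonneg_eq_0_iff)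
      moreover have "\<bar>s + t * v\<bar> \<le> \<bar>s\<bar> + \<bar>t\<bar> * \<bar>v\<bar>" using abs_triangle_ineq[of s "t * v"] by (simp add: abs_mult)
      moreover have "\<bar>t\<bar> * \<bar>v\<bar> \<le> \<bar>t\<bar> * (\<bar>v\<bar> + 1)" by (intro mult_left_mono) auto
      ultimately show ?thesis by linarith
    qed
    let ?c = "\<lambda>t. dline x e (s + t * v)"
    have "smooth_on {-\<epsilon><..<\<epsilon>} ?c"
      unfolding smooth_on_def dline_def
      by (intro allI Ck_on_pmob Ck_on_scaleR Ck_on_add Ck_on_mult Ck_on_const Ck_on_id) (use b sn xn in auto)
    moreover have "?c ` {-\<epsilon><..<\<epsilon>} \<subseteq> gline x e" using b by (force simp: abs_less_iff)
    moreover have "?c 0 = ?q" by simp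
    moreover have "(?c has_vector_derivative w) (at 0)"
    proof -
      have "((\<lambda>t. (s + t * v) *\<^sub>R e) has_derivative (\<lambda>t. t *\<^sub>R (v *\<^sub>R e))) (at 0)" by (auto intro!: derivative_eq_intros)
      from has_derivative_compose[OF this, of "pmob (- x)" "pmob' (- x) (s *\<^sub>R e)"] has_derivative_pmob[OF xn sn[OF s]]
      have "(?c has_derivative (\<lambda>t. t *\<^sub>R pmob' (- x) (s *\<^sub>R e) (v *\<^sub>R e))) (at 0)"
        unfolding dline_def by (simp add: pmob'_smult)
      moreover have "pmob' (- x) (s *\<^sub>R e) (v *\<^sub>R e) = w" by (simp add: r v_def dvel_def pmob'_smult)
      ultimately show ?thesis by (simp add: has_vector_derivative_def)
    qed
    ultimately show "w \<in> tangent_space (gline x e) ?q" unfolding tangent_space_def using eps by blast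
  }
qed

lemma tangent_vectors_gline:
  assumes x: "norm x < 1" and e: "norm e = 1"
  shows "tangent_vectors (gline x e) = dchart x e ` ball 0 1"
proof (intro set_eqI iffI)
  fix y assume y: "y \<in> tangent_vectors (gline x e)"
  obtain q w where qw: "y = (q, w)" by (cases y)
  obtain s where s: "\<bar>s\<bar> < 1" "q = dline x e s"
    using y by (auto simp: tangent_vectors_def qw abs_less_iff)
  then obtain r where r: "w = r *\<^sub>R dvel x e s"
    using y tangent_space_gline[OF x e s(1)] by (auto simp: tangent_vectors_def qw)
  have "y = dchart x e (dpoint s r)" by (simp add: dchart_def dSR_dpoint[OF s(1)] qw s r)
  then show "y \<in> dchart x e ` ball 0 1" using dpoint_parts(4)[OF s(1), of r] by simp
next
  fix y assume "y \<in> dchart x e ` ball 0 1"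
  then obtain \<zeta> where z: "cmod \<zeta> < 1" "y = dchart x e \<zeta>" by auto
  note S = dA_dS(2)[OF z(1)]
  show "y \<in> tangent_vectors (gline x e)"
    using S tangent_space_gline[OF x e S] by (auto simp: z tangent_vectors_def dchart_def abs_less_iff)
qed

lemma gline_isometric:
  fixes x e :: "real^('n::{finite,linorder})"
  assumes n: "CARD('n) \<ge> 2" and x: "norm x < 1" and e: "norm e = 1"
  shows "isometric_to_domain tangent_bundle_metric (tangent_vectors (gline x e)) (ball (0::complex) 1) poincare_metric"
  unfolding isometric_to_domain_def
proof (intro exI conjI ballI allI)
  \<comment> \<open>For the inverse, \<open>mob x\<close> undoes the factor \<open>mob (- x)\<close>
    of \<open>thp\<close> after the chart, and pairing with the unit vector \<open>e\<close> reads
    off the coordinate \<open>\<zeta>\<close>.\<close>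
  let ?N = "tangent_vectors (gline x e)" and ?\<psi> = "\<lambda>q. cdot (mob x (thp q)) (ofr e)"
  have N: "?N = dchart x e ` ball 0 1" by (rule tangent_vectors_gline[OF x e])
  have inv: "?\<psi> (dchart x e \<zeta>) = \<zeta>" if "\<zeta> \<in> ball 0 1" for \<zeta>
  proof -
    have z: "cmod \<zeta> < 1" using that by simp
    show ?thesis
      unfolding thp_dchart[OF x e z] mob_inverse_lie_ball(2)[OF x disk_lie_ball[OF e z]]
      using e by (simp add: cdot_smult_left cdot_ofr norm_eq_1)
  qed
  have NT: "?N \<subseteq> TB" unfolding N using dchart_TB[OF x e] by auto
  show "homeomorphism (ball 0 1) ?N (dchart x e) ?\<psi>"
  proof (rule homeomorphismI)
    show "continuous_on (ball 0 1) (dchart x e)"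
      by (rule Ck_on_imp_continuous_on[OF Ck_on_dchart[OF x e]])
    have "Ck_on 0 TB ?\<psi>"
      by (intro Ck_on_cdot Ck_on_mob Ck_on_thp Ck_on_const open_TB mob_den_nz x thp_LB)
    then show "continuous_on ?N ?\<psi>" using Ck_on_imp_continuous_on NT continuous_on_subset by blast
  qed (use inv in \<open>auto simp: N\<close>)
  show "smooth_on (ball 0 1) (dchart x e)" unfolding smooth_on_def using Ck_on_dchart[OF x e] by blast
  show "pullback_metric (dchart x e) tangent_bundle_metric \<zeta> u v = poincare_metric \<zeta> u v" if "\<zeta> \<in> ball 0 1" for \<zeta> u v
    by (rule dchart_isometric[OF n x e]) (use that in simp)
qed

lemma geodesic_line_gline:
  assumes "geodesic_line B1 pmet l"
  obtains x e where "norm x < 1" "norm e = 1" "l = gline x e"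
proof -
  obtain \<gamma> where g: "geodesic_on B1 pmet UNIV \<gamma>" "\<not> \<gamma> constant_on UNIV" "l = range \<gamma>"
    using assms unfolding geodesic_line_def by blast
  obtain u where u: "(\<gamma> has_vector_derivative u) (at 0)" using g(1) unfolding geodesic_on_def by blast
  have eq: "\<gamma> t = pcurve (\<gamma> 0) u t" for t by (rule poincare_geodesic_unique[OF g(1) _ u]) auto
  define x where "x = \<gamma> 0"
  have x: "norm x < 1" 
  proof -
    have "range \<gamma> \<subseteq> B1" using g(1) unfolding geodesic_on_def by simp
    then have "\<gamma> 0 \<in> B1" by blast
    then show ?thesis by (simp add: x_def)
  qed
  have "u \<noteq> 0"
  proof
    assume "u = 0"
    then have "\<gamma> t = x" for t using eq[of t] by (simp add: x_def[symmetric] pcurve_def pgeo_def ofr_simps)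
    then show False using g(2) unfolding constant_on_def by blast
  qed
  define e where "e = sgn u"
  have e: "norm e = 1" using \<open>u \<noteq> 0\<close> by (simp add: e_def norm_sgn)
  define k where "k = norm u / (1 - x \<bullet> x)"
  have k: "k > 0" using \<open>u \<noteq> 0\<close> ball_inner(2)[OF x] by (simp add: k_def)
  have g': "\<gamma> t = dline x e (tanh (t * k))" for t
    using eq[of t] by (simp add: x_def[symmetric] pcurve_def pgeo_def dline_def e_def k_def)
  have "range \<gamma> = gline x e"
  proof (intro equalityI subsetI)
    fix p assume "p \<in> range \<gamma>"
    then obtain t where "p = dline x e (tanh (t * k))" using g' by auto
    then show "p \<in> gline x e" using tanh_real_bounds[of "t * k"] by auto
  next
    fix p assume "p \<in> gline x e"
    then obtain s where s: "\<bar>s\<bar> < 1" "p = dline x e s" by (auto simp: abs_less_iff)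
    have "p = \<gamma> (artanh s / k)" using k by (simp add: g' s tanh_artanh_real[OF s(1)])
    then show "p \<in> range \<gamma>" by blast
  qed
  then show thesis using that[OF x e] g(3) by simp
qed

theorem mainTheorem2:
  assumes "CARD('n::{finite,linorder}) \<ge> 2"
  shows "(\<forall>p \<in> ball (0::real^('n::{finite,linorder})) 1. \<forall>L. subspace L \<and> dim L = 1 \<longrightarrow>
            geodesic_line ball_tangent_bundle tangent_bundle_metric ({p} \<times> L)) \<and>
         (\<forall>p \<in> ball (0::real^('n::{finite,linorder})) 1.
            totally_geodesic ball_tangent_bundle tangent_bundle_metric ({p} \<times> UNIV)) \<and>
         (\<forall>l :: (real^('n::{finite,linorder})) set. geodesic_line (ball 0 1) poincare_metric l \<longrightarrow>
            isometric_to_domain tangent_bundle_metric (tangent_vectors l)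
              (ball (0::complex) 1) poincare_metric)"
proof (intro conjI ballI allI impI)
  fix p :: "real^('n::{finite,linorder})" and L :: "(real^('n::{finite,linorder})) set"
  assume "p \<in> ball 0 1" "subspace L \<and> dim L = 1"
  then show "geodesic_line ball_tangent_bundle tangent_bundle_metric ({p} \<times> L)"
    using geodesic_line_vector_line[OF assms] by simp
next
  fix p :: "real^('n::{finite,linorder})"
  assume "p \<in> ball 0 1"
  then show "totally_geodesic ball_tangent_bundle tangent_bundle_metric ({p} \<times> UNIV)"
    using totally_geodesic_vertical[OF assms] by simp
next
  fix l :: "(real^('n::{finite,linorder})) set"
  assume "geodesic_line (ball 0 1) poincare_metric l"
  then obtain x e where "norm x < 1" "norm e = 1" "l = gline x e" by (rule geodesic_line_gline)
  then show "isometric_to_domain tangent_bundle_metric (tangent_vectors l) (ball (0::complex) 1) poincare_metric"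
    using gline_isometric[OF assms] by simp
qed

end
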